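(* Let $\lambda\ge 0$ and $1<p<\infty$. The operator $P_\lambda$ given by $$(P_\lambda f)(z)=\int_{\mathbb{D}} f(w)K_\lambda(z,w)\,d\sigma_\lambda(w),\qquad z\in\mathbb{D},$$ is bounded from $L^p_\lambda(\mathbb{D})$ onto $A^p_\lambda(\mathbb{D})$.
   Context: Fix $\lambda\ge0$; $\mathbb{D}$ is the open unit disk in $\mathbb{C}$. For a complex-valued function $f$ put $D_{\bar z}f(z)=\partial_{\bar z}f(z)-\lambda\frac{f(z)-f(\bar z)}{z-\bar z}$, $z=x+iy$ (at real points the quotient is read as its limit $-i\,\partial_y f$). A $C^2$ (real sense) function $f:\mathbb{D}\to\mathbb{C}$ is $\lambda$-analytic if $D_{\bar z}f=0$ in $\mathbb{D}$. Measure: $d\sigma_\lambda(z)=c_\lambda|y|^{2\lambda}dx\,dy$, $z=x+iy$, $c_\lambda=\frac{\Gamma(\lambda+2)}{\Gamma(\lambda+1/2)\Gamma(1/2)}$, so $\sigma_\lambda(\mathbb{D})=1$. $L^p_\lambda(\mathbb{D})=L^p(\mathbb{D};d\sigma_\lambda)$ with norm $\left(\int_{\mathbb{D}}|f|^pd\sigma_\lambda\right)^{1/p}$, and $A^p_\lambda(\mathbb{D})$ is the subspace of $\lambda$-analytic functions in $L^p_\lambda(\mathbb{D})$, with the same norm. For $n\in\mathbb{N}_0=\{0,1,2,\dots\}$, $$\phi_n(z)=\epsilon_n\sum_{j=0}^n\frac{(\lambda)_j(\lambda+1)_{n-j}}{j!(n-j)!}\bar z^jz^{n-j},\qquad \epsilon_n=\sqrt{\frac{n!}{(2\lambda+1)_n}},$$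 with $(a)_j=a(a+1)\cdots(a+j-1)$, $(a)_0=1$. The $\lambda$-Bergman kernel is $K_\lambda(z,w)=\sum_{n=0}^\infty\frac{n+\lambda+1}{\lambda+1}\phi_n(z)\overline{\phi_n(w)}$ (absolutely convergent for $|zw|<1$). *)

theory Defs
  imports "HOL-Analysis.Analysis"
begin

definition partial_x :: "(complex \<Rightarrow> complex) \<Rightarrow> complex \<Rightarrow> complex" where
  "partial_x f z = vector_derivative (\<lambda>t. f (Complex t (Im z))) (at (Re z))"

definition partial_y :: "(complex \<Rightarrow> complex) \<Rightarrow> complex \<Rightarrow> complex" where
  "partial_y f z = vector_derivative (\<lambda>t. f (Complex (Re z) t)) (at (Im z))"

definition partial_zbar :: "(complex \<Rightarrow> complex) \<Rightarrow> complex \<Rightarrow> complex" where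
  "partial_zbar f z = (partial_x f z + \<i> * partial_y f z) / 2"

definition D_zbar :: "real \<Rightarrow> (complex \<Rightarrow> complex) \<Rightarrow> complex \<Rightarrow> complex" where
  "D_zbar l f z = partial_zbar f z - complex_of_real l *
     (if Im z = 0 then - \<i> * partial_y f z else (f z - f (cnj z)) / (z - cnj z))"

(* Twice continuously differentiable in the real sense. The derivatives are real-linear maps
   (blinfun), and the notion is meant for open S. *)
definition C2_on :: "complex set \<Rightarrow> (complex \<Rightarrow> complex) \<Rightarrow> bool" where
  "C2_on S f \<longleftrightarrow>
     (\<exists>(f' :: complex \<Rightarrow> (complex \<Rightarrow>\<^sub>L complex))
       (f'' :: complex \<Rightarrow> (complex \<Rightarrow>\<^sub>L (complex \<Rightarrow>\<^sub>L complex))).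
        (\<forall>z\<in>S. (f has_derivative blinfun_apply (f' z)) (at z)) \<and>
        (\<forall>z\<in>S. (f' has_derivative blinfun_apply (f'' z)) (at z)) \<and>
        continuous_on S f'')"

(* A function on the unit disk is a total function whose values off the disk are irrelevant. *)
definition lambda_analytic :: "real \<Rightarrow> (complex \<Rightarrow> complex) \<Rightarrow> bool" where
  "lambda_analytic l f \<longleftrightarrow> C2_on (ball 0 1) f \<and> (\<forall>z\<in>ball 0 1. D_zbar l f z = 0)"

definition c_const :: "real \<Rightarrow> real" where
  "c_const l = Gamma (l + 2) / (Gamma (l + 1/2) * Gamma (1/2))"

(* For l = 0 the density vanishes on the real axis, because 0 powr 0 = 0; the real axis is a
   null set, so the measure is still normalised area measure. *)
definition sigma_measure :: "real \<Rightarrow> complex measure" where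
  "sigma_measure l =
     density (lebesgue_on (ball 0 1)) (\<lambda>z. ennreal (c_const l * \<bar>Im z\<bar> powr (2 * l)))"

(* Representatives of the elements of the Lebesgue space; no quotient by a.e. equality is taken. *)
definition Lp_space :: "real \<Rightarrow> real \<Rightarrow> (complex \<Rightarrow> complex) set" where
  "Lp_space l p = {f. f \<in> borel_measurable (sigma_measure l) \<and>
     integrable (sigma_measure l) (\<lambda>z. norm (f z) powr p)}"

definition Lp_norm :: "real \<Rightarrow> real \<Rightarrow> (complex \<Rightarrow> complex) \<Rightarrow> real" where
  "Lp_norm l p f = (\<integral>z. norm (f z) powr p \<partial>sigma_measure l) powr (1 / p)"

definition Ap_space :: "real \<Rightarrow> real \<Rightarrow> (complex \<Rightarrow> complex) set" where
  "Ap_space l p = {f \<in> Lp_space l p. lambda_analytic l f}"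

definition eps_coeff :: "real \<Rightarrow> nat \<Rightarrow> real" where
  "eps_coeff l n = sqrt (fact n / pochhammer (2 * l + 1) n)"

definition phi :: "real \<Rightarrow> nat \<Rightarrow> complex \<Rightarrow> complex" where
  "phi l n z = complex_of_real (eps_coeff l n) *
     (\<Sum>j\<le>n. complex_of_real (pochhammer l j * pochhammer (l + 1) (n - j) / (fact j * fact (n - j)))
        * cnj z ^ j * z ^ (n - j))"

definition bergman_kernel :: "real \<Rightarrow> complex \<Rightarrow> complex \<Rightarrow> complex" where
  "bergman_kernel l z w =
     (\<Sum>n. complex_of_real ((real n + l + 1) / (l + 1)) * phi l n z * cnj (phi l n w))"

definition bergman_projection :: "real \<Rightarrow> (complex \<Rightarrow> complex) \<Rightarrow> complex \<Rightarrow> complex" where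
  "bergman_projection l f z = (\<integral>w. f w * bergman_kernel l z w \<partial>sigma_measure l)"

end

theory Submission
  imports Defs
begin

text \<open>
  The theorem holds because the Bergman kernel reproduces every integrable \<open>\<lambda>\<close>-analytic function
  and because it is small enough for Schur's test. Boundedness into the Bergman space is Schur's test, analyticity of
  the image comes from expanding the kernel, and the projection is onto since it fixes each element of the Bergman
  space.

  Write \<open>\<phi>\<^sub>n = \<epsilon>\<^sub>n A\<^sub>n\<close>, with \<open>A\<^sub>n\<close> a homogeneous
  polynomial of degree \<open>n\<close>. On the unit circle with the weight
  \<open>\<bar>sin \<theta>\<bar> powr (2 \<lambda>)\<close>, the equation \<open>D_zbar \<lambda> g = 0\<close> says
  that the radial derivative \<open>r \<partial>\<^sub>r g\<close> equals \<open>\<A> g\<close> for a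
  differential-difference operator \<open>\<A>\<close> in the angle that is symmetric for this weight. If
  \<open>\<A> H = \<mu> H\<close>, then the pairing of \<open>g(r \<sqdot>)\<close> with \<open>H\<close> is therefore a
  constant times \<open>r powr \<mu>\<close> (lemma \<open>circ_pairing_power\<close>). The polynomials
  \<open>A\<^sub>n\<close> have eigenvalue \<open>n\<close>, and the conjugates of \<open>z A\<^sub>n\<close> have
  eigenvalue \<open>-(n + 1 + 2 \<lambda>)\<close>. The latter pairings would blow up at the origin, so they vanish. The
  two families together span all polynomials in \<open>z\<close> and its conjugate on the circle, so the first family
  alone determines \<open>g\<close>: every \<open>\<lambda>\<close>-analytic function on the disk is a series in the
  \<open>A\<^sub>n\<close> (\<open>wirtinger_analytic_expansion\<close>). Integrating this series in polar coordinates
  against the kernel gives the reproducing property (\<open>projection_reproduces\<close>). Conversely such series are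
  smooth and \<open>\<lambda>\<close>-analytic, and the projection of any integrable function is one of them
  (\<open>projection_lambda_analytic\<close>).

  For \<open>\<lambda> > 0\<close> the Cauchy kernel \<open>\<Sum> \<phi>\<^sub>n(z) cnj (\<phi>\<^sub>n(w))\<close> is,
  up to a constant, \<open>1 / (1 - z cnj w)\<close> times the integral over \<open>0 < t < 1\<close> of
  \<open>t powr \<lambda> * (1 - t) powr (\<lambda> - 1) * D\<^sub>t powr (-\<lambda>)\<close>, where
  \<open>D\<^sub>t\<close> interpolates linearly between \<open>\<bar>1 - z cnj w\<bar>\<^sup>2\<close> and
  \<open>\<bar>1 - z w\<bar>\<^sup>2\<close>. Indeed both sides are \<open>\<lambda>\<close>-analytic in
  \<open>z\<close>, and by the expansion a \<open>\<lambda>\<close>-analytic function is determined by its values on the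
  real axis, where \<open>D\<^sub>t\<close> does not depend on \<open>t\<close>
  (\<open>phi_series_eq_cauchy_kernel\<close>). The factor \<open>n + \<lambda> + 1\<close> turns the Cauchy kernel into
  the Bergman kernel by the operator \<open>r \<partial>\<^sub>r + \<lambda> + 1\<close>, and estimating the integral
  yields
  \<open>\<bar>K(z,\<zeta>)\<bar> \<bar>Im \<zeta>\<bar> powr (2 \<lambda>) \<le> C (1 / \<bar>1 - z cnj \<zeta>\<bar>\<^sup>2 + 1 / \<bar>1 - z \<zeta>\<bar>\<^sup>2)\<close>
  for \<open>\<bar>\<zeta>\<bar> = 1\<close> (\<open>bergman_kernel_bound\<close>). For \<open>\<lambda> = 0\<close>
  this is the classical kernel.

  Integrating the bound over the circle gives at most \<open>C / (1 - \<bar>z\<bar>)\<close>, and integrating over the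
  radius against \<open>(1 - \<bar>w\<bar>) powr (-s)\<close>, with \<open>0 < s < 1\<close>, reproduces the weight
  (\<open>kernel_schur\<close>). Hoelder's inequality with a power of \<open>1 - \<bar>w\<bar>\<close> as test function
  then bounds the projection on \<open>L\<^sup>p\<close> (\<open>projection_Lp_bound\<close>).
\<close>

section \<open>The polynomials underlying the orthonormal system\<close>

definition dcoef :: "real \<Rightarrow> nat \<Rightarrow> nat \<Rightarrow> real" where
  "dcoef l j k = pochhammer l j * pochhammer (l + 1) k / (fact j * fact k)"

text \<open>
  This is \<open>\<phi>\<^sub>n\<close> without its normalising square root. The coefficients are then rational in
  \<open>\<lambda>\<close>, and the recurrence and the differential equation below take a clean form.
\<close>

definition gpoly :: "real \<Rightarrow> nat \<Rightarrow> complex \<Rightarrow> complex" where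
  "gpoly l n z = (\<Sum>j\<le>n. complex_of_real (dcoef l j (n - j)) * cnj z ^ j * z ^ (n - j))"

text \<open>
  Besides being the value at \<open>1\<close>, this is the squared norm on the circle up to the total mass, and the
  inverse square of the normalising factor.
\<close>

definition gval :: "real \<Rightarrow> nat \<Rightarrow> real" where
  "gval l n = pochhammer (2 * l + 1) n / fact n"

lemma phi_eq: "phi l n z = complex_of_real (eps_coeff l n) * gpoly l n z"
  by (simp add: phi_def gpoly_def dcoef_def)

lemma pochhammer_ge_0: "0 \<le> l \<Longrightarrow> 0 \<le> pochhammer (l::real) n"
  by (auto simp: pochhammer_prod intro!: prod_nonneg)

lemma dcoef_nonneg: "0 \<le> l \<Longrightarrow> 0 \<le> dcoef l j k"
  by (simp add: dcoef_def pochhammer_ge_0)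

lemma pochhammer_shift: "l * pochhammer (l + 1) n = (l + real n) * pochhammer (l::real) n"
  using pochhammer_rec[of l n] pochhammer_rec'[of l n] by simp

lemma dcoef_rec_0: "real (Suc k) * dcoef l 0 (Suc k) = (real (Suc k) + l) * dcoef l 0 k"
  unfolding dcoef_def pochhammer_rec' fact_Suc of_nat_mult
  by (simp add: divide_simps del: of_nat_Suc)

lemma dcoef_rec_last: "real (Suc j) * dcoef l (Suc j) 0 = l * dcoef l 0 j"
  unfolding dcoef_def pochhammer_rec fact_Suc of_nat_mult
  by simp

lemma dcoef_rec_mid:
  "real (Suc j + Suc k) * dcoef l (Suc j) (Suc k)
     = (real (Suc j + Suc k) + l) * dcoef l (Suc j) k + l * dcoef l (Suc k) j"
proof -
  define P where "P = pochhammer (l + 1) j * pochhammer (l + 1) k / (fact j * fact k)"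
  have a: "pochhammer l (Suc i) = l * pochhammer (l + 1) i" for i by (rule pochhammer_rec)
  have b: "pochhammer (l + 1) (Suc i) = (l + 1 + real i) * pochhammer (l + 1) i" for i by (rule pochhammer_rec')
  have 1: "dcoef l (Suc j) (Suc k) = l * (l + 1 + real k) / (real (Suc j) * real (Suc k)) * P"
    unfolding dcoef_def a b P_def by (simp add: field_simps)
  have 2: "dcoef l (Suc j) k = l / real (Suc j) * P"
    unfolding dcoef_def a P_def by (simp add: field_simps)
  have 3: "dcoef l (Suc k) j = l / real (Suc k) * P"
    unfolding dcoef_def a P_def by (simp add: field_simps)
  show ?thesis unfolding 1 2 3 by (simp add: divide_simps) (simp add: algebra_simps)
qed

lemma gpoly_cnj: "gpoly l n (cnj z) = cnj (gpoly l n z)"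
  by (simp add: gpoly_def)

text \<open>
  The recurrence couples \<open>A\<^sub>n\<^sub>+\<^sub>1\<close> to \<open>z A\<^sub>n\<close> and to the conjugate of
  \<open>z A\<^sub>n\<close>. It is the source of the norms, of the growth bounds and of the completeness argument: it
  lets a product with \<open>z\<close> be rewritten inside the span of the two eigenfunction families.
\<close>

lemma gpoly_rec:
  "of_nat (Suc n) * gpoly l (Suc n) z
     = of_real (real (Suc n) + l) * (z * gpoly l n z) + of_real l * (cnj z * cnj (gpoly l n z))"
proof -
  define u where "u j = cnj z ^ j * z ^ (Suc n - j)" for j
  have A: "z * gpoly l n z = (\<Sum>j\<le>n. of_real (dcoef l j (n - j)) * u j)"
    unfolding gpoly_def sum_distrib_left u_def
    by (intro sum.cong) (auto simp: Suc_diff_le)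
  have "cnj z * cnj (gpoly l n z) = (\<Sum>i\<le>n. of_real (dcoef l i (n - i)) * (z ^ i * cnj z ^ (Suc n - i)))"
    unfolding gpoly_def sum_distrib_left cnj_sum
    by (intro sum.cong) (auto simp: Suc_diff_le)
  also have "\<dots> = (\<Sum>j\<le>n. of_real (dcoef l (n - j) j) * u (Suc j))"
    by (rule sum.reindex_bij_witness[of _ "\<lambda>i. n - i" "\<lambda>i. n - i"]) (auto simp: u_def Suc_diff_le)
  finally have B: "cnj z * cnj (gpoly l n z) = (\<Sum>j\<le>n. of_real (dcoef l (n - j) j) * u (Suc j))" .
  have C: "of_nat (Suc n) * gpoly l (Suc n) z = (\<Sum>j\<le>Suc n. of_real (real (Suc n) * dcoef l j (Suc n - j)) * u j)"
    unfolding gpoly_def sum_distrib_left u_def by (intro sum.cong) auto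
  have D: "(\<Sum>j\<le>n. of_real (dcoef l j (n - j)) * u j)
      = (\<Sum>j\<le>Suc n. of_real (if j \<le> n then dcoef l j (n - j) else 0) * u j)"
    by simp
  have E: "(\<Sum>j\<le>n. of_real (dcoef l (n - j) j) * u (Suc j))
      = (\<Sum>j\<le>Suc n. of_real (if j = 0 then 0 else dcoef l (Suc n - j) (j - 1)) * u j)"
    by (subst sum.atMost_Suc_shift) simp
  have F: "real (Suc n) * dcoef l j (Suc n - j)
     = (real (Suc n) + l) * (if j \<le> n then dcoef l j (n - j) else 0)
       + l * (if j = 0 then 0 else dcoef l (Suc n - j) (j - 1))" if "j \<le> Suc n" for j
  proof -
    consider "j = 0" | "j = Suc n" | i k where "j = Suc i" "n = Suc (i + k)"
    proof (cases j)
      case (Suc i)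
      with \<open>j \<le> Suc n\<close> have "i = n \<or> i < n" by auto
      then show ?thesis using that Suc by (auto dest: less_imp_Suc_add)
    qed (use that in auto)
    then show ?thesis
    proof cases
      case 1 then show ?thesis using dcoef_rec_0[of n l] by simp
    next
      case 2 then show ?thesis using dcoef_rec_last[of n l] by simp
    next
      case 3 then show ?thesis using dcoef_rec_mid[of i k l] by (simp add: Suc_diff_le)
    qed
  qed
  show ?thesis
    unfolding C A B D E sum_distrib_left sum.distrib[symmetric]
    by (intro sum.cong refl, subst F) (auto simp: algebra_simps)
qed

lemma gpoly_0 [simp]: "gpoly l 0 z = 1"
  by (simp add: gpoly_def dcoef_def)

lemma gpoly_zero_param: "gpoly 0 n z = z ^ n"
proof -
  have "gpoly 0 n z = (\<Sum>j\<le>n. if j = 0 then z ^ n else 0)"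
    unfolding gpoly_def
  proof (intro sum.cong refl)
    fix j show "complex_of_real (dcoef 0 j (n - j)) * cnj z ^ j * z ^ (n - j) = (if j = 0 then z ^ n else 0)"
      by (cases j) (auto simp: dcoef_def pochhammer_0_left pochhammer_fact[symmetric])
  qed
  then show ?thesis by simp
qed

lemma gval_zero_param: "gval 0 n = 1"
  by (simp add: gval_def pochhammer_fact[symmetric])

lemma gval_Suc: "gval l (Suc n) = (1 + 2 * l / real (Suc n)) * gval l n"
proof -
  have "1 + 2 * l / real (Suc n) = (real (Suc n) + 2 * l) / real (Suc n)"
    by (simp add: divide_simps)
  then show ?thesis
    by (simp add: gval_def pochhammer_rec' algebra_simps)
qed

lemma gpoly_1: "gpoly l n 1 = of_real (gval l n)"
proof (induction n)
  case (Suc n)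
  have "of_nat (Suc n) * gpoly l (Suc n) 1 = of_real ((real (Suc n) + 2 * l) * gval l n)"
    unfolding gpoly_rec Suc by (simp add: algebra_simps)
  also have "(real (Suc n) + 2 * l) * gval l n = real (Suc n) * gval l (Suc n)"
    by (simp add: gval_Suc divide_simps del: of_nat_Suc)
  finally show ?case by (simp del: of_nat_Suc)
qed (simp add: gval_def)

text \<open>
  Since the coefficients are nonnegative for \<open>\<lambda> \<ge> 0\<close>, their sum, which is the value at
  \<open>1\<close>, dominates the polynomial on the unit circle.
\<close>

lemma sum_dcoef: "(\<Sum>j\<le>n. dcoef l j (n - j)) = gval l n"
proof -
  have "complex_of_real (\<Sum>j\<le>n. dcoef l j (n - j)) = of_real (gval l n)"
    using gpoly_1[of l n] by (simp add: gpoly_def)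
  then show ?thesis by (simp only: of_real_eq_iff)
qed

lemma gval_0 [simp]: "gval l 0 = 1" by (simp add: gval_def)

lemma gval_ge_1: "0 \<le> l \<Longrightarrow> 1 \<le> gval l n"
proof (induction n)
  case (Suc n)
  have "1 * 1 \<le> (1 + 2 * l / real (Suc n)) * gval l n"
    using Suc by (intro mult_mono) auto
  then show ?case by (simp only: gval_Suc)
qed simp

text \<open>
  Bernoulli's inequality absorbs the factor \<open>1 + 2 \<lambda> / n\<close> into a power of \<open>1 + 1/n\<close>,
  so the product telescopes to polynomial growth.
\<close>

lemma gval_le:
  assumes "0 \<le> l"
  shows "gval l n \<le> real (Suc n) ^ nat \<lceil>2 * l\<rceil>"
proof (induction n)
  case (Suc n)
  define m where "m = nat \<lceil>2 * l\<rceil>"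
  have m: "2 * l \<le> real m" unfolding m_def by linarith
  have "1 + 2 * l / real (Suc n) \<le> 1 + real m * (1 / real (Suc n))"
    using m by (simp add: divide_right_mono)
  also have "\<dots> \<le> (1 + 1 / real (Suc n)) ^ m"
    by (rule Bernoulli_inequality) (simp add: field_simps)
  finally have "gval l (Suc n) \<le> (1 + 1 / real (Suc n)) ^ m * real (Suc n) ^ m"
    unfolding gval_Suc using Suc gval_ge_1[OF assms, of n]
    by (intro mult_mono) (auto simp: m_def)
  also have "\<dots> = real (Suc (Suc n)) ^ m"
  proof -
    have "(1 + 1 / real (Suc n)) * real (Suc n) = real (Suc (Suc n))" by (simp add: field_simps)
    then show ?thesis unfolding power_mult_distrib[symmetric] by simp
  qed
  finally show ?case by (simp add: m_def)
qed simp

lemma norm_gpoly_le: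
  assumes "0 \<le> l" shows "norm (gpoly l n z) \<le> gval l n * norm z ^ n"
proof -
  have "norm (gpoly l n z) \<le> (\<Sum>j\<le>n. norm (complex_of_real (dcoef l j (n - j)) * cnj z ^ j * z ^ (n - j)))"
    unfolding gpoly_def by (rule norm_sum)
  also have "\<dots> = (\<Sum>j\<le>n. dcoef l j (n - j) * norm z ^ n)"
    using dcoef_nonneg[OF assms]
    by (intro sum.cong) (auto simp: norm_mult norm_power mult.assoc power_add[symmetric])
  finally show ?thesis by (simp add: sum_distrib_right[symmetric] sum_dcoef)
qed

lemma gpoly_scale: "gpoly l n (of_real r * z) = of_real r ^ n * gpoly l n z"
  unfolding gpoly_def sum_distrib_left
  by (intro sum.cong refl) (auto simp: power_mult_distrib power_add[symmetric] mult_ac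
      simp flip: power_add mult.assoc[of "of_real r ^ _" "of_real r ^ _"])

lemma eps_coeff_sq: "0 \<le> l \<Longrightarrow> (eps_coeff l n)\<^sup>2 = 1 / gval l n"
  by (simp add: eps_coeff_def gval_def pochhammer_nonneg)

lemma eps_coeff_bounds: assumes "0 \<le> l" shows "0 < eps_coeff l n" "eps_coeff l n \<le> 1"
proof -
  have "pochhammer (2 * l + 1) n > 0" using assms by (simp add: pochhammer_pos)
  then show "0 < eps_coeff l n" by (simp add: eps_coeff_def)
  have "(eps_coeff l n)\<^sup>2 \<le> 1" using gval_ge_1[OF assms, of n] by (simp add: eps_coeff_sq[OF assms])
  then show "eps_coeff l n \<le> 1" using \<open>0 < eps_coeff l n\<close> by (simp add: power2_le_iff_abs_le abs_le_square_iff[symmetric] power_le_one_iff)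
qed

section \<open>Homogeneous parts and the deformed Cauchy-Riemann equation\<close>

text \<open>
  Arbitrary coefficient arrays are allowed so that formal differentiation in \<open>z\<close> and in its conjugate stays
  inside the same class; this gives derivatives of all orders at once.
\<close>

definition hpart :: "(nat \<Rightarrow> nat \<Rightarrow> complex) \<Rightarrow> nat \<Rightarrow> complex \<Rightarrow> complex" where
  "hpart c n z = (\<Sum>j\<le>n. c n j * cnj z ^ j * z ^ (n - j))"

definition dz_coef :: "(nat \<Rightarrow> nat \<Rightarrow> complex) \<Rightarrow> nat \<Rightarrow> nat \<Rightarrow> complex" where
  "dz_coef c n j = of_nat (Suc n - j) * c (Suc n) j"

definition dzbar_coef :: "(nat \<Rightarrow> nat \<Rightarrow> complex) \<Rightarrow> nat \<Rightarrow> nat \<Rightarrow> complex" where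
  "dzbar_coef c n j = of_nat (Suc j) * c (Suc n) (Suc j)"

definition phi_coef :: "real \<Rightarrow> (nat \<Rightarrow> complex) \<Rightarrow> nat \<Rightarrow> nat \<Rightarrow> complex" where
  "phi_coef l a n j = a n * of_real (dcoef l j (n - j))"

lemma hpart_phi_coef: "hpart (phi_coef l a) n z = a n * gpoly l n z"
  by (simp add: hpart_def phi_coef_def gpoly_def sum_distrib_left mult.assoc)

lemma dcoef_dzbar_mid:
  "real (Suc j) * dcoef l (Suc j) k - real j * dcoef l j (Suc k) = l * (dcoef l j (Suc k) - dcoef l (Suc k) j)"
proof -
  define P where "P = pochhammer l j * pochhammer (l + 1) k / (fact j * fact k)"
  have a: "pochhammer l (Suc i) = (l + real i) * pochhammer l i" for i by (rule pochhammer_rec')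
  have b: "pochhammer (l + 1) (Suc i) = (l + 1 + real i) * pochhammer (l + 1) i" for i by (rule pochhammer_rec')
  have 1: "real (Suc j) * dcoef l (Suc j) k = (l + real j) * P"
    unfolding dcoef_def a P_def fact_Suc of_nat_mult by (simp del: of_nat_Suc)
  have 2: "dcoef l j (Suc k) = (l + 1 + real k) / real (Suc k) * P"
    unfolding dcoef_def b P_def by (simp add: field_simps)
  have "dcoef l (Suc k) j = pochhammer (l + 1) k * (l * pochhammer (l + 1) j) / (fact j * (real (Suc k) * fact k))"
    unfolding dcoef_def pochhammer_rec[of l k] by (simp add: mult_ac)
  then have 3: "dcoef l (Suc k) j = (l + real j) / real (Suc k) * P"
    unfolding P_def pochhammer_shift by (simp add: field_simps)
  show ?thesis unfolding 1 2 3 by (simp add: divide_simps) (simp add: algebra_simps)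
qed

lemma dcoef_dzbar_last:
  "- real n * dcoef l n 0 = l * (dcoef l n 0 - dcoef l 0 n)"
proof -
  have "l * dcoef l 0 n = (l + real n) * dcoef l n 0"
    unfolding dcoef_def using pochhammer_shift[of l n] by (simp add: field_simps)
  then show ?thesis by (simp add: algebra_simps)
qed

text \<open>
  For a real point both sides vanish, and elsewhere this is the equation \<open>D_zbar \<lambda> f = 0\<close> cleared
  of its denominator. It reduces to a three-term identity between Pochhammer coefficients.
\<close>

lemma hpart_phi_dzbar:
  "(z - cnj z) * hpart (dzbar_coef (phi_coef l a)) n z
     = of_real l * (hpart (phi_coef l a) (Suc n) z - hpart (phi_coef l a) (Suc n) (cnj z))"
proof -
  define u where "u j = cnj z ^ j * z ^ (Suc n - j)" for j
  define d where "d j = dcoef l j (Suc n - j)" for j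
  have A: "z * hpart (dzbar_coef (phi_coef l a)) n z = a (Suc n) * (\<Sum>j\<le>n. of_real (real (Suc j) * d (Suc j)) * u j)"
    unfolding hpart_def sum_distrib_left u_def phi_coef_def dzbar_coef_def d_def
    by (intro sum.cong) (auto simp: Suc_diff_le)
  have "cnj z * hpart (dzbar_coef (phi_coef l a)) n z = a (Suc n) * (\<Sum>j\<le>n. of_real (real (Suc j) * d (Suc j)) * u (Suc j))"
    unfolding hpart_def sum_distrib_left u_def phi_coef_def dzbar_coef_def d_def
    by (intro sum.cong) auto
  also have "(\<Sum>j\<le>n. complex_of_real (real (Suc j) * d (Suc j)) * u (Suc j)) = (\<Sum>j\<le>Suc n. of_real (real j * d j) * u j)"
    by (subst sum.atMost_Suc_shift) simp
  finally have B: "cnj z * hpart (dzbar_coef (phi_coef l a)) n z = a (Suc n) * (\<Sum>j\<le>Suc n. of_real (real j * d j) * u j)" .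
  have C: "hpart (phi_coef l a) (Suc n) z = a (Suc n) * (\<Sum>j\<le>Suc n. of_real (d j) * u j)"
    unfolding hpart_def sum_distrib_left u_def phi_coef_def d_def by (intro sum.cong) auto
  have "hpart (phi_coef l a) (Suc n) (cnj z) = a (Suc n) * (\<Sum>j\<le>Suc n. of_real (d j) * (z ^ j * cnj z ^ (Suc n - j)))"
    unfolding hpart_def sum_distrib_left u_def phi_coef_def d_def by (intro sum.cong) auto
  also have "(\<Sum>j\<le>Suc n. complex_of_real (d j) * (z ^ j * cnj z ^ (Suc n - j))) = (\<Sum>j\<le>Suc n. of_real (d (Suc n - j)) * u j)"
    by (rule sum.reindex_bij_witness[of _ "\<lambda>i. Suc n - i" "\<lambda>i. Suc n - i"]) (auto simp: u_def Suc_diff_le)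
  finally have D: "hpart (phi_coef l a) (Suc n) (cnj z) = a (Suc n) * (\<Sum>j\<le>Suc n. of_real (d (Suc n - j)) * u j)" .
  have E: "(\<Sum>j\<le>n. complex_of_real (real (Suc j) * d (Suc j)) * u j)
      = (\<Sum>j\<le>Suc n. of_real (if j \<le> n then real (Suc j) * d (Suc j) else 0) * u j)" by simp
  have F: "(if j \<le> n then real (Suc j) * d (Suc j) else 0) - real j * d j = l * (d j - d (Suc n - j))" if "j \<le> Suc n" for j
  proof (cases "j \<le> n")
    case True
    then obtain k where "n = j + k" using le_Suc_ex by blast
    then show ?thesis using dcoef_dzbar_mid[of j l k] by (simp add: d_def)
  next
    case False
    then have "j = Suc n" using that by simp
    then show ?thesis using dcoef_dzbar_last[of "Suc n" l] by (simp add: d_def del: of_nat_Suc)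
  qed
  have "(z - cnj z) * hpart (dzbar_coef (phi_coef l a)) n z
      = a (Suc n) * (\<Sum>j\<le>Suc n. of_real ((if j \<le> n then real (Suc j) * d (Suc j) else 0) - real j * d j) * u j)"
    unfolding left_diff_distrib A B E right_diff_distrib[symmetric] sum_subtractf[symmetric] of_real_diff ..
  also have "\<dots> = a (Suc n) * (\<Sum>j\<le>Suc n. of_real (l * (d j - d (Suc n - j))) * u j)"
    using F by simp
  also have "\<dots> = of_real l * (hpart (phi_coef l a) (Suc n) z - hpart (phi_coef l a) (Suc n) (cnj z))"
    unfolding C D right_diff_distrib[symmetric] sum_subtractf[symmetric] sum_distrib_left
    by (intro sum.cong) (auto simp: algebra_simps)
  finally show ?thesis .
qed

section \<open>Wirtinger derivatives\<close>

text \<open>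
  The numbers \<open>a\<close> and \<open>b\<close> are the derivatives in \<open>z\<close> and in the conjugate of
  \<open>z\<close>. Recording both in the total derivative gives a chain rule along real curves.
\<close>

definition has_wirtinger :: "(complex \<Rightarrow> complex) \<Rightarrow> complex \<Rightarrow> complex \<Rightarrow> complex \<Rightarrow> bool" where
  "has_wirtinger f a b z \<longleftrightarrow> (f has_derivative (\<lambda>h. a * h + b * cnj h)) (at z)"

text \<open>
  A first-order form of \<open>\<lambda>\<close>-analyticity: only \<open>C\<^sup>1\<close> is asked for, and the
  equation is multiplied by \<open>z - cnj z\<close>, so that real points need no separate clause. The integral
  representation of the Cauchy kernel is most easily verified in this form.
\<close>

definition wirtinger_analytic ::
  "real \<Rightarrow> (complex \<Rightarrow> complex) \<Rightarrow> (complex \<Rightarrow> complex) \<Rightarrow> (complex \<Rightarrow> complex) \<Rightarrow> bool" where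
  "wirtinger_analytic l f f1 f2 \<longleftrightarrow>
     (\<forall>z\<in>ball 0 1. has_wirtinger f (f1 z) (f2 z) z) \<and>
     continuous_on (ball 0 1) f1 \<and> continuous_on (ball 0 1) f2 \<and>
     (\<forall>z\<in>ball 0 1. (z - cnj z) * f2 z = of_real l * (f z - f (cnj z)))"

lemma has_wirtinger_compose_vector:
  assumes "has_wirtinger f a b (\<gamma> t)" and "(\<gamma> has_vector_derivative v) (at t)"
  shows "((\<lambda>s. f (\<gamma> s)) has_vector_derivative a * v + b * cnj v) (at t)"
proof -
  have "((\<lambda>s. f (\<gamma> s)) has_derivative (\<lambda>h. a * (h *\<^sub>R v) + b * cnj (h *\<^sub>R v))) (at t)"
    using has_derivative_compose[of \<gamma> "\<lambda>h. h *\<^sub>R v" t UNIV f "\<lambda>h. a * h + b * cnj h"] assms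
    by (simp add: has_wirtinger_def has_vector_derivative_def)
  moreover have "(\<lambda>h. a * (h *\<^sub>R v) + b * cnj (h *\<^sub>R v)) = (\<lambda>h. h *\<^sub>R (a * v + b * cnj v))"
    by (auto simp: scaleR_conv_of_real algebra_simps)
  ultimately show ?thesis by (simp add: has_vector_derivative_def)
qed

lemma Complex_line_x: "((\<lambda>t. Complex t y) has_vector_derivative 1) (at x)"
proof -
  have "((\<lambda>t. of_real t + \<i> * of_real y) has_vector_derivative 1) (at x)"
    by (auto intro!: derivative_eq_intros)
  then show ?thesis by (simp add: Complex_eq)
qed

lemma Complex_line_y: "((\<lambda>t. Complex x t) has_vector_derivative \<i>) (at y)"
proof -
  have "((\<lambda>t. of_real x + \<i> * of_real t) has_vector_derivative \<i>) (at y)"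
    by (auto intro!: derivative_eq_intros)
  then show ?thesis by (simp add: Complex_eq)
qed

lemma partial_y_wirtinger:
  assumes "has_wirtinger f a b z" shows "partial_y f z = \<i> * (a - b)"
  unfolding partial_y_def
  using has_wirtinger_compose_vector[OF _ Complex_line_y[of "Re z" "Im z"], of f a b] assms
  by (intro vector_derivative_at) (simp add: algebra_simps)

lemma partial_zbar_wirtinger:
  assumes "has_wirtinger f a b z" shows "partial_zbar f z = b"
proof -
  have "partial_x f z = a + b"
    unfolding partial_x_def
    using has_wirtinger_compose_vector[OF _ Complex_line_x[of "Im z" "Re z"], of f a b] assms
    by (auto intro!: vector_derivative_at)
  then show ?thesis
    unfolding partial_zbar_def partial_y_wirtinger[OF assms] by (simp add: algebra_simps)
qed

text \<open>
  On the real axis the cleared equation is void, but its derivative in the imaginary direction is not. Differentiating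
  both sides along \<open>z + \<i> t\<close> at \<open>t = 0\<close> recovers the limit form of the equation; continuity
  of \<open>f2\<close> suffices on the left because the factor \<open>2 \<i> t\<close> vanishes there.
\<close>

lemma wirtinger_analytic_real_axis:
  assumes "wirtinger_analytic l f f1 f2" and z: "norm z < 1" "Im z = 0"
  shows "f2 z = of_real l * (f1 z - f2 z)"
proof -
  have w: "has_wirtinger f (f1 z) (f2 z) z" and c2: "continuous_on (ball 0 1) f2"
    and eq: "\<And>x. x \<in> ball 0 1 \<Longrightarrow> (x - cnj x) * f2 x = of_real l * (f x - f (cnj x))"
    using assms by (auto simp: wirtinger_analytic_def)
  have zc: "cnj z = z" using z by (simp add: complex_eq_iff)
  have up: "((\<lambda>t::real. z + \<i> * of_real t) has_vector_derivative \<i>) (at 0)"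
    and dn: "((\<lambda>t::real. z - \<i> * of_real t) has_vector_derivative - \<i>) (at 0)"
    by (auto intro!: derivative_eq_intros)
  have d1: "((\<lambda>t. of_real l * (f (z + \<i> * of_real t) - f (z - \<i> * of_real t))) has_vector_derivative
      of_real l * (2 * \<i> * (f1 z - f2 z))) (at 0)"
    using has_wirtinger_compose_vector[OF _ up, of f "f1 z" "f2 z"]
      has_wirtinger_compose_vector[OF _ dn, of f "f1 z" "f2 z"] w
    by (auto intro!: derivative_eq_intros simp: algebra_simps)
  have cont: "isCont f2 z"
    using c2 z by (simp add: continuous_on_eq_continuous_at)
  have lim: "((\<lambda>h::real. f2 (z + \<i> * of_real h)) \<longlongrightarrow> f2 z) (at 0)"
    by (rule isCont_tendsto_compose[OF cont]) (auto intro!: tendsto_eq_intros)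
  have d2: "((\<lambda>t. (2 * \<i> * of_real t) * f2 (z + \<i> * of_real t)) has_vector_derivative
      2 * \<i> * f2 z) (at 0)"
    unfolding has_vector_derivative_def has_derivative_at
  proof
    show "bounded_linear (\<lambda>x. x *\<^sub>R (2 * \<i> * f2 z))" by (rule bounded_linear_scaleR_left)
    have "((\<lambda>h::real. 2 * norm (f2 (z + \<i> * of_real h) - f2 z)) \<longlongrightarrow> 2 * norm (f2 z - f2 z)) (at 0)"
      by (intro tendsto_intros lim)
    moreover have "\<forall>\<^sub>F h::real in at 0. 2 * norm (f2 (z + \<i> * of_real h) - f2 z) =
       norm (2 * \<i> * of_real (0 + h) * f2 (z + \<i> * of_real (0 + h)) - 2 * \<i> * of_real 0 * f2 (z + \<i> * of_real 0) -
          h *\<^sub>R (2 * \<i> * f2 z)) / norm h"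
    proof (intro eventually_at_filter[THEN iffD2] always_eventually allI impI)
      fix h :: real assume "h \<noteq> 0"
      have "2 * \<i> * of_real (0 + h) * f2 (z + \<i> * of_real (0 + h)) - 2 * \<i> * of_real 0 * f2 (z + \<i> * of_real 0) -
          h *\<^sub>R (2 * \<i> * f2 z) = (2 * \<i> * of_real h) * (f2 (z + \<i> * of_real h) - f2 z)"
        by (simp add: scaleR_conv_of_real algebra_simps)
      then show "2 * norm (f2 (z + \<i> * of_real h) - f2 z) =
       norm (2 * \<i> * of_real (0 + h) * f2 (z + \<i> * of_real (0 + h)) - 2 * \<i> * of_real 0 * f2 (z + \<i> * of_real 0) -
          h *\<^sub>R (2 * \<i> * f2 z)) / norm h"
        using \<open>h \<noteq> 0\<close> by (simp add: norm_mult)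
    qed
    ultimately show "((\<lambda>h. norm (2 * \<i> * of_real (0 + h) * f2 (z + \<i> * of_real (0 + h)) -
             2 * \<i> * of_real 0 * f2 (z + \<i> * of_real 0) - h *\<^sub>R (2 * \<i> * f2 z)) / norm h) \<longlongrightarrow> 0) (at 0)"
      by (rule Lim_transform_eventually[THEN tendsto_eq_rhs]) simp
  qed
  have ev: "(2 * \<i> * of_real t) * f2 (z + \<i> * of_real t) =
      of_real l * (f (z + \<i> * of_real t) - f (z - \<i> * of_real t))" if "dist t 0 < 1 - norm z" for t :: real
  proof -
    have "norm (z + \<i> * of_real t) \<le> norm z + norm (\<i> * of_real t)" by (rule norm_triangle_ineq)
    also have "\<dots> < 1" using that by (simp add: norm_mult)
    finally have "z + \<i> * of_real t \<in> ball 0 1" by simp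
    moreover have "z + \<i> * of_real t - cnj (z + \<i> * of_real t) = 2 * \<i> * of_real t"
      "cnj (z + \<i> * of_real t) = z - \<i> * of_real t" using zc by simp_all
    ultimately show ?thesis using eq[of "z + \<i> * of_real t"] by (simp add: mult.assoc)
  qed
  have "((\<lambda>t. of_real l * (f (z + \<i> * of_real t) - f (z - \<i> * of_real t))) has_vector_derivative
      2 * \<i> * f2 z) (at 0)"
    using has_vector_derivative_transform_within[OF d2, of "1 - norm z"] ev z by auto
  from vector_derivative_unique_at[OF this d1] show ?thesis by simp
qed

lemma lambda_analyticI:
  assumes "wirtinger_analytic l f f1 f2" and "C2_on (ball 0 1) f"
  shows "lambda_analytic l f"
  unfolding lambda_analytic_def
proof (intro conjI ballI assms(2))
  fix z :: complex assume z: "z \<in> ball 0 1"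
  have w: "has_wirtinger f (f1 z) (f2 z) z"
    and eq: "(z - cnj z) * f2 z = of_real l * (f z - f (cnj z))"
    using assms z by (auto simp: wirtinger_analytic_def)
  show "D_zbar l f z = 0"
  proof (cases "Im z = 0")
    case True
    have "f2 z = of_real l * (f1 z - f2 z)"
      using wirtinger_analytic_real_axis[OF assms(1)] z True by simp
    then show ?thesis
      using True by (simp add: D_zbar_def partial_zbar_wirtinger[OF w] partial_y_wirtinger[OF w] flip: mult.assoc)
  next
    case False
    then have "z - cnj z \<noteq> 0" by (simp add: complex_eq_iff)
    then show ?thesis
      using False eq by (simp add: D_zbar_def partial_zbar_wirtinger[OF w] field_simps)
  qed
qed

lemma real_linear_wirtinger:
  assumes "bounded_linear (D :: complex \<Rightarrow> complex)"
  shows "D h = (D 1 - \<i> * D \<i>) / 2 * h + (D 1 + \<i> * D \<i>) / 2 * cnj h"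
proof -
  interpret bounded_linear D by fact
  have "h = Re h *\<^sub>R 1 + Im h *\<^sub>R \<i>" by (simp add: complex_eq_iff)
  then have "D h = Re h *\<^sub>R D 1 + Im h *\<^sub>R D \<i>" by (metis add scaleR)
  then show ?thesis
    by (simp add: complex_eq_iff field_simps)
qed

lemma lambda_analyticD:
  assumes "lambda_analytic l f"
  obtains f1 f2 where "wirtinger_analytic l f f1 f2"
proof -
  obtain f' :: "complex \<Rightarrow> complex \<Rightarrow>\<^sub>L complex" and f'' :: "complex \<Rightarrow> complex \<Rightarrow>\<^sub>L (complex \<Rightarrow>\<^sub>L complex)"
    where f': "\<And>z. z \<in> ball 0 1 \<Longrightarrow> (f has_derivative blinfun_apply (f' z)) (at z)"
      and f'': "\<And>z. z \<in> ball 0 1 \<Longrightarrow> (f' has_derivative blinfun_apply (f'' z)) (at z)"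
    using assms unfolding lambda_analytic_def C2_on_def by blast
  have cont: "continuous_on (ball 0 1) f'"
    by (intro continuous_at_imp_continuous_on ballI has_derivative_continuous[OF f''])
  define f1 where "f1 z = (f' z 1 - \<i> * f' z \<i>) / 2" for z
  define f2 where "f2 z = (f' z 1 + \<i> * f' z \<i>) / 2" for z
  have w: "has_wirtinger f (f1 z) (f2 z) z" if "z \<in> ball 0 1" for z
  proof -
    have "blinfun_apply (f' z) = (\<lambda>h. f1 z * h + f2 z * cnj h)"
      unfolding f1_def f2_def by (rule ext, rule real_linear_wirtinger) (rule blinfun.bounded_linear_right)
    then show ?thesis using f'[OF that] by (simp add: has_wirtinger_def)
  qed
  have "(z - cnj z) * f2 z = of_real l * (f z - f (cnj z))" if "z \<in> ball 0 1" for z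
  proof (cases "Im z = 0")
    case True
    then have "cnj z = z" by (simp add: complex_eq_iff)
    then show ?thesis by simp
  next
    case False
    then have "z - cnj z \<noteq> 0" by (simp add: complex_eq_iff)
    moreover have "D_zbar l f z = 0" using assms that by (simp add: lambda_analytic_def)
    ultimately show ?thesis using False by (simp add: D_zbar_def partial_zbar_wirtinger[OF w[OF that]] field_simps)
  qed
  then have "wirtinger_analytic l f f1 f2"
    unfolding wirtinger_analytic_def using w cont
    by (auto simp: f1_def[abs_def] f2_def[abs_def] intro!: continuous_intros)
  then show thesis by (rule that)
qed

text \<open>
  The two Wirtinger derivatives depend linearly and continuously on the total derivative and vice versa, so
  differentiability of the former transfers to the derivative as a map into the space of bounded linear operators.
\<close>

lemma C2_on_wirtinger:
  assumes f: "\<And>z. z \<in> S \<Longrightarrow> has_wirtinger f (f1 z) (f2 z) z"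
    and f1: "\<And>z. z \<in> S \<Longrightarrow> has_wirtinger f1 (f11 z) (f12 z) z"
    and f2: "\<And>z. z \<in> S \<Longrightarrow> has_wirtinger f2 (f21 z) (f22 z) z"
    and c: "continuous_on S f11" "continuous_on S f12" "continuous_on S f21" "continuous_on S f22"
  shows "C2_on S f"
proof -
  define J :: "complex \<Rightarrow>\<^sub>L complex" where "J = Blinfun cnj"
  have J: "blinfun_apply J = cnj" by (simp add: J_def bounded_linear_Blinfun_apply bounded_linear_cnj)
  define W where "W a b = blinfun_mult_right a + (blinfun_mult_right b o\<^sub>L J)" for a b
  have W: "blinfun_apply (W a b) h = a * h + b * cnj h" for a b h
    by (simp add: W_def blinfun.add_left J)
  define M where "M = Blinfun (blinfun_mult_right :: complex \<Rightarrow> _)"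
  have M: "blinfun_apply M = blinfun_mult_right"
    by (simp add: M_def bounded_linear_Blinfun_apply bounded_linear_blinfun_mult_right)
  define R where "R = Blinfun (\<lambda>b. blinfun_mult_right b o\<^sub>L J)"
  have blR: "bounded_linear (\<lambda>b. blinfun_mult_right b o\<^sub>L J)"
    by (rule bounded_linear_compose[OF bounded_bilinear.bounded_linear_left[OF bounded_bilinear_blinfun_compose] bounded_linear_blinfun_mult_right])
  have R: "blinfun_apply R = (\<lambda>b. blinfun_mult_right b o\<^sub>L J)"
    unfolding R_def by (rule bounded_linear_Blinfun_apply[OF blR])
  have contW: "continuous_on S (\<lambda>z. W (a z) (b z))" if "continuous_on S a" "continuous_on S b" for a b
    unfolding W_def
    by (intro continuous_intros bounded_linear.continuous_on[OF bounded_linear_blinfun_mult_right] that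
        bounded_linear.continuous_on[OF blR])
  show ?thesis
    unfolding C2_on_def
  proof (intro exI[of _ "\<lambda>z. W (f1 z) (f2 z)"] exI[of _ "\<lambda>z. (M o\<^sub>L W (f11 z) (f12 z)) + (R o\<^sub>L W (f21 z) (f22 z))"] conjI ballI)
    fix z assume z: "z \<in> S"
    have "blinfun_apply (W (f1 z) (f2 z)) = (\<lambda>h. f1 z * h + f2 z * cnj h)" by (rule ext) (rule W)
    then show "(f has_derivative blinfun_apply (W (f1 z) (f2 z))) (at z)"
      using f[OF z] by (simp add: has_wirtinger_def)
    have "((\<lambda>z. blinfun_mult_right (f1 z) + (blinfun_mult_right (f2 z) o\<^sub>L J)) has_derivative
       (\<lambda>h. blinfun_mult_right (f11 z * h + f12 z * cnj h) + (blinfun_mult_right (f21 z * h + f22 z * cnj h) o\<^sub>L J))) (at z)"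
      using f1[OF z] f2[OF z] unfolding has_wirtinger_def
      by (intro has_derivative_add bounded_linear.has_derivative[OF bounded_linear_blinfun_mult_right]
          bounded_linear.has_derivative[OF blR])
    moreover have "blinfun_apply ((M o\<^sub>L W (f11 z) (f12 z)) + (R o\<^sub>L W (f21 z) (f22 z))) =
      (\<lambda>h. blinfun_mult_right (f11 z * h + f12 z * cnj h) + (blinfun_mult_right (f21 z * h + f22 z * cnj h) o\<^sub>L J))"
      by (rule ext) (simp add: blinfun.add_left M R W)
    ultimately show "((\<lambda>z. W (f1 z) (f2 z)) has_derivative blinfun_apply ((M o\<^sub>L W (f11 z) (f12 z)) + (R o\<^sub>L W (f21 z) (f22 z)))) (at z)"
      unfolding W_def[symmetric] by (simp add: W_def)
  next
    show "continuous_on S (\<lambda>z. (M o\<^sub>L W (f11 z) (f12 z)) + (R o\<^sub>L W (f21 z) (f22 z)))"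
      by (intro continuous_intros contW c)
  qed
qed

section \<open>Series of homogeneous polynomials\<close>

text \<open>
  Equivalently, the power series with these coefficients converges in the unit disk.
\<close>

definition subexp :: "(nat \<Rightarrow> complex) \<Rightarrow> bool" where
  "subexp a \<longleftrightarrow> (\<forall>t. 0 < t \<and> t < 1 \<longrightarrow> (\<exists>C. \<forall>n. norm (a n) * t ^ n \<le> C))"

text \<open>
  The analogue of the preceding condition for arrays. The \<open>n + 1\<close> terms of a homogeneous part cost only a
  factor that the geometric decay absorbs, so a bound on single coefficients is enough.
\<close>

definition tame :: "(nat \<Rightarrow> nat \<Rightarrow> complex) \<Rightarrow> bool" where
  "tame c \<longleftrightarrow> (\<forall>t. 0 < t \<and> t < 1 \<longrightarrow> (\<exists>C. \<forall>n. \<forall>j\<le>n. norm (c n j) * t ^ n \<le> C))"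

definition ser :: "(nat \<Rightarrow> nat \<Rightarrow> complex) \<Rightarrow> complex \<Rightarrow> complex" where
  "ser c z = (\<Sum>n. hpart c n z)"

lemma Suc_geom_bound:
  fixes x :: real assumes "0 \<le> x" "x < 1" shows "real (Suc n) * x ^ n \<le> 1 / (1 - x)\<^sup>2"
proof -
  have s: "(\<lambda>n. real (Suc n) * x ^ n) sums (1 / (1 - x)\<^sup>2)"
    using geometric_deriv_sums[of x] assms by simp
  have "(\<Sum>i\<in>{n}. real (Suc i) * x ^ i) \<le> (\<Sum>n. real (Suc n) * x ^ n)"
    by (rule sum_le_suminf) (use s assms in \<open>auto simp: sums_iff\<close>)
  then show ?thesis using s by (simp add: sums_iff)
qed

lemma poly_geom_bound:
  fixes s :: real assumes "0 < s" "s < 1" shows "\<exists>C. \<forall>n. real (Suc n) ^ m * s ^ n \<le> C"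
proof (cases "m = 0")
  case True
  then show ?thesis using assms by (intro exI[of _ 1]) (simp add: power_le_one)
next
  case False
  define x where "x = root m s"
  have x: "0 \<le> x" "x < 1" "x ^ m = s"
    using assms False by (auto simp: x_def real_root_lt_1_iff)
  have "real (Suc n) ^ m * s ^ n \<le> (1 / (1 - x)\<^sup>2) ^ m" for n
  proof -
    have "real (Suc n) ^ m * s ^ n = (real (Suc n) * x ^ n) ^ m"
      unfolding x(3)[symmetric] by (simp add: power_mult_distrib mult.commute flip: power_mult)
    also have "\<dots> \<le> (1 / (1 - x)\<^sup>2) ^ m"
      using x by (intro power_mono Suc_geom_bound) auto
    finally show ?thesis .
  qed
  then show ?thesis by blast
qed

lemma tame_phi_coef:
  assumes l: "0 \<le> l" and a: "subexp a" shows "tame (phi_coef l a)"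
  unfolding tame_def
proof (intro allI impI)
  fix t :: real assume t: "0 < t \<and> t < 1"
  define s where "s = sqrt t"
  have s: "0 < s" "s < 1" "s * s = t" using t by (auto simp: s_def)
  obtain C1 where C1: "norm (a n) * s ^ n \<le> C1" for n using a s unfolding subexp_def by blast
  obtain C2 where C2: "real (Suc n) ^ nat \<lceil>2 * l\<rceil> * s ^ n \<le> C2" for n using poly_geom_bound[OF s(1,2)] by blast
  have "norm (phi_coef l a n j) * t ^ n \<le> C1 * C2" if "j \<le> n" for n j
  proof -
    have "dcoef l j (n - j) \<le> gval l n"
      unfolding sum_dcoef[symmetric] using that dcoef_nonneg[OF l] by (intro member_le_sum) auto
    also have "\<dots> \<le> real (Suc n) ^ nat \<lceil>2 * l\<rceil>" by (rule gval_le[OF l])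
    finally have d: "dcoef l j (n - j) * s ^ n \<le> C2"
      using C2[of n] s by (meson mult_right_mono order.trans zero_le_power less_imp_le)
    have "norm (phi_coef l a n j) * t ^ n = (norm (a n) * s ^ n) * (dcoef l j (n - j) * s ^ n)"
      using dcoef_nonneg[OF l] by (simp add: phi_coef_def norm_mult power_mult_distrib flip: s(3))
    also have "\<dots> \<le> C1 * C2"
      using C1[of n] d dcoef_nonneg[OF l] s
      by (intro mult_mono) (auto intro: order.trans[OF _ C1])
    finally show ?thesis .
  qed
  then show "\<exists>C. \<forall>n. \<forall>j\<le>n. norm (phi_coef l a n j) * t ^ n \<le> C" by blast
qed

lemma tame_deriv:
  assumes "tame c" shows "tame (dz_coef c)" "tame (dzbar_coef c)"
proof -
  have *: "\<exists>C. \<forall>n. \<forall>j\<le>Suc n. real (Suc n) * norm (c (Suc n) j) * t ^ n \<le> C" if t: "0 < t" "t < 1" for t :: real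
  proof -
    define s where "s = sqrt t"
    have s: "0 < s" "s < 1" "s * s = t" using t by (auto simp: s_def)
    obtain C where C: "\<And>n j. j \<le> n \<Longrightarrow> norm (c n j) * s ^ n \<le> C" using assms s unfolding tame_def by blast
    have "real (Suc n) * norm (c (Suc n) j) * t ^ n \<le> 1 / (1 - s)\<^sup>2 * (C / s)" if "j \<le> Suc n" for n j
    proof -
      have "norm (c (Suc n) j) * s ^ n \<le> C / s"
        using C[OF that] s by (simp add: field_simps)
      then have "(real (Suc n) * s ^ n) * (norm (c (Suc n) j) * s ^ n) \<le> 1 / (1 - s)\<^sup>2 * (C / s)"
        using s Suc_geom_bound[of s n] by (intro mult_mono) auto
      then show ?thesis by (simp add: power_mult_distrib mult_ac flip: s(3))
    qed
    then show ?thesis by blast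
  qed
  show "tame (dz_coef c)"
    unfolding tame_def
  proof (intro allI impI)
    fix t :: real assume "0 < t \<and> t < 1"
    then obtain C where C: "\<And>n j. j \<le> Suc n \<Longrightarrow> real (Suc n) * norm (c (Suc n) j) * t ^ n \<le> C" using * by blast
    have "norm (dz_coef c n j) * t ^ n \<le> C" if "j \<le> n" for n j
    proof -
      have "norm (dz_coef c n j) * t ^ n \<le> real (Suc n) * norm (c (Suc n) j) * t ^ n"
        unfolding dz_coef_def norm_mult norm_of_nat using \<open>0 < t \<and> t < 1\<close> by (intro mult_right_mono) auto
      also have "\<dots> \<le> C" using that by (intro C) auto
      finally show ?thesis .
    qed
    then show "\<exists>C. \<forall>n. \<forall>j\<le>n. norm (dz_coef c n j) * t ^ n \<le> C" by blast
  qed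
  show "tame (dzbar_coef c)"
    unfolding tame_def
  proof (intro allI impI)
    fix t :: real assume "0 < t \<and> t < 1"
    then obtain C where C: "\<And>n j. j \<le> Suc n \<Longrightarrow> real (Suc n) * norm (c (Suc n) j) * t ^ n \<le> C" using * by blast
    have "norm (dzbar_coef c n j) * t ^ n \<le> C" if "j \<le> n" for n j
    proof -
      have "norm (dzbar_coef c n j) * t ^ n \<le> real (Suc n) * norm (c (Suc n) (Suc j)) * t ^ n"
        unfolding dzbar_coef_def norm_mult norm_of_nat using \<open>0 < t \<and> t < 1\<close> that by (intro mult_right_mono) auto
      also have "\<dots> \<le> C" using that by (intro C) auto
      finally show ?thesis .
    qed
    then show "\<exists>C. \<forall>n. \<forall>j\<le>n. norm (dzbar_coef c n j) * t ^ n \<le> C" by blast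
  qed
qed

text \<open>
  The majorant is a geometric series with ratio \<open>\<rho>/t\<close> weighted by the number of monomials;
  \<open>t\<close> lies halfway between \<open>\<rho>\<close> and \<open>1\<close>.
\<close>

lemma tame_hpart_majorant:
  assumes "tame c" and "0 \<le> \<rho>" "\<rho> < 1"
  obtains m where "summable m" "\<And>n z. norm z \<le> \<rho> \<Longrightarrow> norm (hpart c n z) \<le> m n"
proof -
  define t where "t = (1 + \<rho>) / 2"
  have t: "0 < t" "t < 1" "\<rho> < t" using assms by (auto simp: t_def)
  obtain C where C: "\<And>n j. j \<le> n \<Longrightarrow> norm (c n j) * t ^ n \<le> C" using assms t unfolding tame_def by blast
  have "norm (c 0 0) \<le> C" using C[of 0 0] by simp
  then have "C \<ge> 0" by (rule order.trans[OF norm_ge_zero])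
  define m where "m n = C * (real (Suc n) * (\<rho> / t) ^ n)" for n
  have "summable m"
    unfolding m_def using geometric_deriv_sums[of "\<rho> / t"] t assms
    by (intro summable_mult) (simp add: sums_iff del: of_nat_Suc)
  moreover have "norm (hpart c n z) \<le> m n" if z: "norm z \<le> \<rho>" for n z
  proof -
    have "norm (hpart c n z) \<le> (\<Sum>j\<le>n. norm (c n j * cnj z ^ j * z ^ (n - j)))"
      unfolding hpart_def by (rule norm_sum)
    also have "\<dots> \<le> (\<Sum>j\<le>n. C * (\<rho> / t) ^ n)"
    proof (rule sum_mono)
      fix j assume "j \<in> {..n}"
      then have j: "j \<le> n" by simp
      have "norm (c n j * cnj z ^ j * z ^ (n - j)) = norm (c n j) * norm z ^ n"
        using j by (simp add: norm_mult norm_power mult.assoc flip: power_add)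
      also have "\<dots> \<le> norm (c n j) * \<rho> ^ n"
        by (intro mult_left_mono power_mono z) auto
      also have "\<dots> = (norm (c n j) * t ^ n) * (\<rho> / t) ^ n" using t by (simp add: power_divide)
      also have "\<dots> \<le> C * (\<rho> / t) ^ n" using t assms by (intro mult_right_mono C j) auto
      finally show "norm (c n j * cnj z ^ j * z ^ (n - j)) \<le> C * (\<rho> / t) ^ n" .
    qed
    also have "\<dots> = m n" by (simp add: m_def)
    finally show ?thesis .
  qed
  ultimately show thesis by (rule that)
qed

lemma ser_summable:
  assumes "tame c" "norm z < 1" shows "summable (\<lambda>n. norm (hpart c n z))"
proof -
  obtain m where m: "summable m" "\<And>n w. norm w \<le> norm z \<Longrightarrow> norm (hpart c n w) \<le> m n"
    using tame_hpart_majorant[OF assms(1), of "norm z"] assms(2) by auto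
  show ?thesis by (rule summable_comparison_test'[OF m(1), of 0]) (use m(2) in auto)
qed

lemma ser_sums: "tame c \<Longrightarrow> norm z < 1 \<Longrightarrow> (\<lambda>n. hpart c n z) sums ser c z"
  unfolding ser_def by (intro summable_sums summable_norm_cancel[OF ser_summable])

lemma uniform_limit_ser:
  assumes "tame c" "0 \<le> \<rho>" "\<rho> < 1"
  shows "uniform_limit (cball 0 \<rho>) (\<lambda>n z. \<Sum>i<n. hpart c i z) (ser c) sequentially"
proof -
  obtain m where m: "summable m" "\<And>n z. norm z \<le> \<rho> \<Longrightarrow> norm (hpart c n z) \<le> m n"
    using tame_hpart_majorant[OF assms] by blast
  show ?thesis unfolding ser_def[abs_def]
    by (rule Weierstrass_m_test[OF _ m(1)]) (use m(2) in auto)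
qed

lemma hpart_has_derivative:
  "(hpart c (Suc m) has_derivative (\<lambda>h. hpart (dz_coef c) m x * h + hpart (dzbar_coef c) m x * cnj h)) (at x)"
proof -
  define p where "p j = c (Suc m) j * cnj x ^ j * (of_nat (Suc m - j) * x ^ (Suc m - j - 1))" for j
  define q where "q j = c (Suc m) j * (of_nat j * cnj x ^ (j - 1)) * x ^ (Suc m - j)" for j
  have t: "((\<lambda>z. c (Suc m) j * cnj z ^ j * z ^ (Suc m - j)) has_derivative (\<lambda>h. p j * h + q j * cnj h)) (at x)" for j
  proof -
    have 1: "((\<lambda>z. cnj z ^ j) has_derivative (\<lambda>h. of_nat j * cnj h * cnj x ^ (j - 1))) (at x)"
      by (rule has_derivative_power[OF has_derivative_cnj[OF has_derivative_ident]])
    have 2: "((\<lambda>z. z ^ (Suc m - j)) has_derivative (\<lambda>h. of_nat (Suc m - j) * h * x ^ (Suc m - j - 1))) (at x)"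
      by (rule has_derivative_power[OF has_derivative_ident])
    show ?thesis
      by (rule has_derivative_eq_rhs[OF has_derivative_mult[OF has_derivative_mult_right[OF 1] 2]])
         (simp add: p_def q_def fun_eq_iff algebra_simps)
  qed
  have P: "(\<Sum>j\<le>Suc m. p j) = hpart (dz_coef c) m x"
  proof -
    have "(\<Sum>j\<le>Suc m. p j) = (\<Sum>j\<le>m. p j)" by (simp add: p_def)
    also have "\<dots> = hpart (dz_coef c) m x"
      unfolding hpart_def dz_coef_def p_def by (intro sum.cong) (auto simp: Suc_diff_le)
    finally show ?thesis .
  qed
  have Q: "(\<Sum>j\<le>Suc m. q j) = hpart (dzbar_coef c) m x"
  proof -
    have "(\<Sum>j\<le>Suc m. q j) = (\<Sum>j\<le>m. q (Suc j))" by (subst sum.atMost_Suc_shift) (simp add: q_def)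
    also have "\<dots> = hpart (dzbar_coef c) m x"
      unfolding hpart_def dzbar_coef_def q_def by (intro sum.cong) auto
    finally show ?thesis .
  qed
  have "(hpart c (Suc m) has_derivative (\<lambda>h. \<Sum>j\<le>Suc m. p j * h + q j * cnj h)) (at x)"
    unfolding hpart_def[abs_def] by (intro has_derivative_sum t)
  then show ?thesis
    by (rule has_derivative_eq_rhs) (simp only: sum.distrib sum_distrib_right[symmetric] P Q)
qed

text \<open>
  Termwise differentiation: the series of formal derivatives are again tame, so they converge uniformly on every smaller
  disk.
\<close>

lemma ser_has_wirtinger:
  assumes c: "tame c" and z: "norm z < 1"
  shows "has_wirtinger (ser c) (ser (dz_coef c) z) (ser (dzbar_coef c) z) z"
proof -
  define \<rho> where "\<rho> = (1 + norm z) / 2"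
  have \<rho>: "0 \<le> \<rho>" "\<rho> < 1" "norm z < \<rho>" using z by (auto simp: \<rho>_def)
  define f' where "f' n x h = (case n of 0 \<Rightarrow> 0 | Suc m \<Rightarrow> hpart (dz_coef c) m x * h + hpart (dzbar_coef c) m x * cnj h)" for n x h
  define g' where "g' x h = ser (dz_coef c) x * h + ser (dzbar_coef c) x * cnj h" for x h
  have "\<exists>g. \<forall>x\<in>ball 0 \<rho>. (\<lambda>n. hpart c n x) sums g x \<and> (g has_derivative g' x) (at x within ball 0 \<rho>)"
  proof (rule has_derivative_series)
    show "convex (ball (0::complex) \<rho>)" by simp
    show "(hpart c n has_derivative f' n x) (at x within ball 0 \<rho>)" for n x
    proof (cases n)
      case 0
      have "hpart c n = (\<lambda>_. c 0 0)" using 0 by (auto simp: hpart_def)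
      moreover have "f' n x = (\<lambda>_. 0)" using 0 by (simp add: f'_def fun_eq_iff)
      ultimately show ?thesis by simp
    next
      case (Suc m)
      have "f' n x = (\<lambda>h. hpart (dz_coef c) m x * h + hpart (dzbar_coef c) m x * cnj h)"
        using Suc by (simp add: f'_def fun_eq_iff)
      then show ?thesis
        using has_derivative_at_withinI[OF hpart_has_derivative[of c m x]] Suc by simp
    qed
    show "z \<in> ball 0 \<rho>" using \<rho> by simp
    show "(\<lambda>n. hpart c n z) sums ser c z" by (rule ser_sums[OF c z])
    fix e :: real assume "0 < e"
    have "\<forall>\<^sub>F n in sequentially. \<forall>x\<in>cball 0 \<rho>. dist (\<Sum>i<n. hpart (dz_coef c) i x) (ser (dz_coef c) x) < e / 2"
      using uniform_limit_ser[OF tame_deriv(1)[OF c] \<rho>(1,2)] \<open>0 < e\<close> unfolding uniform_limit_iff by (meson half_gt_zero)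
    moreover have "\<forall>\<^sub>F n in sequentially. \<forall>x\<in>cball 0 \<rho>. dist (\<Sum>i<n. hpart (dzbar_coef c) i x) (ser (dzbar_coef c) x) < e / 2"
      using uniform_limit_ser[OF tame_deriv(2)[OF c] \<rho>(1,2)] \<open>0 < e\<close> unfolding uniform_limit_iff by (meson half_gt_zero)
    ultimately have "\<forall>\<^sub>F n in sequentially. \<forall>x\<in>ball 0 \<rho>. \<forall>h. norm ((\<Sum>i<Suc n. f' i x h) - g' x h) \<le> e * norm h"
    proof eventually_elim
      case (elim n)
      show ?case
      proof (intro ballI allI)
        fix x h :: complex assume x: "x \<in> ball 0 \<rho>"
        have s: "(\<Sum>i<Suc n. f' i x h) = (\<Sum>i<n. hpart (dz_coef c) i x) * h + (\<Sum>i<n. hpart (dzbar_coef c) i x) * cnj h"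
          by (subst sum.lessThan_Suc_shift) (simp add: f'_def sum.distrib sum_distrib_right)
        have "(\<Sum>i<Suc n. f' i x h) - g' x h =
            ((\<Sum>i<n. hpart (dz_coef c) i x) - ser (dz_coef c) x) * h + ((\<Sum>i<n. hpart (dzbar_coef c) i x) - ser (dzbar_coef c) x) * cnj h"
          unfolding s g'_def by (simp add: algebra_simps)
        also have "norm \<dots> \<le> norm ((\<Sum>i<n. hpart (dz_coef c) i x) - ser (dz_coef c) x) * norm h +
            norm ((\<Sum>i<n. hpart (dzbar_coef c) i x) - ser (dzbar_coef c) x) * norm h"
          by (rule order.trans[OF norm_triangle_ineq]) (simp add: norm_mult)
        also have "\<dots> \<le> e / 2 * norm h + e / 2 * norm h"
          using elim x by (intro add_mono mult_right_mono) (auto simp: dist_norm less_imp_le)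
        finally show "norm ((\<Sum>i<Suc n. f' i x h) - g' x h) \<le> e * norm h" by simp
      qed
    qed
    then show "\<forall>\<^sub>F n in sequentially. \<forall>x\<in>ball 0 \<rho>. \<forall>h. norm ((\<Sum>i<n. f' i x h) - g' x h) \<le> e * norm h"
      using eventually_sequentially_Suc[of "\<lambda>n. \<forall>x\<in>ball 0 \<rho>. \<forall>h. norm ((\<Sum>i<n. f' i x h) - g' x h) \<le> e * norm h"] by blast
  qed
  then obtain g where g: "\<And>x. x \<in> ball 0 \<rho> \<Longrightarrow> (\<lambda>n. hpart c n x) sums g x"
      "\<And>x. x \<in> ball 0 \<rho> \<Longrightarrow> (g has_derivative g' x) (at x within ball 0 \<rho>)" by blast
  have eq: "g x = ser c x" if "x \<in> ball 0 \<rho>" for x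
    using g(1)[OF that] by (simp add: ser_def sums_iff)
  have zin: "z \<in> ball 0 \<rho>" using \<rho> by simp
  have "(g has_derivative g' z) (at z)"
    using g(2)[of z] \<rho> by (simp add: at_within_open[of z "ball 0 \<rho>"])
  then have "(ser c has_derivative g' z) (at z)"
    by (rule has_derivative_transform_within_open[OF _ open_ball zin eq])
  moreover have "g' z = (\<lambda>h. ser (dz_coef c) z * h + ser (dzbar_coef c) z * cnj h)"
    by (simp add: g'_def fun_eq_iff)
  ultimately show ?thesis unfolding has_wirtinger_def by simp
qed

lemma has_wirtinger_isCont: "has_wirtinger f a b z \<Longrightarrow> isCont f z"
  unfolding has_wirtinger_def by (rule has_derivative_continuous)

lemma continuous_on_ser: "tame c \<Longrightarrow> continuous_on (ball 0 1) (ser c)"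
  by (intro continuous_at_imp_continuous_on ballI has_wirtinger_isCont[OF ser_has_wirtinger]) auto

lemma wirtinger_analytic_ser:
  assumes "0 \<le> l" "subexp a"
  shows "wirtinger_analytic l (ser (phi_coef l a)) (ser (dz_coef (phi_coef l a))) (ser (dzbar_coef (phi_coef l a)))"
proof -
  define c where "c = phi_coef l a"
  have c: "tame c" unfolding c_def by (rule tame_phi_coef[OF assms])
  have "(z - cnj z) * ser (dzbar_coef c) z = of_real l * (ser c z - ser c (cnj z))" if z: "norm z < 1" for z
  proof -
    have "(\<lambda>n. of_real l * (hpart c n z - hpart c n (cnj z))) sums (of_real l * (ser c z - ser c (cnj z)))"
      by (intro sums_mult sums_diff ser_sums c) (use z in auto)
    moreover have "hpart c 0 z - hpart c 0 (cnj z) = 0" by (simp add: hpart_def)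
    ultimately have "(\<lambda>n. of_real l * (hpart c (Suc n) z - hpart c (Suc n) (cnj z))) sums (of_real l * (ser c z - ser c (cnj z)))"
      by (subst sums_Suc_iff) simp
    moreover have "(\<lambda>n. (z - cnj z) * hpart (dzbar_coef c) n z) sums ((z - cnj z) * ser (dzbar_coef c) z)"
      by (intro sums_mult ser_sums tame_deriv c z)
    ultimately show ?thesis
      unfolding c_def hpart_phi_dzbar by (rule sums_unique2[rotated])
  qed
  then show ?thesis
    unfolding wirtinger_analytic_def c_def[symmetric]
    by (auto intro!: ser_has_wirtinger continuous_on_ser tame_deriv c)
qed

section \<open>Integrals depending on a parameter\<close>

text \<open>
  Dominated convergence applied to the difference quotients, which the mean value theorem bounds by \<open>2 B\<close>
  on a convex set.
\<close>

lemma has_derivative_integral_bounded: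
  fixes f :: "'a::real_normed_vector \<Rightarrow> 't \<Rightarrow> 'b::{banach, second_countable_topology}"
  assumes fin: "finite_measure M" and S: "open S" "convex S" "x0 \<in> S"
    and T: "AE t in M. t \<in> T"
    and df: "\<And>x t. x \<in> S \<Longrightarrow> t \<in> T \<Longrightarrow> ((\<lambda>x. f x t) has_derivative f' x t) (at x)"
    and bd: "\<And>x t h. x \<in> S \<Longrightarrow> t \<in> T \<Longrightarrow> norm (f' x t h) \<le> B * norm h"
    and int: "\<And>x. x \<in> S \<Longrightarrow> integrable M (f x)"
    and meas: "\<And>h. (\<lambda>t. f' x0 t h) \<in> borel_measurable M"
  shows "((\<lambda>x. \<integral>t. f x t \<partial>M) has_derivative (\<lambda>h. \<integral>t. f' x0 t h \<partial>M)) (at x0)"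
proof -
  interpret finite_measure M by fact
  have int': "integrable M (\<lambda>t. f' x0 t h)" for h
  proof (rule integrable_const_bound[where B = "B * norm h"])
    show "AE t in M. norm (f' x0 t h) \<le> B * norm h"
      using T by eventually_elim (rule bd[OF S(3)])
  qed (rule meas)
  have lin: "linear (f' x0 t)" if "t \<in> T" for t
    using has_derivative_linear[OF df[OF S(3) that]] .
  have "bounded_linear (\<lambda>h. \<integral>t. f' x0 t h \<partial>M)"
  proof (rule bounded_linear_intro)
    fix h k :: 'a and c :: real
    have "(\<integral>t. f' x0 t (h + k) \<partial>M) = (\<integral>t. f' x0 t h + f' x0 t k \<partial>M)"
      by (rule integral_cong_AE) (use T in \<open>auto intro!: meas borel_measurable_add simp: linear_add[OF lin] elim!: eventually_mono\<close>)
    then show "(\<integral>t. f' x0 t (h + k) \<partial>M) = (\<integral>t. f' x0 t h \<partial>M) + (\<integral>t. f' x0 t k \<partial>M)"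
      using int' by simp
    have "(\<integral>t. f' x0 t (c *\<^sub>R h) \<partial>M) = (\<integral>t. c *\<^sub>R f' x0 t h \<partial>M)"
      by (rule integral_cong_AE) (use T in \<open>auto intro!: meas borel_measurable_scaleR simp: linear_scale[OF lin] elim!: eventually_mono\<close>)
    then show "(\<integral>t. f' x0 t (c *\<^sub>R h) \<partial>M) = c *\<^sub>R (\<integral>t. f' x0 t h \<partial>M)" by simp
    have "norm (\<integral>t. f' x0 t h \<partial>M) \<le> (\<integral>t. norm (f' x0 t h) \<partial>M)" by (rule integral_norm_bound)
    also have "\<dots> \<le> (\<integral>t. B * norm h \<partial>M)"
      by (rule integral_mono_AE) (use T in \<open>auto intro!: int' bd[OF S(3)] elim!: eventually_mono\<close>)
    finally show "norm (\<integral>t. f' x0 t h \<partial>M) \<le> norm h * (B * measure M (space M))"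
      by (simp add: mult_ac)
  qed
  moreover have "((\<lambda>y. norm ((\<integral>t. f y t \<partial>M) - (\<integral>t. f x0 t \<partial>M) - (\<integral>t. f' x0 t (y - x0) \<partial>M)) / norm (y - x0)) \<longlongrightarrow> 0) (at x0 within S)"
    unfolding tendsto_at_iff_sequentially comp_def
  proof (intro allI impI)
    fix X assume X: "\<forall>i. X i \<in> S - {x0}" "X \<longlonglongrightarrow> x0"
    define q where "q i t = norm (f (X i) t - f x0 t - f' x0 t (X i - x0)) / norm (X i - x0)" for i t
    have lim: "(\<lambda>i. \<integral>t. q i t \<partial>M) \<longlonglongrightarrow> (\<integral>t. 0 \<partial>M)"
    proof (rule integral_dominated_convergence[where w = "\<lambda>_. 2 * B"])
      show "q i \<in> borel_measurable M" for i
      proof -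
        have [measurable]: "f (X i) \<in> borel_measurable M" "f x0 \<in> borel_measurable M"
            "(\<lambda>t. f' x0 t (X i - x0)) \<in> borel_measurable M"
          using X(1) S(3) meas by (auto intro!: borel_measurable_integrable[OF int])
        show ?thesis unfolding q_def[abs_def] by measurable
      qed
      show "AE t in M. (\<lambda>i. q i t) \<longlonglongrightarrow> 0"
        using T
      proof eventually_elim
        case (elim t)
        have "((\<lambda>y. norm (f y t - f x0 t - f' x0 t (y - x0)) / norm (y - x0)) \<longlongrightarrow> 0) (at x0 within S)"
          using has_derivative_at_withinI[OF df[OF S(3) elim]] unfolding has_derivative_iff_norm by blast
        then show ?case
          unfolding tendsto_at_iff_sequentially comp_def q_def using X by blast
      qed
      show "AE t in M. norm (q i t) \<le> 2 * B" for i
        using T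
      proof eventually_elim
        case (elim t)
        have "norm (f' x0 t (X i - x0)) \<le> B * norm (X i - x0)" by (rule bd[OF S(3) elim])
        then have "0 \<le> B * norm (X i - x0)" by (rule order.trans[OF norm_ge_zero])
        moreover have "norm (X i - x0) > 0" using X(1) by simp
        ultimately have B0: "0 \<le> B" by (simp add: zero_le_mult_iff)
        have on: "onorm (f' x t) \<le> B" if "x \<in> S" for x
          by (rule onorm_bound[OF B0 bd[OF that elim]])
        have "norm (f (X i) t - f x0 t) \<le> B * norm (X i - x0)"
          by (rule differentiable_bound[OF S(2), where f' = "\<lambda>x. f' x t"])
            (use X S elim in \<open>auto intro!: has_derivative_at_withinI[OF df] on\<close>)
        moreover have "norm (f' x0 t (X i - x0)) \<le> B * norm (X i - x0)" by (rule bd[OF S(3) elim])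
        ultimately have "norm (f (X i) t - f x0 t - f' x0 t (X i - x0)) \<le> 2 * B * norm (X i - x0)"
          using norm_triangle_ineq4[of "f (X i) t - f x0 t" "f' x0 t (X i - x0)"] by linarith
        then show ?case using X(1) unfolding q_def by (simp add: divide_le_eq)
      qed
    qed auto
    show "(\<lambda>i. norm ((\<integral>t. f (X i) t \<partial>M) - (\<integral>t. f x0 t \<partial>M) - (\<integral>t. f' x0 t (X i - x0) \<partial>M)) / norm (X i - x0)) \<longlonglongrightarrow> 0"
    proof (rule tendsto_sandwich[OF _ _ tendsto_const])
      show "(\<lambda>i. \<integral>t. q i t \<partial>M) \<longlonglongrightarrow> 0" using lim by simp
      show "\<forall>\<^sub>F i in sequentially. norm ((\<integral>t. f (X i) t \<partial>M) - (\<integral>t. f x0 t \<partial>M) - (\<integral>t. f' x0 t (X i - x0) \<partial>M)) / norm (X i - x0)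
          \<le> (\<integral>t. q i t \<partial>M)"
      proof (rule always_eventually, rule allI)
        fix i
        have "X i \<in> S" using X by auto
        then have "(\<integral>t. f (X i) t \<partial>M) - (\<integral>t. f x0 t \<partial>M) - (\<integral>t. f' x0 t (X i - x0) \<partial>M)
           = (\<integral>t. f (X i) t - f x0 t - f' x0 t (X i - x0) \<partial>M)"
          using int S(3) int' by simp
        also have "norm \<dots> \<le> (\<integral>t. norm (f (X i) t - f x0 t - f' x0 t (X i - x0)) \<partial>M)" by (rule integral_norm_bound)
        finally show "norm ((\<integral>t. f (X i) t \<partial>M) - (\<integral>t. f x0 t \<partial>M) - (\<integral>t. f' x0 t (X i - x0) \<partial>M)) / norm (X i - x0)
          \<le> (\<integral>t. q i t \<partial>M)"
          unfolding q_def by (simp add: divide_right_mono)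
      qed
    qed auto
  qed
  ultimately have "((\<lambda>x. \<integral>t. f x t \<partial>M) has_derivative (\<lambda>h. \<integral>t. f' x0 t h \<partial>M)) (at x0 within S)"
    unfolding has_derivative_iff_norm by blast
  then show ?thesis using at_within_open[OF S(3,1)] by simp
qed

lemma continuous_on_integral_bounded:
  fixes f :: "'a::metric_space \<Rightarrow> 't \<Rightarrow> 'b::{banach, second_countable_topology}"
  assumes fin: "finite_measure M" and T: "AE t in M. t \<in> T"
    and cont: "\<And>t. t \<in> T \<Longrightarrow> continuous_on S (\<lambda>x. f x t)"
    and bd: "\<And>x t. x \<in> S \<Longrightarrow> t \<in> T \<Longrightarrow> norm (f x t) \<le> B"
    and meas: "\<And>x. x \<in> S \<Longrightarrow> f x \<in> borel_measurable M"
  shows "continuous_on S (\<lambda>x. \<integral>t. f x t \<partial>M)"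
  unfolding continuous_on_sequentially comp_def
proof (intro allI ballI impI)
  interpret finite_measure M by fact
  fix X a assume a: "a \<in> S" and X: "(\<forall>n. X n \<in> S) \<and> X \<longlonglongrightarrow> a"
  show "(\<lambda>n. \<integral>t. f (X n) t \<partial>M) \<longlonglongrightarrow> (\<integral>t. f a t \<partial>M)"
  proof (rule integral_dominated_convergence[where w = "\<lambda>_. B"])
    show "AE t in M. (\<lambda>i. f (X i) t) \<longlonglongrightarrow> f a t"
      using T
    proof eventually_elim
      case (elim t)
      then show ?case using cont[OF elim] a X unfolding continuous_on_sequentially comp_def by blast
    qed
    show "AE t in M. norm (f (X i) t) \<le> B" for i
      using T by eventually_elim (use X bd in auto)
  qed (use a X meas in auto)
qed

section \<open>The weighted circle\<close>

text \<open>
  The angular part of the measure \<open>\<sigma>\<close>. The endpoint of the parameter interval is a null set, and the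
  target is the circle itself so that pointwise hypotheses on the circle suffice.
\<close>

definition circ :: "real \<Rightarrow> complex measure" where
  "circ l = distr (density lborel (\<lambda>\<theta>. ennreal (indicator {-pi<..<pi} \<theta> * \<bar>sin \<theta>\<bar> powr (2 * l))))
     (restrict_space borel (sphere 0 1)) cis"

lemma cis_measurable [measurable]: "cis \<in> lborel \<rightarrow>\<^sub>M restrict_space borel (sphere 0 1)"
  by (intro measurable_restrict_space2) (auto intro!: borel_measurable_continuous_onI continuous_intros)

lemma space_circ [simp]: "space (circ l) = sphere 0 1"
  by (simp add: circ_def space_restrict_space)

lemma measurable_circ_iff: "f \<in> borel_measurable (circ l) \<longleftrightarrow> f \<in> borel_measurable (restrict_space borel (sphere 0 1))"
  by (intro arg_cong2[where f = "(\<in>)"] measurable_cong_sets refl) (simp add: circ_def)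

lemma continuous_measurable_circ:
  fixes f :: "complex \<Rightarrow> 'b::topological_space"
  shows "continuous_on (sphere 0 1) f \<Longrightarrow> f \<in> borel_measurable (circ l)"
  unfolding measurable_circ_iff by (rule borel_measurable_continuous_on_restrict)

lemma nn_integral_circ:
  assumes "f \<in> borel_measurable (circ l)"
  shows "(\<integral>\<^sup>+z. f z \<partial>circ l) = (\<integral>\<^sup>+\<theta>. ennreal (indicator {-pi<..<pi} \<theta> * \<bar>sin \<theta>\<bar> powr (2 * l)) * f (cis \<theta>) \<partial>lborel)"
proof -
  have [measurable]: "f \<in> borel_measurable (restrict_space borel (sphere 0 1))" using assms by (simp only: measurable_circ_iff)
  show ?thesis unfolding circ_def by (simp add: nn_integral_distr nn_integral_density)
qed

lemma integral_circ:
  fixes f :: "complex \<Rightarrow> complex"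
  assumes "f \<in> borel_measurable (circ l)"
  shows "(\<integral>z. f z \<partial>circ l) = (\<integral>\<theta>. (indicator {-pi<..<pi} \<theta> * \<bar>sin \<theta>\<bar> powr (2 * l)) *\<^sub>R f (cis \<theta>) \<partial>lborel)"
proof -
  have [measurable]: "f \<in> borel_measurable (restrict_space borel (sphere 0 1))" using assms by (simp only: measurable_circ_iff)
  show ?thesis unfolding circ_def by (simp add: integral_distr integral_density)
qed

lemma circ_finite: "0 \<le> l \<Longrightarrow> finite_measure (circ l)"
proof
  assume l: "0 \<le> l"
  have "emeasure (circ l) (space (circ l)) = (\<integral>\<^sup>+z. 1 \<partial>circ l)" by simp
  also have "\<dots> = (\<integral>\<^sup>+\<theta>. ennreal (indicator {-pi<..<pi} \<theta> * \<bar>sin \<theta>\<bar> powr (2 * l)) \<partial>lborel)"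
    by (subst nn_integral_circ) auto
  also have "\<dots> \<le> (\<integral>\<^sup>+\<theta>. indicator {-pi<..<pi} \<theta> \<partial>lborel)"
    using l by (intro nn_integral_mono) (auto simp: indicator_def powr_le1)
  also have "\<dots> < \<infinity>" by simp
  finally show "emeasure (circ l) (space (circ l)) \<noteq> \<infinity>" by simp
qed

lemma AE_circ: "AE z in circ l. z \<in> sphere 0 1"
  by (rule AE_I2) simp

lemma integrable_circ:
  fixes f :: "complex \<Rightarrow> complex"
  assumes "0 \<le> l" "continuous_on (sphere 0 1) f"
  shows "integrable (circ l) f"
proof -
  interpret finite_measure "circ l" by (rule circ_finite[OF assms(1)])
  have "bounded (f ` sphere 0 1)"
    by (intro compact_imp_bounded compact_continuous_image assms compact_sphere)
  then obtain B where "\<forall>x\<in>f ` sphere 0 1. norm x \<le> B" unfolding bounded_iff by blast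
  then show ?thesis
    by (intro integrable_const_bound[where B = B] continuous_measurable_circ assms AE_I2) auto
qed

section \<open>The angular eigenvalue equation\<close>

text \<open>
  This is \<open>\<A> H = \<mu> H\<close> with
  \<open>\<A> H = - \<i> (H' + \<lambda> cis (-\<theta>) (H(\<theta>) - H(-\<theta>)) / sin \<theta>)\<close>,
  multiplied by \<open>\<i> sin \<theta>\<close> so that it makes sense at \<open>0\<close> and \<open>\<pi>\<close>.
  For a \<open>\<lambda>\<close>-analytic function restricted to a circle, \<open>\<A>\<close> is the radial derivative
  \<open>r \<partial>\<^sub>r\<close>.
\<close>

definition circle_eigen :: "real \<Rightarrow> real \<Rightarrow> (complex \<Rightarrow> complex) \<Rightarrow> bool" where
  "circle_eigen l \<mu> H \<longleftrightarrow> (\<exists>H'. \<forall>\<theta>. ((\<lambda>\<theta>. H (cis \<theta>)) has_vector_derivative H' \<theta>) (at \<theta>) \<and>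
     of_real (sin \<theta>) * H' \<theta> = \<i> * of_real \<mu> * of_real (sin \<theta>) * H (cis \<theta>)
        - of_real l * cis (- \<theta>) * (H (cis \<theta>) - H (cis (- \<theta>))))"

lemma cis_has_vector_derivative: "(cis has_vector_derivative \<i> * cis \<theta>) (at \<theta>)"
  unfolding cis_conv_exp
  by (rule has_vector_derivative_eq_rhs, rule has_vector_derivative_real_field)
     (auto intro!: derivative_eq_intros)

text \<open>
  Symmetry of \<open>\<A>\<close> in differential form. The suffixes stand for the values at \<open>\<theta>\<close> and
  \<open>-\<theta>\<close>, with \<open>E = \<A> G\<close> and \<open>H\<close> the conjugated eigenfunction. The
  difference terms at the two points combine, through \<open>e + e' = 2 cos \<theta>\<close>, to what differentiating
  the weight produces; hence the integrand of \<open>\<langle>\<A> G - \<mu> G, H\<rangle>\<close>, symmetrised in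
  \<open>\<theta>\<close>, is a total derivative.
\<close>

lemma eigen_boundary_identity:
  fixes Gp Gm Hp Hm Ep Em G'p G'm H'p H'm s c e e' l \<mu> :: complex
  assumes "s \<noteq> 0" "e + e' = 2 * c"
    and "s * G'p = \<i> * s * Ep - l * e' * (Gp - Gm)"
    and "s * G'm = \<i> * s * Em - l * e * (Gp - Gm)"
    and "s * H'p = - \<i> * \<mu> * s * Hp - l * e * (Hp - Hm)"
    and "s * H'm = - \<i> * \<mu> * s * Hm - l * e' * (Hp - Hm)"
  shows "s * ((G'p * Hp + Gp * H'p) + (G'm * Hm + Gm * H'm)) + 2 * l * c * (Gp * Hp - Gm * Hm)
       = s * (\<i> * ((Ep - \<mu> * Gp) * Hp + (Em - \<mu> * Gm) * Hm))"
proof -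
  have "s * ((G'p * Hp + Gp * H'p) + (G'm * Hm + Gm * H'm))
     = (s * G'p) * Hp + Gp * (s * H'p) + (s * G'm) * Hm + Gm * (s * H'm)"
    by (simp add: algebra_simps)
  also have "\<dots> = s * (\<i> * ((Ep - \<mu> * Gp) * Hp + (Em - \<mu> * Gm) * Hm)) - l * (e + e') * (Gp * Hp - Gm * Hm)"
    unfolding assms(3-6) by (simp add: algebra_simps)
  finally show ?thesis unfolding assms(2) by (simp add: algebra_simps)
qed


lemma integral_even_fold:
  fixes F :: "real \<Rightarrow> complex"
  assumes F: "integrable lborel F" and 0: "F 0 = 0"
  shows "(\<integral>t. F t \<partial>lborel) = (\<integral>t. indicator {0<..} t *\<^sub>R (F t + F (- t)) \<partial>lborel)"
proof -
  have F': "integrable lborel (\<lambda>t. F (- t))"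
    using lborel_integrable_real_affine[OF F, of "-1" 0] by simp
  have i1: "integrable lborel (\<lambda>t. indicator {0<..} t *\<^sub>R F t)"
    and i2: "integrable lborel (\<lambda>t. indicator {..<0} t *\<^sub>R F t)"
    and i3: "integrable lborel (\<lambda>t. indicator {0<..} t *\<^sub>R F (- t))"
    by (intro integrable_mult_indicator F F'; simp)+
  have "(\<integral>t. F t \<partial>lborel) = (\<integral>t. indicator {0<..} t *\<^sub>R F t + indicator {..<0} t *\<^sub>R F t \<partial>lborel)"
    using 0 by (intro Bochner_Integration.integral_cong) (auto simp: indicator_def not_less)
  also have "\<dots> = (\<integral>t. indicator {0<..} t *\<^sub>R F t \<partial>lborel) + (\<integral>t. indicator {..<0} t *\<^sub>R F t \<partial>lborel)"
    using i1 i2 by simp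
  also have "(\<integral>t. indicator {..<0} t *\<^sub>R F t \<partial>lborel) = (\<integral>t. indicator {0<..} t *\<^sub>R F (- t) \<partial>lborel)"
    by (subst lborel_integral_real_affine[where c = "-1" and t = 0]) (auto simp: indicator_def intro!: Bochner_Integration.integral_cong)
  finally show ?thesis using i1 i3 by (simp add: scaleR_add_right)
qed

text \<open>
  Folding the integral onto \<open>0 < \<theta> < \<pi>\<close> makes the integrand a multiple of the derivative of
  \<open>U = w Y\<close>, where \<open>Y\<close> is the difference of the values of \<open>G cnj H\<close> at
  \<open>\<theta>\<close> and \<open>-\<theta>\<close>. Since \<open>Y\<close> vanishes at \<open>0\<close> and
  \<open>\<pi>\<close>, so does \<open>U\<close>, for every \<open>\<lambda> \<ge> 0\<close>.
\<close>

lemma circ_eigen_orthogonal: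
  assumes l: "0 \<le> l" and g: "wirtinger_analytic l g g1 g2" and H: "circle_eigen l \<mu> H"
    and cH: "continuous_on (sphere 0 1) H" and r: "0 < r" "r < 1"
  shows "(\<integral>\<zeta>. (of_real r * (\<zeta> * g1 (of_real r * \<zeta>) + cnj \<zeta> * g2 (of_real r * \<zeta>)) - of_real \<mu> * g (of_real r * \<zeta>)) * cnj (H \<zeta>) \<partial>circ l) = 0"
proof -
  have rb: "of_real r * \<zeta> \<in> ball 0 1" if "norm \<zeta> = 1" for \<zeta> :: complex
    using that r by (simp add: norm_mult)
  have gw: "has_wirtinger g (g1 z) (g2 z) z" if "z \<in> ball 0 1" for z
    using g that by (simp add: wirtinger_analytic_def)
  have cg: "continuous_on (ball 0 1) g" 
    by (intro continuous_at_imp_continuous_on ballI has_wirtinger_isCont[OF gw])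
  have cg1: "continuous_on (ball 0 1) g1" and cg2: "continuous_on (ball 0 1) g2"
    using g by (simp_all add: wirtinger_analytic_def)
  have geq: "(z - cnj z) * g2 z = of_real l * (g z - g (cnj z))" if "z \<in> ball 0 1" for z
    using g that by (simp add: wirtinger_analytic_def)
  have cr: "continuous_on (sphere 0 1) (\<lambda>\<zeta>. k (of_real r * \<zeta>))" if "continuous_on (ball 0 1) k" for k :: "complex \<Rightarrow> complex"
    by (rule continuous_on_compose2[OF that]) (auto intro!: continuous_intros rb)
  define P where "P \<zeta> = (of_real r * (\<zeta> * g1 (of_real r * \<zeta>) + cnj \<zeta> * g2 (of_real r * \<zeta>)) - of_real \<mu> * g (of_real r * \<zeta>)) * cnj (H \<zeta>)" for \<zeta>
  have cP: "continuous_on (sphere 0 1) P"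
    unfolding P_def[abs_def] by (intro continuous_intros cr cg cg1 cg2 cH)
  define w where "w \<theta> = \<bar>sin \<theta>\<bar> powr (2 * l)" for \<theta> :: real
  have w1: "0 \<le> w \<theta>" "w \<theta> \<le> 1" for \<theta> using l by (auto simp: w_def powr_le1)
  have [measurable]: "w \<in> borel_measurable borel" unfolding w_def[abs_def] by measurable
  define F where "F \<theta> = (indicator {-pi<..<pi} \<theta> * w \<theta>) *\<^sub>R P (cis \<theta>)" for \<theta>
  have cPc: "continuous_on UNIV (\<lambda>\<theta>. P (cis \<theta>))"
    by (rule continuous_on_compose2[OF cP]) (auto intro!: continuous_intros)
  then have [measurable]: "(\<lambda>\<theta>. P (cis \<theta>)) \<in> borel_measurable borel" by (rule borel_measurable_continuous_onI)
  have "bounded (P ` sphere 0 1)"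
    by (intro compact_imp_bounded compact_continuous_image cP compact_sphere)
  then obtain B where "\<forall>x\<in>P ` sphere 0 1. norm x \<le> B" unfolding bounded_iff by blast
  then have B: "norm (P z) \<le> B" if "norm z = 1" for z using that by auto
  have Fint: "integrable lborel F"
  proof (rule Bochner_Integration.integrable_bound)
    show "integrable lborel (\<lambda>\<theta>. indicator {-pi<..<pi} \<theta> * B)" by (intro integrable_mult_left) auto
    show "AE \<theta> in lborel. norm (F \<theta>) \<le> norm (indicator {-pi<..<pi} \<theta> * B)"
    proof (rule AE_I2)
      fix \<theta> :: real
      have "0 \<le> B" by (rule order.trans[OF norm_ge_zero B[of 1]]) simp
      moreover have "w \<theta> * norm (P (cis \<theta>)) \<le> 1 * B" using w1[of \<theta>] B[of "cis \<theta>"] by (intro mult_mono) auto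
      ultimately show "norm (F \<theta>) \<le> norm (indicator {-pi<..<pi} \<theta> * B)"
        using w1[of \<theta>] by (auto simp: F_def indicator_def)
    qed
  qed (unfold F_def[abs_def], measurable)
  obtain H' where H': "\<And>\<theta>. ((\<lambda>\<theta>. H (cis \<theta>)) has_vector_derivative H' \<theta>) (at \<theta>)"
     "\<And>\<theta>. of_real (sin \<theta>) * H' \<theta> = \<i> * of_real \<mu> * of_real (sin \<theta>) * H (cis \<theta>)
        - of_real l * cis (- \<theta>) * (H (cis \<theta>) - H (cis (- \<theta>)))"
    using H unfolding circle_eigen_def by blast
  define G where "G \<theta> = g (of_real r * cis \<theta>)" for \<theta>
  define E where "E \<theta> = of_real r * (cis \<theta> * g1 (of_real r * cis \<theta>) + cnj (cis \<theta>) * g2 (of_real r * cis \<theta>))" for \<theta>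
  define G' where "G' \<theta> = \<i> * of_real r * (cis \<theta> * g1 (of_real r * cis \<theta>) - cnj (cis \<theta>) * g2 (of_real r * cis \<theta>))" for \<theta>
  have dG: "(G has_vector_derivative G' \<theta>) (at \<theta>)" for \<theta>
  proof -
    have "((\<lambda>\<theta>. of_real r * cis \<theta>) has_vector_derivative of_real r * (\<i> * cis \<theta>)) (at \<theta>)"
      by (intro has_vector_derivative_mult_right cis_has_vector_derivative)
    from has_wirtinger_compose_vector[OF gw[OF rb] this] show ?thesis
      unfolding G_def[abs_def] G'_def
      by (rule has_vector_derivative_eq_rhs) (simp_all add: algebra_simps)
  qed
  have sG: "of_real (sin \<theta>) * G' \<theta> = \<i> * of_real (sin \<theta>) * E \<theta> - of_real l * cis (- \<theta>) * (G \<theta> - G (- \<theta>))" for \<theta>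
  proof -
    have "of_real r * cis \<theta> - cnj (of_real r * cis \<theta>) = 2 * \<i> * of_real r * of_real (sin \<theta>)"
      by (simp add: complex_eq_iff)
    then have e: "2 * \<i> * of_real r * of_real (sin \<theta>) * g2 (of_real r * cis \<theta>) = of_real l * (G \<theta> - G (- \<theta>))"
      using geq[OF rb[of "cis \<theta>"]] by (simp add: G_def cis_cnj)
    have "of_real (sin \<theta>) * G' \<theta> = \<i> * of_real (sin \<theta>) * E \<theta> - cnj (cis \<theta>) * (2 * \<i> * of_real r * of_real (sin \<theta>) * g2 (of_real r * cis \<theta>))"
      unfolding G'_def E_def by (simp add: algebra_simps)
    then show ?thesis unfolding e by (simp add: cis_cnj)
  qed
  define Q where "Q \<theta> = P (cis \<theta>) + P (cis (- \<theta>))" for \<theta>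
  have PQ: "P (cis \<theta>) = (E \<theta> - of_real \<mu> * G \<theta>) * cnj (H (cis \<theta>))" for \<theta>
    by (simp add: P_def E_def G_def)
  define Y where "Y \<theta> = G \<theta> * cnj (H (cis \<theta>)) - G (- \<theta>) * cnj (H (cis (- \<theta>)))" for \<theta>
  define Y' where "Y' \<theta> = (G' \<theta> * cnj (H (cis \<theta>)) + G \<theta> * cnj (H' \<theta>)) + (G' (-\<theta>) * cnj (H (cis (-\<theta>))) + G (-\<theta>) * cnj (H' (-\<theta>)))" for \<theta>
  have dY: "(Y has_vector_derivative Y' \<theta>) (at \<theta>)" for \<theta>
  proof -
    have d: "((\<lambda>\<theta>. G \<theta> * cnj (H (cis \<theta>))) has_vector_derivative G \<theta> * cnj (H' \<theta>) + G' \<theta> * cnj (H (cis \<theta>))) (at \<theta>)" for \<theta>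
      by (intro has_vector_derivative_mult dG has_vector_derivative_cnj H')
    have "((\<lambda>\<theta>. (\<lambda>\<theta>. G \<theta> * cnj (H (cis \<theta>))) (- \<theta>)) has_vector_derivative (-1) *\<^sub>R (G (-\<theta>) * cnj (H' (-\<theta>)) + G' (-\<theta>) * cnj (H (cis (-\<theta>))))) (at \<theta>)"
    proof -
      have "(uminus has_vector_derivative (-1::real)) (at \<theta>)" by (auto intro!: derivative_eq_intros)
      from vector_diff_chain_at[OF this d[of "-\<theta>"]] show ?thesis by (simp only: comp_def)
    qed
    from has_vector_derivative_diff[OF d[of \<theta>] this] show ?thesis
      unfolding Y_def[abs_def] Y'_def by (rule has_vector_derivative_eq_rhs) (simp add: algebra_simps)
  qed
  define U where "U \<theta> = of_real (w \<theta>) * Y \<theta>" for \<theta>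
  have dU: "(U has_vector_derivative \<i> * of_real (w \<theta>) * Q \<theta>) (at \<theta>)" if \<theta>: "0 < \<theta>" "\<theta> < pi" for \<theta>
  proof -
    have s: "sin \<theta> > 0" using \<theta> by (rule sin_gt_zero)
    have "((\<lambda>\<theta>. sin \<theta> powr (2 * l)) has_real_derivative 2 * l * cos \<theta> / sin \<theta> * w \<theta>) (at \<theta>)"
      using s by (auto intro!: derivative_eq_intros simp: w_def powr_diff)
    then have dw': "((\<lambda>\<theta>. sin \<theta> powr (2 * l)) has_vector_derivative 2 * l * cos \<theta> / sin \<theta> * w \<theta>) (at \<theta>)"
      by (simp add: has_real_derivative_iff_has_vector_derivative)
    \<comment> \<open>the derivative of the weight is what the boundary identity expects as its second summand\<close>
    have dw: "(w has_vector_derivative 2 * l * cos \<theta> / sin \<theta> * w \<theta>) (at \<theta>)"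
    proof (rule has_vector_derivative_transform_within_open[OF dw'])
      show "open {0<..<pi}" by simp
      show "\<And>x. x \<in> {0<..<pi} \<Longrightarrow> sin x powr (2 * l) = w x" by (simp add: w_def sin_gt_zero less_imp_le)
    qed (use \<theta> in auto)
    have key: "of_real (sin \<theta>) * Y' \<theta> + 2 * of_real l * of_real (cos \<theta>) * Y \<theta> = of_real (sin \<theta>) * (\<i> * Q \<theta>)"
      unfolding Y'_def Y_def Q_def PQ
    proof (rule eigen_boundary_identity)
      show "complex_of_real (sin \<theta>) \<noteq> 0" using s by simp
      show "cis \<theta> + cis (- \<theta>) = 2 * complex_of_real (cos \<theta>)" by (simp add: complex_eq_iff)
      show "of_real (sin \<theta>) * G' \<theta> = \<i> * of_real (sin \<theta>) * E \<theta> - of_real l * cis (- \<theta>) * (G \<theta> - G (- \<theta>))" by (rule sG)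
      have "- (of_real (sin \<theta>) * G' (-\<theta>)) = - (\<i> * of_real (sin \<theta>) * E (-\<theta>)) - of_real l * cis \<theta> * (G (-\<theta>) - G \<theta>)"
        using sG[of "-\<theta>"] by simp
      then show "of_real (sin \<theta>) * G' (-\<theta>) = \<i> * of_real (sin \<theta>) * E (-\<theta>) - of_real l * cis \<theta> * (G \<theta> - G (- \<theta>))"
        by (simp add: algebra_simps)
      show "of_real (sin \<theta>) * cnj (H' \<theta>) = - \<i> * of_real \<mu> * of_real (sin \<theta>) * cnj (H (cis \<theta>)) - of_real l * cis \<theta> * (cnj (H (cis \<theta>)) - cnj (H (cis (- \<theta>))))"
        using arg_cong[OF H'(2)[of \<theta>], of cnj] by (simp add: cis_cnj)
      have "- (of_real (sin \<theta>) * cnj (H' (-\<theta>))) = \<i> * of_real \<mu> * of_real (sin \<theta>) * cnj (H (cis (-\<theta>))) - of_real l * cis (-\<theta>) * (cnj (H (cis (-\<theta>))) - cnj (H (cis \<theta>)))"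
        using arg_cong[OF H'(2)[of "-\<theta>"], of cnj] by (simp add: cis_cnj)
      then show "of_real (sin \<theta>) * cnj (H' (-\<theta>)) = - \<i> * of_real \<mu> * of_real (sin \<theta>) * cnj (H (cis (-\<theta>))) - of_real l * cis (-\<theta>) * (cnj (H (cis \<theta>)) - cnj (H (cis (-\<theta>))))"
        by (simp add: algebra_simps)
    qed
    have "of_real (w \<theta>) * Y' \<theta> + of_real (2 * l * cos \<theta> / sin \<theta> * w \<theta>) * Y \<theta>
       = of_real (w \<theta>) / of_real (sin \<theta>) * (of_real (sin \<theta>) * Y' \<theta> + 2 * of_real l * of_real (cos \<theta>) * Y \<theta>)"
      using s by (simp add: field_simps)
    also have "\<dots> = \<i> * of_real (w \<theta>) * Q \<theta>" unfolding key using s by simp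
    finally have e: "of_real (w \<theta>) * Y' \<theta> + of_real (2 * l * cos \<theta> / sin \<theta> * w \<theta>) * Y \<theta> = \<i> * of_real (w \<theta>) * Q \<theta>" .
    show ?thesis
      unfolding U_def[abs_def]
      by (rule has_vector_derivative_eq_rhs[OF has_vector_derivative_mult[OF has_vector_derivative_of_real[OF dw[folded has_real_derivative_iff_has_vector_derivative]] dY]])
         (use e in \<open>simp add: algebra_simps\<close>)
  qed
  have cY: "continuous_on UNIV Y"
    by (intro continuous_at_imp_continuous_on ballI has_vector_derivative_continuous[OF dY])
  have cQ: "continuous_on UNIV Q"
    unfolding Q_def[abs_def] by (intro continuous_on_add cPc continuous_on_compose2[OF cPc]) (auto intro!: continuous_intros)
  have [measurable]: "Q \<in> borel_measurable borel" by (rule borel_measurable_continuous_onI[OF cQ])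
  have lim: "(U \<longlongrightarrow> 0) (at a within S)" if "Y a = 0" for a S
  proof (rule Lim_null_comparison)
    show "\<forall>\<^sub>F \<theta> in at a within S. norm (U \<theta>) \<le> norm (Y \<theta>)"
      using w1 by (intro always_eventually) (auto simp: U_def norm_mult mult_left_le_one_le)
    have "(Y \<longlongrightarrow> Y a) (at a within S)"
      using cY by (meson continuous_on_def UNIV_I tendsto_within_subset subset_UNIV)
    then show "((\<lambda>\<theta>. norm (Y \<theta>)) \<longlongrightarrow> 0) (at a within S)" using that by (simp add: tendsto_norm_zero_iff)
  qed
  have Y0: "Y 0 = 0" by (simp add: Y_def)
  have "cis (-pi) = cis pi" by (simp add: complex_eq_iff)
  then have Ypi: "Y pi = 0" by (simp add: Y_def G_def)
  have "(LBINT \<theta>=ereal 0..ereal pi. \<i> * of_real (w \<theta>) * Q \<theta>) = 0 - 0"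
  proof (rule interval_integral_FTC_integrable[where F = U])
    show "ereal 0 < ereal pi" by simp
    show "(U has_vector_derivative \<i> * of_real (w x) * Q x) (at x)" if "ereal 0 < ereal x" "ereal x < ereal pi" for x
      using dU[of x] that by simp
    show "isCont (\<lambda>\<theta>. \<i> * of_real (w \<theta>) * Q \<theta>) x" if "ereal 0 < ereal x" "ereal x < ereal pi" for x
    proof -
      have "sin x \<noteq> 0" using sin_gt_zero[of x] that by simp
      moreover have "isCont Q x" using cQ by (simp add: continuous_on_eq_continuous_at)
      ultimately show ?thesis unfolding w_def by (intro continuous_intros) auto
    qed
    show "set_integrable lborel (einterval (ereal 0) (ereal pi)) (\<lambda>\<theta>. \<i> * of_real (w \<theta>) * Q \<theta>)"
      unfolding set_integrable_def
    proof (rule Bochner_Integration.integrable_bound)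
      show "integrable lborel (\<lambda>\<theta>. indicator {0<..<pi} \<theta> * (2 * B))" by (intro integrable_mult_left) auto
      show "AE \<theta> in lborel. norm (indicator (einterval (ereal 0) (ereal pi)) \<theta> *\<^sub>R (\<i> * of_real (w \<theta>) * Q \<theta>)) \<le> norm (indicator {0<..<pi} \<theta> * (2 * B))"
      proof (rule AE_I2)
        fix \<theta> :: real
        have "norm (Q \<theta>) \<le> 2 * B"
          unfolding Q_def using norm_triangle_ineq[of "P (cis \<theta>)" "P (cis (-\<theta>))"] B[of "cis \<theta>"] B[of "cis (-\<theta>)"] by simp
        then have "w \<theta> * norm (Q \<theta>) \<le> 1 * (2 * B)" using w1[of \<theta>] by (intro mult_mono) auto
        then show "norm (indicator (einterval (ereal 0) (ereal pi)) \<theta> *\<^sub>R (\<i> * of_real (w \<theta>) * Q \<theta>)) \<le> norm (indicator {0<..<pi} \<theta> * (2 * B))"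
          using w1[of \<theta>] by (auto simp: indicator_def norm_mult einterval_def)
      qed
    qed measurable
    show "((U \<circ> real_of_ereal) \<longlongrightarrow> 0) (at_right (ereal 0))"
      unfolding ereal_tendsto_simps1 by (rule lim[OF Y0])
    show "((U \<circ> real_of_ereal) \<longlongrightarrow> 0) (at_left (ereal pi))"
      unfolding ereal_tendsto_simps1 by (rule lim[OF Ypi])
  qed
  then have zero: "(\<integral>\<theta>. indicator {0<..<pi} \<theta> *\<^sub>R (\<i> * of_real (w \<theta>) * Q \<theta>) \<partial>lborel) = 0"
    by (simp add: interval_lebesgue_integral_def set_lebesgue_integral_def einterval_eq)
  have "(\<integral>\<zeta>. P \<zeta> \<partial>circ l) = (\<integral>\<theta>. F \<theta> \<partial>lborel)"
    unfolding F_def w_def by (rule integral_circ[OF continuous_measurable_circ[OF cP]])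
  also have "\<dots> = (\<integral>\<theta>. indicator {0<..} \<theta> *\<^sub>R (F \<theta> + F (- \<theta>)) \<partial>lborel)"
    by (rule integral_even_fold[OF Fint]) (simp add: F_def w_def)
  also have "\<dots> = (\<integral>\<theta>. - \<i> * (indicator {0<..<pi} \<theta> *\<^sub>R (\<i> * of_real (w \<theta>) * Q \<theta>)) \<partial>lborel)"
    by (intro Bochner_Integration.integral_cong refl)
       (auto simp: F_def Q_def w_def indicator_def scaleR_conv_of_real algebra_simps)
  also have "\<dots> = 0" unfolding integral_mult_right_zero zero by simp
  finally show ?thesis unfolding P_def .
qed


text \<open>
  By the preceding orthogonality the pairing \<open>m\<close> satisfies Euler's equation \<open>r m' = \<mu> m\<close>.
\<close>

lemma circ_pairing_power:
  assumes l: "0 \<le> l" and g: "wirtinger_analytic l g g1 g2" and H: "circle_eigen l \<mu> H"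
    and cH: "continuous_on (sphere 0 1) H"
  obtains c where "\<And>r. 0 < r \<Longrightarrow> r < 1 \<Longrightarrow>
    (\<integral>\<zeta>. g (of_real r * \<zeta>) * cnj (H \<zeta>) \<partial>circ l) = of_real (r powr \<mu>) * c"
proof -
  have rb: "of_real r * \<zeta> \<in> ball 0 1" if "norm \<zeta> = 1" "0 < r" "r < 1" for \<zeta> :: complex and r :: real
    using that by (simp add: norm_mult)
  have gw: "has_wirtinger g (g1 z) (g2 z) z" if "z \<in> ball 0 1" for z
    using g that by (simp add: wirtinger_analytic_def)
  have cg: "continuous_on (ball 0 1) g" 
    by (intro continuous_at_imp_continuous_on ballI has_wirtinger_isCont[OF gw])
  have cg1: "continuous_on (ball 0 1) g1" and cg2: "continuous_on (ball 0 1) g2"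
    using g by (simp_all add: wirtinger_analytic_def)
  have cr: "continuous_on (sphere 0 1) (\<lambda>\<zeta>. k (of_real r * \<zeta>))" if "continuous_on (ball 0 1) k" "0 < r" "r < 1" for k :: "complex \<Rightarrow> complex" and r
    by (rule continuous_on_compose2[OF that(1)]) (use that in \<open>auto intro!: continuous_intros rb\<close>)
  define m where "m r = (\<integral>\<zeta>. g (of_real r * \<zeta>) * cnj (H \<zeta>) \<partial>circ l)" for r :: real
  define D where "D r \<zeta> = (\<zeta> * g1 (of_real r * \<zeta>) + cnj \<zeta> * g2 (of_real r * \<zeta>)) * cnj (H \<zeta>)" for r :: real and \<zeta>
  have cD: "continuous_on (sphere 0 1) (D r)" if "0 < r" "r < 1" for r
    unfolding D_def[abs_def] using that by (intro continuous_intros cr cg1 cg2 cH)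
  have cI: "continuous_on (sphere 0 1) (\<lambda>\<zeta>. g (of_real r * \<zeta>) * cnj (H \<zeta>))" if "0 < r" "r < 1" for r
    using that by (intro continuous_intros cr cg cH)
  have dm: "(m has_vector_derivative (\<integral>\<zeta>. D r \<zeta> \<partial>circ l)) (at r)" if r: "0 < r" "r < 1" for r
  proof -
    define R where "R = (1 + r) / 2"
    have R: "0 < R" "R < 1" "r < R" using r by (auto simp: R_def)
    have sub: "cball 0 R \<subseteq> ball (0::complex) 1" using R by auto
    have "bounded (g1 ` cball 0 R)" "bounded (g2 ` cball 0 R)" "bounded (H ` sphere 0 1)"
      by (intro compact_imp_bounded compact_continuous_image cH compact_sphere compact_cball
          continuous_on_subset[OF cg1 sub] continuous_on_subset[OF cg2 sub])+
    then obtain B1 B2 BH where "\<forall>x\<in>g1 ` cball 0 R. norm x \<le> B1" "\<forall>x\<in>g2 ` cball 0 R. norm x \<le> B2" "\<forall>x\<in>H ` sphere 0 1. norm x \<le> BH"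
      unfolding bounded_iff by blast
    then have B1: "norm (g1 z) \<le> B1" and B2: "norm (g2 z) \<le> B2" if "norm z \<le> R" for z using that by auto
    have BH: "norm (H z) \<le> BH" if "norm z = 1" for z using that \<open>\<forall>x\<in>H ` sphere 0 1. norm x \<le> BH\<close> by auto
    have BH0: "0 \<le> BH" by (rule order.trans[OF norm_ge_zero BH[of 1]]) simp
    have "(m has_derivative (\<lambda>h. \<integral>\<zeta>. h *\<^sub>R D r \<zeta> \<partial>circ l)) (at r)"
      unfolding m_def[abs_def]
    proof (rule has_derivative_integral_bounded[where S = "{0<..<R}" and T = "sphere 0 1" and B = "(B1 + B2) * BH"
          and f' = "\<lambda>r \<zeta> h. h *\<^sub>R D r \<zeta>"])
      show "finite_measure (circ l)" by (rule circ_finite[OF l])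
      show "r \<in> {0<..<R}" using r R by simp
      show "AE t in circ l. t \<in> sphere 0 1" by (rule AE_circ)
      fix x :: real and t :: complex assume x: "x \<in> {0<..<R}" and t: "t \<in> sphere 0 1"
      have xb: "norm (of_real x * t) \<le> R" using x t by (simp add: norm_mult)
      have "((\<lambda>x. of_real x * t) has_vector_derivative t) (at x)"
        by (auto intro!: derivative_eq_intros)
      then have "((\<lambda>x. g (of_real x * t)) has_vector_derivative g1 (of_real x * t) * t + g2 (of_real x * t) * cnj t) (at x)"
        using x t R by (intro has_wirtinger_compose_vector gw rb) auto
      then have "((\<lambda>x. g (of_real x * t) * cnj (H t)) has_vector_derivative (g1 (of_real x * t) * t + g2 (of_real x * t) * cnj t) * cnj (H t)) (at x)"
        by (rule has_vector_derivative_mult_left)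
      then show "((\<lambda>x. g (of_real x * t) * cnj (H t)) has_derivative (\<lambda>h. h *\<^sub>R D x t)) (at x)"
        unfolding has_vector_derivative_def by (rule has_derivative_eq_rhs) (simp add: D_def fun_eq_iff algebra_simps)
      fix h :: real
      have "norm (t * g1 (of_real x * t) + cnj t * g2 (of_real x * t)) \<le> B1 + B2"
        using norm_triangle_ineq[of "t * g1 (of_real x * t)" "cnj t * g2 (of_real x * t)"] B1[OF xb] B2[OF xb] t
        by (simp add: norm_mult)
      then have "norm (D x t) \<le> (B1 + B2) * BH"
        unfolding D_def norm_mult complex_mod_cnj using BH[of t] BH0 t by (intro mult_mono) (auto intro: order.trans[OF norm_ge_zero])
      then show "norm (h *\<^sub>R D x t) \<le> (B1 + B2) * BH * norm h"
        by (simp add: mult.commute mult_left_mono)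
    next
      fix x assume "x \<in> {0<..<R}"
      then show "integrable (circ l) (\<lambda>\<zeta>. g (of_real x * \<zeta>) * cnj (H \<zeta>))"
        using R by (intro integrable_circ[OF l] cI) auto
    next
      fix h
      show "(\<lambda>t. h *\<^sub>R D r t) \<in> borel_measurable (circ l)"
        using r by (intro continuous_measurable_circ continuous_intros cD)
    qed auto
    then show ?thesis unfolding has_vector_derivative_def
      by (rule has_derivative_eq_rhs) (simp add: fun_eq_iff)
  qed
  have ode: "of_real r * (\<integral>\<zeta>. D r \<zeta> \<partial>circ l) = of_real \<mu> * m r" if r: "0 < r" "r < 1" for r
  proof -
    have "0 = (\<integral>\<zeta>. of_real r * D r \<zeta> - of_real \<mu> * (g (of_real r * \<zeta>) * cnj (H \<zeta>)) \<partial>circ l)"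
      unfolding circ_eigen_orthogonal[OF l g H cH r, symmetric] D_def
      by (intro Bochner_Integration.integral_cong refl) (simp add: algebra_simps)
    also have "\<dots> = of_real r * (\<integral>\<zeta>. D r \<zeta> \<partial>circ l) - of_real \<mu> * m r"
      unfolding m_def
      by (subst Bochner_Integration.integral_diff) (use r in \<open>auto intro!: integrable_circ[OF l] continuous_intros cD cI\<close>)
    finally show ?thesis by simp
  qed
  \<comment> \<open>integrating factor for Euler's equation\<close>
  have const: "((\<lambda>r. (r powr - \<mu>) *\<^sub>R m r) has_vector_derivative 0) (at r within {0<..<1})" if r: "r \<in> {0<..<1}" for r
  proof -
    have r: "0 < r" "r < 1" using r by auto
    have "((\<lambda>r. r powr - \<mu>) has_real_derivative (- \<mu> / r * r powr - \<mu>)) (at r)"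
      using r by (auto intro!: derivative_eq_intros simp: powr_diff)
    from has_vector_derivative_scaleR[OF this dm[OF r]]
    have "((\<lambda>r. (r powr - \<mu>) *\<^sub>R m r) has_vector_derivative (r powr - \<mu>) *\<^sub>R (\<integral>\<zeta>. D r \<zeta> \<partial>circ l) + (- \<mu> / r * r powr - \<mu>) *\<^sub>R m r) (at r)" .
    moreover have "(r powr - \<mu>) *\<^sub>R (\<integral>\<zeta>. D r \<zeta> \<partial>circ l) + (- \<mu> / r * r powr - \<mu>) *\<^sub>R m r
       = of_real (r powr - \<mu> / r) * (of_real r * (\<integral>\<zeta>. D r \<zeta> \<partial>circ l) - of_real \<mu> * m r)"
      using r by (simp add: scaleR_conv_of_real field_simps)
    ultimately show ?thesis using ode[OF r] by (simp add: has_vector_derivative_at_within)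
  qed
  obtain c where c: "\<And>r. r \<in> {0<..<1} \<Longrightarrow> (r powr - \<mu>) *\<^sub>R m r = c"
    by (rule has_vector_derivative_zero_constant[OF convex_real_interval(8) const]) (assumption, rule that, blast)
  show thesis
  proof (rule that[of c])
    fix r :: real assume r: "0 < r" "r < 1"
    then have "of_real (r powr \<mu>) * ((r powr - \<mu>) *\<^sub>R m r) = m r"
      by (simp add: scaleR_conv_of_real powr_minus)
    then show "(\<integral>\<zeta>. g (of_real r * \<zeta>) * cnj (H \<zeta>) \<partial>circ l) = of_real (r powr \<mu>) * c"
      unfolding m_def[symmetric] using c[of r] r by simp
  qed
qed

section \<open>Orthogonality on the circle\<close>

text \<open>
  These complement the \<open>A\<^sub>n\<close> to a complete system on the circle, as the negative powers of
  \<open>z\<close>, to which they reduce on the circle for \<open>\<lambda> = 0\<close>, complement the nonnegative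
  ones.
\<close>

definition antipoly :: "real \<Rightarrow> nat \<Rightarrow> complex \<Rightarrow> complex" where
  "antipoly l n z = cnj (z * gpoly l n z)"

lemma continuous_on_gpoly [continuous_intros]: "continuous_on S (gpoly l n)"
  unfolding gpoly_def[abs_def] by (intro continuous_intros)

lemma continuous_on_antipoly [continuous_intros]: "continuous_on S (antipoly l n)"
  unfolding antipoly_def[abs_def] by (intro continuous_intros)

text \<open>
  Euler's identity for homogeneous polynomials gives the radial derivative, and the deformed Cauchy-Riemann equation
  converts it into the angular one.
\<close>

lemma gpoly_derivative_circle:
  obtains \<psi>' where "\<And>\<theta>. ((\<lambda>\<theta>. gpoly l n (cis \<theta>)) has_vector_derivative \<psi>' \<theta>) (at \<theta>)"
    "\<And>\<theta>. of_real (sin \<theta>) * \<psi>' \<theta> = \<i> * of_real (real n) * of_real (sin \<theta>) * gpoly l n (cis \<theta>)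
        - of_real l * cis (- \<theta>) * (gpoly l n (cis \<theta>) - gpoly l n (cis (- \<theta>)))"
proof (cases n)
  case 0
  then show thesis by (intro that[of "\<lambda>_. 0"]) (auto simp: gpoly_0[abs_def])
next
  case (Suc m)
  define c where "c = phi_coef l (\<lambda>_. 1)"
  define D1 where "D1 = hpart (dz_coef c) m"
  define D2 where "D2 = hpart (dzbar_coef c) m"
  have hc: "hpart c n = gpoly l n" by (simp add: fun_eq_iff c_def hpart_phi_coef)
  have w: "has_wirtinger (gpoly l n) (D1 z) (D2 z) z" for z
    using hpart_has_derivative[of c m z] Suc hc by (simp add: has_wirtinger_def D1_def D2_def)
  have euler: "z * D1 z + cnj z * D2 z = of_nat n * gpoly l n z" for z
  proof -
    define t where "t j = c (Suc m) j * cnj z ^ j * z ^ (Suc m - j)" for j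
    have "z * D1 z = (\<Sum>j\<le>m. of_nat (Suc m - j) * t j)"
      unfolding D1_def hpart_def dz_coef_def sum_distrib_left t_def by (intro sum.cong) (auto simp: Suc_diff_le)
    also have "\<dots> = (\<Sum>j\<le>Suc m. of_nat (Suc m - j) * t j)" by simp
    finally have 1: "z * D1 z = (\<Sum>j\<le>Suc m. of_nat (Suc m - j) * t j)" .
    have "cnj z * D2 z = (\<Sum>j\<le>m. of_nat (Suc j) * t (Suc j))"
      unfolding D2_def hpart_def dzbar_coef_def sum_distrib_left t_def by (intro sum.cong) auto
    also have "\<dots> = (\<Sum>j\<le>Suc m. of_nat j * t j)" by (subst sum.atMost_Suc_shift) simp
    finally have 2: "cnj z * D2 z = (\<Sum>j\<le>Suc m. of_nat j * t j)" .
    have "z * D1 z + cnj z * D2 z = (\<Sum>j\<le>Suc m. of_nat (Suc m) * t j)"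
      unfolding 1 2 sum.distrib[symmetric]
      by (intro sum.cong refl) (auto simp: algebra_simps of_nat_diff simp flip: of_nat_Suc)
    moreover have "gpoly l n z = (\<Sum>j\<le>Suc m. t j)"
      unfolding hc[symmetric] hpart_def t_def using Suc by simp
    ultimately show ?thesis by (simp only: Suc sum_distrib_left)
  qed
  have dz: "(z - cnj z) * D2 z = of_real l * (gpoly l n z - gpoly l n (cnj z))" for z
    using hpart_phi_dzbar[of z l "\<lambda>_. 1" m] unfolding c_def[symmetric] D2_def[symmetric] Suc[symmetric] hc .
  define \<psi>' where "\<psi>' \<theta> = D1 (cis \<theta>) * (\<i> * cis \<theta>) + D2 (cis \<theta>) * cnj (\<i> * cis \<theta>)" for \<theta>
  show thesis
  proof (rule that[of \<psi>'])
    show "((\<lambda>\<theta>. gpoly l n (cis \<theta>)) has_vector_derivative \<psi>' \<theta>) (at \<theta>)" for \<theta>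
      unfolding \<psi>'_def by (rule has_wirtinger_compose_vector[OF w cis_has_vector_derivative])
    fix \<theta>
    have s: "2 * \<i> * of_real (sin \<theta>) = cis \<theta> - cnj (cis \<theta>)" by (simp add: complex_eq_iff)
    have "of_real (sin \<theta>) * \<psi>' \<theta> = \<i> * of_real (sin \<theta>) * (cis \<theta> * D1 (cis \<theta>) + cnj (cis \<theta>) * D2 (cis \<theta>))
        - cnj (cis \<theta>) * ((2 * \<i> * of_real (sin \<theta>)) * D2 (cis \<theta>))"
      unfolding \<psi>'_def by (simp add: algebra_simps)
    then show "of_real (sin \<theta>) * \<psi>' \<theta> = \<i> * of_real (real n) * of_real (sin \<theta>) * gpoly l n (cis \<theta>)
        - of_real l * cis (- \<theta>) * (gpoly l n (cis \<theta>) - gpoly l n (cis (- \<theta>)))"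
      unfolding s euler dz by (simp add: cis_cnj mult_ac)
  qed
qed

lemma gpoly_eigen: "circle_eigen l (real n) (gpoly l n)"
  by (rule gpoly_derivative_circle[of l n]) (auto simp: circle_eigen_def)

text \<open>
  Conjugation turns the equation for \<open>A\<^sub>n\<close> into one with eigenvalue \<open>-n\<close> and
  \<open>cis \<theta>\<close> in place of \<open>cis (-\<theta>)\<close>; the factor \<open>cnj z\<close> shifts the
  eigenvalue by \<open>-1\<close>, and commuting it with the difference term contributes the remaining
  \<open>-2 \<lambda>\<close> because \<open>cis \<theta> - cis (-\<theta>) = 2 \<i> sin \<theta>\<close>.
\<close>

lemma antipoly_eigen: "circle_eigen l (- (real (Suc n) + 2 * l)) (antipoly l n)"
proof -
  obtain p where p: "\<And>\<theta>. ((\<lambda>\<theta>. gpoly l n (cis \<theta>)) has_vector_derivative p \<theta>) (at \<theta>)"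
    "\<And>\<theta>. of_real (sin \<theta>) * p \<theta> = \<i> * of_real (real n) * of_real (sin \<theta>) * gpoly l n (cis \<theta>)
        - of_real l * cis (- \<theta>) * (gpoly l n (cis \<theta>) - gpoly l n (cis (- \<theta>)))"
    using gpoly_derivative_circle[of l n] by blast
  define H' where "H' \<theta> = cnj (cis \<theta> * p \<theta> + \<i> * cis \<theta> * gpoly l n (cis \<theta>))" for \<theta>
  show ?thesis
    unfolding circle_eigen_def
  proof (intro exI[of _ H'] allI conjI)
    fix \<theta>
    show "((\<lambda>\<theta>. antipoly l n (cis \<theta>)) has_vector_derivative H' \<theta>) (at \<theta>)"
      unfolding antipoly_def H'_def
      by (intro has_vector_derivative_cnj has_vector_derivative_mult cis_has_vector_derivative p)
    define s where "s = complex_of_real (sin \<theta>)"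
    define e where "e = cis \<theta>"
    define e' where "e' = cis (- \<theta>)"
    define a where "a = gpoly l n (cis \<theta>)"
    have ee: "e * e' = 1" "cnj e = e'" "cnj e' = e" by (simp_all add: e_def e'_def cis_mult cis_cnj)
    have ss: "e - e' = 2 * \<i> * s" by (simp add: e_def e'_def s_def complex_eq_iff)
    have ac: "gpoly l n (cis (- \<theta>)) = cnj a" unfolding a_def by (simp add: cis_cnj flip: gpoly_cnj)
    have h: "antipoly l n (cis \<theta>) = e' * cnj a" "antipoly l n (cis (- \<theta>)) = e * a"
      by (simp_all add: antipoly_def cis_cnj e_def e'_def a_def ac[unfolded a_def])
    have "s * p \<theta> = \<i> * of_nat n * s * a - of_real l * e' * (a - cnj a)"
      using p(2)[of \<theta>] by (simp add: s_def e'_def a_def ac[unfolded a_def])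
    from arg_cong[OF this, of cnj]
    have cp: "s * cnj (p \<theta>) = - \<i> * of_nat n * s * cnj a - of_real l * e * (cnj a - a)"
      by (simp add: ee s_def)
    have "s * H' \<theta> = e' * (s * cnj (p \<theta>)) - \<i> * s * e' * cnj a"
      unfolding H'_def a_def[symmetric] unfolding e_def[symmetric] by (simp add: ee algebra_simps)
    also have "\<dots> = - \<i> * (of_nat n + 1) * s * (e' * cnj a) - of_real l * (e * e') * (cnj a - a)"
      unfolding cp by (simp add: algebra_simps)
    also have "\<dots> = - \<i> * (of_nat n + 1 + 2 * of_real l) * s * (e' * cnj a) + of_real l * (2 * \<i> * s) * e' * cnj a - of_real l * (e * e') * (cnj a - a)"
      by (simp add: algebra_simps)
    also have "\<dots> = - \<i> * (of_nat n + 1 + 2 * of_real l) * s * (e' * cnj a) - of_real l * e' * (e' * cnj a - e * a)"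
      unfolding ss[symmetric] by (simp add: algebra_simps ee)
    finally show "complex_of_real (sin \<theta>) * H' \<theta> = \<i> * of_real (- (real (Suc n) + 2 * l)) * of_real (sin \<theta>) * antipoly l n (cis \<theta>) -
       of_real l * cis (- \<theta>) * (antipoly l n (cis \<theta>) - antipoly l n (cis (- \<theta>)))"
      unfolding h unfolding s_def[symmetric] e'_def[symmetric] by (simp add: algebra_simps)
  qed
qed

definition circ_pair :: "real \<Rightarrow> (complex \<Rightarrow> complex) \<Rightarrow> (complex \<Rightarrow> complex) \<Rightarrow> complex" where
  "circ_pair l G H = (\<integral>\<zeta>. G \<zeta> * cnj (H \<zeta>) \<partial>circ l)"

lemma circ_pair_cnj: "circ_pair l H G = cnj (circ_pair l G H)"
  unfolding circ_pair_def by (subst Bochner_Integration.integral_cnj[symmetric]) (simp add: mult.commute)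

lemma circ_pair_add_left:
  "0 \<le> l \<Longrightarrow> continuous_on (sphere 0 1) F \<Longrightarrow> continuous_on (sphere 0 1) G \<Longrightarrow> continuous_on (sphere 0 1) H \<Longrightarrow>
   circ_pair l (\<lambda>z. F z + G z) H = circ_pair l F H + circ_pair l G H"
  unfolding circ_pair_def distrib_right
  by (intro Bochner_Integration.integral_add integrable_circ continuous_intros)

lemma circ_pair_scale_left: "circ_pair l (\<lambda>z. c * F z) H = c * circ_pair l F H"
  unfolding circ_pair_def mult.assoc by simp

lemma circ_pair_cong:
  "(\<And>z. norm z = 1 \<Longrightarrow> F z = F' z) \<Longrightarrow> (\<And>z. norm z = 1 \<Longrightarrow> H z = H' z) \<Longrightarrow> circ_pair l F H = circ_pair l F' H'"
  unfolding circ_pair_def by (intro Bochner_Integration.integral_cong) auto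

lemma circ_pair_add_right:
  "0 \<le> l \<Longrightarrow> continuous_on (sphere 0 1) F \<Longrightarrow> continuous_on (sphere 0 1) G \<Longrightarrow> continuous_on (sphere 0 1) H \<Longrightarrow>
   circ_pair l H (\<lambda>z. F z + G z) = circ_pair l H F + circ_pair l H G"
  by (subst (1 2 3) circ_pair_cnj) (simp add: circ_pair_add_left)

lemma circ_pair_scale_right: "circ_pair l H (\<lambda>z. c * F z) = cnj c * circ_pair l H F"
  by (subst (1 2) circ_pair_cnj) (simp add: circ_pair_scale_left)

lemma wirtinger_analytic_gpoly:
  assumes "0 \<le> l" obtains g1 g2 where "wirtinger_analytic l (gpoly l k) g1 g2"
proof -
  define a where "a n = (if n = k then 1 else 0 :: complex)" for n
  have "norm (a n) * t ^ n \<le> 1" if "0 < t \<and> t < 1" for t :: real and n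
    using that by (simp add: a_def power_le_one)
  then have "subexp a" unfolding subexp_def by blast
  have "ser (phi_coef l a) z = gpoly l k z" for z
  proof -
    have "(\<lambda>n. hpart (phi_coef l a) n z) = (\<lambda>n. if n = k then gpoly l n z else 0)"
      by (simp add: fun_eq_iff hpart_phi_coef a_def)
    then have "(\<lambda>n. hpart (phi_coef l a) n z) sums gpoly l k z" using sums_single[of k "\<lambda>n. gpoly l n z"] by simp
    then show ?thesis by (simp add: ser_def sums_iff)
  qed
  then have "ser (phi_coef l a) = gpoly l k" by (rule ext)
  with wirtinger_analytic_ser[OF assms \<open>subexp a\<close>] show thesis by (auto intro: that)
qed

text \<open>
  Homogeneity makes the pairing on the circle of radius \<open>r\<close> proportional to \<open>r\<^sup>k\<close>, while
  the eigenvalue forces the power \<open>\<mu>\<close>. Two different powers agree only if both constants vanish;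
  comparing \<open>r = 1/2\<close> and \<open>r = 1/4\<close> is enough.
\<close>

lemma gpoly_orthogonal:
  assumes l: "0 \<le> l" and H: "circle_eigen l \<mu> H" "continuous_on (sphere 0 1) H" and \<mu>: "\<mu> \<noteq> real k"
  shows "circ_pair l (gpoly l k) H = 0"
proof -
  obtain g1 g2 where g: "wirtinger_analytic l (gpoly l k) g1 g2" using wirtinger_analytic_gpoly[OF l] .
  obtain c where c: "\<And>r. 0 < r \<Longrightarrow> r < 1 \<Longrightarrow> (\<integral>\<zeta>. gpoly l k (of_real r * \<zeta>) * cnj (H \<zeta>) \<partial>circ l) = of_real (r powr \<mu>) * c"
    using circ_pairing_power[OF l g H] by blast
  have e: "circ_pair l (gpoly l k) H = of_real (r powr (\<mu> - real k)) * c" if "0 < r" "r < 1" for r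
  proof -
    have "of_real (r ^ k) * circ_pair l (gpoly l k) H = of_real (r powr \<mu>) * c"
      using c[OF that] unfolding gpoly_scale circ_pair_def by (simp add: mult.assoc)
    moreover have "r powr \<mu> = r ^ k * r powr (\<mu> - real k)"
      using that by (simp add: powr_diff powr_realpow)
    ultimately have "of_real (r ^ k) * circ_pair l (gpoly l k) H = of_real (r ^ k) * (of_real (r powr (\<mu> - real k)) * c)"
      by (simp add: mult.assoc)
    then show ?thesis using that by simp
  qed
  \<comment> \<open>q is neither 0 nor 1, so c = 0 follows from q^2 c = q c\<close>
  define q where "q = (1/2::real) powr (\<mu> - real k)"
  have "(1/4::real) powr (\<mu> - real k) = q * q"
    unfolding q_def powr_mult[symmetric] by (simp add: powr_divide flip: powr_mult)
  with e[of "1/4"] have e4: "circ_pair l (gpoly l k) H = of_real (q * q) * c" by simp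
  have e2: "circ_pair l (gpoly l k) H = of_real q * c" using e[of "1/2"] by (simp add: q_def)
  have "q \<noteq> 0" "q \<noteq> 1" using \<mu> by (auto simp: q_def powr_def)
  with e2 e4 show ?thesis by auto
qed

text \<open>
  The pairing would behave like a negative power of \<open>r\<close>, yet it stays bounded as \<open>r\<close> tends to
  \<open>0\<close>.
\<close>

lemma pairing_antipoly_zero:
  assumes l: "0 \<le> l" and g: "wirtinger_analytic l g g1 g2" and r: "0 < r" "r < 1"
  shows "(\<integral>\<zeta>. g (of_real r * \<zeta>) * cnj (antipoly l n \<zeta>) \<partial>circ l) = 0"
proof -
  define \<mu> where "\<mu> = real (Suc n) + 2 * l"
  have \<mu>1: "1 \<le> \<mu>" using l by (simp add: \<mu>_def)
  obtain c where c: "\<And>r. 0 < r \<Longrightarrow> r < 1 \<Longrightarrow> (\<integral>\<zeta>. g (of_real r * \<zeta>) * cnj (antipoly l n \<zeta>) \<partial>circ l) = of_real (r powr (-\<mu>)) * c"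
    using circ_pairing_power[OF l g antipoly_eigen[of l n, folded \<mu>_def] continuous_on_antipoly] by blast
  have cg: "continuous_on (ball 0 1) g"
    using g by (intro continuous_at_imp_continuous_on ballI has_wirtinger_isCont) (auto simp: wirtinger_analytic_def)
  have "bounded (g ` cball 0 (1/2))" "bounded (antipoly l n ` sphere 0 1)"
    by (intro compact_imp_bounded compact_continuous_image compact_sphere compact_cball continuous_intros
          continuous_on_subset[OF cg]; auto)+
  then obtain B1 B2 where "\<forall>x\<in>g ` cball 0 (1/2). norm x \<le> B1" "\<forall>x\<in>antipoly l n ` sphere 0 1. norm x \<le> B2"
    unfolding bounded_iff by blast
  then have B1: "norm (g z) \<le> B1" if "norm z \<le> 1/2" for z using that by auto
  have B2: "norm (antipoly l n z) \<le> B2" if "norm z = 1" for z using that \<open>\<forall>x\<in>antipoly l n ` sphere 0 1. norm x \<le> B2\<close> by auto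
  have B0: "0 \<le> B1" "0 \<le> B2" by (rule order.trans[OF norm_ge_zero B1[of 0]], simp, rule order.trans[OF norm_ge_zero B2[of 1]], simp)
  interpret finite_measure "circ l" by (rule circ_finite[OF l])
  define K where "K = B1 * B2 * measure (circ l) (sphere 0 1)"
  have K: "norm c \<le> s * K" if s: "0 < s" "s < 1/2" for s
  proof -
    have "norm (\<integral>\<zeta>. g (of_real s * \<zeta>) * cnj (antipoly l n \<zeta>) \<partial>circ l) \<le> (\<integral>\<zeta>. norm (g (of_real s * \<zeta>) * cnj (antipoly l n \<zeta>)) \<partial>circ l)"
      by (rule integral_norm_bound)
    also have "\<dots> \<le> (\<integral>\<zeta>. B1 * B2 \<partial>circ l)"
    proof (rule integral_mono)
      have "continuous_on (sphere 0 1) (\<lambda>\<zeta>. g (of_real s * \<zeta>))"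
        by (rule continuous_on_compose2[OF cg]) (use s in \<open>auto intro!: continuous_intros simp: norm_mult\<close>)
      then show "integrable (circ l) (\<lambda>\<zeta>. norm (g (of_real s * \<zeta>) * cnj (antipoly l n \<zeta>)))"
        by (intro integrable_norm integrable_circ[OF l] continuous_intros)
      fix \<zeta> assume "\<zeta> \<in> space (circ l)"
      then show "norm (g (of_real s * \<zeta>) * cnj (antipoly l n \<zeta>)) \<le> B1 * B2"
        unfolding norm_mult complex_mod_cnj using s B0 by (intro mult_mono B1 B2) (auto simp: norm_mult)
    qed auto
    also have "\<dots> = K" by (simp add: K_def mult.commute)
    finally have "s powr (-\<mu>) * norm c \<le> K" using c[of s] s by (simp add: norm_mult)
    then have "norm c \<le> s powr \<mu> * K" using s by (simp add: powr_minus divide_simps mult.commute)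
    also have "\<dots> \<le> s * K"
    proof (rule mult_right_mono)
      show "s powr \<mu> \<le> s" using powr_mono'[OF \<mu>1, of s] s by simp
      show "0 \<le> K" using B0 by (simp add: K_def)
    qed
    finally show ?thesis .
  qed
  have "(\<lambda>n. (1 / real (n + 3)) * K) \<longlonglongrightarrow> 0 * K"
    by (intro tendsto_intros LIMSEQ_ignore_initial_segment[OF lim_1_over_n])
  then have "norm c \<le> 0 * K"
    by (rule LIMSEQ_le_const) (intro exI[of _ 0] allI impI K; simp)
  then show ?thesis using c[OF r] by simp
qed

lemma gpoly_antipoly_orthogonal: "0 \<le> l \<Longrightarrow> circ_pair l (gpoly l k) (antipoly l n) = 0"
  by (rule gpoly_orthogonal[OF _ antipoly_eigen]) (auto intro!: continuous_intros)

definition circ_mass :: "real \<Rightarrow> real" where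
  "circ_mass l = measure (circ l) (sphere 0 1)"

lemma gpoly_rec_anti:
  "of_nat (Suc n) * gpoly l (Suc n) z = of_real (real (Suc n) + l) * (z * gpoly l n z) + of_real l * antipoly l n z"
  using gpoly_rec[of n l z] by (simp add: antipoly_def)

text \<open>
  Pair the recurrence with each of its three terms. Multiplication by \<open>z\<close> and conjugation are isometries,
  and \<open>A\<^sub>n\<^sub>+\<^sub>1\<close> is orthogonal to the conjugate of \<open>z A\<^sub>n\<close>, so the
  three resulting equations determine the new norm.
\<close>

lemma gpoly_norm:
  assumes l: "0 \<le> l"
  shows "circ_pair l (gpoly l n) (gpoly l n) = of_real (gval l n * circ_mass l)"
proof (induction n)
  case 0
  show ?case by (simp add: circ_pair_def circ_mass_def scaleR_conv_of_real)
next
  case (Suc n)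
  define A where "A = gpoly l (Suc n)"
  define B where "B = antipoly l n"
  define Z where "Z = (\<lambda>z. z * gpoly l n z)"
  define N where "N = complex_of_real (gval l n * circ_mass l)"
  define k where "k = complex_of_real (real (Suc n))"
  define L where "L = complex_of_real l"
  have k0: "k \<noteq> 0" by (simp add: k_def del: of_nat_Suc)
  have kl0: "k + L \<noteq> 0"
  proof -
    have "real (Suc n) + l \<noteq> 0" using l by linarith
    then show ?thesis unfolding k_def L_def of_real_add[symmetric] by (simp only: of_real_eq_0_iff not_False_eq_True)
  qed
  have c: "continuous_on (sphere 0 1) A" "continuous_on (sphere 0 1) B" "continuous_on (sphere 0 1) Z"
    unfolding A_def B_def Z_def by (intro continuous_intros)+
  have rec: "k * A z = (k + L) * Z z + L * B z" for z
    unfolding A_def B_def Z_def k_def L_def using gpoly_rec_anti[of n l z] by (simp only: of_real_of_nat_eq of_real_add)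
  have ZZ: "circ_pair l Z Z = N"
  proof -
    have "circ_pair l Z Z = circ_pair l (gpoly l n) (gpoly l n)"
      unfolding circ_pair_def Z_def
    proof (intro Bochner_Integration.integral_cong refl)
      fix z assume "z \<in> space (circ l)"
      then have "z * cnj z = 1" by (simp add: complex_norm_square[symmetric])
      then show "z * gpoly l n z * cnj (z * gpoly l n z) = gpoly l n z * cnj (gpoly l n z)"
        by (metis (no_types, lifting) complex_cnj_mult mult.assoc mult.commute mult.left_neutral)
    qed
    then show ?thesis using Suc N_def by simp
  qed
  have "circ_pair l B B = circ_pair l Z Z"
    unfolding circ_pair_def B_def Z_def antipoly_def by (simp add: mult.commute)
  then have BB: "circ_pair l B B = N" using ZZ by simp
  have AB: "circ_pair l A B = 0" unfolding A_def B_def by (rule gpoly_antipoly_orthogonal[OF l])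
  then have BA: "circ_pair l B A = 0" by (subst circ_pair_cnj) simp
  have left: "k * circ_pair l A H = (k + L) * circ_pair l Z H + L * circ_pair l B H" if "continuous_on (sphere 0 1) H" for H
  proof -
    have "k * circ_pair l A H = circ_pair l (\<lambda>z. (k + L) * Z z + L * B z) H"
      unfolding circ_pair_scale_left[symmetric] rec ..
    also have "\<dots> = (k + L) * circ_pair l Z H + L * circ_pair l B H"
      using c that by (subst circ_pair_add_left[OF l]) (auto intro!: continuous_intros simp: circ_pair_scale_left)
    finally show ?thesis .
  qed
  have ZB: "(k + L) * circ_pair l Z B = - L * N"
    using left[OF c(2)] AB BB by (simp add: add_eq_0_iff2)
  have AZ: "k * circ_pair l A Z = (k + L) * N + L * circ_pair l B Z" using left[OF c(3)] ZZ by simp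
  have ZA: "k * circ_pair l Z A = (k + L) * N + L * circ_pair l Z B"
    using arg_cong[OF AZ, of cnj] by (simp add: circ_pair_cnj[of l Z A] circ_pair_cnj[of l Z B] k_def L_def N_def)
  have "k * (k * circ_pair l A A) = (k + L) * (k * circ_pair l Z A)"
    using left[OF c(1)] BA by simp
  also have "\<dots> = (k + L) * ((k + L) * N) + L * ((k + L) * circ_pair l Z B)"
    unfolding ZA by (simp add: algebra_simps)
  also have "\<dots> = k * ((k + 2 * L) * N)" unfolding ZB by (simp add: algebra_simps)
  finally have "k * circ_pair l A A = (k + 2 * L) * N" using k0 by simp
  moreover have "k + 2 * L = k * of_real (1 + 2 * l / real (Suc n))"
    using k0 by (simp add: k_def L_def field_simps del: of_nat_Suc)
  ultimately have "k * circ_pair l A A = k * of_real ((1 + 2 * l / real (Suc n)) * (gval l n * circ_mass l))"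
    by (simp add: N_def mult.assoc)
  then have "circ_pair l A A = of_real ((1 + 2 * l / real (Suc n)) * (gval l n * circ_mass l))"
    using k0 by (simp only: mult_cancel_left) simp
  then show ?case unfolding A_def gval_Suc by (simp add: mult.assoc)
qed

lemma gpoly_pair:
  assumes "0 \<le> l"
  shows "circ_pair l (gpoly l k) (gpoly l n) = (if k = n then of_real (gval l n * circ_mass l) else 0)"
  using gpoly_norm[OF assms, of n] gpoly_orthogonal[OF assms gpoly_eigen[of l n], of k] by (auto intro!: continuous_intros)


section \<open>Completeness on the circle\<close>

text \<open>
  The linear span of the two families as functions on the circle. Values elsewhere are irrelevant, which the last rule
  expresses.
\<close>

inductive circ_span :: "real \<Rightarrow> (complex \<Rightarrow> complex) \<Rightarrow> bool" for l where
  gpoly: "circ_span l (gpoly l n)"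
| antipoly: "circ_span l (antipoly l n)"
| add: "circ_span l h \<Longrightarrow> circ_span l k \<Longrightarrow> circ_span l (\<lambda>z. h z + k z)"
| scale: "circ_span l h \<Longrightarrow> circ_span l (\<lambda>z. c * h z)"
| cong: "circ_span l h \<Longrightarrow> (\<And>z. norm z = 1 \<Longrightarrow> h z = k z) \<Longrightarrow> circ_span l k"

lemma circ_span_lincomb:
  assumes "circ_span l h" "circ_span l k" "\<And>z. norm z = 1 \<Longrightarrow> c * f z = a * h z + b * k z" "c \<noteq> 0"
  shows "circ_span l f"
proof (rule circ_span.cong)
  show "circ_span l (\<lambda>z. (a / c) * h z + (b / c) * k z)" by (intro circ_span.add circ_span.scale assms)
  show "(a / c) * h z + (b / c) * k z = f z" if "norm z = 1" for z
    using assms(3)[OF that] assms(4) by (simp add: field_simps)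
qed

text \<open>
  The recurrence and its conjugate express products with \<open>z\<close> and \<open>cnj z\<close>, using
  \<open>z cnj z = 1\<close>; the leading coefficient \<open>n + 1 + \<lambda>\<close> never vanishes.
\<close>

lemma circ_span_shift_generators:
  assumes l: "0 \<le> l"
  shows "circ_span l (\<lambda>z. z * gpoly l n z)" "circ_span l (\<lambda>z. z * antipoly l n z)"
    and "circ_span l (\<lambda>z. cnj z * gpoly l n z)" "circ_span l (\<lambda>z. cnj z * antipoly l n z)"
proof -
  have c0: "complex_of_real (real (Suc n) + l) \<noteq> 0" for n
  proof -
    have "real (Suc n) + l \<noteq> 0" using l by linarith
    then show ?thesis by (simp only: of_real_eq_0_iff not_False_eq_True)
  qed
  have z1: "z * cnj z = 1" if "norm z = 1" for z :: complex
    using that by (simp add: complex_norm_square[symmetric])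
  have rec: "of_nat (Suc n) * gpoly l (Suc n) z = of_real (real (Suc n) + l) * (z * gpoly l n z) + of_real l * antipoly l n z" for n z
    by (rule gpoly_rec_anti)
  have crec: "of_nat (Suc n) * cnj (gpoly l (Suc n) z) = of_real (real (Suc n) + l) * antipoly l n z + of_real l * (z * gpoly l n z)" for n z
    using arg_cong[OF rec[of n z], of cnj] by (simp add: antipoly_def)
  show zA: "circ_span l (\<lambda>z. z * gpoly l n z)" for n
    by (rule circ_span_lincomb[OF circ_span.gpoly[of l "Suc n"] circ_span.antipoly[of l n] _ c0[of n], where a = "of_nat (Suc n)" and b = "- of_real l"])
      (simp only: rec, simp)
  have cA: "circ_span l (\<lambda>z. cnj (gpoly l n z))" for n
  proof (cases n)
    case 0 then show ?thesis using circ_span.gpoly[of l 0] by (simp add: gpoly_0[abs_def])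
  next
    case (Suc m)
    have "circ_span l (\<lambda>z. cnj (gpoly l (Suc m) z))"
      by (rule circ_span_lincomb[OF circ_span.antipoly[of l m] zA[of m] crec]) (simp del: of_nat_Suc)
    then show ?thesis using Suc by simp
  qed
  show "circ_span l (\<lambda>z. z * antipoly l n z)"
    by (rule circ_span.cong[OF cA[of n]]) (simp add: antipoly_def mult.assoc[symmetric] z1)
  show zB: "circ_span l (\<lambda>z. cnj z * antipoly l n z)" for n
  proof (rule circ_span_lincomb[OF circ_span.antipoly[of l "Suc n"] circ_span.gpoly[of l n] _ c0[of n], where a = "of_nat (Suc n)" and b = "- of_real l"])
    fix z :: complex assume z: "norm z = 1"
    have "of_nat (Suc n) * antipoly l (Suc n) z = cnj z * (of_nat (Suc n) * cnj (gpoly l (Suc n) z))"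
      by (simp add: antipoly_def)
    also have "\<dots> = of_real (real (Suc n) + l) * (cnj z * antipoly l n z) + of_real l * ((z * cnj z) * gpoly l n z)"
      unfolding crec by (simp add: algebra_simps)
    finally show "complex_of_real (real (Suc n) + l) * (cnj z * antipoly l n z) = of_nat (Suc n) * antipoly l (Suc n) z + - of_real l * gpoly l n z"
      unfolding z1[OF z] by simp
  qed
  show "circ_span l (\<lambda>z. cnj z * gpoly l n z)"
  proof (cases n)
    case 0
    then show ?thesis using circ_span.antipoly[of l 0] by (simp add: antipoly_def[abs_def])
  next
    case (Suc m)
    have "circ_span l (\<lambda>z. cnj z * gpoly l (Suc m) z)"
    proof (rule circ_span_lincomb[OF circ_span.gpoly[of l m] zB[of m], where c = "of_nat (Suc m)" and a = "of_real (real (Suc m) + l)" and b = "of_real l"])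
      fix z :: complex assume z: "norm z = 1"
      have "of_nat (Suc m) * (cnj z * gpoly l (Suc m) z) = cnj z * (of_nat (Suc m) * gpoly l (Suc m) z)" by simp
      also have "\<dots> = of_real (real (Suc m) + l) * ((z * cnj z) * gpoly l m z) + of_real l * (cnj z * antipoly l m z)"
        unfolding rec by (simp add: algebra_simps)
      finally show "of_nat (Suc m) * (cnj z * gpoly l (Suc m) z) = of_real (real (Suc m) + l) * gpoly l m z + of_real l * (cnj z * antipoly l m z)"
        unfolding z1[OF z] by simp
    qed (simp del: of_nat_Suc)
    then show ?thesis using Suc by simp
  qed
qed

lemma circ_span_mult:
  assumes l: "0 \<le> l" and h: "circ_span l h"
  shows "circ_span l (\<lambda>z. z * h z)" "circ_span l (\<lambda>z. cnj z * h z)"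
proof -
  have *: "circ_span l (\<lambda>z. q z * h z)"
    if q: "\<And>n. circ_span l (\<lambda>z. q z * gpoly l n z)" "\<And>n. circ_span l (\<lambda>z. q z * antipoly l n z)" for q
    using h
  proof induction
    case (gpoly n) then show ?case by (rule q)
  next
    case (antipoly n) then show ?case by (rule q)
  next
    case (add h k)
    show ?case unfolding distrib_left by (rule circ_span.add[OF add.IH])
  next
    case (scale h c)
    show ?case unfolding mult.left_commute[of _ c] by (rule circ_span.scale[OF scale.IH])
  next
    case (cong h k)
    show ?case by (rule circ_span.cong[OF cong.IH]) (simp add: cong.hyps)
  qed
  show "circ_span l (\<lambda>z. z * h z)" "circ_span l (\<lambda>z. cnj z * h z)"
    by (intro * circ_span_shift_generators l)+
qed

lemma circ_span_real_polynomial: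
  assumes l: "0 \<le> l" and "real_polynomial_function p" and "circ_span l h"
  shows "circ_span l (\<lambda>z. of_real (p z) * h z)"
  using assms(2,3)
proof (induction p arbitrary: h)
  case (linear f)
  have f: "of_real (f z) * h z = (of_real (f 1) / 2) * (z * h z + cnj z * h z) + (of_real (f \<i>) / (2 * \<i>)) * (z * h z + (-1) * (cnj z * h z))" for z
  proof -
    interpret bounded_linear f by fact
    have "z = Re z *\<^sub>R 1 + Im z *\<^sub>R \<i>" by (simp add: complex_eq_iff)
    then have "f z = Re z * f 1 + Im z * f \<i>" by (metis add scaleR real_scaleR_def)
    then have e: "of_real (f z) = of_real (Re z) * of_real (f 1) + of_real (Im z) * complex_of_real (f \<i>)" by simp
    have re: "complex_of_real (Re z) = (z + cnj z) / 2" and im: "complex_of_real (Im z) = (z - cnj z) / (2 * \<i>)"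
      by (simp_all add: complex_eq_iff)
    show ?thesis unfolding e re im by (simp add: field_simps)
  qed
  show ?case unfolding f
    by (intro circ_span.add circ_span.scale circ_span_mult l linear.prems)
next
  case (const c) then show ?case by (rule circ_span.scale)
next
  case (add f g)
  show ?case unfolding of_real_add distrib_right by (intro circ_span.add add.IH add.prems)
next
  case (mult f g)
  show ?case unfolding of_real_mult mult.assoc by (intro mult.IH mult.prems)
qed

lemma circ_span_polynomial:
  assumes l: "0 \<le> l" and p: "polynomial_function (p :: complex \<Rightarrow> complex)"
  shows "circ_span l p"
proof -
  have 1: "circ_span l (\<lambda>z. 1)" using circ_span.gpoly[of l 0] by (simp add: gpoly_0[abs_def])
  have "real_polynomial_function (Re \<circ> p)" "real_polynomial_function (Im \<circ> p)"
    using p unfolding polynomial_function_def by (auto intro: bounded_linear_Re bounded_linear_Im)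
  then have "circ_span l (\<lambda>z. of_real ((Re \<circ> p) z) * 1 + \<i> * (of_real ((Im \<circ> p) z) * 1))"
    by (intro circ_span.add circ_span.scale circ_span_real_polynomial[OF l] 1)
  moreover have "(\<lambda>z. of_real ((Re \<circ> p) z) * 1 + \<i> * (of_real ((Im \<circ> p) z) * 1)) = p"
    by (auto simp: fun_eq_iff complex_eq_iff)
  ultimately show ?thesis by simp
qed

lemma circ_span_orthogonal:
  assumes l: "0 \<le> l" and G: "continuous_on (sphere 0 1) G"
    and A: "\<And>n. circ_pair l G (gpoly l n) = 0" and B: "\<And>n. circ_pair l G (antipoly l n) = 0"
    and h: "circ_span l h"
  shows "continuous_on (sphere 0 1) h \<and> circ_pair l G h = 0"
  using h
proof induction
  case (cong h k)
  then show ?case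
    using circ_pair_cong[of G G h k l] continuous_on_cong[of "sphere 0 1" "sphere 0 1" h k] by auto
qed (auto intro!: continuous_intros A B simp: circ_pair_add_right[OF l _ _ G] circ_pair_scale_right)

text \<open>
  By the Stone-Weierstrass theorem \<open>G\<close> is a uniform limit of polynomials, to each of which it is
  orthogonal; hence \<open>G\<close> is orthogonal to itself. The weight vanishes only at \<open>\<plusminus>1\<close>,
  where continuity takes over.
\<close>

lemma circ_complete:
  assumes l: "0 \<le> l" and G: "continuous_on (sphere 0 1) G"
    and A: "\<And>n. circ_pair l G (gpoly l n) = 0" and B: "\<And>n. circ_pair l G (antipoly l n) = 0"
    and z: "norm z = 1"
  shows "G z = 0"
proof -
  interpret finite_measure "circ l" by (rule circ_finite[OF l])
  define I where "I = (\<integral>\<zeta>. norm (G \<zeta>) \<partial>circ l)"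
  have iG: "integrable (circ l) (\<lambda>\<zeta>. norm (G \<zeta>))" by (intro integrable_norm integrable_circ l G)
  have I0: "0 \<le> I" by (simp add: I_def)
  have small: "norm (circ_pair l G G) \<le> e * I" if e: "0 < e" for e
  proof -
    obtain p where p: "polynomial_function p" "\<And>x. x \<in> sphere 0 1 \<Longrightarrow> norm (G x - p x) < e"
      using Stone_Weierstrass_polynomial_function[OF compact_sphere G e] by blast
    have cp: "continuous_on (sphere 0 1) p" "circ_pair l G p = 0"
      using circ_span_orthogonal[OF l G A B circ_span_polynomial[OF l p(1)]] by auto
    have "circ_pair l G G = circ_pair l G (\<lambda>z. (G z - p z) + p z)" by simp
    also have "\<dots> = circ_pair l G (\<lambda>z. G z - p z)"
      using cp by (subst circ_pair_add_right[OF l]) (auto intro!: continuous_intros G)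
    finally have "norm (circ_pair l G G) \<le> (\<integral>\<zeta>. norm (G \<zeta> * cnj (G \<zeta> - p \<zeta>)) \<partial>circ l)"
      by (simp add: circ_pair_def)
    also have "\<dots> \<le> (\<integral>\<zeta>. e * norm (G \<zeta>) \<partial>circ l)"
    proof (rule integral_mono)
      show "integrable (circ l) (\<lambda>\<zeta>. norm (G \<zeta> * cnj (G \<zeta> - p \<zeta>)))"
        by (intro integrable_norm integrable_circ l continuous_intros G cp)
      show "integrable (circ l) (\<lambda>\<zeta>. e * norm (G \<zeta>))" using iG by simp
      fix x assume "x \<in> space (circ l)"
      then show "norm (G x * cnj (G x - p x)) \<le> e * norm (G x)"
        using mult_left_mono[OF less_imp_le[OF p(2)[of x]], of "norm (G x)"] unfolding norm_mult complex_mod_cnj by (simp add: mult.commute)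
    qed
    also have "\<dots> = e * I" by (simp add: I_def)
    finally show ?thesis .
  qed
  have pair0: "circ_pair l G G = 0"
  proof (rule ccontr)
    assume "circ_pair l G G \<noteq> 0"
    then have pos: "norm (circ_pair l G G) > 0" by simp
    \<comment> \<open>small enough to contradict the bound e * I, also when I = 0\<close>
    define e where "e = norm (circ_pair l G G) / (2 * (I + 1))"
    have "0 < e" using pos I0 by (simp add: e_def)
    from small[OF this] have "norm (circ_pair l G G) * (2 * (I + 1)) \<le> norm (circ_pair l G G) * I"
      using I0 by (simp add: e_def field_simps)
    then have "2 * (I + 1) \<le> I" using pos by (simp only: mult_le_cancel_left_pos)
    then show False using I0 by simp
  qed
  have GG: "G \<zeta> * cnj (G \<zeta>) = of_real ((norm (G \<zeta>))\<^sup>2)" for \<zeta> by (rule complex_norm_square[symmetric])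
  have "(\<integral>\<zeta>. (norm (G \<zeta>))\<^sup>2 \<partial>circ l) = 0"
  proof -
    have "complex_of_real (\<integral>\<zeta>. (norm (G \<zeta>))\<^sup>2 \<partial>circ l) = circ_pair l G G"
      unfolding circ_pair_def GG by (rule integral_complex_of_real[symmetric])
    then show ?thesis using pair0 by simp
  qed
  moreover have "integrable (circ l) (\<lambda>\<zeta>. (norm (G \<zeta>))\<^sup>2)"
  proof -
    have "integrable (circ l) (\<lambda>\<zeta>. G \<zeta> * cnj (G \<zeta>))" by (intro integrable_circ l continuous_intros G)
    then show ?thesis unfolding GG by (simp only: complex_of_real_integrable_eq)
  qed
  ultimately have "AE \<zeta> in circ l. (norm (G \<zeta>))\<^sup>2 = 0"
    by (subst (asm) integral_nonneg_eq_0_iff_AE) auto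
  then have "(\<integral>\<^sup>+\<zeta>. ennreal (norm (G \<zeta>)) \<partial>circ l) = 0"
    by (subst nn_integral_0_iff_AE) (auto intro!: continuous_measurable_circ continuous_intros G measurable_compose[OF _ measurable_ennreal])
  then have "(\<integral>\<^sup>+\<theta>. ennreal (indicator {-pi<..<pi} \<theta> * \<bar>sin \<theta>\<bar> powr (2 * l)) * ennreal (norm (G (cis \<theta>))) \<partial>lborel) = 0"
    by (subst (asm) nn_integral_circ) (auto intro!: continuous_measurable_circ continuous_intros G measurable_compose[OF _ measurable_ennreal])
  moreover have cGc: "continuous_on UNIV (\<lambda>\<theta>. G (cis \<theta>))"
    by (rule continuous_on_compose2[OF G]) (auto intro!: continuous_intros)
  have [measurable]: "(\<lambda>\<theta>. G (cis \<theta>)) \<in> borel_measurable borel" by (rule borel_measurable_continuous_onI[OF cGc])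
  ultimately have ae: "AE \<theta> in lborel. ennreal (indicator {-pi<..<pi} \<theta> * \<bar>sin \<theta>\<bar> powr (2 * l)) * ennreal (norm (G (cis \<theta>))) = 0"
    by (subst (asm) nn_integral_0_iff_AE) auto
  define S where "S = {\<theta>. G (cis \<theta>) \<noteq> 0} \<inter> ({-pi<..<0} \<union> {0<..<pi})"
  have "open {\<theta>. G (cis \<theta>) \<noteq> 0}"
    by (rule open_Collect_neq[OF cGc continuous_on_const])
  then have oS: "open S" unfolding S_def by (intro open_Int open_Un) auto
  have "AE \<theta> in lborel. \<theta> \<notin> S"
    using ae
  proof eventually_elim
    case (elim \<theta>)
    show ?case
    proof
      assume \<theta>: "\<theta> \<in> S"
      then have "sin \<theta> \<noteq> 0"
        using sin_gt_zero[of \<theta>] sin_gt_zero[of "-\<theta>"] by (auto simp: S_def)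
      with \<theta> elim show False by (auto simp: S_def ennreal_mult_eq_top_iff ennreal_eq_0_iff)
    qed
  qed
  then have "S \<in> null_sets lborel"
    using oS by (subst (asm) AE_iff_null_sets[symmetric]) auto
  then have "negligible S" by (simp add: negligible_iff_null_sets null_sets_completionI)
  then have Se: "S = {}" using oS open_not_negligible by blast
  \<comment> \<open>the exceptional angles 0 and \<pi> are approached from below\<close>
  have off: "G (cis \<theta>) = 0" if "\<theta> \<in> {-pi<..<0} \<union> {0<..<pi}" for \<theta>
    using that Se unfolding S_def by blast
  have z0: "G (cis \<theta>) = 0" if \<theta>: "-pi < \<theta>" "\<theta> \<le> pi" for \<theta>
  proof (cases "\<theta> = 0 \<or> \<theta> = pi")
    case True
    have "(\<lambda>n. \<theta> - 1 / real (n + 1)) \<longlonglongrightarrow> \<theta> - 0"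
      by (intro tendsto_intros LIMSEQ_ignore_initial_segment[OF lim_1_over_n])
    moreover have "isCont (\<lambda>\<theta>. G (cis \<theta>)) \<theta>" using cGc by (simp add: continuous_on_eq_continuous_at)
    ultimately have "(\<lambda>n. G (cis (\<theta> - 1 / real (n + 1)))) \<longlonglongrightarrow> G (cis \<theta>)"
      using isCont_tendsto_compose[of \<theta> "\<lambda>\<theta>. G (cis \<theta>)" "\<lambda>n. \<theta> - 1 / real (n + 1)" sequentially] by simp
    moreover have "G (cis (\<theta> - 1 / real (n + 1))) = 0" for n
    proof (rule off)
      define d where "d = 1 / real (n + 1)"
      have "0 < d" "d \<le> 1" by (simp_all add: d_def)
      then show "\<theta> - 1 / real (n + 1) \<in> {-pi<..<0} \<union> {0<..<pi}"
        unfolding d_def[symmetric] using True pi_gt3 by auto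
    qed
    ultimately have "(\<lambda>n. 0) \<longlonglongrightarrow> G (cis \<theta>)" by simp
    then show ?thesis by (simp add: LIMSEQ_const_iff)
  next
    case False
    with \<theta> have "\<theta> \<in> {-pi<..<0} \<union> {0<..<pi}" by (auto simp: linorder_neq_iff)
    then show ?thesis by (rule off)
  qed
  have "z = cis (Arg z)" using z by (metis cis_Arg norm_zero zero_neq_one sgn_eq div_by_1 of_real_1)
  moreover have "-pi < Arg z" "Arg z \<le> pi" using Arg_bounded[of z] by auto
  ultimately show ?thesis using z0 by metis
qed

section \<open>Expansion of \<lambda>-analytic functions\<close>

text \<open>
  The majorant of the series on the circle of radius \<open>r\<close> justifies integrating term by term.
\<close>

lemma ser_pair:
  assumes l: "0 \<le> l" and a: "subexp a" and r: "0 < r" "r < 1" and H: "continuous_on (sphere 0 1) H"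
  shows "(\<lambda>k. a k * of_real (r ^ k) * circ_pair l (gpoly l k) H) sums
     (\<integral>\<zeta>. ser (phi_coef l a) (of_real r * \<zeta>) * cnj (H \<zeta>) \<partial>circ l)"
proof -
  interpret finite_measure "circ l" by (rule circ_finite[OF l])
  define c where "c = phi_coef l a"
  have tc: "tame c" unfolding c_def by (rule tame_phi_coef[OF l a])
  obtain m where m: "summable m" "\<And>n z. norm z \<le> r \<Longrightarrow> norm (hpart c n z) \<le> m n"
    using tame_hpart_majorant[OF tc, of r] r by auto
  have "bounded (H ` sphere 0 1)" by (intro compact_imp_bounded compact_continuous_image compact_sphere H)
  then obtain B where "\<forall>x\<in>H ` sphere 0 1. norm x \<le> B" unfolding bounded_iff by blast
  then have B: "norm (H z) \<le> B" if "norm z = 1" for z using that by auto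
  have B0: "0 \<le> B" by (rule order.trans[OF norm_ge_zero B[of 1]]) simp
  define f where "f k \<zeta> = hpart c k (of_real r * \<zeta>) * cnj (H \<zeta>)" for k \<zeta>
  have fe: "f k \<zeta> = (a k * of_real (r ^ k)) * (gpoly l k \<zeta> * cnj (H \<zeta>))" for k \<zeta>
    by (simp add: f_def c_def hpart_phi_coef gpoly_scale)
  have cf: "continuous_on (sphere 0 1) (f k)" for k
    unfolding fe[abs_def] by (intro continuous_intros H)
  have fm: "norm (f k \<zeta>) \<le> m k * B" if "norm \<zeta> = 1" for k \<zeta>
    unfolding f_def norm_mult complex_mod_cnj using that r B0
    by (intro mult_mono m B) (auto simp: norm_mult intro: order.trans[OF norm_ge_zero m(2)[of 0]])
  have sm: "summable (\<lambda>k. m k * B)" using m by (intro summable_mult2)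
  have "(\<lambda>k. \<integral>\<zeta>. f k \<zeta> \<partial>circ l) sums (\<integral>\<zeta>. (\<Sum>k. f k \<zeta>) \<partial>circ l)"
  proof (rule sums_integral)
    show "integrable (circ l) (f k)" for k by (rule integrable_circ[OF l cf])
    show "AE \<zeta> in circ l. summable (\<lambda>k. norm (f k \<zeta>))"
      by (rule AE_I2, rule summable_comparison_test'[OF sm, of 0]) (use fm in auto)
    have "norm (\<integral>\<zeta>. norm (f k \<zeta>) \<partial>circ l) \<le> m k * B * circ_mass l" for k
    proof -
      have "(\<integral>\<zeta>. norm (f k \<zeta>) \<partial>circ l) \<le> (\<integral>\<zeta>. m k * B \<partial>circ l)"
        by (rule integral_mono) (auto intro!: integrable_circ[OF l cf] fm)
      then show ?thesis by (simp add: circ_mass_def mult_ac)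
    qed
    then show "summable (\<lambda>k. \<integral>\<zeta>. norm (f k \<zeta>) \<partial>circ l)"
      by (intro summable_comparison_test'[OF summable_mult2[OF sm, of "circ_mass l"], of 0])
  qed
  moreover have "(\<integral>\<zeta>. f k \<zeta> \<partial>circ l) = a k * of_real (r ^ k) * circ_pair l (gpoly l k) H" for k
    unfolding fe circ_pair_def by simp
  moreover have "(\<integral>\<zeta>. (\<Sum>k. f k \<zeta>) \<partial>circ l) = (\<integral>\<zeta>. ser c (of_real r * \<zeta>) * cnj (H \<zeta>) \<partial>circ l)"
  proof (rule Bochner_Integration.integral_cong[OF refl])
    fix \<zeta> assume "\<zeta> \<in> space (circ l)"
    then have "norm (of_real r * \<zeta>) < 1" using r by (simp add: norm_mult)
    from sums_mult2[OF ser_sums[OF tc this], of "cnj (H \<zeta>)"]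
    show "(\<Sum>k. f k \<zeta>) = ser c (of_real r * \<zeta>) * cnj (H \<zeta>)" by (simp add: f_def sums_iff)
  qed
  ultimately show ?thesis by (simp add: c_def)
qed

text \<open>
  Were the mass zero, the constant \<open>1\<close> would be orthogonal to the whole complete system.
\<close>

lemma circ_mass_pos: assumes l: "0 \<le> l" shows "0 < circ_mass l"
proof -
  have "circ_pair l (gpoly l 0) (gpoly l 0) \<noteq> 0"
  proof
    assume z: "circ_pair l (gpoly l 0) (gpoly l 0) = 0"
    have "circ_pair l (gpoly l 0) (gpoly l n) = 0" for n
    proof (cases "n = 0")
      case True
      then show ?thesis using z by (simp only:)
    next
      case False
      then show ?thesis unfolding gpoly_pair[OF l] by simp
    qed
    then have "gpoly l 0 1 = 0"
      by (intro circ_complete[OF l continuous_on_gpoly] gpoly_antipoly_orthogonal[OF l]) simp_all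
    then show False unfolding gpoly_0 by (rule one_neq_zero[THEN notE])
  qed
  then have "circ_mass l \<noteq> 0" unfolding gpoly_norm[OF l] by simp
  moreover have "0 \<le> circ_mass l" by (simp add: circ_mass_def)
  ultimately show ?thesis by linarith
qed

text \<open>
  The coefficients are read off from the pairings with \<open>A\<^sub>n\<close>, whose dependence on the radius is
  known. Boundedness of \<open>g\<close> on compact disks makes them subexponential, so the series converges, and on
  each circle it has the same pairings as \<open>g\<close> with both families. Completeness finishes the proof. The
  formula for the pairings is kept, since the reproducing property is computed from it.
\<close>

theorem wirtinger_analytic_expansion:
  assumes l: "0 \<le> l" and g: "wirtinger_analytic l g g1 g2"
  obtains a where "subexp a" "\<And>z. norm z < 1 \<Longrightarrow> g z = ser (phi_coef l a) z"
    "\<And>r n. 0 < r \<Longrightarrow> r < 1 \<Longrightarrow>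
       (\<integral>\<zeta>. g (of_real r * \<zeta>) * cnj (gpoly l n \<zeta>) \<partial>circ l) = a n * of_real (r ^ n * gval l n * circ_mass l)"
proof -
  interpret finite_measure "circ l" by (rule circ_finite[OF l])
  have m0: "circ_mass l > 0" by (rule circ_mass_pos[OF l])
  have cg: "continuous_on (ball 0 1) g"
    using g by (intro continuous_at_imp_continuous_on ballI has_wirtinger_isCont) (auto simp: wirtinger_analytic_def)
  have cr: "continuous_on (sphere 0 1) (\<lambda>\<zeta>. g (of_real r * \<zeta>))" if "0 < r" "r < 1" for r
    by (rule continuous_on_compose2[OF cg]) (use that in \<open>auto intro!: continuous_intros simp: norm_mult\<close>)
  have "\<exists>c. \<forall>r. 0 < r \<longrightarrow> r < 1 \<longrightarrow> (\<integral>\<zeta>. g (of_real r * \<zeta>) * cnj (gpoly l n \<zeta>) \<partial>circ l) = of_real (r powr real n) * c" for n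
    by (rule circ_pairing_power[OF l g gpoly_eigen[of l n] continuous_on_gpoly]) blast
  then obtain c where c: "\<And>r n. 0 < r \<Longrightarrow> r < 1 \<Longrightarrow> (\<integral>\<zeta>. g (of_real r * \<zeta>) * cnj (gpoly l n \<zeta>) \<partial>circ l) = of_real (r powr real n) * c n"
    by metis
  define a where "a n = c n / of_real (gval l n * circ_mass l)" for n
  have gv: "gval l n > 0" for n using gval_ge_1[OF l, of n] by simp
  have ac: "(\<integral>\<zeta>. g (of_real r * \<zeta>) * cnj (gpoly l n \<zeta>) \<partial>circ l) = a n * of_real (r ^ n * gval l n * circ_mass l)"
    if r: "0 < r" "r < 1" for r n
    unfolding c[OF r] a_def using gv[of n] m0 r by (simp add: powr_realpow field_simps)
  have "subexp a"
    unfolding subexp_def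
  proof (intro allI impI)
    fix t :: real assume t: "0 < t \<and> t < 1"
    have "bounded (g ` cball 0 t)"
      by (intro compact_imp_bounded compact_continuous_image compact_cball continuous_on_subset[OF cg]) (use t in auto)
    then obtain B where "\<forall>x\<in>g ` cball 0 t. norm x \<le> B" unfolding bounded_iff by blast
    then have B: "norm (g z) \<le> B" if "norm z \<le> t" for z using that by auto
    have B0: "0 \<le> B" by (rule order.trans[OF norm_ge_zero B[of 0]]) (use t in simp)
    have "norm (a n) * t ^ n \<le> B" for n
    proof -
      have "norm (a n * of_real (t ^ n * gval l n * circ_mass l)) \<le> (\<integral>\<zeta>. norm (g (of_real t * \<zeta>) * cnj (gpoly l n \<zeta>)) \<partial>circ l)"
        using t by (subst ac[symmetric]) (auto intro!: integral_norm_bound)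
      also have "\<dots> \<le> (\<integral>\<zeta>. B * gval l n \<partial>circ l)"
      proof (rule integral_mono)
        show "integrable (circ l) (\<lambda>\<zeta>. norm (g (of_real t * \<zeta>) * cnj (gpoly l n \<zeta>)))"
          using t by (intro integrable_norm integrable_circ l continuous_intros cr) auto
        fix \<zeta> assume "\<zeta> \<in> space (circ l)"
        then show "norm (g (of_real t * \<zeta>) * cnj (gpoly l n \<zeta>)) \<le> B * gval l n"
          unfolding norm_mult complex_mod_cnj using t B0 norm_gpoly_le[OF l, of n \<zeta>] by (intro mult_mono B) (auto simp: norm_mult)
      qed auto
      also have "\<dots> = B * (gval l n * circ_mass l)" by (simp add: circ_mass_def)
      finally have *: "norm (a n * of_real (t ^ n * gval l n * circ_mass l)) \<le> B * (gval l n * circ_mass l)" .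
      have "norm (a n * of_real (t ^ n * gval l n * circ_mass l)) = (norm (a n) * t ^ n) * (gval l n * circ_mass l)"
        unfolding norm_mult norm_of_real using t gv[of n] m0 by (simp add: abs_mult)
      with * show ?thesis using gv[of n] m0 by (simp only: mult_le_cancel_right_pos mult_pos_pos)
    qed
    then show "\<exists>C. \<forall>n. norm (a n) * t ^ n \<le> C" by blast
  qed
  define S where "S = ser (phi_coef l a)"
  have cS: "continuous_on (ball 0 1) S" unfolding S_def by (intro continuous_on_ser tame_phi_coef l \<open>subexp a\<close>)
  have cSr: "continuous_on (sphere 0 1) (\<lambda>\<zeta>. S (of_real r * \<zeta>))" if "0 < r" "r < 1" for r
    by (rule continuous_on_compose2[OF cS]) (use that in \<open>auto intro!: continuous_intros simp: norm_mult\<close>)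
  have circle: "g (of_real r * \<zeta>) = S (of_real r * \<zeta>)" if r: "0 < r" "r < 1" and \<zeta>: "norm \<zeta> = 1" for r \<zeta>
  proof -
    have diff: "circ_pair l (\<lambda>\<zeta>. g (of_real r * \<zeta>) - S (of_real r * \<zeta>)) H =
       (\<integral>\<zeta>. g (of_real r * \<zeta>) * cnj (H \<zeta>) \<partial>circ l) - (\<integral>\<zeta>. S (of_real r * \<zeta>) * cnj (H \<zeta>) \<partial>circ l)"
      if "continuous_on (sphere 0 1) H" for H
      unfolding circ_pair_def left_diff_distrib
      by (intro Bochner_Integration.integral_diff integrable_circ l continuous_intros cr cSr r that)
    have "(\<lambda>\<zeta>. g (of_real r * \<zeta>) - S (of_real r * \<zeta>)) \<zeta> = 0"
    proof (rule circ_complete[OF l _ _ _ \<zeta>])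
      show "continuous_on (sphere 0 1) (\<lambda>\<zeta>. g (of_real r * \<zeta>) - S (of_real r * \<zeta>))"
        by (intro continuous_intros cr cSr r)
      show "circ_pair l (\<lambda>\<zeta>. g (of_real r * \<zeta>) - S (of_real r * \<zeta>)) (gpoly l n) = 0" for n
      proof -
        have "(\<lambda>k. a k * of_real (r ^ k) * circ_pair l (gpoly l k) (gpoly l n)) =
           (\<lambda>k. if k = n then a k * of_real (r ^ k * gval l k * circ_mass l) else 0)"
          by (auto simp: fun_eq_iff gpoly_pair[OF l])
        then have "(\<integral>\<zeta>. S (of_real r * \<zeta>) * cnj (gpoly l n \<zeta>) \<partial>circ l) = a n * of_real (r ^ n * gval l n * circ_mass l)"
          using ser_pair[OF l \<open>subexp a\<close> r continuous_on_gpoly[of _ l n]]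
            sums_single[of n "\<lambda>k. a k * of_real (r ^ k * gval l k * circ_mass l)"]
          unfolding S_def by (metis (mono_tags, lifting) sums_unique2)
        then show ?thesis using ac[OF r, of n] by (subst diff) (auto intro!: continuous_intros)
      qed
      show "circ_pair l (\<lambda>\<zeta>. g (of_real r * \<zeta>) - S (of_real r * \<zeta>)) (antipoly l n) = 0" for n
        using pairing_antipoly_zero[OF l g r, of n] pairing_antipoly_zero[OF l wirtinger_analytic_ser[OF l \<open>subexp a\<close>] r, of n]
        by (subst diff) (auto intro!: continuous_intros simp: S_def)
    qed
    then show ?thesis by simp
  qed
  have off: "g z = S z" if "norm z < 1" "z \<noteq> 0" for z
    using circle[of "norm z" "sgn z"] that by (simp add: sgn_eq norm_divide)
  have "g 0 = S 0"
  proof -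
    have "isCont (\<lambda>z. g z - S z) 0"
      using cg cS by (intro continuous_intros) (auto simp: continuous_on_eq_continuous_at)
    moreover have lim: "(\<lambda>n. complex_of_real (1 / real (n + 2))) \<longlonglongrightarrow> of_real 0"
      by (intro tendsto_intros LIMSEQ_ignore_initial_segment[OF lim_1_over_n])
    ultimately have "(\<lambda>n. g (complex_of_real (1 / real (n + 2))) - S (complex_of_real (1 / real (n + 2)))) \<longlonglongrightarrow> g 0 - S 0"
      using isCont_tendsto_compose[of 0 "\<lambda>z. g z - S z" "\<lambda>n. complex_of_real (1 / real (n + 2))" sequentially] by simp
    moreover have "g (complex_of_real (1 / real (n + 2))) - S (complex_of_real (1 / real (n + 2))) = 0" for n
    proof -
      have "norm (complex_of_real (1 / real (n + 2))) < 1" unfolding norm_of_real by simp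
      moreover have "complex_of_real (1 / real (n + 2)) \<noteq> 0" unfolding of_real_eq_0_iff by simp
      ultimately have "g (complex_of_real (1 / real (n + 2))) = S (complex_of_real (1 / real (n + 2)))" by (rule off)
      then show ?thesis by (simp only: diff_self)
    qed
    ultimately have "(\<lambda>n. 0) \<longlonglongrightarrow> g 0 - S 0" by simp
    then show ?thesis by (simp add: LIMSEQ_const_iff)
  qed
  with off have "g z = S z" if "norm z < 1" for z using that by (cases "z = 0") auto
  with \<open>subexp a\<close> ac show thesis by (intro that[of a]) (auto simp: S_def)
qed

section \<open>Power series identities\<close>

text \<open>
  The hypothesis concerns only the interval, because that is where the two expansions of the Cauchy kernel can be
  compared.
\<close>

lemma powser_zero_coeffs:
  fixes d :: "nat \<Rightarrow> complex"
  assumes s: "\<And>x::real. 0 < x \<Longrightarrow> x < 1 \<Longrightarrow> (\<lambda>n. d n * of_real x ^ n) sums 0"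
  shows "d n = 0"
proof (induction n rule: less_induct)
  case (less m)
  have tail: "(\<lambda>n. d (n + m) * of_real x ^ n) sums 0" if x: "0 < x" "x < 1" for x :: real
  proof -
    have "(\<lambda>n. d (n + m) * of_real x ^ (n + m)) sums 0"
      using sums_split_initial_segment[OF s[OF x], of m] less by simp
    from sums_mult[OF this, of "inverse (of_real x ^ m)"] x show ?thesis
      by (simp add: power_add field_simps)
  qed
  define h where "h z = (\<Sum>n. d (n + m) * z ^ n)" for z
  have "isCont h 0"
    unfolding h_def using sums_summable[OF tail[of "1/2"]] by (intro isCont_powser[where K = "of_real (1/2)"]) auto
  moreover have "(\<lambda>k. complex_of_real (1 / real (k + 2))) \<longlonglongrightarrow> of_real 0"
    by (intro tendsto_intros LIMSEQ_ignore_initial_segment[OF lim_1_over_n])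
  ultimately have "(\<lambda>k. h (complex_of_real (1 / real (k + 2)))) \<longlonglongrightarrow> h 0"
    by (intro isCont_tendsto_compose[of 0 h]) simp_all
  moreover have "h (complex_of_real (1 / real (k + 2))) = 0" for k
    using tail[of "1 / real (k + 2)"] unfolding h_def sums_iff by simp
  ultimately have "h 0 = 0" by (simp add: LIMSEQ_const_iff)
  then show ?case by (simp add: h_def)
qed

lemma binomial_series:
  assumes u: "norm (u::complex) < 1"
  shows "(\<lambda>n. of_real (pochhammer l n / fact n) * u ^ n) sums ((1 - u) powr (- of_real l))"
    and "summable (\<lambda>n. norm (of_real (pochhammer l n / fact n) * u ^ n))"
proof -
  have *: "(\<lambda>n. of_real (pochhammer l n / fact n) * v ^ n) sums ((1 - v) powr (- of_real l))" if "norm v < 1" for v :: complex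
  proof -
    have "(\<lambda>n. ((- complex_of_real l) gchoose n) * (- v) ^ n) sums (1 + (- v)) powr (- of_real l)"
      by (rule gen_binomial_complex) (use that in simp)
    moreover have "((- complex_of_real l) gchoose n) * (- v) ^ n = of_real (pochhammer l n / fact n) * v ^ n" for n
    proof -
      have "(- v) ^ n = (-1) ^ n * v ^ n" by (rule power_minus)
      moreover have "(-1::complex) ^ n * (-1) ^ n = 1" by (simp flip: power_add)
      ultimately show ?thesis
        unfolding gbinomial_pochhammer by (simp add: pochhammer_of_real field_simps)
    qed
    ultimately show ?thesis by simp
  qed
  show "(\<lambda>n. of_real (pochhammer l n / fact n) * u ^ n) sums ((1 - u) powr (- of_real l))" by (rule *[OF u])
  show "summable (\<lambda>n. norm (of_real (pochhammer l n / fact n) * u ^ n))"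
    by (rule powser_insidea[OF sums_summable[OF *[of "of_real ((1 + norm u) / 2)"]]]) (use u in \<open>auto simp: norm_of_real simp del: of_real_add of_real_divide\<close>)
qed

text \<open>
  The Cauchy product of the binomial series of \<open>(1 - cnj u) powr (-\<lambda>)\<close> and
  \<open>(1 - u) powr (-\<lambda> - 1)\<close>; the two principal powers have conjugate bases in the right half-plane
  and multiply to a power of the modulus.
\<close>

lemma gpoly_generating_function:
  assumes u: "norm (u::complex) < 1"
  shows "(\<lambda>n. gpoly l n u) sums (of_real (norm (1 - u) powr (- 2 * l)) / (1 - u))"
proof -
  define A where "A = 1 - u"
  have "Re u < 1" using u complex_Re_le_cmod[of u] by linarith
  then have reA: "Re A > 0" by (simp add: A_def)
  then have A0: "A \<noteq> 0" and An: "A \<notin> \<real>\<^sub>\<le>\<^sub>0" by (auto simp: complex_nonpos_Reals_iff)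
  have c: "norm (cnj u) < 1" using u by simp
  have "(\<lambda>k. \<Sum>i\<le>k. (of_real (pochhammer l i / fact i) * cnj u ^ i) * (of_real (pochhammer (l + 1) (k - i) / fact (k - i)) * u ^ (k - i)))
    sums ((\<Sum>k. of_real (pochhammer l k / fact k) * cnj u ^ k) * (\<Sum>k. of_real (pochhammer (l + 1) k / fact k) * u ^ k))"
    by (rule Cauchy_product_sums[OF binomial_series(2)[OF c] binomial_series(2)[OF u]])
  also have "(\<lambda>k. \<Sum>i\<le>k. (of_real (pochhammer l i / fact i) * cnj u ^ i) * (of_real (pochhammer (l + 1) (k - i) / fact (k - i)) * u ^ (k - i)))
     = (\<lambda>k. gpoly l k u)"
    unfolding gpoly_def dcoef_def by (intro ext sum.cong refl) (simp add: field_simps)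
  also have "(\<Sum>k. of_real (pochhammer l k / fact k) * cnj u ^ k) = cnj A powr (- of_real l)"
    using binomial_series(1)[OF c, of l] by (simp add: sums_iff A_def)
  also have "(\<Sum>k. of_real (pochhammer (l + 1) k / fact k) * u ^ k) = A powr (- of_real l - 1)"
    using binomial_series(1)[OF u, of "l + 1"] by (simp add: sums_iff A_def)
  also have "cnj A powr (- of_real l) * A powr (- of_real l - 1) = of_real (norm A powr (- 2 * l)) / A"
  proof -
    have "cnj A powr (- of_real l) = cnj (A powr (- of_real l))"
      by (subst cnj_powr) (use reA in auto)
    moreover have "A powr (- of_real l - 1) = A powr (- of_real l) / A"
      using A0 by (simp add: powr_diff)
    moreover have "cnj (A powr (- of_real l)) * A powr (- of_real l) = of_real ((norm (A powr (- complex_of_real l)))\<^sup>2)"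
      by (subst complex_norm_square) (simp add: mult.commute)
    moreover have "norm (A powr (- complex_of_real l)) = norm A powr (- l)"
      by (subst norm_powr_real_powr') auto
    moreover have "(norm A powr (- l))\<^sup>2 = norm A powr (- 2 * l)"
      by (simp add: power2_eq_square flip: powr_add)
    ultimately show ?thesis by (metis times_divide_eq_right)
  qed
  finally show ?thesis by (simp add: A_def)
qed

section \<open>Beta weights\<close>

lemma power2_powr:
  assumes "0 < (x::real)" shows "(x\<^sup>2) powr s = x powr (2 * s)"
proof -
  have "x\<^sup>2 = x powr 2" using assms by simp
  then show ?thesis by (simp only: powr_powr)
qed

text \<open>
  The weight is symmetric under \<open>t \<mapsto> 1 - t\<close>, which corresponds to replacing \<open>z\<close> by its
  conjugate. The further factor \<open>t\<close> of the Cauchy kernel is kept in the integrands. The measure is finite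
  only for \<open>\<lambda> > 0\<close>.
\<close>

definition beta_measure :: "real \<Rightarrow> real measure" where
  "beta_measure l = density lborel (\<lambda>t. ennreal (indicator {0<..<1} t * (t powr (l - 1) * (1 - t) powr (l - 1))))"

lemma sets_beta [simp, measurable_cong]: "sets (beta_measure l) = sets borel" and space_beta [simp]: "space (beta_measure l) = UNIV"
  by (simp_all add: beta_measure_def)

lemma AE_beta: "AE t in beta_measure l. t \<in> {0<..<1}"
  unfolding beta_measure_def by (subst AE_density) (auto intro!: AE_I2 simp: indicator_def)

lemma integrable_beta_powr:
  assumes "a > 0" "b > 0"
  shows "integrable lborel (\<lambda>t::real. indicator {0<..<1} t * (t powr (a - 1) * (1 - t) powr (b - 1)))"
proof -
  have "set_integrable lborel {0<..<1} (\<lambda>t::real. t powr (a - 1) * (1 - t) powr (b - 1))"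
    by (rule set_integrable_subset[OF integrable_Beta[OF assms]]) auto
  then show ?thesis by (simp add: set_integrable_def)
qed

lemma beta_finite: assumes "0 < l" shows "finite_measure (beta_measure l)"
proof
  have "emeasure (beta_measure l) (space (beta_measure l)) = (\<integral>\<^sup>+t. ennreal (indicator {0<..<1} t * (t powr (l - 1) * (1 - t) powr (l - 1))) \<partial>lborel)"
    unfolding beta_measure_def by (subst emeasure_density) (auto simp: space_density)
  also have "\<dots> < \<infinity>"
    using integrable_beta_powr[OF assms assms] by (subst nn_integral_eq_integral) (auto intro!: AE_I2)
  finally show "emeasure (beta_measure l) (space (beta_measure l)) \<noteq> \<infinity>" by simp
qed

lemma integral_beta:
  fixes f :: "real \<Rightarrow> 'b::{banach, second_countable_topology}"
  assumes [measurable]: "f \<in> borel_measurable borel"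
  shows "(\<integral>t. f t \<partial>beta_measure l) = (\<integral>t. (indicator {0<..<1} t * (t powr (l - 1) * (1 - t) powr (l - 1))) *\<^sub>R f t \<partial>lborel)"
  unfolding beta_measure_def by (subst integral_density) auto

lemma integrable_beta_iff:
  fixes f :: "real \<Rightarrow> 'b::{banach, second_countable_topology}"
  assumes [measurable]: "f \<in> borel_measurable borel"
  shows "integrable (beta_measure l) f \<longleftrightarrow> integrable lborel (\<lambda>t. (indicator {0<..<1} t * (t powr (l - 1) * (1 - t) powr (l - 1))) *\<^sub>R f t)"
  unfolding beta_measure_def by (subst integrable_density) auto

lemma integral_beta_reflect:
  fixes f :: "real \<Rightarrow> complex"
  assumes [measurable]: "f \<in> borel_measurable borel"
  shows "(\<integral>t. f (1 - t) \<partial>beta_measure l) = (\<integral>t. f t \<partial>beta_measure l)"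
  apply (subst (1 2) integral_beta)
    apply measurable
  apply (subst (2) lborel_integral_real_affine[where c = "-1" and t = 1])
   apply simp
  apply (auto intro!: Bochner_Integration.integral_cong simp: indicator_def mult_ac)
  done

section \<open>Interpolation between two squared distances\<close>

definition interp :: "complex \<Rightarrow> complex \<Rightarrow> real \<Rightarrow> real" where
  "interp w z t = (1 - t) * (norm (1 - z * cnj w))\<^sup>2 + t * (norm (1 - z * w))\<^sup>2"

text \<open>
  The derivative of the interpolant in the conjugate of \<open>z\<close>; the derivative in \<open>z\<close> is its
  conjugate, the interpolant being real.
\<close>

definition interp_d :: "complex \<Rightarrow> complex \<Rightarrow> real \<Rightarrow> complex" where
  "interp_d w z t = - (of_real (1 - t) * (1 - z * cnj w) * w + of_real t * (1 - z * w) * cnj w)"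

lemma norm_one_minus_ge:
  assumes "norm z \<le> 1" shows "1 - norm w \<le> norm (1 - z * cnj w)" "1 - norm w \<le> norm (1 - z * w)"
proof -
  have "norm z * norm w \<le> 1 * norm w" using assms by (intro mult_right_mono) auto
  then show "1 - norm w \<le> norm (1 - z * cnj w)" "1 - norm w \<le> norm (1 - z * w)"
    using norm_triangle_ineq2[of 1 "z * cnj w"] norm_triangle_ineq2[of 1 "z * w"] by (auto simp: norm_mult)
qed

lemma norm_one_minus_le:
  assumes "norm z \<le> 1" "norm w \<le> 1" shows "norm (1 - z * cnj w) \<le> 2" "norm (1 - z * w) \<le> 2"
proof -
  have "norm z * norm w \<le> 1 * 1" using assms by (intro mult_mono) auto
  then show "norm (1 - z * cnj w) \<le> 2" "norm (1 - z * w) \<le> 2"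
    using norm_triangle_ineq4[of 1 "z * cnj w"] norm_triangle_ineq4[of 1 "z * w"] by (auto simp: norm_mult)
qed

lemma interp_ge:
  assumes "norm z \<le> 1" "norm w \<le> 1" "0 \<le> t" "t \<le> 1" shows "(1 - norm w)\<^sup>2 \<le> interp w z t"
proof -
  have "(1 - norm w)\<^sup>2 = (1 - t) * (1 - norm w)\<^sup>2 + t * (1 - norm w)\<^sup>2" by (simp add: algebra_simps)
  also have "\<dots> \<le> interp w z t"
    unfolding interp_def using assms norm_one_minus_ge[OF assms(1), of w]
    by (intro add_mono mult_left_mono power_mono) auto
  finally show ?thesis .
qed

lemma interp_pos:
  assumes "norm z \<le> 1" "norm w < 1" "0 \<le> t" "t \<le> 1" shows "0 < interp w z t"
proof -
  have "0 < (1 - norm w)\<^sup>2" using assms by simp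
  also have "\<dots> \<le> interp w z t" using assms by (intro interp_ge) auto
  finally show ?thesis .
qed

text \<open>
  Both terms of the derivative are bounded by the distances whose squares are interpolated, and the square is convex. In
  the derivatives of the Cauchy kernel the square root cancels half a power of the interpolant; a constant bound would
  lose it.
\<close>

lemma interp_d_le:
  assumes "norm w \<le> 1" "0 \<le> t" "t \<le> 1"
  shows "norm (interp_d w z t) \<le> sqrt (interp w z t)"
proof (rule real_le_rsqrt)
  define x where "x = norm (1 - z * cnj w)"
  define y where "y = norm (1 - z * w)"
  have "norm (interp_d w z t) \<le> (1 - t) * x * norm w + t * y * norm w"
    unfolding interp_d_def norm_minus_cancel x_def y_def
    by (rule order.trans[OF norm_triangle_ineq]) (use assms in \<open>simp add: norm_mult del: of_real_diff\<close>)
  also have "\<dots> \<le> (1 - t) * x * 1 + t * y * 1"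
    using assms by (intro add_mono mult_left_mono) (auto simp: x_def y_def)
  finally have "(norm (interp_d w z t))\<^sup>2 \<le> ((1 - t) * x + t * y)\<^sup>2" by (intro power_mono) auto
  also have "\<dots> \<le> (1 - t) * x\<^sup>2 + t * y\<^sup>2"
  proof -
    have "(1 - t) * x\<^sup>2 + t * y\<^sup>2 - ((1 - t) * x + t * y)\<^sup>2 = t * (1 - t) * (x - y)\<^sup>2"
      by (simp add: power2_eq_square algebra_simps)
    moreover have "0 \<le> t * (1 - t) * (x - y)\<^sup>2" using assms by simp
    ultimately show ?thesis by linarith
  qed
  finally show "(norm (interp_d w z t))\<^sup>2 \<le> interp w z t" by (simp add: interp_def x_def y_def)
qed

lemma interp_has_derivative:
  "((\<lambda>z. interp w z t) has_derivative (\<lambda>h. 2 * Re (cnj (interp_d w z t) * h))) (at z)"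
proof -
  have i: "interp w z t = Re (of_real (1 - t) * ((1 - z * cnj w) * (1 - cnj z * w)) + of_real t * ((1 - z * w) * (1 - cnj z * cnj w)))" for z
  proof -
    have "of_real ((norm (1 - z * cnj w))\<^sup>2) = (1 - z * cnj w) * (1 - cnj z * w)"
      "of_real ((norm (1 - z * w))\<^sup>2) = (1 - z * w) * (1 - cnj z * cnj w)"
      by (subst complex_norm_square, simp)+
    then have "complex_of_real (interp w z t) = of_real (1 - t) * ((1 - z * cnj w) * (1 - cnj z * w)) + of_real t * ((1 - z * w) * (1 - cnj z * cnj w))"
      unfolding interp_def of_real_add of_real_mult by simp
    then show ?thesis by (metis Re_complex_of_real)
  qed
  have d: "((\<lambda>z. of_real (1 - t) * ((1 - z * cnj w) * (1 - cnj z * w)) + of_real t * ((1 - z * w) * (1 - cnj z * cnj w))) has_derivative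
     (\<lambda>h. of_real (1 - t) * ((1 - z * cnj w) * (- (cnj h * w)) + (- (h * cnj w)) * (1 - cnj z * w))
        + of_real t * ((1 - z * w) * (- (cnj h * cnj w)) + (- (h * w)) * (1 - cnj z * cnj w)))) (at z)"
    by (intro has_derivative_add has_derivative_mult_right has_derivative_mult)
       (auto intro!: derivative_eq_intros)
  show ?thesis
    unfolding i
  proof (rule has_derivative_eq_rhs[OF bounded_linear.has_derivative[OF bounded_linear_Re d]], rule ext)
    fix h
    have "of_real (1 - t) * ((1 - z * cnj w) * (- (cnj h * w)) + (- (h * cnj w)) * (1 - cnj z * w))
        + of_real t * ((1 - z * w) * (- (cnj h * cnj w)) + (- (h * w)) * (1 - cnj z * cnj w))
      = cnj (interp_d w z t) * h + cnj (cnj (interp_d w z t) * h)"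
      unfolding interp_d_def by (simp add: algebra_simps)
    then show "Re (of_real (1 - t) * ((1 - z * cnj w) * (- (cnj h * w)) + (- (h * cnj w)) * (1 - cnj z * w))
        + of_real t * ((1 - z * w) * (- (cnj h * cnj w)) + (- (h * w)) * (1 - cnj z * cnj w))) = 2 * Re (cnj (interp_d w z t) * h)"
      by simp
  qed
qed

lemma interp_powr_has_derivative:
  assumes "0 < interp w z t"
  shows "((\<lambda>z. complex_of_real (interp w z t powr - l)) has_derivative
     (\<lambda>h. of_real (- l * interp w z t powr (- l - 1)) * (cnj (interp_d w z t) * h + interp_d w z t * cnj h))) (at z)"
proof -
  have "((\<lambda>x. x powr - l) has_derivative (\<lambda>x. - l * interp w z t powr (- l - 1) * x)) (at (interp w z t))"
    using has_real_derivative_powr[OF assms, of "- l"] unfolding has_field_derivative_def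
    by (rule has_derivative_eq_rhs) (simp add: fun_eq_iff)
  from has_derivative_of_real[OF has_derivative_compose[OF interp_has_derivative this], where 'a = complex]
  show ?thesis
  proof (rule has_derivative_eq_rhs, intro ext)
    fix h
    have "complex_of_real (2 * Re (cnj (interp_d w z t) * h)) = cnj (interp_d w z t) * h + interp_d w z t * cnj h"
      by (subst complex_add_cnj[symmetric]) simp
    then show "complex_of_real (- l * interp w z t powr (- l - 1) * (2 * Re (cnj (interp_d w z t) * h))) =
         of_real (- l * interp w z t powr (- l - 1)) * (cnj (interp_d w z t) * h + interp_d w z t * cnj h)"
      unfolding of_real_mult by simp
  qed
qed

lemma interp_cnj: "interp w (cnj z) t = interp w z (1 - t)"
proof -
  have "norm (1 - cnj z * cnj w) = norm (1 - z * w)" "norm (1 - cnj z * w) = norm (1 - z * cnj w)"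
    using complex_mod_cnj[of "1 - z * w"] complex_mod_cnj[of "1 - z * cnj w"] by simp_all
  then show ?thesis by (simp add: interp_def)
qed

lemma continuous_interp [continuous_intros]: "continuous_on S (interp w z)"
  unfolding interp_def[abs_def] by (intro continuous_intros)

lemma cnj_borel_measurable [measurable]: "cnj \<in> borel_measurable borel"
  by (intro borel_measurable_continuous_onI continuous_intros)

lemma interp_measurable [measurable]: "interp w z \<in> borel_measurable borel"
  by (rule borel_measurable_continuous_onI) (rule continuous_interp)

lemma interp_d_measurable [measurable]: "interp_d w z \<in> borel_measurable borel"
  unfolding interp_d_def[abs_def] by (intro borel_measurable_continuous_onI continuous_intros)

section \<open>The closed form of the Cauchy kernel\<close>

text \<open>
  The Cauchy kernel multiplied by \<open>1 - z cnj w\<close> and by the constant \<open>beta_mass\<close> introduced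
  below; the two functions that follow are its Wirtinger derivatives.
\<close>

definition cauchy_num :: "real \<Rightarrow> complex \<Rightarrow> complex \<Rightarrow> complex" where
  "cauchy_num l w z = (\<integral>t. of_real (t * interp w z t powr - l) \<partial>beta_measure l)"

definition cauchy_num_z :: "real \<Rightarrow> complex \<Rightarrow> complex \<Rightarrow> complex" where
  "cauchy_num_z l w z = (\<integral>t. of_real (- l * (t * interp w z t powr (- l - 1))) * cnj (interp_d w z t) \<partial>beta_measure l)"

definition cauchy_num_zbar :: "real \<Rightarrow> complex \<Rightarrow> complex \<Rightarrow> complex" where
  "cauchy_num_zbar l w z = (\<integral>t. of_real (- l * (t * interp w z t powr (- l - 1))) * interp_d w z t \<partial>beta_measure l)"

context
  fixes l :: real and w :: complex
  assumes l: "0 < l" and w: "norm w < 1"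
begin

lemma interp_powr_le:
  assumes "norm z \<le> 1" "t \<in> {0<..<1}" "0 \<le> s"
  shows "interp w z t powr - s \<le> ((1 - norm w)\<^sup>2) powr - s"
  using assms w interp_ge[of z w t] by (intro powr_mono2') auto

lemma kernel_factor_le:
  assumes "norm z \<le> 1" "t \<in> {0<..<1}" "0 \<le> s"
  shows "norm (t * interp w z t powr - s) \<le> ((1 - norm w)\<^sup>2) powr - s"
proof -
  have "t * interp w z t powr - s \<le> 1 * ((1 - norm w)\<^sup>2) powr - s"
    using assms interp_powr_le[OF assms] by (intro mult_mono) auto
  then show ?thesis using assms by (simp add: abs_mult)
qed

lemma norm_interp_d_le_2:
  assumes "norm z \<le> 1" "t \<in> {0<..<1}" shows "norm (interp_d w z t) \<le> 2"
proof -
  have "interp w z t \<le> (1 - t) * 2\<^sup>2 + t * 2\<^sup>2"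
    unfolding interp_def using assms w norm_one_minus_le[of z w] by (intro add_mono mult_left_mono power_mono) auto
  then have "sqrt (interp w z t) \<le> sqrt (2\<^sup>2)" by (intro real_sqrt_le_mono) simp
  then show ?thesis using interp_d_le[of w t z] assms w by simp
qed

lemma integrable_kernel_factor:
  assumes "norm z \<le> 1" "0 \<le> s"
  shows "integrable (beta_measure l) (\<lambda>t. t * interp w z t powr - s)"
proof -
  interpret finite_measure "beta_measure l" by (rule beta_finite[OF l])
  show ?thesis
  proof (rule integrable_const_bound)
    show "AE t in beta_measure l. norm (t * interp w z t powr - s) \<le> ((1 - norm w)\<^sup>2) powr - s"
      using AE_beta by eventually_elim (rule kernel_factor_le[OF assms(1) _ assms(2)])
  qed measurable
qed

lemma norm_cauchy_num_deriv_integrand: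
  assumes "norm z \<le> 1" "t \<in> {0<..<1}"
  shows "norm (of_real (- l * (t * interp w z t powr (- l - 1))) * interp_d w z t) \<le> l * ((1 - norm w)\<^sup>2) powr - (l + 1) * 2"
proof -
  have "norm (t * interp w z t powr - (l + 1)) \<le> ((1 - norm w)\<^sup>2) powr - (l + 1)"
    using l by (intro kernel_factor_le assms) auto
  then have "l * norm (t * interp w z t powr - (l + 1)) * norm (interp_d w z t) \<le> l * ((1 - norm w)\<^sup>2) powr - (l + 1) * 2"
    using l norm_interp_d_le_2[OF assms] by (intro mult_mono) auto
  moreover have "- (l + 1) = - l - 1" by simp
  ultimately show ?thesis using l by (simp only: norm_mult norm_of_real norm_minus_cancel abs_minus_cancel abs_mult real_norm_def)
qed

lemma integrable_cauchy_num_deriv: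
  assumes "norm z \<le> 1"
  shows "integrable (beta_measure l) (\<lambda>t. of_real (- l * (t * interp w z t powr (- l - 1))) * interp_d w z t)"
    "integrable (beta_measure l) (\<lambda>t. of_real (- l * (t * interp w z t powr (- l - 1))) * cnj (interp_d w z t))"
proof -
  interpret finite_measure "beta_measure l" by (rule beta_finite[OF l])
  show *: "integrable (beta_measure l) (\<lambda>t. of_real (- l * (t * interp w z t powr (- l - 1))) * interp_d w z t)"
  proof (rule integrable_const_bound)
    show "AE t in beta_measure l. norm (of_real (- l * (t * interp w z t powr (- l - 1))) * interp_d w z t) \<le> l * ((1 - norm w)\<^sup>2) powr - (l + 1) * 2"
      using AE_beta by eventually_elim (rule norm_cauchy_num_deriv_integrand[OF assms])
  qed measurable
  have "integrable (beta_measure l) (\<lambda>t. cnj (of_real (- l * (t * interp w z t powr (- l - 1))) * interp_d w z t))"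
    by (rule integrable_cnj[OF *])
  then show "integrable (beta_measure l) (\<lambda>t. of_real (- l * (t * interp w z t powr (- l - 1))) * cnj (interp_d w z t))"
    by simp
qed

lemma cauchy_num_has_wirtinger:
  assumes z: "z \<in> ball 0 1"
  shows "has_wirtinger (cauchy_num l w) (cauchy_num_z l w z) (cauchy_num_zbar l w z) z"
proof -
  define q where "q z t = complex_of_real (- l * (t * interp w z t powr (- l - 1)))" for z t
  have "((\<lambda>z. \<integral>t. of_real (t * interp w z t powr - l) \<partial>beta_measure l) has_derivative
     (\<lambda>h. \<integral>t. q z t * cnj (interp_d w z t) * h + q z t * interp_d w z t * cnj h \<partial>beta_measure l)) (at z)"
  proof (rule has_derivative_integral_bounded[where S = "ball 0 1" and T = "{0<..<1}" and B = "2 * (l * ((1 - norm w)\<^sup>2) powr - (l + 1) * 2)"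
        and f' = "\<lambda>z t h. q z t * cnj (interp_d w z t) * h + q z t * interp_d w z t * cnj h"])
    show "finite_measure (beta_measure l)" by (rule beta_finite[OF l])
    show "AE t in beta_measure l. t \<in> {0<..<1}" by (rule AE_beta)
    fix x :: complex and t :: real assume x: "x \<in> ball 0 1" and t: "t \<in> {0<..<1}"
    have pos: "0 < interp w x t" using x t w by (intro interp_pos) auto
    show "((\<lambda>x. complex_of_real (t * interp w x t powr - l)) has_derivative (\<lambda>h. q x t * cnj (interp_d w x t) * h + q x t * interp_d w x t * cnj h)) (at x)"
      unfolding of_real_mult
      by (rule has_derivative_eq_rhs[OF has_derivative_mult_right[OF interp_powr_has_derivative[OF pos]]])
         (simp add: q_def fun_eq_iff algebra_simps)
    fix h
    have "norm (q x t * cnj (interp_d w x t) * h + q x t * interp_d w x t * cnj h) \<le> norm (q x t * interp_d w x t) * norm h + norm (q x t * interp_d w x t) * norm h"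
      by (rule order.trans[OF norm_triangle_ineq]) (simp add: norm_mult)
    also have "\<dots> = 2 * norm (q x t * interp_d w x t) * norm h" by simp
    also have "\<dots> \<le> 2 * (l * ((1 - norm w)\<^sup>2) powr - (l + 1) * 2) * norm h"
      unfolding q_def using x t by (intro mult_right_mono mult_left_mono norm_cauchy_num_deriv_integrand) auto
    finally show "norm (q x t * cnj (interp_d w x t) * h + q x t * interp_d w x t * cnj h) \<le> 2 * (l * ((1 - norm w)\<^sup>2) powr - (l + 1) * 2) * norm h" .
  next
    fix x :: complex assume "x \<in> ball 0 1"
    then show "integrable (beta_measure l) (\<lambda>t. complex_of_real (t * interp w x t powr - l))"
      using integrable_kernel_factor[of x l] l by (intro integrable_of_real) auto
  next
    fix h
    show "(\<lambda>t. q z t * cnj (interp_d w z t) * h + q z t * interp_d w z t * cnj h) \<in> borel_measurable (beta_measure l)"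
      unfolding q_def by measurable
  qed (use z in auto)
  moreover have "(\<integral>t. q z t * cnj (interp_d w z t) * h + q z t * interp_d w z t * cnj h \<partial>beta_measure l)
      = cauchy_num_z l w z * h + cauchy_num_zbar l w z * cnj h" for h
    unfolding cauchy_num_z_def cauchy_num_zbar_def q_def
    using integrable_cauchy_num_deriv[of z] z
    by (subst Bochner_Integration.integral_add) (auto intro!: integrable_mult_left)
  ultimately show ?thesis unfolding has_wirtinger_def cauchy_num_def[abs_def] by simp
qed

lemma continuous_cauchy_num_deriv:
  "continuous_on (ball 0 1) (cauchy_num_z l w)" "continuous_on (ball 0 1) (cauchy_num_zbar l w)"
proof -
  have c: "continuous_on (ball 0 1) (\<lambda>z. complex_of_real (- l * (t * interp w z t powr (- l - 1))))"
    "continuous_on (ball 0 1) (\<lambda>z. interp_d w z t)" if "t \<in> {0<..<1}" for t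
  proof -
    have "continuous_on (ball 0 1) (\<lambda>z. interp w z t)" unfolding interp_def by (intro continuous_intros)
    then show "continuous_on (ball 0 1) (\<lambda>z. complex_of_real (- l * (t * interp w z t powr (- l - 1))))"
    proof (intro continuous_intros, assumption)
      show "\<forall>z\<in>ball 0 1. interp w z t \<noteq> 0"
      proof
        fix z :: complex assume "z \<in> ball 0 1"
        then have "0 < interp w z t" using that w by (intro interp_pos) auto
        then show "interp w z t \<noteq> 0" by simp
      qed
    qed
    show "continuous_on (ball 0 1) (\<lambda>z. interp_d w z t)" unfolding interp_d_def by (intro continuous_intros)
  qed
  show "continuous_on (ball 0 1) (cauchy_num_z l w)"
    unfolding cauchy_num_z_def[abs_def]
  proof (rule continuous_on_integral_bounded[OF beta_finite[OF l] AE_beta])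
    fix t :: real assume t: "t \<in> {0<..<1}"
    show "continuous_on (ball 0 1) (\<lambda>z. of_real (- l * (t * interp w z t powr (- l - 1))) * cnj (interp_d w z t))"
      by (intro continuous_on_mult c continuous_on_cnj t)
    fix z :: complex assume "z \<in> ball 0 1"
    then show "norm (of_real (- l * (t * interp w z t powr (- l - 1))) * cnj (interp_d w z t)) \<le> l * ((1 - norm w)\<^sup>2) powr - (l + 1) * 2"
      using norm_cauchy_num_deriv_integrand[of z t] t unfolding norm_mult complex_mod_cnj by simp
  qed measurable
  show "continuous_on (ball 0 1) (cauchy_num_zbar l w)"
    unfolding cauchy_num_zbar_def[abs_def]
  proof (rule continuous_on_integral_bounded[OF beta_finite[OF l] AE_beta])
    fix t :: real assume t: "t \<in> {0<..<1}"
    show "continuous_on (ball 0 1) (\<lambda>z. of_real (- l * (t * interp w z t powr (- l - 1))) * interp_d w z t)"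
      by (intro continuous_on_mult c t)
    fix z :: complex assume "z \<in> ball 0 1"
    then show "norm (of_real (- l * (t * interp w z t powr (- l - 1))) * interp_d w z t) \<le> l * ((1 - norm w)\<^sup>2) powr - (l + 1) * 2"
      by (intro norm_cauchy_num_deriv_integrand t) auto
  qed measurable
qed

text \<open>
  Up to the factor \<open>\<lambda>\<close> the integrand, with its weight, is the derivative of
  \<open>(t (1 - t) / D\<^sub>t) powr \<lambda>\<close>, which vanishes at both ends since \<open>\<lambda> > 0\<close>.
\<close>

lemma beta_total_derivative:
  assumes z: "norm z < 1"
  defines "A \<equiv> (norm (1 - z * cnj w))\<^sup>2" and "B \<equiv> (norm (1 - z * w))\<^sup>2"
  shows "(\<integral>t. interp w z t powr (- l - 1) * ((1 - t)\<^sup>2 * A - t\<^sup>2 * B) \<partial>beta_measure l) = 0"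
proof -
  define D where "D = interp w z"
  have De: "D t = (1 - t) * A + t * B" for t by (simp add: D_def interp_def A_def B_def)
  have Dpos: "0 < D t" if "0 \<le> t" "t \<le> 1" for t unfolding D_def using z w that by (intro interp_pos) auto
  define wt where "wt t = t powr (l - 1) * (1 - t) powr (l - 1)" for t :: real
  define f where "f t = l * wt t * (D t powr (- l - 1) * ((1 - t)\<^sup>2 * A - t\<^sup>2 * B))" for t
  define U where "U t = t powr l * (1 - t) powr l * D t powr - l" for t
  have cD: "continuous_on UNIV D" unfolding D_def by (rule continuous_interp)
  have dU: "(U has_real_derivative f t) (at t)" if t: "0 < t" "t < 1" for t
  proof -
    have p: "0 < D t" using t by (intro Dpos) auto
    have dD: "(D has_real_derivative (B - A)) (at t)"
      unfolding De[abs_def] by (auto intro!: derivative_eq_intros)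
    have 1: "((\<lambda>t. t powr l) has_real_derivative l * t powr (l - 1)) (at t)"
      using t by (rule_tac has_real_derivative_powr) auto
    have 2: "((\<lambda>t. (1 - t) powr l) has_real_derivative - (l * (1 - t) powr (l - 1))) (at t)"
      using t by (auto intro!: derivative_eq_intros)
    have 3: "((\<lambda>t. D t powr - l) has_real_derivative - l * D t powr (- l - 1) * (B - A)) (at t)"
      using p by (intro DERIV_chain2[OF has_real_derivative_powr dD])
    have e: "t powr l = t * t powr (l - 1)" "(1 - t) powr l = (1 - t) * (1 - t) powr (l - 1)" "D t powr - l = D t * D t powr (- l - 1)"
      using t p by (simp_all add: powr_diff powr_minus field_simps)
    show ?thesis
      unfolding U_def[abs_def]
    proof (rule DERIV_cong[OF DERIV_mult[OF DERIV_mult[OF 1 2] 3]])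
      show "(l * t powr (l - 1) * (1 - t) powr l + - (l * (1 - t) powr (l - 1)) * t powr l) * D t powr - l
         + - l * D t powr (- l - 1) * (B - A) * (t powr l * (1 - t) powr l) = f t"
        unfolding e f_def wt_def by (simp add: De power2_eq_square algebra_simps)
    qed
  qed
  have [measurable]: "D \<in> borel_measurable borel" unfolding D_def by measurable
  have bound: "integrable lborel (\<lambda>t. indicator {0<..<1} t *\<^sub>R f t)"
  proof -
    define G where "G t = D t powr (- l - 1) * ((1 - t)\<^sup>2 * A - t\<^sup>2 * B)" for t
    have "continuous_on {0..1} G"
      unfolding G_def
    proof (intro continuous_intros continuous_on_subset[OF cD])
      show "\<forall>x\<in>{0..1}. D x \<noteq> 0" using Dpos by force
    qed auto
    then have "bounded (G ` {0..1})" by (intro compact_imp_bounded compact_continuous_image) auto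
    then obtain K where "\<forall>x\<in>G ` {0..1}. norm x \<le> K" unfolding bounded_iff by blast
    then have K: "\<bar>G t\<bar> \<le> K" if "t \<in> {0..1}" for t using that by auto
    show ?thesis
    proof (rule Bochner_Integration.integrable_bound)
      show "integrable lborel (\<lambda>t. indicator {0<..<1} t * wt t * (l * K))"
        unfolding wt_def by (intro integrable_mult_left integrable_beta_powr l)
      show "(\<lambda>t. indicator {0<..<1} t *\<^sub>R f t) \<in> borel_measurable lborel"
        unfolding f_def wt_def by measurable
      show "AE t in lborel. norm (indicator {0<..<1} t *\<^sub>R f t) \<le> norm (indicator {0<..<1} t * wt t * (l * K))"
      proof (rule AE_I2)
        fix t :: real
        have "\<bar>G t\<bar> \<le> \<bar>K\<bar>" if "t \<in> {0..1}" using K[OF that] by simp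
        then show "norm (indicator {0<..<1} t *\<^sub>R f t) \<le> norm (indicator {0<..<1} t * wt t * (l * K))"
          using l unfolding f_def G_def[symmetric]
          by (cases "t \<in> {0<..<1}") (auto simp: abs_mult mult_ac intro!: mult_left_mono mult_right_mono)
      qed
    qed
  qed
  have lim: "(U \<longlongrightarrow> 0) (at_right 0)" "(U \<longlongrightarrow> 0) (at_left 1)"
  proof -
    have tD: "((\<lambda>t. D t powr - l) \<longlongrightarrow> D a powr - l) (at a within S)" if "a \<in> {0, 1}" for a S
    proof (rule tendsto_powr)
      show "(D \<longlongrightarrow> D a) (at a within S)" using cD by (meson continuous_on_def UNIV_I tendsto_within_subset subset_UNIV)
      show "D a \<noteq> 0" using Dpos[of a] that by auto
    qed auto
    have "((\<lambda>t. t powr l) \<longlongrightarrow> 0) (at_right (0::real))"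
      by (rule tendsto_zero_powrI[where b = l]) (auto intro!: tendsto_eq_intros simp: l eventually_at_right_less[THEN eventually_mono])
    moreover have "((\<lambda>t. (1 - t) powr l) \<longlongrightarrow> (1 - 0) powr l) (at_right (0::real))"
      by (intro tendsto_intros) auto
    ultimately have "(U \<longlongrightarrow> 0 * (1 - 0) powr l * D 0 powr - l) (at_right 0)"
      unfolding U_def[abs_def] using tD[of 0] by (intro tendsto_mult) auto
    then show "(U \<longlongrightarrow> 0) (at_right 0)" by simp
    have "\<forall>\<^sub>F x in at_left (1::real). x < 1" by (simp add: eventually_at_filter)
    then have "((\<lambda>t. (1 - t) powr l) \<longlongrightarrow> 0) (at_left (1::real))"
      by (intro tendsto_zero_powrI[where b = l]) (auto intro!: tendsto_eq_intros simp: l elim!: eventually_mono)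
    moreover have "((\<lambda>t. t powr l) \<longlongrightarrow> 1 powr l) (at_left (1::real))"
      by (intro tendsto_intros) auto
    ultimately have "(U \<longlongrightarrow> 1 powr l * 0 * D 1 powr - l) (at_left 1)"
      unfolding U_def[abs_def] using tD[of 1] by (intro tendsto_mult) auto
    then show "(U \<longlongrightarrow> 0) (at_left 1)" by simp
  qed
  have "(LBINT t=ereal 0..ereal 1. f t) = 0 - 0"
  proof (rule interval_integral_FTC_integrable[where F = U])
    show "(U has_vector_derivative f x) (at x)" if "ereal 0 < ereal x" "ereal x < ereal 1" for x
      using dU[of x] that by (simp add: has_real_derivative_iff_has_vector_derivative)
    show "isCont f x" if "ereal 0 < ereal x" "ereal x < ereal 1" for x
    proof -
      have "isCont D x" using cD by (simp add: continuous_on_eq_continuous_at)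
      moreover have "D x \<noteq> 0" using Dpos[of x] that by auto
      ultimately show ?thesis unfolding f_def wt_def using that by (intro continuous_intros) auto
    qed
    show "set_integrable lborel (einterval (ereal 0) (ereal 1)) f"
      using bound by (simp add: set_integrable_def einterval_eq)
    show "((U \<circ> real_of_ereal) \<longlongrightarrow> 0) (at_right (ereal 0))" "((U \<circ> real_of_ereal) \<longlongrightarrow> 0) (at_left (ereal 1))"
      unfolding ereal_tendsto_simps1 by (rule lim)+
  qed simp
  then have "(\<integral>t. indicator {0<..<1} t *\<^sub>R f t \<partial>lborel) = 0"
    unfolding interval_lebesgue_integral_def set_lebesgue_integral_def einterval_eq by simp
  moreover have "(\<integral>t. indicator {0<..<1} t *\<^sub>R f t \<partial>lborel) = l * (\<integral>t. D t powr (- l - 1) * ((1 - t)\<^sup>2 * A - t\<^sup>2 * B) \<partial>beta_measure l)"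
    by (subst integral_beta) (auto simp: f_def wt_def mult_ac simp flip: integral_mult_right_zero intro!: Bochner_Integration.integral_cong)
  ultimately show ?thesis using l by (simp add: D_def)
qed

end

definition beta_mass :: "real \<Rightarrow> real" where
  "beta_mass l = (\<integral>t. t \<partial>beta_measure l)"

text \<open>
  This mass is the constant by which the closed form below has to be divided.
\<close>

lemma beta_mass_pos: assumes l: "0 < l" shows "0 < beta_mass l"
proof -
  define f where "f t = indicator {0<..<1} t * (t powr (l - 1) * (1 - t) powr (l - 1)) * t" for t :: real
  have e: "beta_mass l = (\<integral>t. f t \<partial>lborel)"
    unfolding beta_mass_def f_def by (subst integral_beta) auto
  have i: "integrable lborel f"
  proof -
    have "f = (\<lambda>t. indicator {0<..<1} t * (t powr (l + 1 - 1) * (1 - t) powr (l - 1)))"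
    proof
      fix t :: real
      have "t powr l = t powr (l - 1) * t" if "0 < t" using that by (simp add: powr_diff)
      then show "f t = indicator {0<..<1} t * (t powr (l + 1 - 1) * (1 - t) powr (l - 1))"
        by (auto simp: f_def indicator_def)
    qed
    then show ?thesis using integrable_beta_powr[of "l + 1" l] l by simp
  qed
  have nn: "0 \<le> f t" for t by (auto simp: f_def indicator_def)
  have "beta_mass l \<noteq> 0"
  proof
    assume "beta_mass l = 0"
    then have "AE t in lborel. f t = 0"
      unfolding e using i nn by (subst (asm) integral_nonneg_eq_0_iff_AE) auto
    then have "AE t in lborel. t \<notin> {0<..<1::real}"
      by eventually_elim (auto simp: f_def)
    then have "{0<..<1::real} \<in> null_sets lborel" by (subst (asm) AE_iff_null_sets[symmetric]) auto
    then have "emeasure lborel {0<..<1::real} = 0" by auto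
    then show False by simp
  qed
  moreover have "0 \<le> beta_mass l" unfolding e by (intro integral_nonneg_AE AE_I2 nn)
  ultimately show ?thesis by linarith
qed

text \<open>
  The defect of the deformed Cauchy-Riemann equation for the integrand, cleared of denominators, is a multiple of the
  integrand that was just shown to be a total derivative. Conjugates are separate variables here (\<open>cz\<close> for
  the conjugate of \<open>z\<close>, and so on), \<open>D'\<close> stands for \<open>Dd powr (-\<lambda> - 1)\<close>,
  where \<open>Dd\<close> is the interpolant, and \<open>E\<close> for its derivative.
\<close>

lemma kernel_ring_identity:
  fixes z cz w cw t D' l a b ca cb E Dd :: complex
  assumes "a = 1 - z * cw" "b = 1 - z * w" "ca = 1 - cz * w" "cb = 1 - cz * cw"
    "E = - ((1 - t) * a * w + t * b * cw)" "Dd = (1 - t) * (a * ca) + t * (b * cb)"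
  shows "cb * (z - cz) * ((- l * (t * D')) * E) - l * (cb * (t * (Dd * D')) - a * ((1 - t) * (Dd * D')))
       = l * a * (D' * ((1 - t)\<^sup>2 * (a * ca) - t\<^sup>2 * (b * cb)))"
proof -
  have 1: "(z - cz) * w = ca - b" "(z - cz) * cw = cb - a" unfolding assms(1-4) by (simp_all add: algebra_simps)
  have "(z - cz) * E = - ((1 - t) * a * ((z - cz) * w) + t * b * ((z - cz) * cw))"
    unfolding assms(5) by (simp add: algebra_simps)
  then have 2: "(z - cz) * E = - ((1 - t) * a * (ca - b) + t * b * (cb - a))" unfolding 1 .
  have "cb * (z - cz) * ((- l * (t * D')) * E) = cb * (- l * (t * D')) * ((z - cz) * E)" by (simp add: mult_ac)
  then show ?thesis unfolding 2 assms(6) by (simp add: algebra_simps power2_eq_square)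
qed

definition cauchy_kernel :: "real \<Rightarrow> complex \<Rightarrow> complex \<Rightarrow> complex" where
  "cauchy_kernel l w z = cauchy_num l w z / (1 - z * cnj w)"

context
  fixes l :: real and w :: complex
  assumes l: "0 < l" and w: "norm w < 1"
begin

lemma one_minus_nz:
  assumes "norm z \<le> 1" shows "1 - z * cnj w \<noteq> 0" "1 - z * w \<noteq> 0"
  using norm_one_minus_ge[OF assms, of w] w by auto

lemma cauchy_kernel_has_wirtinger:
  assumes z: "z \<in> ball 0 1"
  shows "has_wirtinger (cauchy_kernel l w)
     (cauchy_num_z l w z / (1 - z * cnj w) + cauchy_num l w z * cnj w / (1 - z * cnj w)\<^sup>2)
     (cauchy_num_zbar l w z / (1 - z * cnj w)) z"
proof -
  have nz: "1 - z * cnj w \<noteq> 0" using z by (intro one_minus_nz) auto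
  have d: "((\<lambda>z. 1 - z * cnj w) has_derivative (\<lambda>h. - (h * cnj w))) (at z)"
    by (auto intro!: derivative_eq_intros)
  show ?thesis
    unfolding has_wirtinger_def cauchy_kernel_def[abs_def]
  proof (rule has_derivative_eq_rhs[OF has_derivative_divide[OF cauchy_num_has_wirtinger[OF l w z, unfolded has_wirtinger_def] d nz]], rule ext)
    fix h
    define A where "A = 1 - z * cnj w"
    have A0: "A \<noteq> 0" using nz by (simp add: A_def)
    show "- cauchy_num l w z * (inverse (1 - z * cnj w) * - (h * cnj w) * inverse (1 - z * cnj w)) + (cauchy_num_z l w z * h + cauchy_num_zbar l w z * cnj h) / (1 - z * cnj w) =
         (cauchy_num_z l w z / (1 - z * cnj w) + cauchy_num l w z * cnj w / (1 - z * cnj w)\<^sup>2) * h + cauchy_num_zbar l w z / (1 - z * cnj w) * cnj h"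
      unfolding A_def[symmetric] using A0 by (simp add: field_simps power2_eq_square)
  qed
qed

text \<open>
  Replacing \<open>z\<close> by its conjugate exchanges the two distances, that is, reflects \<open>t\<close>. All three
  terms thus become integrals with the same interpolant, and the algebraic identity leaves a total derivative.
\<close>

lemma cauchy_kernel_analytic:
  assumes z: "norm z < 1"
  shows "(z - cnj z) * (cauchy_num_zbar l w z / (1 - z * cnj w)) = of_real l * (cauchy_kernel l w z - cauchy_kernel l w (cnj z))"
proof -
  define a where "a = 1 - z * cnj w"
  define b where "b = 1 - z * w"
  define J where "J = (\<integral>t. complex_of_real ((1 - t) * interp w z t powr - l) \<partial>beta_measure l)"
  have a0: "a \<noteq> 0" and b0: "cnj b \<noteq> 0" using one_minus_nz[of z] z by (simp_all add: a_def b_def del: complex_cnj_diff)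
  have cb: "cnj b = 1 - cnj z * cnj w" by (simp add: b_def)
  have J: "cauchy_num l w (cnj z) = J"
    unfolding J_def cauchy_num_def interp_cnj
    using integral_beta_reflect[of "\<lambda>t. complex_of_real ((1 - t) * interp w z t powr - l)" l] by simp
  have i1: "integrable (beta_measure l) (\<lambda>t. complex_of_real (t * interp w z t powr - l))"
    using integrable_kernel_factor[OF l w, of z l] z l by (intro integrable_of_real) auto
  have i2: "integrable (beta_measure l) (\<lambda>t. complex_of_real ((1 - t) * interp w z t powr - l))"
  proof -
    interpret finite_measure "beta_measure l" by (rule beta_finite[OF l])
    show ?thesis
    proof (intro integrable_of_real integrable_const_bound)
      show "AE t in beta_measure l. norm ((1 - t) * interp w z t powr - l) \<le> ((1 - norm w)\<^sup>2) powr - l"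
        using AE_beta
      proof eventually_elim
        case (elim t)
        then have "(1 - t) * interp w z t powr - l \<le> 1 * ((1 - norm w)\<^sup>2) powr - l"
          using interp_powr_le[OF l w, of z t l] l z by (intro mult_mono) auto
        then show ?case using elim by (simp add: abs_mult)
      qed
    qed measurable
  qed
  have i3: "integrable (beta_measure l) (\<lambda>t. of_real (- l * (t * interp w z t powr (- l - 1))) * interp_d w z t)"
    using integrable_cauchy_num_deriv[OF l w, of z] z by auto
  have "cnj b * (z - cnj z) * cauchy_num_zbar l w z - of_real l * (cnj b * cauchy_num l w z - a * J)
    = (\<integral>t. cnj b * (z - cnj z) * (of_real (- l * (t * interp w z t powr (- l - 1))) * interp_d w z t)
        - of_real l * (cnj b * of_real (t * interp w z t powr - l) - a * of_real ((1 - t) * interp w z t powr - l)) \<partial>beta_measure l)"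
    unfolding cauchy_num_zbar_def cauchy_num_def J_def using i1 i2 i3
    by (simp del: of_real_mult of_real_diff of_real_minus)
  also have "\<dots> = (\<integral>t. of_real l * a * of_real (interp w z t powr (- l - 1) * ((1 - t)\<^sup>2 * (norm (1 - z * cnj w))\<^sup>2 - t\<^sup>2 * (norm (1 - z * w))\<^sup>2)) \<partial>beta_measure l)"
  proof (rule integral_cong_AE)
    show "AE t in beta_measure l. cnj b * (z - cnj z) * (of_real (- l * (t * interp w z t powr (- l - 1))) * interp_d w z t)
        - of_real l * (cnj b * of_real (t * interp w z t powr - l) - a * of_real ((1 - t) * interp w z t powr - l))
       = of_real l * a * of_real (interp w z t powr (- l - 1) * ((1 - t)\<^sup>2 * (norm (1 - z * cnj w))\<^sup>2 - t\<^sup>2 * (norm (1 - z * w))\<^sup>2))"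
      using AE_beta
    proof eventually_elim
      case (elim t)
      have pos: "0 < interp w z t" using elim z w by (intro interp_pos) auto
      have Dl: "interp w z t powr - l = interp w z t * interp w z t powr (- l - 1)"
        using pos by (simp add: powr_diff powr_minus field_simps)
      have na: "complex_of_real ((norm (1 - z * cnj w))\<^sup>2) = a * cnj a" and nb: "complex_of_real ((norm (1 - z * w))\<^sup>2) = b * cnj b"
        by (subst complex_norm_square, simp add: a_def b_def)+
      have Dd: "complex_of_real (interp w z t) = (1 - of_real t) * (a * cnj a) + of_real t * (b * cnj b)"
        unfolding interp_def of_real_add of_real_mult na nb by simp
      have Ed: "interp_d w z t = - ((1 - of_real t) * a * w + of_real t * b * cnj w)"
        by (simp add: interp_d_def a_def b_def)
      have ca: "cnj a = 1 - cnj z * w" by (simp add: a_def)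
      from kernel_ring_identity[OF a_def b_def ca cb Ed Dd, of "of_real l" "of_real (interp w z t powr (- l - 1))"]
      show ?case unfolding Dl of_real_mult of_real_diff of_real_power of_real_minus na[unfolded of_real_power] nb[unfolded of_real_power] of_real_1 by simp
    qed
  qed measurable
  also have "\<dots> = 0"
    unfolding integral_mult_right_zero integral_complex_of_real beta_total_derivative[OF l w z] by simp
  finally have e: "cnj b * (z - cnj z) * cauchy_num_zbar l w z = of_real l * (cnj b * cauchy_num l w z - a * J)" by simp
  have "(z - cnj z) * (cauchy_num_zbar l w z / a) = cnj b * (z - cnj z) * cauchy_num_zbar l w z / (a * cnj b)"
    using a0 b0 by simp
  also have "\<dots> = of_real l * (cauchy_num l w z / a - J / cnj b)"
    unfolding e using a0 b0 by (simp add: right_diff_distrib diff_divide_distrib)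
  finally show ?thesis
    unfolding cauchy_kernel_def J a_def[symmetric] cb[symmetric] .
qed

lemma cauchy_kernel_wirtinger_analytic:
  "wirtinger_analytic l (cauchy_kernel l w)
     (\<lambda>z. cauchy_num_z l w z / (1 - z * cnj w) + cauchy_num l w z * cnj w / (1 - z * cnj w)\<^sup>2)
     (\<lambda>z. cauchy_num_zbar l w z / (1 - z * cnj w))"
proof -
  have "continuous_on (ball 0 1) (cauchy_num l w)"
    by (intro continuous_at_imp_continuous_on ballI has_wirtinger_isCont[OF cauchy_num_has_wirtinger[OF l w]])
  moreover have "\<forall>z\<in>ball 0 1. 1 - z * cnj w \<noteq> 0" using one_minus_nz by auto
  ultimately show ?thesis
    unfolding wirtinger_analytic_def
    by (intro conjI ballI cauchy_kernel_has_wirtinger continuous_intros continuous_cauchy_num_deriv[OF l w] cauchy_kernel_analytic) auto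
qed

text \<open>
  On the real axis the two distances agree, so the interpolant leaves the integral.
\<close>

lemma cauchy_kernel_real:
  assumes x: "0 < x" "x < 1"
  shows "cauchy_kernel l w (of_real x) = of_real (beta_mass l) * (of_real (norm (1 - of_real x * w) powr (- 2 * l)) / (1 - of_real x * cnj w))"
proof -
  define N where "N = norm (1 - of_real x * w)"
  have N: "N > 0" using one_minus_nz(2)[of "of_real x"] x by (simp add: N_def)
  have N': "norm (1 - of_real x * cnj w) = N"
    using complex_mod_cnj[of "1 - of_real x * w"] by (simp add: N_def)
  have "interp w (of_real x) t = N\<^sup>2" for t
    unfolding interp_def N' unfolding N_def[symmetric] by (simp add: algebra_simps)
  moreover have "(N\<^sup>2) powr - l = N powr (- 2 * l)"
    using power2_powr[OF N, of "- l"] by simp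
  ultimately have "cauchy_num l w (of_real x) = (\<integral>t. of_real (t * N powr (- 2 * l)) \<partial>beta_measure l)"
    unfolding cauchy_num_def by simp
  also have "\<dots> = of_real (beta_mass l) * of_real (N powr (- 2 * l))"
    unfolding integral_complex_of_real beta_mass_def by simp
  finally show ?thesis by (simp add: cauchy_kernel_def N_def)
qed

text \<open>
  Both sides are \<open>\<lambda>\<close>-analytic in \<open>z\<close>. Expanding the right side in the
  \<open>A\<^sub>n\<close> and restricting to the interval \<open>(0, 1)\<close>, where \<open>A\<^sub>n(x)\<close> is
  \<open>x\<^sup>n\<close> times a positive number, identifies the coefficients through the generating function.
\<close>

lemma phi_series_eq_cauchy_kernel:
  assumes z: "norm z < 1"
  shows "(\<lambda>n. phi l n z * cnj (phi l n w)) sums (cauchy_kernel l w z / of_real (beta_mass l))"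
proof -
  have l0: "0 \<le> l" using l by simp
  obtain a where a: "subexp a" "\<And>z. norm z < 1 \<Longrightarrow> cauchy_kernel l w z = ser (phi_coef l a) z"
    using wirtinger_analytic_expansion[OF l0 cauchy_kernel_wirtinger_analytic] by metis
  have s: "(\<lambda>n. a n * gpoly l n z) sums cauchy_kernel l w z" if "norm z < 1" for z
    using ser_sums[OF tame_phi_coef[OF l0 a(1)] that] unfolding a(2)[OF that] hpart_phi_coef .
  have b0: "beta_mass l > 0" by (rule beta_mass_pos[OF l])
  have "a n * of_real (gval l n) - of_real (beta_mass l) * cnj (gpoly l n w) = 0" for n
  proof (rule powser_zero_coeffs[of "\<lambda>n. a n * of_real (gval l n) - of_real (beta_mass l) * cnj (gpoly l n w)"])
    fix x :: real assume x: "0 < x" "x < 1"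
    have "norm (of_real x * w) < 1" using x w mult_strict_mono[of x 1 "norm w" 1] by (simp add: norm_mult)
    from gpoly_generating_function[OF this, of l]
    have "(\<lambda>n. cnj (gpoly l n (of_real x * w))) sums cnj (of_real (norm (1 - of_real x * w) powr (- 2 * l)) / (1 - of_real x * w))"
      by (simp only: sums_cnj)
    from sums_mult[OF this, of "of_real (beta_mass l)"]
    have 1: "(\<lambda>n. of_real (beta_mass l) * cnj (gpoly l n w) * of_real x ^ n) sums cauchy_kernel l w (of_real x)"
      unfolding cauchy_kernel_real[OF x] gpoly_scale by (simp add: mult_ac)
    have "gpoly l n (of_real x) = of_real x ^ n * of_real (gval l n)" for n
      using gpoly_scale[of l n x 1] by (simp add: gpoly_1)
    then have "(\<lambda>n. a n * of_real (gval l n) * of_real x ^ n) sums cauchy_kernel l w (of_real x)"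
      using s[of "of_real x"] x by (simp add: mult_ac)
    from sums_diff[OF this 1] show "(\<lambda>n. (a n * of_real (gval l n) - of_real (beta_mass l) * cnj (gpoly l n w)) * of_real x ^ n) sums 0"
      by (simp add: left_diff_distrib)
  qed
  then have coef: "a n * of_real (gval l n) = of_real (beta_mass l) * cnj (gpoly l n w)" for n by simp
  have "phi l n z * cnj (phi l n w) = a n * gpoly l n z / of_real (beta_mass l)" for n
  proof -
    have g: "gval l n > 0" using gval_ge_1[OF l0, of n] by simp
    have "phi l n z * cnj (phi l n w) = of_real ((eps_coeff l n)\<^sup>2) * (gpoly l n z * cnj (gpoly l n w))"
      by (simp add: phi_eq power2_eq_square)
    also have "\<dots> = gpoly l n z * cnj (gpoly l n w) / of_real (gval l n)"
      unfolding eps_coeff_sq[OF l0] by simp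
    also have "cnj (gpoly l n w) = a n * of_real (gval l n) / of_real (beta_mass l)"
      using coef[of n] b0 by (simp add: field_simps)
    finally show ?thesis using g by simp
  qed
  then show ?thesis using sums_divide[OF s[OF z], of "of_real (beta_mass l)"] by simp
qed

end

section \<open>Pointwise bound for the Bergman kernel\<close>

text \<open>
  Here \<open>p\<close> and \<open>q\<close> are the two distances and \<open>D\<close> is the interpolant. If
  \<open>p \<le> q\<close>, use \<open>D \<ge> t q\<^sup>2\<close> and \<open>D \<ge> p\<^sup>2\<close>. Otherwise
  \<open>D \<ge> (1 - t) p\<^sup>2\<close> alone would cost \<open>(1 - t) powr (-\<lambda>)\<close>, which is not
  integrable against the beta weight. So the part \<open>D powr (-\<kappa>)\<close> is estimated by
  \<open>D \<ge> q\<^sup>2\<close> instead; \<open>\<kappa> > 0\<close> restores integrability,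
  \<open>\<kappa> \<le> \<lambda>\<close> keeps the exponent of the first factor nonpositive, and
  \<open>\<kappa> \<le> 1/2\<close> ensures that at most the square of \<open>p / q\<close> appears.
\<close>

lemma kernel_weight_bound:
  fixes p q t l :: real
  assumes l: "0 < l" and p: "0 < p" and q: "0 < q" and t: "0 < t" "t < 1"
  defines "D \<equiv> (1 - t) * p\<^sup>2 + t * q\<^sup>2" and "\<kappa> \<equiv> min l (1/2)"
  shows "max p q powr (2 * l) * (D powr - l / p\<^sup>2 + D powr (- l - 1/2) / p)
    \<le> 2 * (1 / p\<^sup>2 + 1 / q\<^sup>2) * (t powr - l * (1 - t) powr (\<kappa> - l))"
proof -
  note sq = power2_powr[symmetric]
  have k: "0 < \<kappa>" "\<kappa> \<le> l" "\<kappa> \<le> 1/2" using l by (auto simp: \<kappa>_def)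
  have tl: "1 \<le> t powr - l"
  proof -
    have "t powr 0 \<le> t powr - l" using t l by (intro powr_mono') auto
    then show ?thesis using t by simp
  qed
  have tk: "1 \<le> (1 - t) powr (\<kappa> - l)"
  proof -
    have "(1 - t) powr 0 \<le> (1 - t) powr (\<kappa> - l)" using t k by (intro powr_mono') auto
    then show ?thesis using t by simp
  qed
  have Dpos: "0 < D" unfolding D_def using t p q by (intro add_pos_pos) auto
  show ?thesis
  proof (cases "p \<le> q")
    case True
    have D1: "t * q\<^sup>2 \<le> D" unfolding D_def using t by simp
    have D2: "p\<^sup>2 \<le> D"
    proof -
      have "p\<^sup>2 = (1 - t) * p\<^sup>2 + t * p\<^sup>2" by (simp add: algebra_simps)
      also have "\<dots> \<le> D" unfolding D_def using True t p by (intro add_mono mult_left_mono power_mono) auto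
      finally show ?thesis .
    qed
    have a: "D powr - l \<le> t powr - l * q powr (- 2 * l)"
    proof -
      have "D powr - l \<le> (t * q\<^sup>2) powr - l" using D1 t q l by (intro powr_mono2') auto
      also have "\<dots> = t powr - l * q powr (- 2 * l)" using t q sq[of q "- l"] by (simp add: powr_mult)
      finally show ?thesis .
    qed
    have b: "D powr (- 1/2) \<le> 1 / p"
    proof -
      have "D powr (- 1/2) \<le> (p\<^sup>2) powr (- 1/2)" using D2 p by (intro powr_mono2') auto
      also have "\<dots> = 1 / p" using p sq[of p "- 1/2"] by (simp add: powr_minus divide_simps)
      finally show ?thesis .
    qed
    have "D powr (- l - 1/2) = D powr - l * D powr (- 1/2)" by (simp flip: powr_add)
    also have "\<dots> \<le> (t powr - l * q powr (- 2 * l)) * (1 / p)" using a b by (intro mult_mono) auto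
    finally have "D powr (- l - 1/2) / p \<le> (t powr - l * q powr (- 2 * l)) * (1 / p) / p"
      using p by (intro divide_right_mono) auto
    moreover have "D powr - l / p\<^sup>2 \<le> (t powr - l * q powr (- 2 * l)) / p\<^sup>2" using a by (intro divide_right_mono) auto
    ultimately have "D powr - l / p\<^sup>2 + D powr (- l - 1/2) / p \<le> 2 * t powr - l * q powr (- 2 * l) / p\<^sup>2"
      by (simp add: power2_eq_square)
    then have "q powr (2 * l) * (D powr - l / p\<^sup>2 + D powr (- l - 1/2) / p) \<le> q powr (2 * l) * (2 * t powr - l * q powr (- 2 * l) / p\<^sup>2)"
      by (intro mult_left_mono) auto
    also have "\<dots> = 2 * (1 / p\<^sup>2) * (t powr - l * 1)" using q by (simp add: powr_minus field_simps)
    also have "\<dots> \<le> 2 * (1 / p\<^sup>2 + 1 / q\<^sup>2) * (t powr - l * (1 - t) powr (\<kappa> - l))"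
      using tk by (intro mult_mono mult_left_mono) auto
    finally show ?thesis using True by (simp add: max_def)
  next
    case False
    define x where "x = p / q"
    have x: "1 \<le> x" using False q by (simp add: x_def)
    have D1: "(1 - t) * p\<^sup>2 \<le> D" unfolding D_def using t by simp
    have D2: "q\<^sup>2 \<le> D"
    proof -
      have "q\<^sup>2 = (1 - t) * q\<^sup>2 + t * q\<^sup>2" by (simp add: algebra_simps)
      also have "\<dots> \<le> D" unfolding D_def using False t q by (intro add_mono mult_left_mono power_mono) auto
      finally show ?thesis .
    qed
    \<comment> \<open>used with s = 0 for the numerator and s = 1/2 for its derivatives\<close>
    have gen: "D powr - (l + s) * p powr (2 * l) \<le> (1 - t) powr (\<kappa> - l) * p powr (- 2 * s) * x powr (2 * (\<kappa> + s))" if "0 \<le> s" for s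
    proof -
      have "D powr - (l + s) = D powr (\<kappa> - l) * D powr - (\<kappa> + s)" by (simp flip: powr_add)
      also have "\<dots> \<le> ((1 - t) * p\<^sup>2) powr (\<kappa> - l) * (q\<^sup>2) powr - (\<kappa> + s)"
        using D1 D2 t p q k that by (intro mult_mono powr_mono2') auto
      also have "\<dots> = (1 - t) powr (\<kappa> - l) * p powr (2 * (\<kappa> - l)) * q powr (2 * - (\<kappa> + s))"
        using t p q sq[of p "\<kappa> - l"] sq[of q "- (\<kappa> + s)"] by (simp add: powr_mult)
      finally have "D powr - (l + s) * p powr (2 * l) \<le> (1 - t) powr (\<kappa> - l) * p powr (2 * (\<kappa> - l)) * q powr (2 * - (\<kappa> + s)) * p powr (2 * l)"
        by (intro mult_right_mono) auto
      also have "\<dots> = (1 - t) powr (\<kappa> - l) * (p powr (2 * (\<kappa> - l)) * p powr (2 * l)) * q powr (2 * - (\<kappa> + s))" by simp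
      also have "p powr (2 * (\<kappa> - l)) * p powr (2 * l) = p powr (- 2 * s) * p powr (2 * (\<kappa> + s))"
        by (simp flip: powr_add add: algebra_simps)
      also have "(1 - t) powr (\<kappa> - l) * (p powr (- 2 * s) * p powr (2 * (\<kappa> + s))) * q powr (2 * - (\<kappa> + s)) = (1 - t) powr (\<kappa> - l) * p powr (- 2 * s) * x powr (2 * (\<kappa> + s))"
      proof -
        have "q powr (2 * - (\<kappa> + s)) = 1 / q powr (2 * (\<kappa> + s))"
          by (simp only: mult_minus_right powr_minus inverse_eq_divide)
        then show ?thesis using p q by (simp only: x_def powr_divide less_imp_le) simp
      qed
      finally show ?thesis .
    qed
    have x2: "x powr a \<le> x\<^sup>2" if "a \<le> 2" for a
      using powr_mono[OF that x] x by simp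
    have A: "p powr (2 * l) * (D powr - l / p\<^sup>2) \<le> (1 - t) powr (\<kappa> - l) * (1 / q\<^sup>2)"
    proof -
      have "p powr (2 * l) * (D powr - l / p\<^sup>2) = D powr - (l + 0) * p powr (2 * l) / p\<^sup>2" by simp
      also have "\<dots> \<le> (1 - t) powr (\<kappa> - l) * p powr (- 2 * 0) * x powr (2 * (\<kappa> + 0)) / p\<^sup>2"
        by (intro divide_right_mono gen) auto
      also have "\<dots> \<le> (1 - t) powr (\<kappa> - l) * x\<^sup>2 / p\<^sup>2"
        using p k by (intro divide_right_mono) (auto intro!: mult_left_mono x2)
      also have "\<dots> = (1 - t) powr (\<kappa> - l) * (1 / q\<^sup>2)" using p q by (simp add: x_def power_divide)
      finally show ?thesis .
    qed
    have B: "p powr (2 * l) * (D powr (- l - 1/2) / p) \<le> (1 - t) powr (\<kappa> - l) * (1 / q\<^sup>2)"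
    proof -
      have "p powr (2 * l) * (D powr (- l - 1/2) / p) = D powr - (l + 1/2) * p powr (2 * l) / p" by simp
      also have "\<dots> \<le> (1 - t) powr (\<kappa> - l) * p powr (- 2 * (1/2)) * x powr (2 * (\<kappa> + 1/2)) / p"
        using p by (intro divide_right_mono gen) auto
      also have "\<dots> \<le> (1 - t) powr (\<kappa> - l) * p powr (- 2 * (1/2)) * x\<^sup>2 / p"
        using p k by (intro divide_right_mono mult_left_mono x2) auto
      also have "\<dots> = (1 - t) powr (\<kappa> - l) * (1 / q\<^sup>2)"
        using p q by (simp add: x_def power_divide powr_minus divide_simps power2_eq_square)
      finally show ?thesis .
    qed
    have "p powr (2 * l) * (D powr - l / p\<^sup>2 + D powr (- l - 1/2) / p) \<le> 2 * (1 / q\<^sup>2) * (1 * (1 - t) powr (\<kappa> - l))"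
      using A B by (simp add: distrib_left)
    also have "\<dots> \<le> 2 * (1 / p\<^sup>2 + 1 / q\<^sup>2) * (t powr - l * (1 - t) powr (\<kappa> - l))"
      using tl by (intro mult_mono mult_right_mono) auto
    finally show ?thesis using False by (simp add: max_def)
  qed
qed

context
  fixes l :: real and w :: complex
  assumes l: "0 < l" and w: "norm w < 1"
begin

text \<open>
  The operator \<open>r \<partial>\<^sub>r + \<lambda> + 1\<close> multiplies the \<open>n\<close>-th term of the Cauchy
  kernel by \<open>n + \<lambda> + 1\<close>. By homogeneity the radial derivative is that of an ordinary power series
  in the scaling factor, evaluated at \<open>1\<close>.
\<close>

lemma bergman_kernel_formula:
  assumes z: "norm z < 1"
  shows "of_real ((l + 1) * beta_mass l) * bergman_kernel l z w
    = (cauchy_num_z l w z / (1 - z * cnj w) + cauchy_num l w z * cnj w / (1 - z * cnj w)\<^sup>2) * z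
      + (cauchy_num_zbar l w z / (1 - z * cnj w)) * cnj z + of_real (l + 1) * cauchy_kernel l w z"
proof -
  define F1 where "F1 = cauchy_num_z l w z / (1 - z * cnj w) + cauchy_num l w z * cnj w / (1 - z * cnj w)\<^sup>2"
  define F2 where "F2 = cauchy_num_zbar l w z / (1 - z * cnj w)"
  define b where "b = complex_of_real (beta_mass l)"
  have b0: "b \<noteq> 0" using beta_mass_pos[OF l] by (simp add: b_def)
  define u where "u n = phi l n z * cnj (phi l n w)" for n
  \<comment> \<open>Any R > 1 with R |z| < 1 would do: it puts the evaluation point 1 inside the disk of convergence.\<close>
  define R where "R = 2 / (1 + norm z)"
  have n1: "1 + norm z > 0" using norm_ge_zero[of z] by linarith
  have R: "1 < R" "R * norm z < 1" using z n1 by (auto simp: R_def field_simps)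
  have S: "(\<lambda>n. u n * of_real s ^ n) sums (cauchy_kernel l w (of_real s * z) / b)" if s: "0 < s" "s \<le> R" for s
  proof -
    have "s * norm z \<le> R * norm z" using s by (intro mult_right_mono) auto
    then have "norm (of_real s * z) < 1" using R s by (simp add: norm_mult)
    from phi_series_eq_cauchy_kernel[OF l w this] show ?thesis
      unfolding u_def b_def phi_eq gpoly_scale by (simp add: mult_ac)
  qed
  have smR: "summable (\<lambda>n. u n * of_real R ^ n)" using S[of R] R by (simp add: sums_iff)
  have nR: "norm (1::complex) < norm (complex_of_real R)" using R by simp
  have "((\<lambda>x. \<Sum>n. u n * x ^ n) has_field_derivative (\<Sum>n. diffs u n * of_real 1 ^ n)) (at (complex_of_real 1))"
    using termdiffs_strong[OF smR, of 1] nR by simp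
  then have d1: "((\<lambda>x. \<Sum>n. u n * of_real x ^ n) has_vector_derivative (\<Sum>n. diffs u n)) (at 1)"
    using has_vector_derivative_real_field[of "\<lambda>x. \<Sum>n. u n * x ^ n" _ 1] by simp
  have "((\<lambda>x. of_real x * z) has_vector_derivative z) (at 1)" by (auto intro!: derivative_eq_intros)
  from has_wirtinger_compose_vector[OF _ this, of "cauchy_kernel l w" F1 F2]
  have "((\<lambda>x. cauchy_kernel l w (of_real x * z)) has_vector_derivative F1 * z + F2 * cnj z) (at 1)"
    using cauchy_kernel_has_wirtinger[OF l w, of z] z by (simp add: F1_def F2_def)
  then have d2: "((\<lambda>x. cauchy_kernel l w (of_real x * z) / b) has_vector_derivative (F1 * z + F2 * cnj z) / b) (at 1)"
    by (rule has_vector_derivative_divide)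
  have "((\<lambda>x. \<Sum>n. u n * of_real x ^ n) has_vector_derivative (F1 * z + F2 * cnj z) / b) (at 1)"
  proof (rule has_vector_derivative_transform_within_open[OF d2, of "{0<..<R}"])
    fix x assume "x \<in> {0<..<R}"
    then show "cauchy_kernel l w (of_real x * z) / b = (\<Sum>n. u n * of_real x ^ n)"
      using S[of x] by (simp add: sums_iff)
  qed (use R in auto)
  with d1 have e: "(\<Sum>n. diffs u n) = (F1 * z + F2 * cnj z) / b" by (rule vector_derivative_unique_at)
  have "summable (\<lambda>n. diffs u n * 1 ^ n)"
  proof (rule termdiff_converges)
    show "norm (1::complex) < R" using R by simp
    show "summable (\<lambda>n. u n * x ^ n)" if "norm x < R" for x
      using that R by (intro powser_inside[OF smR]) auto
  qed
  then have "(\<lambda>n. of_nat (Suc n) * u (Suc n)) sums ((F1 * z + F2 * cnj z) / b)"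
    using e by (simp add: sums_iff diffs_def)
  then have "(\<lambda>n. of_nat n * u n) sums ((F1 * z + F2 * cnj z) / b)"
    by (subst (asm) sums_Suc_iff) simp
  moreover have "u sums (cauchy_kernel l w z / b)" using S[of 1] R by simp
  ultimately have "(\<lambda>n. (of_nat n * u n + of_real (l + 1) * u n) / of_real (l + 1)) sums (((F1 * z + F2 * cnj z) / b + of_real (l + 1) * (cauchy_kernel l w z / b)) / of_real (l + 1))"
    by (intro sums_divide sums_add sums_mult)
  moreover have "(of_nat n * u n + of_real (l + 1) * u n) / of_real (l + 1) = of_real ((real n + l + 1) / (l + 1)) * phi l n z * cnj (phi l n w)" for n
    using l by (simp add: u_def field_simps)
  ultimately have "bergman_kernel l z w = ((F1 * z + F2 * cnj z) / b + of_real (l + 1) * (cauchy_kernel l w z / b)) / of_real (l + 1)"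
    unfolding bergman_kernel_def by (simp only: sums_iff)
  moreover have "complex_of_real (l + 1) \<noteq> 0" using l by (simp only: of_real_eq_0_iff)
  ultimately show ?thesis unfolding F1_def[symmetric] F2_def[symmetric] of_real_mult b_def[symmetric] using b0
    by (simp add: divide_simps mult_ac del: of_real_add)
qed

text \<open>
  The exponents that occur are \<open>\<lambda>\<close>, for the numerator, and \<open>\<lambda> + 1/2\<close>, for its
  derivatives.
\<close>

definition kernel_moment :: "complex \<Rightarrow> real \<Rightarrow> real" where
  "kernel_moment z s = (\<integral>t. t * interp w z t powr - s \<partial>beta_measure l)"

lemma kernel_moment_nonneg: "0 \<le> kernel_moment z s"
  unfolding kernel_moment_def using AE_beta[of l] by (intro integral_nonneg_AE) (auto elim!: eventually_mono)

lemma norm_cauchy_num: "norm (cauchy_num l w z) \<le> kernel_moment z l"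
  unfolding cauchy_num_def integral_complex_of_real
  unfolding kernel_moment_def[symmetric] using kernel_moment_nonneg[of z l] by simp

lemma norm_cauchy_num_deriv:
  assumes z: "norm z < 1"
  shows "norm (cauchy_num_z l w z) \<le> l * kernel_moment z (l + 1/2)" "norm (cauchy_num_zbar l w z) \<le> l * kernel_moment z (l + 1/2)"
proof -
  have i: "integrable (beta_measure l) (\<lambda>t. l * (t * interp w z t powr - (l + 1/2)))"
    using integrable_kernel_factor[OF l w, of z "l + 1/2"] z l by (intro integrable_mult_right) auto
  have AEb: "AE t in beta_measure l. norm (of_real (- l * (t * interp w z t powr (- l - 1))) * interp_d w z t) \<le> l * (t * interp w z t powr - (l + 1/2))"
    using AE_beta
  proof eventually_elim
    case (elim t)
    have pos: "0 < interp w z t" using elim z w by (intro interp_pos) auto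
    have "norm (of_real (- l * (t * interp w z t powr (- l - 1))) * interp_d w z t) = l * (t * interp w z t powr (- l - 1)) * norm (interp_d w z t)"
      unfolding norm_mult norm_of_real using l elim by (simp add: abs_mult)
    also have "\<dots> \<le> l * (t * interp w z t powr (- l - 1)) * interp w z t powr (1/2)"
      using interp_d_le[of w t z] w elim pos l by (intro mult_left_mono) (auto simp: powr_half_sqrt)
    also have "\<dots> = l * (t * (interp w z t powr (- l - 1) * interp w z t powr (1/2)))" by simp
    also have "interp w z t powr (- l - 1) * interp w z t powr (1/2) = interp w z t powr - (l + 1/2)"
    proof -
      have "- l - 1 + 1/2 = - (l + 1/2)" by simp
      then show ?thesis by (simp only: powr_add[symmetric])
    qed
    finally show ?case .
  qed
  have km: "l * kernel_moment z (l + 1/2) = (\<integral>t. l * (t * interp w z t powr - (l + 1/2)) \<partial>beta_measure l)"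
    unfolding kernel_moment_def by simp
  have z1: "norm z \<le> 1" using z by simp
  show "norm (cauchy_num_zbar l w z) \<le> l * kernel_moment z (l + 1/2)"
    unfolding cauchy_num_zbar_def km
    by (rule order.trans[OF integral_norm_bound integral_mono_AE[OF integrable_norm[OF integrable_cauchy_num_deriv(1)[OF l w z1]] i AEb]])
  show "norm (cauchy_num_z l w z) \<le> l * kernel_moment z (l + 1/2)"
    unfolding cauchy_num_z_def km
    by (rule order.trans[OF integral_norm_bound integral_mono_AE[OF integrable_norm[OF integrable_cauchy_num_deriv(2)[OF l w z1]] i]])
       (use AEb in \<open>simp add: norm_mult\<close>)
qed

lemma kernel_moment_bound:
  assumes z: "norm z < 1"
  defines "p \<equiv> norm (1 - z * cnj w)" and "q \<equiv> norm (1 - z * w)"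
  shows "max p q powr (2 * l) * (kernel_moment z l / p\<^sup>2 + kernel_moment z (l + 1/2) / p)
     \<le> 2 * (1 / p\<^sup>2 + 1 / q\<^sup>2) * (\<integral>t. indicator {0<..<1} t * (1 - t) powr (min l (1/2) - 1) \<partial>lborel)"
proof -
  define \<kappa> where "\<kappa> = min l (1/2)"
  have k: "0 < \<kappa>" using l by (simp add: \<kappa>_def)
  have pq: "0 < p" "0 < q" using one_minus_nz[OF l w, of z] z by (auto simp: p_def q_def)
  define g where "g t = t * (t powr - l * (1 - t) powr (\<kappa> - l))" for t :: real
  have [measurable]: "g \<in> borel_measurable borel" unfolding g_def[abs_def] by measurable
  have wt: "indicator {0<..<1} t * (t powr (l - 1) * (1 - t) powr (l - 1)) * g t = indicator {0<..<1} t * (1 - t) powr (\<kappa> - 1)" for t :: real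
  proof (cases "t \<in> {0<..<1}")
    case True
    then have "t powr (l - 1) * t powr 1 * t powr - l = 1" unfolding powr_add[symmetric] by simp
    moreover have "(1 - t) powr (l - 1) * (1 - t) powr (\<kappa> - l) = (1 - t) powr (\<kappa> - 1)" by (simp flip: powr_add)
    ultimately show ?thesis using True by (simp add: g_def) (metis (no_types, opaque_lifting) mult.assoc mult.commute mult.left_neutral)
  qed auto
  have ig: "integrable (beta_measure l) g"
  proof -
    have "integrable lborel (\<lambda>t::real. indicator {0<..<1} t * (1 - t) powr (\<kappa> - 1))"
    proof (rule integrable_cong_AE_imp[OF integrable_beta_powr[of 1 \<kappa>]])
      show "AE t in lborel. indicator {0<..<1} t * (t powr (1 - 1) * (1 - t) powr (\<kappa> - 1)) = indicator {0<..<1} t * (1 - t) powr (\<kappa> - 1)"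
        by (rule AE_I2) (auto simp: indicator_def)
    qed (use k in auto)
    then show ?thesis by (subst integrable_beta_iff) (auto simp: wt)
  qed
  have Ig: "(\<integral>t. g t \<partial>beta_measure l) = (\<integral>t. indicator {0<..<1} t * (1 - t) powr (\<kappa> - 1) \<partial>lborel)"
    by (subst integral_beta) (auto simp: wt)
  have i1: "integrable (beta_measure l) (\<lambda>t. t * interp w z t powr - l)" "integrable (beta_measure l) (\<lambda>t. t * interp w z t powr - (l + 1/2))"
    by (rule integrable_kernel_factor[OF l w]; use z l in simp)+
  have "max p q powr (2 * l) * (kernel_moment z l / p\<^sup>2 + kernel_moment z (l + 1/2) / p)
     = (\<integral>t. max p q powr (2 * l) * (t * interp w z t powr - l / p\<^sup>2 + t * interp w z t powr - (l + 1/2) / p) \<partial>beta_measure l)"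
    unfolding kernel_moment_def using i1 by simp
  also have "\<dots> \<le> (\<integral>t. 2 * (1 / p\<^sup>2 + 1 / q\<^sup>2) * g t \<partial>beta_measure l)"
  proof (rule integral_mono_AE)
    show "AE t in beta_measure l. max p q powr (2 * l) * (t * interp w z t powr - l / p\<^sup>2 + t * interp w z t powr - (l + 1/2) / p) \<le> 2 * (1 / p\<^sup>2 + 1 / q\<^sup>2) * g t"
      using AE_beta
    proof eventually_elim
      case (elim t)
      have e: "- (l + 1/2) = - l - 1/2" by simp
      have "max p q powr (2 * l) * (interp w z t powr - l / p\<^sup>2 + interp w z t powr (- l - 1/2) / p) \<le> 2 * (1 / p\<^sup>2 + 1 / q\<^sup>2) * (t powr - l * (1 - t) powr (\<kappa> - l))"
        using kernel_weight_bound[OF l pq, of t] elim by (simp add: interp_def p_def q_def \<kappa>_def)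
      then have "t * (max p q powr (2 * l) * (interp w z t powr - l / p\<^sup>2 + interp w z t powr (- l - 1/2) / p)) \<le> t * (2 * (1 / p\<^sup>2 + 1 / q\<^sup>2) * (t powr - l * (1 - t) powr (\<kappa> - l)))"
        using elim by (intro mult_left_mono) auto
      then show ?case unfolding e g_def by (simp add: algebra_simps)
    qed
  qed (use i1 ig in auto)
  also have "\<dots> = 2 * (1 / p\<^sup>2 + 1 / q\<^sup>2) * (\<integral>t. g t \<partial>beta_measure l)" by simp
  finally show ?thesis unfolding Ig \<kappa>_def .
qed

lemma bergman_kernel_le_moments:
  assumes z: "norm z < 1"
  defines "p \<equiv> norm (1 - z * cnj w)"
  shows "(l + 1) * beta_mass l * norm (bergman_kernel l z w) \<le> (2 * l + 3) * (kernel_moment z l / p\<^sup>2 + kernel_moment z (l + 1/2) / p)"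
proof -
  define I J where "I = kernel_moment z l" and "J = kernel_moment z (l + 1/2)"
  have IJ: "0 \<le> I" "0 \<le> J" by (simp_all add: I_def J_def kernel_moment_nonneg)
  have p: "0 < p" "p \<le> 2" using one_minus_nz[OF l w, of z] norm_one_minus_le[of z w] z w by (auto simp: p_def)
  have zw: "norm z \<le> 1" "norm w \<le> 1" "norm z * norm w \<le> 1"
    using z w mult_mono[of "norm z" 1 "norm w" 1] by auto
  have t1: "norm (cauchy_num_z l w z / (1 - z * cnj w) * z) \<le> l * J / p"
  proof -
    have "norm (cauchy_num_z l w z / (1 - z * cnj w) * z) = norm (cauchy_num_z l w z) / p * norm z" by (simp add: norm_mult norm_divide p_def)
    also have "\<dots> \<le> l * J / p * 1"
      using norm_cauchy_num_deriv(1)[OF z] p zw l IJ unfolding J_def by (intro mult_mono divide_right_mono) auto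
    finally show ?thesis by simp
  qed
  have t2: "norm (cauchy_num_zbar l w z / (1 - z * cnj w) * cnj z) \<le> l * J / p"
  proof -
    have "norm (cauchy_num_zbar l w z / (1 - z * cnj w) * cnj z) = norm (cauchy_num_zbar l w z) / p * norm z" by (simp add: norm_mult norm_divide p_def)
    also have "\<dots> \<le> l * J / p * 1"
      using norm_cauchy_num_deriv(2)[OF z] p zw l IJ unfolding J_def by (intro mult_mono divide_right_mono) auto
    finally show ?thesis by simp
  qed
  have t3: "norm (cauchy_num l w z * cnj w / (1 - z * cnj w)\<^sup>2 * z) \<le> I / p\<^sup>2"
  proof -
    have "norm (cauchy_num l w z * cnj w / (1 - z * cnj w)\<^sup>2 * z) = norm (cauchy_num l w z) / p\<^sup>2 * (norm z * norm w)"
      by (simp add: norm_mult norm_divide norm_power p_def)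
    also have "\<dots> \<le> I / p\<^sup>2 * 1"
      using norm_cauchy_num[of z] zw IJ unfolding I_def by (intro mult_mono divide_right_mono) auto
    finally show ?thesis by simp
  qed
  have t4: "norm (of_real (l + 1) * cauchy_kernel l w z) \<le> (l + 1) * (2 * (I / p\<^sup>2))"
  proof -
    have "norm (of_real (l + 1) * cauchy_kernel l w z) = (l + 1) * (norm (cauchy_num l w z) / p)"
      using l by (simp add: norm_mult norm_divide cauchy_kernel_def p_def del: of_real_add)
    also have "\<dots> \<le> (l + 1) * (I / p)"
      using norm_cauchy_num[of z] l p unfolding I_def by (intro mult_left_mono divide_right_mono) auto
    also have "I / p = I * p / p\<^sup>2" using p by (simp add: power2_eq_square)
    also have "(l + 1) * (I * p / p\<^sup>2) \<le> (l + 1) * (I * 2 / p\<^sup>2)"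
      using l p IJ by (intro mult_left_mono divide_right_mono) auto
    finally show ?thesis by (simp add: mult.commute)
  qed
  have "(l + 1) * beta_mass l * norm (bergman_kernel l z w) = norm (of_real ((l + 1) * beta_mass l) * bergman_kernel l z w)"
    unfolding norm_mult norm_of_real using l beta_mass_pos[OF l] by (simp add: abs_mult)
  also have "\<dots> = norm ((cauchy_num_z l w z / (1 - z * cnj w) * z + cauchy_num l w z * cnj w / (1 - z * cnj w)\<^sup>2 * z)
      + cauchy_num_zbar l w z / (1 - z * cnj w) * cnj z + of_real (l + 1) * cauchy_kernel l w z)"
    unfolding bergman_kernel_formula[OF z] by (simp add: distrib_right)
  also have "\<dots> \<le> l * J / p + I / p\<^sup>2 + l * J / p + (l + 1) * (2 * (I / p\<^sup>2))"
    by (intro order.trans[OF norm_triangle_ineq] add_mono t1 t2 t3 t4)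
  also have "\<dots> = (2 * l + 3) * (I / p\<^sup>2) + 2 * l * (J / p)"
  proof -
    have "l * y + x + l * y + (l + 1) * (2 * x) = (2 * l + 3) * x + 2 * l * y" for x y :: real
      by (simp add: algebra_simps)
    from this[of "J / p" "I / p\<^sup>2"] show ?thesis by simp
  qed
  also have "\<dots> \<le> (2 * l + 3) * (I / p\<^sup>2) + (2 * l + 3) * (J / p)"
    using IJ p by (intro add_left_mono mult_right_mono) auto
  finally show ?thesis by (simp add: I_def J_def distrib_left)
qed

end

lemma bergman_kernel_bound_pos:
  assumes l: "0 < l"
  obtains C where "0 \<le> C" "\<And>z w. norm z < 1 \<Longrightarrow> norm w < 1 \<Longrightarrow>
    norm (bergman_kernel l z w) * max (norm (1 - z * cnj w)) (norm (1 - z * w)) powr (2 * l)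
      \<le> C * (1 / (norm (1 - z * cnj w))\<^sup>2 + 1 / (norm (1 - z * w))\<^sup>2)"
proof -
  define B where "B = (\<integral>t. indicator {0<..<1} t * (1 - t) powr (min l (1/2) - 1) \<partial>lborel)"
  have B0: "0 \<le> B" unfolding B_def by (intro integral_nonneg_AE AE_I2) auto
  define M where "M = (l + 1) * beta_mass l"
  have M: "0 < M" using l beta_mass_pos[OF l] by (simp add: M_def)
  show thesis
  proof (rule that[of "(2 * l + 3) * 2 * B / M"])
    show "0 \<le> (2 * l + 3) * 2 * B / M" using l B0 M by simp
    fix z w :: complex assume z: "norm z < 1" and w: "norm w < 1"
    define p q where "p = norm (1 - z * cnj w)" and "q = norm (1 - z * w)"
    define X where "X = kernel_moment l w z l / p\<^sup>2 + kernel_moment l w z (l + 1/2) / p"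
    have 1: "M * norm (bergman_kernel l z w) \<le> (2 * l + 3) * X"
      using bergman_kernel_le_moments[OF l w z] by (simp add: M_def X_def p_def)
    have 2: "max p q powr (2 * l) * X \<le> 2 * (1 / p\<^sup>2 + 1 / q\<^sup>2) * B"
      using kernel_moment_bound[OF l w z] by (simp add: X_def B_def p_def q_def)
    have "M * (norm (bergman_kernel l z w) * max p q powr (2 * l)) = (M * norm (bergman_kernel l z w)) * max p q powr (2 * l)" by simp
    also have "\<dots> \<le> (2 * l + 3) * X * max p q powr (2 * l)" using 1 by (intro mult_right_mono) auto
    also have "\<dots> = (2 * l + 3) * (max p q powr (2 * l) * X)" by simp
    also have "\<dots> \<le> (2 * l + 3) * (2 * (1 / p\<^sup>2 + 1 / q\<^sup>2) * B)" using 2 l by (intro mult_left_mono) auto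
    finally have "norm (bergman_kernel l z w) * max p q powr (2 * l) \<le> (2 * l + 3) * (2 * (1 / p\<^sup>2 + 1 / q\<^sup>2) * B) / M"
      using M by (simp add: pos_le_divide_eq mult.commute)
    also have "(2 * l + 3) * (2 * (1 / p\<^sup>2 + 1 / q\<^sup>2) * B) / M = (2 * l + 3) * 2 * B / M * (1 / p\<^sup>2 + 1 / q\<^sup>2)"
    proof -
      have "(2 * l + 3) * (2 * Y * B) / M = (2 * l + 3) * 2 * B / M * Y" for Y by simp
      then show ?thesis .
    qed
    finally show "norm (bergman_kernel l z w) * max (norm (1 - z * cnj w)) (norm (1 - z * w)) powr (2 * l)
      \<le> (2 * l + 3) * 2 * B / M * (1 / (norm (1 - z * cnj w))\<^sup>2 + 1 / (norm (1 - z * w))\<^sup>2)"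
      unfolding p_def q_def .
  qed
qed

text \<open>
  For \<open>\<lambda> = 0\<close> the beta weight degenerates to a point mass and the closed form is replaced by the
  classical one.
\<close>

lemma bergman_kernel_0:
  assumes "norm z < 1" "norm w \<le> 1"
  shows "bergman_kernel 0 z w = 1 / (1 - z * cnj w)\<^sup>2"
proof -
  have e: "eps_coeff 0 n = 1" for n by (simp add: eps_coeff_def pochhammer_fact[symmetric])
  have "norm z * norm w \<le> norm z * 1" using assms by (intro mult_left_mono) auto
  then have "norm (z * cnj w) < 1" using assms by (simp add: norm_mult)
  from geometric_deriv_sums[OF this]
  have "(\<lambda>n. of_nat (Suc n) * (z * cnj w) ^ n) sums (1 / (1 - z * cnj w)\<^sup>2)" .
  moreover have "of_real ((real n + 0 + 1) / (0 + 1)) * phi 0 n z * cnj (phi 0 n w) = of_nat (Suc n) * (z * cnj w) ^ n" for n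
    by (simp add: phi_eq gpoly_zero_param e power_mult_distrib algebra_simps)
  ultimately show ?thesis unfolding bergman_kernel_def by (simp only: sums_iff)
qed

text \<open>
  The kernel depends on \<open>z\<close> and \<open>\<zeta>\<close> through products of homogeneous polynomials of equal
  degree, so it does not change when \<open>z\<close> is divided and \<open>\<zeta>\<close> is multiplied by the same
  real number. This moves \<open>\<zeta>\<close> off the boundary, where the estimate for two interior points applies.
  The weight is controlled because \<open>\<bar>Im \<zeta>\<bar>\<close> is at most the larger of the two distances.
\<close>

theorem bergman_kernel_bound:
  assumes l: "0 \<le> l"
  obtains C where "0 \<le> C" "\<And>z \<zeta>. norm z < 1 \<Longrightarrow> norm \<zeta> = 1 \<Longrightarrow>
    norm (bergman_kernel l z \<zeta>) * \<bar>Im \<zeta>\<bar> powr (2 * l) \<le> C * (1 / (norm (1 - z * cnj \<zeta>))\<^sup>2 + 1 / (norm (1 - z * \<zeta>))\<^sup>2)"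
proof (cases "l = 0")
  case True
  show thesis
  proof (rule that[of 1])
    fix z \<zeta> :: complex assume z: "norm z < 1" "norm \<zeta> = 1"
    have "norm (bergman_kernel l z \<zeta>) * \<bar>Im \<zeta>\<bar> powr (2 * l) \<le> norm (bergman_kernel l z \<zeta>) * 1"
      using True by (intro mult_left_mono) auto
    also have "\<dots> = 1 / (norm (1 - z * cnj \<zeta>))\<^sup>2" using z True by (simp add: bergman_kernel_0 norm_divide norm_power)
    also have "\<dots> \<le> 1 / (norm (1 - z * cnj \<zeta>))\<^sup>2 + 1 / (norm (1 - z * \<zeta>))\<^sup>2" by simp
    finally show "norm (bergman_kernel l z \<zeta>) * \<bar>Im \<zeta>\<bar> powr (2 * l) \<le> 1 * (1 / (norm (1 - z * cnj \<zeta>))\<^sup>2 + 1 / (norm (1 - z * \<zeta>))\<^sup>2)" by simp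
  qed simp
next
  case False
  then have l0: "0 < l" using l by simp
  obtain C where C: "0 \<le> C" "\<And>z w. norm z < 1 \<Longrightarrow> norm w < 1 \<Longrightarrow>
    norm (bergman_kernel l z w) * max (norm (1 - z * cnj w)) (norm (1 - z * w)) powr (2 * l)
      \<le> C * (1 / (norm (1 - z * cnj w))\<^sup>2 + 1 / (norm (1 - z * w))\<^sup>2)"
    using bergman_kernel_bound_pos[OF l0] by metis
  show thesis
  proof (rule that[OF C(1)])
    fix z \<zeta> :: complex assume z: "norm z < 1" and \<zeta>: "norm \<zeta> = 1"
    \<comment> \<open>|z| < s < 1 keeps both z / s and s \<zeta> inside the disk.\<close>
    define s where "s = (1 + norm z) / 2"
    have s: "0 < s" "s < 1" "norm z < s" using z norm_ge_zero[of z] by (auto simp: s_def simp del: norm_ge_zero)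
    define z' w' where "z' = z / of_real s" and "w' = of_real s * \<zeta>"
    have n: "norm z' < 1" "norm w' < 1" using s \<zeta> by (auto simp: z'_def w'_def norm_divide norm_mult)
    have pr: "z' * cnj w' = z * cnj \<zeta>" "z' * w' = z * \<zeta>" using s by (auto simp: z'_def w'_def)
    have ph: "phi l n z' * cnj (phi l n w') = phi l n z * cnj (phi l n \<zeta>)" for n
    proof -
      have "z = of_real s * z'" using s by (simp add: z'_def)
      then have "gpoly l n z = of_real s ^ n * gpoly l n z'" by (simp only: gpoly_scale)
      moreover have "gpoly l n w' = of_real s ^ n * gpoly l n \<zeta>" by (simp only: w'_def gpoly_scale)
      ultimately show ?thesis by (simp add: phi_eq)
    qed
    have K: "bergman_kernel l z' w' = bergman_kernel l z \<zeta>"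
      unfolding bergman_kernel_def mult.assoc ph ..
    define M where "M = max (norm (1 - z * cnj \<zeta>)) (norm (1 - z * \<zeta>))"
    have "\<bar>Im \<zeta>\<bar> \<le> M"
    proof -
      have u: "\<zeta> * cnj \<zeta> = 1" using \<zeta> by (simp add: complex_norm_square[symmetric])
      have "2 * \<i> * of_real (Im \<zeta>) = \<zeta> * (1 - z * cnj \<zeta>) - cnj \<zeta> * (1 - z * \<zeta>)"
      proof -
        have "\<zeta> * (1 - z * cnj \<zeta>) - cnj \<zeta> * (1 - z * \<zeta>) = \<zeta> - cnj \<zeta>" by (simp add: algebra_simps)
        then show ?thesis by (simp add: complex_eq_iff)
      qed
      then have "2 * \<bar>Im \<zeta>\<bar> = norm (\<zeta> * (1 - z * cnj \<zeta>) - cnj \<zeta> * (1 - z * \<zeta>))"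
        by (metis (no_types, opaque_lifting) norm_mult norm_numeral norm_ii norm_of_real mult.right_neutral)
      also have "\<dots> \<le> norm (1 - z * cnj \<zeta>) + norm (1 - z * \<zeta>)"
        by (rule order.trans[OF norm_triangle_ineq4]) (simp add: norm_mult \<zeta>)
      also have "\<dots> \<le> 2 * M" by (simp add: M_def)
      finally show ?thesis by simp
    qed
    then have "norm (bergman_kernel l z \<zeta>) * \<bar>Im \<zeta>\<bar> powr (2 * l) \<le> norm (bergman_kernel l z \<zeta>) * M powr (2 * l)"
      using l by (intro mult_left_mono powr_mono2) auto
    also have "\<dots> \<le> C * (1 / (norm (1 - z * cnj \<zeta>))\<^sup>2 + 1 / (norm (1 - z * \<zeta>))\<^sup>2)"
      using C(2)[OF n] unfolding K pr M_def .
    finally show "norm (bergman_kernel l z \<zeta>) * \<bar>Im \<zeta>\<bar> powr (2 * l) \<le> C * (1 / (norm (1 - z * cnj \<zeta>))\<^sup>2 + 1 / (norm (1 - z * \<zeta>))\<^sup>2)" .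
  qed
qed

section \<open>Polar coordinates in the plane\<close>

lemma Basis_real2: "(Basis :: (real^2) set) = {axis 1 1, axis 2 1}"
  by (auto simp: Basis_vec_def UNIV_2)

text \<open>
  Connects the product measure with the Lebesgue measure of \<open>real^2\<close>, where determinants and the change of
  variables formula are available.
\<close>

lemma lborel_real2: "lborel = distr (lborel \<Otimes>\<^sub>M lborel) borel (\<lambda>(x, y). vector [x, y] :: real^2)"
proof (rule lborel_eqI)
  have m: "(\<lambda>p::real \<times> real. vector [fst p, snd p] :: real^2) \<in> borel_measurable (lborel \<Otimes>\<^sub>M lborel)"
  proof -
    have "(\<lambda>p::real \<times> real. vector [fst p, snd p] :: real^2) = (\<lambda>p. fst p *\<^sub>R axis 1 1 + snd p *\<^sub>R axis 2 1)"
      by (auto simp: fun_eq_iff vec_eq_iff forall_2 vector_2 axis_def)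
    then show ?thesis by simp
  qed
  fix lo up :: "real^2" assume lu: "\<And>b. b \<in> Basis \<Longrightarrow> lo \<bullet> b \<le> up \<bullet> b"
  have le: "lo $ 1 \<le> up $ 1" "lo $ 2 \<le> up $ 2"
    using lu[of "axis 1 1"] lu[of "axis 2 1"] by (auto simp: Basis_real2 inner_axis)
  have "(\<lambda>p. vector [fst p, snd p] :: real^2) -` box lo up \<inter> space (lborel \<Otimes>\<^sub>M lborel) = {lo $ 1<..<up $ 1} \<times> {lo $ 2<..<up $ 2}"
    by (auto simp: space_pair_measure mem_box_cart forall_2)
  then have "emeasure (distr (lborel \<Otimes>\<^sub>M lborel) borel (\<lambda>(x, y). vector [x, y] :: real^2)) (box lo up)
     = emeasure (lborel \<Otimes>\<^sub>M lborel) ({lo $ 1<..<up $ 1} \<times> {lo $ 2<..<up $ 2})"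
    using m by (subst emeasure_distr) (auto simp: case_prod_beta')
  also have "\<dots> = ennreal (up $ 1 - lo $ 1) * ennreal (up $ 2 - lo $ 2)"
    by (subst lborel.emeasure_pair_measure_Times) (auto simp: le)
  also have "\<dots> = ennreal (\<Prod>b\<in>Basis. (up - lo) \<bullet> b)"
    using le by (simp add: Basis_real2 inner_axis axis_eq_axis ennreal_mult)
  finally show "emeasure (distr (lborel \<Otimes>\<^sub>M lborel) borel (\<lambda>(x, y). vector [x, y] :: real^2)) (box lo up) = (\<Prod>b\<in>Basis. (up - lo) \<bullet> b)" .
qed simp

definition polar2 :: "real^2 \<Rightarrow> real^2" where
  "polar2 v = vector [v $ 1 * cos (v $ 2), v $ 1 * sin (v $ 2)]"

definition polar2_d :: "real^2 \<Rightarrow> real^2 \<Rightarrow> real^2" where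
  "polar2_d v h = vector [h $ 1 * cos (v $ 2) - v $ 1 * sin (v $ 2) * h $ 2, h $ 1 * sin (v $ 2) + v $ 1 * cos (v $ 2) * h $ 2]"

lemma polar2_has_derivative: "(polar2 has_derivative polar2_d v) (at v)"
proof -
  have n: "((\<lambda>v::real^2. v $ i) has_derivative (\<lambda>h. h $ i)) (at v)" for i
    by (rule bounded_linear_imp_has_derivative[OF bounded_linear_vec_nth])
  have c: "((\<lambda>v::real^2. v $ 1 * cos (v $ 2)) has_derivative (\<lambda>h. h $ 1 * cos (v $ 2) - v $ 1 * sin (v $ 2) * h $ 2)) (at v)"
    by (rule has_derivative_eq_rhs[OF has_derivative_mult[OF n has_derivative_cos[OF n]]]) (auto simp: algebra_simps)
  have s: "((\<lambda>v::real^2. v $ 1 * sin (v $ 2)) has_derivative (\<lambda>h. h $ 1 * sin (v $ 2) + v $ 1 * cos (v $ 2) * h $ 2)) (at v)"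
    by (rule has_derivative_eq_rhs[OF has_derivative_mult[OF n has_derivative_sin[OF n]]]) (auto simp: algebra_simps)
  have "((\<lambda>v. (v $ 1 * cos (v $ 2)) *\<^sub>R axis 1 1 + (v $ 1 * sin (v $ 2)) *\<^sub>R axis 2 1 :: real^2) has_derivative
     (\<lambda>h. (h $ 1 * cos (v $ 2) - v $ 1 * sin (v $ 2) * h $ 2) *\<^sub>R axis 1 1 + (h $ 1 * sin (v $ 2) + v $ 1 * cos (v $ 2) * h $ 2) *\<^sub>R axis 2 1)) (at v)"
    by (intro has_derivative_add has_derivative_scaleR_left c s)
  moreover have "vector [x, y] = x *\<^sub>R axis 1 1 + y *\<^sub>R (axis 2 1 :: real^2)" for x y
    by (auto simp: vec_eq_iff forall_2 vector_2 axis_def)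
  ultimately show ?thesis unfolding polar2_def[abs_def] polar2_d_def[abs_def] by simp
qed

lemma det_polar2: "det (matrix (polar2_d v)) = v $ 1"
proof -
  have "det (matrix (polar2_d v)) = v $ 1 * (sin (v $ 2) * sin (v $ 2)) + v $ 1 * (cos (v $ 2) * cos (v $ 2))"
    by (simp add: det_2 matrix_def polar2_d_def vector_2 axis_def algebra_simps)
  also have "\<dots> = v $ 1 * ((sin (v $ 2))\<^sup>2 + (cos (v $ 2))\<^sup>2)"
    by (simp only: power2_eq_square distrib_left)
  also have "\<dots> = v $ 1" by (simp only: sin_cos_squared_add mult_1_right)
  finally show ?thesis .
qed

definition polar_domain :: "(real^2) set" where
  "polar_domain = {v. 0 < v $ 1 \<and> - pi < v $ 2 \<and> v $ 2 < pi}"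

lemma polar_uniq:
  assumes "x \<in> polar_domain" "y \<in> polar_domain" "polar2 x = polar2 y" shows "x = y"
proof -
  have e: "x $ 1 * cos (x $ 2) = y $ 1 * cos (y $ 2)" "x $ 1 * sin (x $ 2) = y $ 1 * sin (y $ 2)"
    using assms(3) by (auto simp: polar2_def vec_eq_iff forall_2 vector_2)
  have c: "of_real (x $ 1) * cis (x $ 2) = of_real (y $ 1) * cis (y $ 2)"
    using e by (simp add: complex_eq_iff)
  have "norm (of_real (x $ 1) * cis (x $ 2)) = x $ 1" "norm (of_real (y $ 1) * cis (y $ 2)) = y $ 1"
    using assms by (auto simp: norm_mult polar_domain_def)
  with c have 1: "x $ 1 = y $ 1" by metis
  then have "cis (x $ 2) = cis (y $ 2)" using c assms by (auto simp: polar_domain_def)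
  then have "Arg (cis (x $ 2)) = Arg (cis (y $ 2))" by simp
  then have "x $ 2 = y $ 2"
    using assms by (simp add: Arg_cis polar_domain_def)
  with 1 show ?thesis by (simp add: vec_eq_iff forall_2)
qed

lemma measurable_vec_nth [measurable]: "(\<lambda>v::real^2. v $ i) \<in> borel_measurable borel"
  by (intro borel_measurable_continuous_onI continuous_intros)

lemma polar2_measurable [measurable]: "polar2 \<in> borel_measurable borel"
  by (intro borel_measurable_continuous_onI continuous_at_imp_continuous_on ballI has_derivative_continuous[OF polar2_has_derivative])

text \<open>
  The plane minus the horizontal axis lies in the image of the polar map, so up to a null set a box is the image of its
  preimage, and the change of variables formula computes its measure.
\<close>

lemma nn_integral_polar2_box:
  assumes le: "a \<le> b" "c \<le> d"
  shows "(\<integral>\<^sup>+v. ennreal (indicator polar_domain v * v $ 1) * indicator {v::real^2. a < v $ 1 \<and> v $ 1 < b \<and> c < v $ 2 \<and> v $ 2 < d} (polar2 v) \<partial>lborel)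
     = ennreal ((b - a) * (d - c))"
proof -
  define E where "E = {v::real^2. a < v $ 1 \<and> v $ 1 < b \<and> c < v $ 2 \<and> v $ 2 < d}"
  have Eb: "E = box (vector [a, c]) (vector [b, d])" by (auto simp: E_def mem_box_cart forall_2 vector_2)
  define S where "S = polar_domain \<inter> polar2 -` E"
  have [measurable]: "polar_domain \<in> sets borel" "E \<in> sets borel"
    unfolding polar_domain_def E_def by measurable
  have Sb: "S \<in> sets borel"
    using measurable_sets[OF polar2_measurable, of E] by (auto simp: S_def)
  then have "S \<in> sets lebesgue" by simp
  moreover have "(polar2 has_derivative polar2_d v) (at v within S)" for v
    by (rule has_derivative_at_withinI[OF polar2_has_derivative])
  moreover have "inj_on polar2 S" by (rule inj_onI) (auto simp: S_def intro: polar_uniq)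
  ultimately have cov: "polar2 ` S \<in> lmeasurable \<and> measure lebesgue (polar2 ` S) = m \<longleftrightarrow> ((\<lambda>v. \<bar>det (matrix (polar2_d v))\<bar>) has_integral m) S" for m
    by (rule has_measure_differentiable_image)
  \<comment> \<open>the polar map misses the nonpositive half of this axis\<close>
  define Z where "Z = {v::real^2. v $ 2 = 0}"
  have negZ: "negligible Z"
    unfolding Z_def using negligible_standard_hyperplane_cart[of 2] by simp
  have img: "E - Z \<subseteq> polar2 ` S" "polar2 ` S \<subseteq> E"
  proof
    fix v assume v: "v \<in> E - Z"
    define u where "u = Complex (v $ 1) (v $ 2)"
    have u0: "u \<noteq> 0" using v by (auto simp: u_def Z_def complex_eq_iff)
    define x :: "real^2" where "x = vector [norm u, Arg u]"
    have "u = of_real (norm u) * cis (Arg u)" by (metis rcis_cmod_Arg rcis_def)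
    then have "Re u = norm u * cos (Arg u)" "Im u = norm u * sin (Arg u)"
      by (metis Re_rcis rcis_def, metis Im_rcis rcis_def)
    then have px: "polar2 x = v"
      by (auto simp: polar2_def x_def vec_eq_iff forall_2 vector_2 u_def)
    have "Arg u \<noteq> pi"
    proof
      assume "Arg u = pi"
      then have "Im u = 0" using \<open>Im u = norm u * sin (Arg u)\<close> by simp
      then show False using v by (auto simp: u_def Z_def)
    qed
    then have "x \<in> polar_domain"
      using Arg_bounded[of u] u0 by (auto simp: polar_domain_def x_def vector_2)
    then show "v \<in> polar2 ` S" using px v by (auto simp: S_def intro!: image_eqI[of _ _ x])
  qed (auto simp: S_def)
  have Elm: "E \<in> lmeasurable" unfolding Eb by simp
  have Em: "measure lebesgue E = (b - a) * (d - c)"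
  proof -
    have "\<forall>i\<in>Basis. vector [a, c] \<bullet> i \<le> (vector [b, d] :: real^2) \<bullet> i"
      using le by (auto simp: Basis_real2 inner_axis vector_2)
    then show ?thesis unfolding Eb
      by (simp add: measure_lborel_box_eq Basis_real2 inner_axis axis_eq_axis vector_2 le)
  qed
  have sd: "negligible (sym_diff E (polar2 ` S))"
    by (rule negligible_subset[OF negZ]) (use img in auto)
  have "polar2 ` S \<in> lmeasurable" "measure lebesgue (polar2 ` S) = (b - a) * (d - c)"
    using lmeasurable_negligible_symdiff[OF Elm sd] measure_negligible_symdiff[OF _ sd] Elm Em
    by (auto simp: fmeasurableD)
  with cov[of "(b - a) * (d - c)"] have "((\<lambda>v. \<bar>det (matrix (polar2_d v))\<bar>) has_integral (b - a) * (d - c)) S" by blast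
  from nn_integral_has_integral_lebesgue'[OF _ this]
  have "(\<integral>\<^sup>+v. ennreal \<bar>v $ 1\<bar> * indicator S v \<partial>lborel) = ennreal ((b - a) * (d - c))"
    by (simp add: det_polar2)
  also have "(\<integral>\<^sup>+v. ennreal \<bar>v $ 1\<bar> * indicator S v \<partial>lborel) = (\<integral>\<^sup>+v. ennreal (indicator polar_domain v * v $ 1) * indicator E (polar2 v) \<partial>lborel)"
    by (intro nn_integral_cong) (auto simp: S_def indicator_def polar_domain_def)
  finally show ?thesis unfolding E_def .
qed

definition polar_density :: "real \<times> real \<Rightarrow> ennreal" where
  "polar_density p = ennreal (indicator {0<..} (fst p) * indicator {-pi<..<pi} (snd p) * fst p)"

lemma polar_density_measurable [measurable]: "polar_density \<in> borel_measurable (lborel \<Otimes>\<^sub>M lborel)"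
  unfolding polar_density_def[abs_def] by measurable

lemma polar_map_measurable [measurable]: "(\<lambda>p. complex_of_real (fst p) * cis (snd p)) \<in> borel_measurable (lborel \<Otimes>\<^sub>M lborel)"
proof -
  have "(\<lambda>p::real \<times> real. complex_of_real (fst p) * cis (snd p)) \<in> borel_measurable borel"
    by (intro borel_measurable_continuous_onI continuous_intros)
  then show ?thesis by (simp add: lborel_prod)
qed

text \<open>
  Lebesgue measure is characterised by its values on boxes, so the preceding computation suffices.
\<close>

lemma lborel_complex_polar:
  "(lborel :: complex measure) = distr (density (lborel \<Otimes>\<^sub>M lborel) polar_density) borel (\<lambda>p. complex_of_real (fst p) * cis (snd p))"
proof (rule lborel_eqI)
  fix lo up :: complex assume lu: "\<And>b. b \<in> Basis \<Longrightarrow> lo \<bullet> b \<le> up \<bullet> b"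
  have le: "Re lo \<le> Re up" "Im lo \<le> Im up" using lu[of 1] lu[of \<i>] by (auto simp: Basis_complex_def)
  define E where "E = {v::real^2. Re lo < v $ 1 \<and> v $ 1 < Re up \<and> Im lo < v $ 2 \<and> v $ 2 < Im up}"
  have [measurable]: "E \<in> sets borel" "polar_domain \<in> sets borel" unfolding E_def polar_domain_def by measurable
  have bx: "(z \<in> box lo up) = (Re lo < Re z \<and> Re z < Re up \<and> Im lo < Im z \<and> Im z < Im up)" for z
    by (auto simp: box_def Basis_complex_def)
  have vm: "(\<lambda>(x, y). vector [x, y] :: real^2) \<in> lborel \<Otimes>\<^sub>M lborel \<rightarrow>\<^sub>M borel"
  proof -
    have "(\<lambda>(x, y). vector [x, y] :: real^2) = (\<lambda>p. fst p *\<^sub>R axis 1 1 + snd p *\<^sub>R axis 2 1)"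
      by (auto simp: fun_eq_iff vec_eq_iff forall_2 vector_2 axis_def)
    then show ?thesis by simp
  qed
  have "emeasure (distr (density (lborel \<Otimes>\<^sub>M lborel) polar_density) borel (\<lambda>p. complex_of_real (fst p) * cis (snd p))) (box lo up)
     = (\<integral>\<^sup>+z. indicator (box lo up) z \<partial>distr (density (lborel \<Otimes>\<^sub>M lborel) polar_density) borel (\<lambda>p. complex_of_real (fst p) * cis (snd p)))"
    by simp
  also have "\<dots> = (\<integral>\<^sup>+p. polar_density p * indicator (box lo up) (complex_of_real (fst p) * cis (snd p)) \<partial>(lborel \<Otimes>\<^sub>M lborel))"
    by (subst nn_integral_distr) (auto simp: nn_integral_density)
  also have "\<dots> = (\<integral>\<^sup>+p. (\<lambda>v::real^2. ennreal (indicator polar_domain v * v $ 1) * indicator E (polar2 v)) ((\<lambda>(x, y). vector [x, y]) p) \<partial>(lborel \<Otimes>\<^sub>M lborel))"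
    by (intro nn_integral_cong) (auto simp: polar_density_def indicator_def polar_domain_def E_def polar2_def bx vector_2)
  also have "\<dots> = (\<integral>\<^sup>+v. ennreal (indicator polar_domain v * v $ 1) * indicator E (polar2 v) \<partial>(distr (lborel \<Otimes>\<^sub>M lborel) borel (\<lambda>(x, y). vector [x, y] :: real^2)))"
    using vm by (subst nn_integral_distr) auto
  also have "\<dots> = (\<integral>\<^sup>+v. ennreal (indicator polar_domain v * v $ 1) * indicator E (polar2 v) \<partial>lborel)"
    by (simp only: lborel_real2[symmetric])
  also have "\<dots> = ennreal ((Re up - Re lo) * (Im up - Im lo))"
    unfolding E_def by (rule nn_integral_polar2_box[OF le])
  also have "\<dots> = ennreal (\<Prod>b\<in>Basis. (up - lo) \<bullet> b)"
    by (simp add: Basis_complex_def)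
  finally show "emeasure (distr (density (lborel \<Otimes>\<^sub>M lborel) polar_density) borel (\<lambda>p. complex_of_real (fst p) * cis (snd p))) (box lo up)
     = (\<Prod>b\<in>Basis. (up - lo) \<bullet> b)" .
qed simp

lemma nn_integral_polar:
  fixes f :: "complex \<Rightarrow> ennreal"
  assumes [measurable]: "f \<in> borel_measurable borel"
  shows "(\<integral>\<^sup>+z. f z \<partial>lborel) = (\<integral>\<^sup>+r. \<integral>\<^sup>+\<theta>. polar_density (r, \<theta>) * f (of_real r * cis \<theta>) \<partial>lborel \<partial>lborel)"
proof -
  have "(\<integral>\<^sup>+z. f z \<partial>lborel) = (\<integral>\<^sup>+p. polar_density p * f (of_real (fst p) * cis (snd p)) \<partial>(lborel \<Otimes>\<^sub>M lborel))"
    by (subst lborel_complex_polar) (simp add: nn_integral_distr nn_integral_density)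
  also have "\<dots> = (\<integral>\<^sup>+r. \<integral>\<^sup>+\<theta>. polar_density (r, \<theta>) * f (of_real r * cis \<theta>) \<partial>lborel \<partial>lborel)"
    by (subst lborel.nn_integral_fst[symmetric]) auto
  finally show ?thesis .
qed

section \<open>The weighted area measure in polar coordinates\<close>

lemma c_const_pos: "0 \<le> l \<Longrightarrow> 0 < c_const l"
  by (auto simp: c_const_def intro!: divide_pos_pos mult_pos_pos Gamma_real_pos)

lemma sigma_density_measurable:
  "(\<lambda>z. ennreal (c_const l * \<bar>Im z\<bar> powr (2 * l))) \<in> borel_measurable (lebesgue_on (ball 0 1))"
  by (intro measurable_restrict_space1 measurable_completion) measurable

lemma borel_measurable_sigma:
  "f \<in> borel_measurable borel \<Longrightarrow> f \<in> borel_measurable (sigma_measure l)"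
  unfolding sigma_measure_def by (auto intro!: measurable_restrict_space1 measurable_completion)

lemma space_sigma [simp]: "space (sigma_measure l) = ball 0 1"
  by (simp add: sigma_measure_def)

lemma nn_integral_sigma:
  assumes f: "f \<in> borel_measurable borel"
  shows "(\<integral>\<^sup>+z. f z \<partial>sigma_measure l) = (\<integral>\<^sup>+z. ennreal (c_const l * \<bar>Im z\<bar> powr (2 * l)) * f z * indicator (ball 0 1) z \<partial>lborel)"
proof -
  have "f \<in> borel_measurable (lebesgue_on (ball 0 1))"
    by (intro measurable_restrict_space1 measurable_completion) (use f in simp)
  then show ?thesis
    unfolding sigma_measure_def
    by (simp add: nn_integral_density[OF sigma_density_measurable] nn_integral_restrict_space nn_integral_completion)
qed

text \<open>
  Homogeneity of the weight splits off \<open>r powr (2 \<lambda>)\<close>, and the Jacobian contributes one more power.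
\<close>

lemma nn_integral_sigma_polar:
  assumes l: "0 \<le> l" and f: "f \<in> borel_measurable borel"
  shows "(\<integral>\<^sup>+z. f z \<partial>sigma_measure l)
    = (\<integral>\<^sup>+r. ennreal (indicator {0<..<1} r * (c_const l * r powr (2 * l + 1))) * (\<integral>\<^sup>+\<zeta>. f (of_real r * \<zeta>) \<partial>circ l) \<partial>lborel)"
proof -
  note [measurable] = f
  have c0: "0 < c_const l" by (rule c_const_pos[OF l])
  have [measurable]: "ball (0::complex) 1 \<in> sets borel" by simp
  have "(\<lambda>z. ennreal (c_const l * \<bar>Im z\<bar> powr (2 * l)) * f z * indicator (ball 0 1) z) \<in> borel_measurable borel"
    by measurable
  note pol = nn_integral_polar[OF this]
  have "(\<integral>\<^sup>+z. f z \<partial>sigma_measure l) = (\<integral>\<^sup>+r. \<integral>\<^sup>+\<theta>. polar_density (r, \<theta>) * (ennreal (c_const l * \<bar>Im (of_real r * cis \<theta>)\<bar> powr (2 * l)) * f (of_real r * cis \<theta>) * indicator (ball 0 1) (of_real r * cis \<theta>)) \<partial>lborel \<partial>lborel)"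
    unfolding nn_integral_sigma[OF f] by (rule pol)
  also have "\<dots> = (\<integral>\<^sup>+r. \<integral>\<^sup>+\<theta>. ennreal (indicator {0<..<1} r * (c_const l * r powr (2 * l + 1))) * (ennreal (indicator {-pi<..<pi} \<theta> * \<bar>sin \<theta>\<bar> powr (2 * l)) * f (of_real r * cis \<theta>)) \<partial>lborel \<partial>lborel)"
  proof (intro nn_integral_cong)
    fix r \<theta> :: real
    show "polar_density (r, \<theta>) * (ennreal (c_const l * \<bar>Im (of_real r * cis \<theta>)\<bar> powr (2 * l)) * f (of_real r * cis \<theta>) * indicator (ball 0 1) (of_real r * cis \<theta>))
      = ennreal (indicator {0<..<1} r * (c_const l * r powr (2 * l + 1))) * (ennreal (indicator {-pi<..<pi} \<theta> * \<bar>sin \<theta>\<bar> powr (2 * l)) * f (of_real r * cis \<theta>))"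
    proof (cases "0 < r \<and> r < 1 \<and> -pi < \<theta> \<and> \<theta> < pi")
      case True
      have "r * (c_const l * \<bar>r * sin \<theta>\<bar> powr (2 * l)) = c_const l * r powr (2 * l + 1) * \<bar>sin \<theta>\<bar> powr (2 * l)"
        using True by (simp add: abs_mult powr_mult powr_add)
      then have "ennreal r * ennreal (c_const l * \<bar>r * sin \<theta>\<bar> powr (2 * l)) = ennreal (c_const l * r powr (2 * l + 1)) * ennreal (\<bar>sin \<theta>\<bar> powr (2 * l))"
        using True c0 by (simp flip: ennreal_mult)
      then show ?thesis
        using True by (simp add: polar_density_def norm_mult flip: mult.assoc)
    next
      case False
      then have "\<not> 0 < r \<or> \<not> r < 1 \<or> \<not> (-pi < \<theta> \<and> \<theta> < pi)" by auto
      then show ?thesis by (auto simp: polar_density_def norm_mult indicator_def abs_less_iff)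
    qed
  qed
  also have "\<dots> = (\<integral>\<^sup>+r. ennreal (indicator {0<..<1} r * (c_const l * r powr (2 * l + 1))) * (\<integral>\<^sup>+\<theta>. ennreal (indicator {-pi<..<pi} \<theta> * \<bar>sin \<theta>\<bar> powr (2 * l)) * f (of_real r * cis \<theta>) \<partial>lborel) \<partial>lborel)"
  proof (intro nn_integral_cong)
    fix r :: real
    have [measurable]: "(\<lambda>\<theta>. complex_of_real r * cis \<theta>) \<in> borel_measurable borel"
      by (intro borel_measurable_continuous_onI continuous_intros)
    show "(\<integral>\<^sup>+\<theta>. ennreal (indicator {0<..<1} r * (c_const l * r powr (2 * l + 1))) * (ennreal (indicator {-pi<..<pi} \<theta> * \<bar>sin \<theta>\<bar> powr (2 * l)) * f (of_real r * cis \<theta>)) \<partial>lborel)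
      = ennreal (indicator {0<..<1} r * (c_const l * r powr (2 * l + 1))) * (\<integral>\<^sup>+\<theta>. ennreal (indicator {-pi<..<pi} \<theta> * \<bar>sin \<theta>\<bar> powr (2 * l)) * f (of_real r * cis \<theta>) \<partial>lborel)"
      by (rule nn_integral_cmult) measurable
  qed
  also have "\<dots> = (\<integral>\<^sup>+r. ennreal (indicator {0<..<1} r * (c_const l * r powr (2 * l + 1))) * (\<integral>\<^sup>+\<zeta>. f (of_real r * \<zeta>) \<partial>circ l) \<partial>lborel)"
  proof (intro nn_integral_cong)
    fix r :: real
    have "(\<lambda>\<zeta>. f (of_real r * \<zeta>)) \<in> borel_measurable (restrict_space borel (sphere 0 1))"
      by (rule measurable_restrict_space1) measurable
    then show "ennreal (indicator {0<..<1} r * (c_const l * r powr (2 * l + 1))) * (\<integral>\<^sup>+\<theta>. ennreal (indicator {-pi<..<pi} \<theta> * \<bar>sin \<theta>\<bar> powr (2 * l)) * f (of_real r * cis \<theta>) \<partial>lborel)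
      = ennreal (indicator {0<..<1} r * (c_const l * r powr (2 * l + 1))) * (\<integral>\<^sup>+\<zeta>. f (of_real r * \<zeta>) \<partial>circ l)"
      by (subst nn_integral_circ) (auto simp: measurable_circ_iff)
  qed
  finally show ?thesis .
qed

text \<open>
  By symmetry the integral is four times that over \<open>(0, \<pi>/2)\<close>, where the substitution
  \<open>x = sin\<^sup>2 \<theta>\<close> leads to Euler's Beta integral.
\<close>

lemma nn_integral_sin_powr:
  assumes l: "0 \<le> l"
  shows "(\<integral>\<^sup>+\<theta>. ennreal (indicator {-pi<..<pi} \<theta> * \<bar>sin \<theta>\<bar> powr (2 * l)) \<partial>lborel) = ennreal (2 * Beta (l + 1/2) (1/2))"
proof -
  define h where "h \<theta> = ennreal (\<bar>sin \<theta>\<bar> powr (2 * l))" for \<theta>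
  have [measurable]: "h \<in> borel_measurable borel" unfolding h_def by measurable
  define A where "A = (\<integral>\<^sup>+\<theta>. h \<theta> * indicator {0<..<pi/2} \<theta> \<partial>lborel)"
  have B: "2 * A = ennreal (Beta (l + 1/2) (1/2))"
  proof -
    define f where "f x = x powr (l - 1/2) * (1 - x) powr (- 1/2)" for x :: real
    define g where "g x = (sin x)\<^sup>2" for x :: real
    have [measurable]: "f \<in> borel_measurable borel" unfolding f_def by measurable
    have "(\<integral>\<^sup>+x. f x * indicator {g 0..g (pi/2)} x \<partial>lborel) = (\<integral>\<^sup>+x. f (g x) * (2 * sin x * cos x) * indicator {0..pi/2} x \<partial>lborel)"
    proof (rule nn_integral_substitution)
      show "set_borel_measurable borel {g 0..g (pi/2)} f" unfolding set_borel_measurable_def by measurable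
      show "(g has_real_derivative 2 * sin x * cos x) (at x)" for x
        unfolding g_def by (auto intro!: derivative_eq_intros)
      show "continuous_on {0..pi/2} (\<lambda>x. 2 * sin x * cos x)" by (intro continuous_intros)
      show "0 \<le> 2 * sin x * cos x" if "x \<in> {0..pi/2}" for x
        using that by (auto intro!: mult_nonneg_nonneg sin_ge_zero cos_ge_zero)
    qed simp
    also have "\<dots> = (\<integral>\<^sup>+x. 2 * (h x * indicator {0<..<pi/2} x) \<partial>lborel)"
    proof (rule nn_integral_cong_AE)
      have "AE x in lborel. x \<noteq> (0::real)" "AE x in lborel. x \<noteq> pi/2" by (rule AE_lborel_singleton)+
      then show "AE x in lborel. ennreal (f (g x) * (2 * sin x * cos x) * indicator {0..pi/2} x) = 2 * (h x * indicator {0<..<pi/2} x)"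
      proof eventually_elim
        case (elim x)
        show ?case
        proof (cases "0 < x \<and> x < pi/2")
          case True
          have s: "0 < sin x" "0 < cos x" using True by (auto intro!: sin_gt_zero cos_gt_zero)
          note sq = power2_powr
          have "1 - (sin x)\<^sup>2 = (cos x)\<^sup>2" by (simp add: cos_squared_eq)
          then have "f (g x) = ((sin x)\<^sup>2) powr (l - 1/2) * ((cos x)\<^sup>2) powr (- 1/2)"
            by (simp only: f_def g_def)
          also have "\<dots> = sin x powr (2 * l - 1) * cos x powr (-1)"
            unfolding sq[OF s(1)] sq[OF s(2)] by (simp add: right_diff_distrib)
          also have "\<dots> = sin x powr (2 * l) / (sin x * cos x)"
            using s by (simp add: powr_diff powr_minus divide_simps)
          finally have e: "f (g x) * (2 * sin x * cos x) = 2 * sin x powr (2 * l)" using s by simp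
          have "ennreal (f (g x) * (2 * sin x * cos x)) = 2 * ennreal (sin x powr (2 * l))"
            unfolding e by (subst ennreal_mult) auto
          then show ?thesis using True s by (simp add: h_def)
        next
          case False
          with elim show ?thesis by (auto simp: indicator_def)
        qed
      qed
    qed
    also have "\<dots> = 2 * A" unfolding A_def by (rule nn_integral_cmult) measurable
    also have "(\<integral>\<^sup>+x. f x * indicator {g 0..g (pi/2)} x \<partial>lborel) = ennreal (Beta (l + 1/2) (1/2))"
    proof -
      have "(f has_integral Beta (l + 1/2) (1/2)) {0..1}"
        using has_integral_Beta_real[of "l + 1/2" "1/2"] l by (simp add: f_def[abs_def])
      from nn_integral_has_integral_lebesgue'[OF _ this] have "(\<integral>\<^sup>+x. ennreal (f x) * indicator {0..1} x \<partial>lborel) = ennreal (Beta (l + 1/2) (1/2))"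
        by (simp add: f_def)
      moreover have "(\<integral>\<^sup>+x. f x * indicator {g 0..g (pi/2)} x \<partial>lborel) = (\<integral>\<^sup>+x. ennreal (f x) * indicator {0..1} x \<partial>lborel)"
        by (intro nn_integral_cong) (auto simp: g_def indicator_def)
      ultimately show ?thesis by simp
    qed
    finally show ?thesis by simp
  qed
  have pos: "(\<integral>\<^sup>+\<theta>. h \<theta> * indicator {0<..<pi} \<theta> \<partial>lborel) = 2 * A"
  proof -
    have "(\<integral>\<^sup>+\<theta>. h \<theta> * indicator {0<..<pi} \<theta> \<partial>lborel) = (\<integral>\<^sup>+\<theta>. h \<theta> * indicator {0<..<pi/2} \<theta> + h \<theta> * indicator {pi/2<..<pi} \<theta> \<partial>lborel)"
    proof (rule nn_integral_cong_AE)
      have "AE x in lborel. x \<noteq> pi/2" by (rule AE_lborel_singleton)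
      then show "AE \<theta> in lborel. h \<theta> * indicator {0<..<pi} \<theta> = h \<theta> * indicator {0<..<pi/2} \<theta> + h \<theta> * indicator {pi/2<..<pi} \<theta>"
      proof eventually_elim
        case (elim x)
        have "x < pi/2 \<Longrightarrow> x < pi" "pi/2 < x \<Longrightarrow> 0 < x" using pi_gt_zero by linarith+
        then show ?case using elim by (auto simp: indicator_def)
      qed
    qed
    also have "\<dots> = A + (\<integral>\<^sup>+\<theta>. h \<theta> * indicator {pi/2<..<pi} \<theta> \<partial>lborel)"
      unfolding A_def by (rule nn_integral_add) measurable
    also have "(\<integral>\<^sup>+\<theta>. h \<theta> * indicator {pi/2<..<pi} \<theta> \<partial>lborel) = A"
      unfolding A_def by (subst nn_integral_real_affine[where c = "-1" and t = pi]) (auto simp: h_def indicator_def intro!: nn_integral_cong)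
    finally show ?thesis by (simp add: mult_2)
  qed
  have "(\<integral>\<^sup>+\<theta>. ennreal (indicator {-pi<..<pi} \<theta> * \<bar>sin \<theta>\<bar> powr (2 * l)) \<partial>lborel)
     = (\<integral>\<^sup>+\<theta>. h \<theta> * indicator {0<..<pi} \<theta> + h \<theta> * indicator {-pi<..<0} \<theta> \<partial>lborel)"
    by (intro nn_integral_cong) (auto simp: h_def indicator_def not_less)
  also have "\<dots> = 2 * A + (\<integral>\<^sup>+\<theta>. h \<theta> * indicator {-pi<..<0} \<theta> \<partial>lborel)"
    unfolding pos[symmetric] by (rule nn_integral_add) measurable
  also have "(\<integral>\<^sup>+\<theta>. h \<theta> * indicator {-pi<..<0} \<theta> \<partial>lborel) = 2 * A"
    unfolding pos[symmetric]
    by (subst nn_integral_real_affine[where c = "-1" and t = 0]) (auto simp: h_def indicator_def intro!: nn_integral_cong)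
  also have "2 * A + 2 * A = ennreal (2 * Beta (l + 1/2) (1/2))"
  proof -
    have "0 \<le> Beta (l + 1/2) (1/2)" using l by (auto simp: Beta_def intro!: divide_nonneg_nonneg mult_nonneg_nonneg Gamma_real_nonneg)
    then show ?thesis unfolding B unfolding mult_2 by (intro ennreal_plus[symmetric])
  qed
  finally show ?thesis .
qed

text \<open>
  This is the normalisation \<open>\<sigma>(\<D>) = 1\<close> in disguise, the radial integral being
  \<open>1 / (2 (\<lambda> + 1))\<close>. It makes the weights \<open>(n + \<lambda> + 1) / (\<lambda> + 1)\<close> of
  the kernel exactly those of the reproducing kernel.
\<close>

lemma c_const_circ_mass: assumes l: "0 \<le> l" shows "c_const l * circ_mass l = 2 * (l + 1)"
proof -
  interpret finite_measure "circ l" by (rule circ_finite[OF l])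
  have Bp: "0 \<le> Beta (l + 1/2) (1/2)" using l by (auto simp: Beta_def intro!: divide_nonneg_nonneg mult_nonneg_nonneg Gamma_real_nonneg)
  have "ennreal (circ_mass l) = (\<integral>\<^sup>+\<zeta>. 1 \<partial>circ l)" by (simp add: circ_mass_def emeasure_eq_measure)
  also have "\<dots> = ennreal (2 * Beta (l + 1/2) (1/2))"
    unfolding nn_integral_sin_powr[OF l, symmetric] by (subst nn_integral_circ) auto
  finally have "circ_mass l = 2 * Beta (l + 1/2) (1/2)" using Bp by (simp add: circ_mass_def)
  moreover have "Beta (l + 1/2) (1/2) = Gamma (l + 1/2) * Gamma (1/2) / Gamma (l + 1)"
    by (simp add: Beta_def add.commute)
  moreover have "Gamma (l + 2) = (l + 1) * Gamma (l + 1)"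
  proof -
    have "l + 1 \<notin> \<int>\<^sub>\<le>\<^sub>0" using l nonpos_Ints_nonpos[of "l + 1"] by auto
    from Gamma_plus1[OF this] show ?thesis by (simp add: add.assoc)
  qed
  moreover have "Gamma (l + 1/2) * Gamma (1/2) \<noteq> 0" "Gamma (l + 1) \<noteq> 0"
  proof -
    have "Gamma (l + 1/2) > 0" "Gamma (1/2 :: real) > 0" "Gamma (l + 1) > 0"
      using l by (intro Gamma_real_pos; simp)+
    then show "Gamma (l + 1/2) * Gamma (1/2) \<noteq> 0" "Gamma (l + 1) \<noteq> 0" by (auto simp: Gamma_one_half_real)
  qed
  moreover have "(l + 1) * x / y * (2 * (y / x)) = 2 * (l + 1)" if "y \<noteq> 0" "x \<noteq> 0" for x y :: real
    using that by simp
  ultimately show ?thesis unfolding c_const_def by simp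
qed

section \<open>Integral estimates for the kernel\<close>

lemma kernel_scale: "bergman_kernel l z (of_real r * w) = bergman_kernel l (of_real r * z) w"
proof -
  have "phi l n z * cnj (phi l n (of_real r * w)) = phi l n (of_real r * z) * cnj (phi l n w)" for n
    unfolding phi_eq gpoly_scale by simp
  then show ?thesis unfolding bergman_kernel_def mult.assoc by simp
qed

lemma norm_phi_prod_le:
  assumes l: "0 \<le> l" and w: "norm w \<le> 1"
  shows "norm (phi l n z) * norm (phi l n w) \<le> gval l n * norm z ^ n"
proof -
  have g: "0 < gval l n" using gval_ge_1[OF l, of n] by simp
  have "norm (phi l n z) * norm (phi l n w) = (eps_coeff l n)\<^sup>2 * (norm (gpoly l n z) * norm (gpoly l n w))"
    using eps_coeff_bounds(1)[OF l, of n] by (simp add: phi_eq norm_mult power2_eq_square)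
  also have "\<dots> \<le> (1 / gval l n) * ((gval l n * norm z ^ n) * (gval l n * 1))"
    unfolding eps_coeff_sq[OF l] using g w norm_gpoly_le[OF l, of n z] norm_gpoly_le[OF l, of n w]
    by (intro mult_left_mono mult_mono) (auto intro!: order.trans[OF norm_gpoly_le[OF l]] mult_left_le power_le_one)
  also have "\<dots> = gval l n * norm z ^ n" using g by simp
  finally show ?thesis .
qed

text \<open>
  A bound for the terms of the kernel series that is uniform in \<open>w\<close> on the closed disk.
\<close>

definition kernel_majorant :: "real \<Rightarrow> complex \<Rightarrow> nat \<Rightarrow> real" where
  "kernel_majorant l z n = (real n + l + 1) / (l + 1) * (gval l n * norm z ^ n)"

lemma kernel_weight_le: "0 \<le> l \<Longrightarrow> (real n + l + 1) / (l + 1) \<le> real (Suc n)"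
  by (simp add: divide_le_eq algebra_simps)

lemma summable_poly_geom:
  fixes x :: real assumes "0 \<le> x" "x < 1" shows "summable (\<lambda>n. real (Suc n) ^ m * x ^ n)"
proof -
  define y where "y = (1 + x) / 2"
  have y: "0 < y" "x < y" "y < 1" using assms by (auto simp: y_def)
  define s where "s = (x + y) / (2 * y)"
  have s: "0 < s" "s < 1" "x / y \<le> s" using y assms by (auto simp: s_def field_simps)
  obtain C where C: "\<And>n. real (Suc n) ^ m * s ^ n \<le> C" using poly_geom_bound[OF s(1,2)] by blast
  show ?thesis
  proof (rule summable_comparison_test')
    show "summable (\<lambda>n. C * y ^ n)" using y by (intro summable_mult summable_geometric) auto
    fix n
    have "x ^ n = (x / y) ^ n * y ^ n" using y by (simp add: power_divide)
    also have "\<dots> \<le> s ^ n * y ^ n" using s y assms by (intro mult_right_mono power_mono) auto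
    finally have "real (Suc n) ^ m * x ^ n \<le> real (Suc n) ^ m * (s ^ n * y ^ n)" by (intro mult_left_mono) auto
    also have "\<dots> \<le> C * y ^ n" using C[of n] y by (simp only: mult.assoc[symmetric]) (intro mult_right_mono, auto)
    finally show "norm (real (Suc n) ^ m * x ^ n) \<le> C * y ^ n" using assms by (simp add: abs_mult)
  qed
qed

lemma kernel_majorant:
  assumes l: "0 \<le> l" and z: "norm z < 1"
  shows "summable (kernel_majorant l z)"
    and "norm w \<le> 1 \<Longrightarrow> norm (of_real ((real n + l + 1) / (l + 1)) * phi l n z * cnj (phi l n w)) \<le> kernel_majorant l z n"
    and "0 \<le> kernel_majorant l z n"
proof -
  define m where "m = nat \<lceil>2 * l\<rceil>"
  have g: "0 < gval l n" for n using gval_ge_1[OF l, of n] by simp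
  show nn: "0 \<le> kernel_majorant l z n" for n using l g[of n] by (simp add: kernel_majorant_def)
  show "summable (kernel_majorant l z)"
  proof (rule summable_comparison_test')
    show "summable (\<lambda>n. real (Suc n) ^ Suc m * norm z ^ n)" by (rule summable_poly_geom) (use z in auto)
    fix n
    have "kernel_majorant l z n \<le> real (Suc n) * (real (Suc n) ^ m * norm z ^ n)"
      unfolding kernel_majorant_def using kernel_weight_le[OF l, of n] gval_le[OF l, of n] l g[of n]
      by (intro mult_mono) (auto simp: m_def)
    then show "norm (kernel_majorant l z n) \<le> real (Suc n) ^ Suc m * norm z ^ n"
      using nn[of n] by (simp add: mult_ac)
  qed
  show "norm (of_real ((real n + l + 1) / (l + 1)) * phi l n z * cnj (phi l n w)) \<le> kernel_majorant l z n" if "norm w \<le> 1"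
  proof -
    have "norm (of_real ((real n + l + 1) / (l + 1)) * phi l n z * cnj (phi l n w)) = (real n + l + 1) / (l + 1) * (norm (phi l n z) * norm (phi l n w))"
      unfolding norm_mult norm_of_real complex_mod_cnj using l by simp
    also have "\<dots> \<le> kernel_majorant l z n"
      unfolding kernel_majorant_def using l by (intro mult_left_mono norm_phi_prod_le that) auto
    finally show ?thesis .
  qed
qed

lemma kernel_bounded:
  assumes l: "0 \<le> l" and z: "norm z < 1"
  obtains B where "0 \<le> B" "\<And>w. norm w \<le> 1 \<Longrightarrow> norm (bergman_kernel l z w) \<le> B"
proof (rule that[of "\<Sum>n. kernel_majorant l z n"])
  show "0 \<le> (\<Sum>n. kernel_majorant l z n)"
    by (intro suminf_nonneg kernel_majorant[OF l z])
  fix w :: complex assume w: "norm w \<le> 1"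
  have s: "summable (\<lambda>n. norm (of_real ((real n + l + 1) / (l + 1)) * phi l n z * cnj (phi l n w)))"
    by (rule summable_comparison_test'[OF kernel_majorant(1)[OF l z], of 0]) (use kernel_majorant(2)[OF l z w] in auto)
  show "norm (bergman_kernel l z w) \<le> (\<Sum>n. kernel_majorant l z n)"
    unfolding bergman_kernel_def
    by (rule order.trans[OF summable_norm[OF s] suminf_le[OF kernel_majorant(2)[OF l z w] s kernel_majorant(1)[OF l z]]])
qed

lemma norm_kernel_commute:
  assumes l: "0 \<le> l" and z: "norm z < 1" and w: "norm w \<le> 1"
  shows "norm (bergman_kernel l w z) = norm (bergman_kernel l z w)"
proof -
  have "summable (\<lambda>n. of_real ((real n + l + 1) / (l + 1)) * phi l n z * cnj (phi l n w))"
    by (rule summable_comparison_test'[OF kernel_majorant(1)[OF l z], of 0]) (use kernel_majorant(2)[OF l z w] in auto)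
  then have "(\<lambda>n. of_real ((real n + l + 1) / (l + 1)) * phi l n z * cnj (phi l n w)) sums bergman_kernel l z w"
    unfolding bergman_kernel_def by (rule summable_sums)
  then have "(\<lambda>n. cnj (of_real ((real n + l + 1) / (l + 1)) * phi l n z * cnj (phi l n w))) sums cnj (bergman_kernel l z w)"
    by (simp only: sums_cnj)
  moreover have "cnj (of_real ((real n + l + 1) / (l + 1)) * phi l n z * cnj (phi l n w)) = of_real ((real n + l + 1) / (l + 1)) * phi l n w * cnj (phi l n z)" for n
    by simp
  ultimately have "bergman_kernel l w z = cnj (bergman_kernel l z w)"
    unfolding bergman_kernel_def[of l w z] by (simp only: sums_iff)
  then show ?thesis by simp
qed

lemma gpoly_measurable [measurable]: "gpoly l n \<in> borel_measurable borel"
  by (intro borel_measurable_continuous_onI continuous_intros)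

lemma phi_measurable [measurable]: "phi l n \<in> borel_measurable borel"
  unfolding phi_eq[abs_def] by measurable

lemma kernel_measurable_pair [measurable]:
  "(\<lambda>p. bergman_kernel l (fst p) (snd p)) \<in> borel_measurable (borel \<Otimes>\<^sub>M borel)"
  unfolding bergman_kernel_def by measurable

lemma kernel_measurable1 [measurable]: "(\<lambda>w. bergman_kernel l z w) \<in> borel_measurable borel"
  unfolding bergman_kernel_def by measurable

text \<open>
  Moves the weight into the integrand, where the pointwise kernel bound consumes it. For \<open>\<lambda> = 0\<close>
  the weight is \<open>0\<close> instead of \<open>1\<close> at real points, by the convention
  \<open>0 powr 0 = 0\<close>; the measure itself follows the same convention, so the identity is unaffected.
\<close>

lemma nn_integral_circ_0:
  assumes l: "0 \<le> l" and f: "f \<in> borel_measurable (restrict_space borel (sphere 0 1))"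
  shows "(\<integral>\<^sup>+\<zeta>. f \<zeta> \<partial>circ l) = (\<integral>\<^sup>+\<zeta>. ennreal (\<bar>Im \<zeta>\<bar> powr (2 * l)) * f \<zeta> \<partial>circ 0)"
proof -
  have [measurable]: "(\<lambda>\<zeta>. ennreal (\<bar>Im \<zeta>\<bar> powr (2 * l)) * f \<zeta>) \<in> borel_measurable (restrict_space borel (sphere 0 1))"
    by (intro borel_measurable_times_ennreal f measurable_restrict_space1) measurable
  show ?thesis
    using f by (subst (1 2) nn_integral_circ) (auto simp: measurable_circ_iff indicator_def intro!: nn_integral_cong)
qed

text \<open>
  Parseval's identity for the geometric series of \<open>1 / (1 - z \<zeta>)\<close>, for which the expansion machinery
  at \<open>\<lambda> = 0\<close> can be reused.
\<close>

lemma circ_poisson: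
  assumes z: "norm z < 1"
  shows "(\<integral>\<^sup>+\<zeta>. ennreal (1 / (norm (1 - z * \<zeta>))\<^sup>2) \<partial>circ 0) \<le> ennreal (circ_mass 0 / (1 - norm z))"
proof -
  \<comment> \<open>H is the boundary function of an analytic series only after rescaling: sum z^n \<zeta>^n = sum (z/r)^n (r \<zeta>)^n.\<close>
  define r where "r = (1 + norm z) / 2"
  have r: "0 < r" "r < 1" "norm z < r" using z norm_ge_zero[of z] by (auto simp: r_def simp del: norm_ge_zero)
  define a where "a n = (z / of_real r) ^ n" for n
  have ar: "a n * of_real (r ^ n) = z ^ n" for n using r by (simp add: a_def power_divide)
  have "norm (a n) * t ^ n \<le> 1" if "0 < t \<and> t < 1" for t n
  proof -
    have "norm z * t \<le> norm z * 1" using that by (intro mult_left_mono) auto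
    also have "\<dots> \<le> r" using r by simp
    finally have "norm (z / of_real r) * t \<le> 1" using r by (simp add: norm_divide divide_le_eq)
    then show ?thesis
      using that unfolding a_def norm_power power_mult_distrib[symmetric] by (intro power_le_one) auto
  qed
  then have sa: "subexp a" unfolding subexp_def by blast
  define H where "H \<zeta> = 1 / (1 - z * \<zeta>)" for \<zeta>
  have nz: "1 - z * \<zeta> \<noteq> 0" if "norm \<zeta> = 1" for \<zeta>
  proof
    assume "1 - z * \<zeta> = 0"
    then have "norm (z * \<zeta>) = 1" by (metis eq_iff_diff_eq_0 norm_one)
    then show False using that z by (simp add: norm_mult)
  qed
  have cH: "continuous_on (sphere 0 1) H" unfolding H_def using nz by (intro continuous_intros) auto
  have S: "ser (phi_coef 0 a) (of_real r * \<zeta>) = H \<zeta>" if "norm \<zeta> = 1" for \<zeta>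
  proof -
    have "hpart (phi_coef 0 a) n (of_real r * \<zeta>) = (z * \<zeta>) ^ n" for n
      unfolding hpart_phi_coef gpoly_zero_param using ar[of n] by (simp add: power_mult_distrib mult.assoc[symmetric])
    moreover have "norm (z * \<zeta>) < 1" using that z by (simp add: norm_mult)
    ultimately show ?thesis unfolding ser_def H_def by (simp add: suminf_geometric)
  qed
  have SH: "(\<integral>\<zeta>. ser (phi_coef 0 a) (of_real r * \<zeta>) * cnj (G \<zeta>) \<partial>circ 0) = circ_pair 0 H G" for G
    unfolding circ_pair_def by (intro Bochner_Integration.integral_cong) (auto simp: S)
  have p1: "circ_pair 0 H (gpoly 0 n) = z ^ n * of_real (circ_mass 0)" for n
  proof -
    have "(\<lambda>k. a k * of_real (r ^ k) * circ_pair 0 (gpoly 0 k) (gpoly 0 n)) sums circ_pair 0 H (gpoly 0 n)"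
      using ser_pair[of 0 a r "gpoly 0 n"] sa r SH[of "gpoly 0 n"] by (auto intro!: continuous_intros)
    moreover have "(\<lambda>k. a k * of_real (r ^ k) * circ_pair 0 (gpoly 0 k) (gpoly 0 n)) = (\<lambda>k. if k = n then z ^ k * of_real (circ_mass 0) else 0)"
      unfolding ar by (auto simp: fun_eq_iff gpoly_pair gval_zero_param)
    ultimately show ?thesis using sums_single[of n "\<lambda>k. z ^ k * of_real (circ_mass 0)"] by (metis (mono_tags, lifting) sums_unique2)
  qed
  have p2: "(\<lambda>k. z ^ k * circ_pair 0 (gpoly 0 k) H) sums circ_pair 0 H H"
    using ser_pair[OF order_refl sa r(1,2) cH] SH[of H] unfolding ar by simp
  have "z ^ k * circ_pair 0 (gpoly 0 k) H = of_real (circ_mass 0) * of_real ((norm z)\<^sup>2) ^ k" for k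
  proof -
    have "z ^ k * circ_pair 0 (gpoly 0 k) H = (z * cnj z) ^ k * of_real (circ_mass 0)"
      unfolding circ_pair_cnj[of 0 "gpoly 0 k" H] p1 by (simp add: power_mult_distrib)
    then show ?thesis by (simp only: complex_norm_square[symmetric] mult.commute)
  qed
  then have "(\<lambda>k. complex_of_real (circ_mass 0) * of_real ((norm z)\<^sup>2) ^ k) sums circ_pair 0 H H"
    using p2 by simp
  moreover have "norm (complex_of_real ((norm z)\<^sup>2)) < 1" unfolding norm_of_real using z by (simp add: power_less_one_iff)
  from sums_mult[OF geometric_sums[OF this], of "of_real (circ_mass 0)"]
  have "(\<lambda>k. complex_of_real (circ_mass 0) * of_real ((norm z)\<^sup>2) ^ k) sums (of_real (circ_mass 0) * (1 / (1 - of_real ((norm z)\<^sup>2))))" .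
  ultimately have HH: "circ_pair 0 H H = of_real (circ_mass 0 / (1 - (norm z)\<^sup>2))"
    by (simp add: sums_iff)
  have e: "H \<zeta> * cnj (H \<zeta>) = of_real (1 / (norm (1 - z * \<zeta>))\<^sup>2)" for \<zeta>
    unfolding complex_norm_square[symmetric] by (simp add: H_def norm_divide power_divide)
  have ci: "continuous_on (sphere 0 1) (\<lambda>\<zeta>. H \<zeta> * cnj (H \<zeta>))" by (intro continuous_intros cH)
  have int: "integrable (circ 0) (\<lambda>\<zeta>. 1 / (norm (1 - z * \<zeta>))\<^sup>2)"
    using integrable_circ[OF _ ci] unfolding e by (simp only: complex_of_real_integrable_eq order_refl simp_thms)
  have "complex_of_real (\<integral>\<zeta>. 1 / (norm (1 - z * \<zeta>))\<^sup>2 \<partial>circ 0) = of_real (circ_mass 0 / (1 - (norm z)\<^sup>2))"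
    using HH unfolding circ_pair_def e by (simp only: integral_complex_of_real)
  then have I: "(\<integral>\<zeta>. 1 / (norm (1 - z * \<zeta>))\<^sup>2 \<partial>circ 0) = circ_mass 0 / (1 - (norm z)\<^sup>2)" by (simp only: of_real_eq_iff)
  have "(\<integral>\<^sup>+\<zeta>. ennreal (1 / (norm (1 - z * \<zeta>))\<^sup>2) \<partial>circ 0) = ennreal (circ_mass 0 / (1 - (norm z)\<^sup>2))"
    unfolding I[symmetric] by (intro nn_integral_eq_integral int) auto
  also have "\<dots> \<le> ennreal (circ_mass 0 / (1 - norm z))"
  proof (intro ennreal_leI divide_left_mono)
    show "1 - norm z \<le> 1 - (norm z)\<^sup>2" using z by (simp add: power2_eq_square mult_left_le)
    show "0 \<le> circ_mass 0" by (simp add: circ_mass_def)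
    show "0 < (1 - (norm z)\<^sup>2) * (1 - norm z)" using z by (simp add: power_less_one_iff)
  qed
  finally show ?thesis .
qed

lemma kernel_circ_L1:
  assumes l: "0 \<le> l"
  obtains C where "0 \<le> C" "\<And>z. norm z < 1 \<Longrightarrow> (\<integral>\<^sup>+\<zeta>. ennreal (norm (bergman_kernel l z \<zeta>)) \<partial>circ l) \<le> ennreal (C / (1 - norm z))"
proof -
  obtain C where C: "0 \<le> C" "\<And>z \<zeta>. norm z < 1 \<Longrightarrow> norm \<zeta> = 1 \<Longrightarrow>
    norm (bergman_kernel l z \<zeta>) * \<bar>Im \<zeta>\<bar> powr (2 * l) \<le> C * (1 / (norm (1 - z * cnj \<zeta>))\<^sup>2 + 1 / (norm (1 - z * \<zeta>))\<^sup>2)"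
    using bergman_kernel_bound[OF l] by metis
  show thesis
  proof (rule that[of "2 * C * circ_mass 0"])
    show "0 \<le> 2 * C * circ_mass 0" using C by (simp add: circ_mass_def)
    fix z :: complex assume z: "norm z < 1"
    define q where "q u \<zeta> = ennreal (1 / (norm (1 - u * \<zeta>))\<^sup>2)" for u \<zeta> :: complex
    have [measurable]: "q u \<in> borel_measurable (restrict_space borel (sphere 0 1))" for u
      unfolding q_def[abs_def] by (rule measurable_restrict_space1) measurable
    have qm: "q u \<in> borel_measurable (circ 0)" for u by (simp add: measurable_circ_iff)
    have cn: "norm (1 - z * cnj \<zeta>) = norm (1 - cnj z * \<zeta>)" for \<zeta>
      using complex_mod_cnj[of "1 - z * cnj \<zeta>"] by simp
    have "(\<integral>\<^sup>+\<zeta>. ennreal (norm (bergman_kernel l z \<zeta>)) \<partial>circ l) = (\<integral>\<^sup>+\<zeta>. ennreal (\<bar>Im \<zeta>\<bar> powr (2 * l)) * ennreal (norm (bergman_kernel l z \<zeta>)) \<partial>circ 0)"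
      by (rule nn_integral_circ_0[OF l], rule measurable_restrict_space1) measurable
    also have "\<dots> \<le> (\<integral>\<^sup>+\<zeta>. ennreal C * (q (cnj z) \<zeta> + q z \<zeta>) \<partial>circ 0)"
    proof (rule nn_integral_mono)
      fix \<zeta> assume "\<zeta> \<in> space (circ 0)"
      then have "norm (bergman_kernel l z \<zeta>) * \<bar>Im \<zeta>\<bar> powr (2 * l) \<le> C * (1 / (norm (1 - cnj z * \<zeta>))\<^sup>2 + 1 / (norm (1 - z * \<zeta>))\<^sup>2)"
        using C(2)[OF z, of \<zeta>] unfolding cn by simp
      from ennreal_leI[OF this]
      have "ennreal (norm (bergman_kernel l z \<zeta>)) * ennreal (\<bar>Im \<zeta>\<bar> powr (2 * l)) \<le> ennreal C * (q (cnj z) \<zeta> + q z \<zeta>)"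
        unfolding q_def using C(1) by (simp only: ennreal_mult[symmetric] ennreal_plus[symmetric] norm_ge_zero powr_ge_zero add_nonneg_nonneg zero_le_divide_1_iff zero_le_power2)
      then show "ennreal (\<bar>Im \<zeta>\<bar> powr (2 * l)) * ennreal (norm (bergman_kernel l z \<zeta>)) \<le> ennreal C * (q (cnj z) \<zeta> + q z \<zeta>)"
        by (simp only: mult.commute)
    qed
    also have "\<dots> = ennreal C * ((\<integral>\<^sup>+\<zeta>. q (cnj z) \<zeta> \<partial>circ 0) + (\<integral>\<^sup>+\<zeta>. q z \<zeta> \<partial>circ 0))"
      by (subst nn_integral_cmult) (auto intro!: nn_integral_add qm borel_measurable_add arg_cong[where f = "\<lambda>x. ennreal C * x"])
    also have "\<dots> \<le> ennreal C * (ennreal (circ_mass 0 / (1 - norm z)) + ennreal (circ_mass 0 / (1 - norm z)))"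
      using circ_poisson[of z] circ_poisson[of "cnj z"] z unfolding q_def by (intro mult_left_mono add_mono) auto
    also have "\<dots> = ennreal (2 * C * circ_mass 0 / (1 - norm z))"
    proof -
      have "0 \<le> circ_mass 0 / (1 - norm z)" using z by (simp add: circ_mass_def)
      then have "ennreal C * (ennreal (circ_mass 0 / (1 - norm z)) + ennreal (circ_mass 0 / (1 - norm z))) = ennreal (C * (circ_mass 0 / (1 - norm z) + circ_mass 0 / (1 - norm z)))"
        using C(1) by (simp only: ennreal_mult[symmetric] ennreal_plus[symmetric] add_nonneg_nonneg)
      also have "C * (circ_mass 0 / (1 - norm z) + circ_mass 0 / (1 - norm z)) = 2 * C * circ_mass 0 / (1 - norm z)" by simp
      finally show ?thesis .
    qed
    finally show "(\<integral>\<^sup>+\<zeta>. ennreal (norm (bergman_kernel l z \<zeta>)) \<partial>circ l) \<le> ennreal (2 * C * circ_mass 0 / (1 - norm z))" .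
  qed
qed

text \<open>
  Split at \<open>r = \<rho>\<close>: below, \<open>1 - r \<rho>\<close> is at least \<open>1 - r\<close>, above, it is
  at least \<open>1 - \<rho>\<close>. The first part needs \<open>s > 0\<close> and the second \<open>s < 1\<close>.
\<close>

lemma radial_integral:
  assumes s: "0 < s" "s < 1" and \<rho>: "0 \<le> \<rho>" "\<rho> < 1"
  shows "(\<integral>\<^sup>+r. ennreal (indicator {0<..<1} r * ((1 - r) powr - s / (1 - r * \<rho>))) \<partial>lborel) \<le> ennreal ((1 / s + 1 / (1 - s)) * (1 - \<rho>) powr - s)"
proof -
  have A: "(\<integral>\<^sup>+r. ennreal ((1 - r) powr (- s - 1)) * indicator {0..\<rho>} r \<partial>lborel) = ennreal ((1 - \<rho>) powr - s / s - (1 - 0) powr - s / s)"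
  proof (rule nn_integral_FTC_Icc)
    show "((\<lambda>r. (1 - r) powr - s / s) has_real_derivative (1 - x) powr (- s - 1)) (at x)" if "x \<in> {0..\<rho>}" for x
    proof -
      have "((\<lambda>r. 1 - r) has_real_derivative (0 - 1)) (at x)" by (intro DERIV_diff DERIV_const DERIV_ident)
      then have "((\<lambda>r. (1 - r) powr - s) has_real_derivative - s * (1 - x) powr (- s - 1) * (0 - 1)) (at x)"
        using that \<rho> by (intro DERIV_chain2[OF has_real_derivative_powr]) auto
      from DERIV_cdivide[OF this, of s] show "((\<lambda>r. (1 - r) powr - s / s) has_real_derivative (1 - x) powr (- s - 1)) (at x)"
        using s by simp
    qed
  qed (use \<rho> in auto)
  have B: "(\<integral>\<^sup>+r. ennreal ((1 - r) powr - s) * indicator {\<rho>..1} r \<partial>lborel) = ennreal ((1 - \<rho>) powr (1 - s) / (1 - s))"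
  proof -
    have "((\<lambda>x. x powr - s) has_integral (1 - \<rho>) powr (- s + 1) / (- s + 1)) {0..1 - \<rho>}"
      by (rule has_integral_powr_from_0) (use s \<rho> in auto)
    then have "(\<integral>\<^sup>+x. ennreal (x powr - s) * indicator {0..1 - \<rho>} x \<partial>lborel) = ennreal ((1 - \<rho>) powr (- s + 1) / (- s + 1))"
      by (intro nn_integral_has_integral_lebesgue') auto
    moreover have "(\<integral>\<^sup>+r. ennreal ((1 - r) powr - s) * indicator {\<rho>..1} r \<partial>lborel) = (\<integral>\<^sup>+x. ennreal (x powr - s) * indicator {0..1 - \<rho>} x \<partial>lborel)"
      by (subst nn_integral_real_affine[where c = "-1" and t = 1]) (auto simp: indicator_def intro!: nn_integral_cong)
    ultimately show ?thesis by (simp add: algebra_simps)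
  qed
  have "(\<integral>\<^sup>+r. ennreal (indicator {0<..<1} r * ((1 - r) powr - s / (1 - r * \<rho>))) \<partial>lborel)
    \<le> (\<integral>\<^sup>+r. ennreal ((1 - r) powr (- s - 1)) * indicator {0..\<rho>} r + ennreal (1 / (1 - \<rho>)) * (ennreal ((1 - r) powr - s) * indicator {\<rho>..1} r) \<partial>lborel)"
  proof (rule nn_integral_mono)
    fix r :: real
    show "ennreal (indicator {0<..<1} r * ((1 - r) powr - s / (1 - r * \<rho>))) \<le> ennreal ((1 - r) powr (- s - 1)) * indicator {0..\<rho>} r + ennreal (1 / (1 - \<rho>)) * (ennreal ((1 - r) powr - s) * indicator {\<rho>..1} r)"
    proof (cases "0 < r \<and> r < 1")
      case True
      have r1: "1 - r \<le> 1 - r * \<rho>" using True \<rho> by (simp add: mult_left_le)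
      have r3: "0 < 1 - r * \<rho>" using r1 True by linarith
      have r2: "1 - \<rho> \<le> 1 - r * \<rho>" using True \<rho> by (simp add: mult_left_le_one_le)
      show ?thesis
      proof (cases "r \<le> \<rho>")
        case le: True
        have "(1 - r) powr - s / (1 - r * \<rho>) \<le> (1 - r) powr - s / (1 - r)" using r1 r3 True by (intro divide_left_mono mult_pos_pos) simp_all
        also have "\<dots> = (1 - r) powr (- s - 1)" using True by (simp add: powr_diff)
        finally show ?thesis using True le by (auto intro: order.trans[OF ennreal_leI] simp: add_increasing2)
      next
        case False
        have "(1 - r) powr - s / (1 - r * \<rho>) \<le> (1 - r) powr - s / (1 - \<rho>)" using r2 r3 \<rho> by (intro divide_left_mono mult_pos_pos) simp_all
        also have "\<dots> = 1 / (1 - \<rho>) * (1 - r) powr - s" by simp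
        finally have "ennreal ((1 - r) powr - s / (1 - r * \<rho>)) \<le> ennreal (1 / (1 - \<rho>)) * ennreal ((1 - r) powr - s)"
          using \<rho> by (simp flip: ennreal_mult)
        then show ?thesis using True False by simp
      qed
    qed auto
  qed
  also have "\<dots> = ennreal ((1 - \<rho>) powr - s / s - (1 - 0) powr - s / s) + ennreal (1 / (1 - \<rho>)) * ennreal ((1 - \<rho>) powr (1 - s) / (1 - s))"
    unfolding A[symmetric] B[symmetric] by (subst nn_integral_add) (auto simp: nn_integral_cmult)
  also have "\<dots> \<le> ennreal ((1 - \<rho>) powr - s / s) + ennreal ((1 - \<rho>) powr - s / (1 - s))"
  proof (intro add_mono)
    show "ennreal ((1 - \<rho>) powr - s / s - (1 - 0) powr - s / s) \<le> ennreal ((1 - \<rho>) powr - s / s)" using s by (intro ennreal_leI) auto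
    have "1 / (1 - \<rho>) * ((1 - \<rho>) powr (1 - s) / (1 - s)) = (1 - \<rho>) powr - s / (1 - s)"
      using \<rho> by (simp add: powr_diff powr_minus divide_simps)
    then show "ennreal (1 / (1 - \<rho>)) * ennreal ((1 - \<rho>) powr (1 - s) / (1 - s)) \<le> ennreal ((1 - \<rho>) powr - s / (1 - s))"
      using \<rho> s by (simp flip: ennreal_mult)
  qed
  also have "\<dots> = ennreal ((1 / s + 1 / (1 - s)) * (1 - \<rho>) powr - s)"
    using s by (simp add: distrib_right flip: ennreal_plus)
  finally show ?thesis .
qed

text \<open>
  Homogeneity lets the radius of \<open>w\<close> be transferred to \<open>z\<close>, so each circle contributes at most
  \<open>C / (1 - r \<bar>z\<bar>)\<close>; the radial estimate does the rest.
\<close>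

theorem kernel_schur:
  assumes l: "0 \<le> l" and s: "0 < s" "s < 1"
  obtains C where "0 < C" "\<And>z. norm z < 1 \<Longrightarrow>
    (\<integral>\<^sup>+w. ennreal (norm (bergman_kernel l z w) * (1 - norm w) powr - s) \<partial>sigma_measure l) \<le> ennreal (C * (1 - norm z) powr - s)"
proof -
  obtain C where C: "0 \<le> C" "\<And>z. norm z < 1 \<Longrightarrow> (\<integral>\<^sup>+\<zeta>. ennreal (norm (bergman_kernel l z \<zeta>)) \<partial>circ l) \<le> ennreal (C / (1 - norm z))"
    using kernel_circ_L1[OF l] by metis
  have c0: "0 < c_const l" by (rule c_const_pos[OF l])
  define D where "D = c_const l * C * (1 / s + 1 / (1 - s))"
  have D0: "0 \<le> D" using C c0 s by (simp add: D_def)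
  show thesis
  proof (rule that[of "D + 1"])
    show "0 < D + 1" using D0 by simp
    fix z :: complex assume z: "norm z < 1"
    have "(\<integral>\<^sup>+w. ennreal (norm (bergman_kernel l z w) * (1 - norm w) powr - s) \<partial>sigma_measure l)
      = (\<integral>\<^sup>+r. ennreal (indicator {0<..<1} r * (c_const l * r powr (2 * l + 1))) * (\<integral>\<^sup>+\<zeta>. ennreal (norm (bergman_kernel l z (of_real r * \<zeta>)) * (1 - norm (of_real r * \<zeta>)) powr - s) \<partial>circ l) \<partial>lborel)"
      by (rule nn_integral_sigma_polar[OF l]) measurable
    also have "\<dots> \<le> (\<integral>\<^sup>+r. ennreal (c_const l * C) * ennreal (indicator {0<..<1} r * ((1 - r) powr - s / (1 - r * norm z))) \<partial>lborel)"
    proof (rule nn_integral_mono)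
      fix r :: real
      show "ennreal (indicator {0<..<1} r * (c_const l * r powr (2 * l + 1))) * (\<integral>\<^sup>+\<zeta>. ennreal (norm (bergman_kernel l z (of_real r * \<zeta>)) * (1 - norm (of_real r * \<zeta>)) powr - s) \<partial>circ l)
         \<le> ennreal (c_const l * C) * ennreal (indicator {0<..<1} r * ((1 - r) powr - s / (1 - r * norm z)))"
      proof (cases "0 < r \<and> r < 1")
        case True
        have "r * norm z \<le> 1 * norm z" using True by (intro mult_right_mono) auto
        then have rz: "norm (of_real r * z) < 1" "r * norm z < 1" using True z by (auto simp: norm_mult)
        have Km: "(\<lambda>\<zeta>. ennreal (norm (bergman_kernel l (of_real r * z) \<zeta>))) \<in> borel_measurable (circ l)"
          unfolding measurable_circ_iff by (rule measurable_restrict_space1) measurable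
        have "(\<integral>\<^sup>+\<zeta>. ennreal (norm (bergman_kernel l z (of_real r * \<zeta>)) * (1 - norm (of_real r * \<zeta>)) powr - s) \<partial>circ l)
          = (\<integral>\<^sup>+\<zeta>. ennreal ((1 - r) powr - s) * ennreal (norm (bergman_kernel l (of_real r * z) \<zeta>)) \<partial>circ l)"
          using True unfolding kernel_scale by (intro nn_integral_cong) (auto simp: norm_mult ennreal_mult mult.commute)
        also have "\<dots> = ennreal ((1 - r) powr - s) * (\<integral>\<^sup>+\<zeta>. ennreal (norm (bergman_kernel l (of_real r * z) \<zeta>)) \<partial>circ l)"
          by (rule nn_integral_cmult[OF Km])
        also have "\<dots> \<le> ennreal ((1 - r) powr - s) * ennreal (C / (1 - r * norm z))"
          using C(2)[OF rz(1)] True by (intro mult_left_mono) (auto simp: norm_mult)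
        finally have "ennreal (c_const l * r powr (2 * l + 1)) * (\<integral>\<^sup>+\<zeta>. ennreal (norm (bergman_kernel l z (of_real r * \<zeta>)) * (1 - norm (of_real r * \<zeta>)) powr - s) \<partial>circ l)
          \<le> ennreal (c_const l * 1) * (ennreal ((1 - r) powr - s) * ennreal (C / (1 - r * norm z)))"
          using True c0 l by (intro mult_mono ennreal_leI mult_left_mono) (auto simp: powr_le1)
        also have "\<dots> = ennreal (c_const l * C * ((1 - r) powr - s / (1 - r * norm z)))"
          using c0 C(1) rz by (simp flip: ennreal_mult add: mult_ac)
        also have "\<dots> = ennreal (c_const l * C) * ennreal ((1 - r) powr - s / (1 - r * norm z))"
          using c0 C(1) rz by (intro ennreal_mult) auto
        finally show ?thesis using True by simp
      qed auto
    qed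
    also have "\<dots> = ennreal (c_const l * C) * (\<integral>\<^sup>+r. ennreal (indicator {0<..<1} r * ((1 - r) powr - s / (1 - r * norm z))) \<partial>lborel)"
      by (rule nn_integral_cmult) measurable
    also have "\<dots> \<le> ennreal (c_const l * C) * ennreal ((1 / s + 1 / (1 - s)) * (1 - norm z) powr - s)"
      using z by (intro mult_left_mono radial_integral s) auto
    also have "\<dots> = ennreal (D * (1 - norm z) powr - s)"
      using c0 C(1) s by (simp add: D_def mult_ac flip: ennreal_mult)
    also have "\<dots> \<le> ennreal ((D + 1) * (1 - norm z) powr - s)"
      by (intro ennreal_leI mult_right_mono) auto
    finally show "(\<integral>\<^sup>+w. ennreal (norm (bergman_kernel l z w) * (1 - norm w) powr - s) \<partial>sigma_measure l) \<le> ennreal ((D + 1) * (1 - norm z) powr - s)" .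
  qed
qed

section \<open>A weighted Hoelder inequality\<close>

text \<open>
  Hoelder's inequality for the measure with density \<open>k\<close>, raised to the power \<open>p\<close> and with only
  an upper bound \<open>R\<close> for the second factor, as Schur's test supplies it. It is deduced from Young's
  inequality for the rescaled factors. The number \<open>A\<close> slightly exceeds the first integral, which may be
  zero, and tends to it in the end.
\<close>

lemma Holder_weighted:
  fixes k u v :: "'a \<Rightarrow> real"
  assumes pq: "1 < p" "1 < q" "1 / p + 1 / q = 1"
    and nn: "\<And>x. x \<in> space M \<Longrightarrow> 0 \<le> k x" "\<And>x. x \<in> space M \<Longrightarrow> 0 \<le> u x" "\<And>x. x \<in> space M \<Longrightarrow> 0 \<le> v x"
    and meas: "(\<lambda>x. k x * (u x * v x)) \<in> borel_measurable M"
    and iu: "integrable M (\<lambda>x. k x * u x powr p)" and iv: "integrable M (\<lambda>x. k x * v x powr q)"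
    and R: "(\<integral>x. k x * v x powr q \<partial>M) \<le> R" "0 < R"
  shows "integrable M (\<lambda>x. k x * (u x * v x))"
    and "(\<integral>x. k x * (u x * v x) \<partial>M) powr p \<le> (\<integral>x. k x * u x powr p \<partial>M) * R powr (p / q)"
proof -
  have Y: "k x * (u x * v x) \<le> A powr (1 / p) * B powr (1 / q) * (k x * u x powr p / (p * A) + k x * v x powr q / (q * B))"
    if "x \<in> space M" "0 < A" "0 < B" for x A B
  proof -
    have "(u x / A powr (1 / p)) * (v x / B powr (1 / q)) \<le> (u x / A powr (1 / p)) powr p / p + (v x / B powr (1 / q)) powr q / q"
      using nn that by (intro Youngs_inequality pq) auto
    also have "\<dots> = u x powr p / (p * A) + v x powr q / (q * B)"
      using nn that pq by (simp add: powr_divide powr_powr mult.commute)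
    finally have "A powr (1 / p) * B powr (1 / q) * k x * ((u x / A powr (1 / p)) * (v x / B powr (1 / q)))
       \<le> A powr (1 / p) * B powr (1 / q) * k x * (u x powr p / (p * A) + v x powr q / (q * B))"
      using nn that by (intro mult_left_mono) auto
    then show ?thesis using that by (simp add: algebra_simps)
  qed
  show int: "integrable M (\<lambda>x. k x * (u x * v x))"
  proof (rule Bochner_Integration.integrable_bound)
    show "integrable M (\<lambda>x. 1 powr (1 / p) * 1 powr (1 / q) * (k x * u x powr p / (p * 1) + k x * v x powr q / (q * 1)))"
      using iu iv by (intro integrable_mult_right Bochner_Integration.integrable_add integrable_divide)
    show "AE x in M. norm (k x * (u x * v x)) \<le> norm (1 powr (1 / p) * 1 powr (1 / q) * (k x * u x powr p / (p * 1) + k x * v x powr q / (q * 1)))"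
    proof (rule AE_I2)
      fix x assume x: "x \<in> space M"
      have "0 \<le> k x * (u x * v x)" using nn x by auto
      then show "norm (k x * (u x * v x)) \<le> norm (1 powr (1 / p) * 1 powr (1 / q) * (k x * u x powr p / (p * 1) + k x * v x powr q / (q * 1)))"
        using Y[OF x, of 1 1] unfolding real_norm_def by linarith
    qed
  qed (rule meas)
  define X where "X = (\<integral>x. k x * (u x * v x) \<partial>M)"
  define Q where "Q = (\<integral>x. k x * u x powr p \<partial>M)"
  have X0: "0 \<le> X" unfolding X_def using nn by (intro integral_nonneg_AE AE_I2) auto
  have Q0: "0 \<le> Q" unfolding Q_def using nn by (intro integral_nonneg_AE AE_I2) auto
  have main: "X powr p \<le> A * R powr (p / q)" if A: "Q < A" for A
  proof -
    have A0: "0 < A" using A Q0 by simp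
    have "X \<le> (\<integral>x. A powr (1 / p) * R powr (1 / q) * (k x * u x powr p / (p * A) + k x * v x powr q / (q * R)) \<partial>M)"
      unfolding X_def using Y A0 R(2) iu iv by (intro integral_mono int integrable_mult_right Bochner_Integration.integrable_add integrable_divide) auto
    also have "\<dots> = A powr (1 / p) * R powr (1 / q) * (Q / (p * A) + (\<integral>x. k x * v x powr q \<partial>M) / (q * R))"
      unfolding Q_def using iu iv by simp
    also have "\<dots> \<le> A powr (1 / p) * R powr (1 / q) * (A / (p * A) + R / (q * R))"
      using A A0 R pq by (intro mult_left_mono add_mono divide_right_mono) auto
    also have "A / (p * A) + R / (q * R) = 1" using A0 R(2) pq by simp
    finally have "X powr p \<le> (A powr (1 / p) * R powr (1 / q)) powr p"
      using X0 pq by (intro powr_mono2) auto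
    also have "\<dots> = A * R powr (p / q)"
      using A0 R(2) pq by (simp add: powr_mult powr_powr mult.commute)
    finally show ?thesis .
  qed
  have "X powr p / R powr (p / q) \<le> Q"
  proof (rule dense_ge)
    fix A assume "Q < A"
    from main[OF this] show "X powr p / R powr (p / q) \<le> A" using R(2) by (simp add: divide_le_eq)
  qed
  then show "(\<integral>x. k x * (u x * v x) \<partial>M) powr p \<le> (\<integral>x. k x * u x powr p \<partial>M) * R powr (p / q)"
    unfolding X_def Q_def using R(2) by (simp add: divide_le_eq)
qed

section \<open>Iterated integrals over radius and angle\<close>

definition radial :: "real \<Rightarrow> real measure" where
  "radial l = density lborel (\<lambda>r. ennreal (indicator {0<..<1} r * (c_const l * r powr (2 * l + 1))))"

lemma sets_radial [simp, measurable_cong]: "sets (radial l) = sets borel" and space_radial [simp]: "space (radial l) = UNIV"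
  by (simp_all add: radial_def)

lemma radial_finite: assumes l: "0 \<le> l" shows "finite_measure (radial l)"
proof
  have "emeasure (radial l) (space (radial l)) = (\<integral>\<^sup>+r. ennreal (indicator {0<..<1} r * (c_const l * r powr (2 * l + 1))) \<partial>lborel)"
    unfolding radial_def by (subst emeasure_density) (auto simp: space_density)
  also have "\<dots> \<le> (\<integral>\<^sup>+r. ennreal (c_const l) * indicator {0<..<1::real} r \<partial>lborel)"
  proof (rule nn_integral_mono)
    fix r :: real
    have "c_const l * r powr (2 * l + 1) \<le> c_const l * 1" if "0 < r" "r < 1"
      using that l c_const_pos[OF l] by (intro mult_left_mono powr_le1) auto
    then show "ennreal (indicator {0<..<1} r * (c_const l * r powr (2 * l + 1))) \<le> ennreal (c_const l) * indicator {0<..<1} r"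
      by (auto simp: indicator_def intro!: ennreal_leI)
  qed
  also have "\<dots> < \<infinity>" by (subst nn_integral_cmult) (auto simp: ennreal_mult_less_top)
  finally show "emeasure (radial l) (space (radial l)) \<noteq> \<infinity>" by simp
qed

lemma id_measurable_circ [measurable]: "(\<lambda>\<zeta>. \<zeta>) \<in> circ l \<rightarrow>\<^sub>M borel"
  by (intro continuous_measurable_circ continuous_intros)

lemma id_measurable_sigma [measurable]: "(\<lambda>z. z) \<in> sigma_measure l \<rightarrow>\<^sub>M borel"
  by (rule borel_measurable_sigma) simp

lemma polar_product_measurable: "(\<lambda>p. of_real (fst p) * snd p) \<in> borel_measurable (radial l \<Otimes>\<^sub>M circ l)"
proof -
  have "fst \<in> radial l \<Otimes>\<^sub>M circ l \<rightarrow>\<^sub>M borel" by (rule measurable_compose[OF measurable_fst]) simp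
  moreover have "snd \<in> radial l \<Otimes>\<^sub>M circ l \<rightarrow>\<^sub>M borel" by (rule measurable_compose[OF measurable_snd id_measurable_circ])
  ultimately show ?thesis by measurable
qed

text \<open>
  The measure \<open>\<sigma>\<close> lives on the Lebesgue sets, the polar product on Borel sets; pushing both to the
  Borel sets makes them comparable.
\<close>

lemma distr_sigma_polar:
  assumes l: "0 \<le> l"
  shows "distr (sigma_measure l) borel (\<lambda>z. z) = distr (radial l \<Otimes>\<^sub>M circ l) borel (\<lambda>p. of_real (fst p) * snd p)"
proof (rule measure_eqI)
  interpret circ: finite_measure "circ l" by (rule circ_finite[OF l])
  fix A :: "complex set" assume "A \<in> sets (distr (sigma_measure l) borel (\<lambda>z. z))"
  then have A [measurable]: "A \<in> sets borel" by simp
  have m: "(\<lambda>p. indicator A (of_real (fst p) * snd p) :: ennreal) \<in> borel_measurable (radial l \<Otimes>\<^sub>M circ l)"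
    by (rule measurable_compose[OF polar_product_measurable]) measurable
  have mi: "(\<lambda>r. \<integral>\<^sup>+\<zeta>. indicator A (of_real r * \<zeta>) \<partial>circ l) \<in> borel_measurable borel"
    using circ.borel_measurable_nn_integral_fst[OF m] by simp
  have "emeasure (distr (sigma_measure l) borel (\<lambda>z. z)) A = (\<integral>\<^sup>+z. indicator A z \<partial>distr (sigma_measure l) borel (\<lambda>z. z))" by simp
  also have "\<dots> = (\<integral>\<^sup>+z. indicator A z \<partial>sigma_measure l)" by (subst nn_integral_distr) auto
  also have "\<dots> = (\<integral>\<^sup>+r. ennreal (indicator {0<..<1} r * (c_const l * r powr (2 * l + 1))) * (\<integral>\<^sup>+\<zeta>. indicator A (of_real r * \<zeta>) \<partial>circ l) \<partial>lborel)"
    by (rule nn_integral_sigma_polar[OF l]) measurable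
  also have "\<dots> = (\<integral>\<^sup>+r. (\<integral>\<^sup>+\<zeta>. indicator A (of_real r * \<zeta>) \<partial>circ l) \<partial>radial l)"
    unfolding radial_def using mi by (subst nn_integral_density) auto
  also have "\<dots> = (\<integral>\<^sup>+p. indicator A (of_real (fst p) * snd p) \<partial>(radial l \<Otimes>\<^sub>M circ l))"
    using circ.nn_integral_fst[OF m] by simp
  also have "\<dots> = emeasure (distr (radial l \<Otimes>\<^sub>M circ l) borel (\<lambda>p. of_real (fst p) * snd p)) A"
    by (subst nn_integral_distr[symmetric, OF polar_product_measurable]) auto
  finally show "emeasure (distr (sigma_measure l) borel (\<lambda>z. z)) A = emeasure (distr (radial l \<Otimes>\<^sub>M circ l) borel (\<lambda>p. of_real (fst p) * snd p)) A" .
qed simp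

lemma integral_sigma_polar:
  fixes f :: "complex \<Rightarrow> complex"
  assumes l: "0 \<le> l" and f: "f \<in> borel_measurable borel" and i: "integrable (sigma_measure l) f"
  shows "(\<integral>z. f z \<partial>sigma_measure l) = (\<integral>r. (\<integral>\<zeta>. f (of_real r * \<zeta>) \<partial>circ l) \<partial>radial l)"
proof -
  interpret c: finite_measure "circ l" by (rule circ_finite[OF l])
  interpret r: finite_measure "radial l" by (rule radial_finite[OF l])
  interpret pair_sigma_finite "radial l" "circ l" ..
  have "integrable (distr (sigma_measure l) borel (\<lambda>z. z)) f"
    using i f by (subst integrable_distr_eq) auto
  then have ip: "integrable (radial l \<Otimes>\<^sub>M circ l) (\<lambda>p. f (of_real (fst p) * snd p))"
    unfolding distr_sigma_polar[OF l] using f by (subst (asm) integrable_distr_eq[OF polar_product_measurable]) auto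
  have "(\<integral>z. f z \<partial>sigma_measure l) = (\<integral>z. f z \<partial>distr (sigma_measure l) borel (\<lambda>z. z))"
    using f by (subst integral_distr) auto
  also have "\<dots> = (\<integral>p. f (of_real (fst p) * snd p) \<partial>(radial l \<Otimes>\<^sub>M circ l))"
    unfolding distr_sigma_polar[OF l] using f by (subst integral_distr[OF polar_product_measurable]) auto
  also have "\<dots> = (\<integral>r. (\<integral>\<zeta>. f (of_real r * \<zeta>) \<partial>circ l) \<partial>radial l)"
    using integral_fst'[OF ip] by simp
  finally show ?thesis .
qed

lemma finite_measure_sigma: assumes l: "0 \<le> l" shows "finite_measure (sigma_measure l)"
proof
  interpret r: finite_measure "radial l" by (rule radial_finite[OF l])
  interpret c: finite_measure "circ l" by (rule circ_finite[OF l])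
  have "emeasure (sigma_measure l) (space (sigma_measure l)) = (\<integral>\<^sup>+z. 1 \<partial>sigma_measure l)" by simp
  also have "\<dots> = (\<integral>\<^sup>+r. ennreal (indicator {0<..<1} r * (c_const l * r powr (2 * l + 1))) * emeasure (circ l) (space (circ l)) \<partial>lborel)"
    by (subst nn_integral_sigma_polar[OF l]) auto
  also have "\<dots> = (\<integral>\<^sup>+r. emeasure (circ l) (space (circ l)) \<partial>radial l)"
    unfolding radial_def by (subst nn_integral_density) auto
  also have "\<dots> < \<infinity>"
  proof -
    have "emeasure (circ l) (space (circ l)) < top" "emeasure (radial l) (space (radial l)) < top"
      by (metis c.emeasure_finite infinity_ennreal_def top.not_eq_extremum,
          metis r.emeasure_finite infinity_ennreal_def top.not_eq_extremum)
    then show ?thesis unfolding nn_integral_const by (simp only: ennreal_mult_less_top infinity_ennreal_def simp_thms)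
  qed
  finally show "emeasure (sigma_measure l) (space (sigma_measure l)) \<noteq> \<infinity>" by simp
qed

lemma radial_moment:
  assumes l: "0 \<le> l"
  shows "(\<integral>r. r ^ (2 * n) \<partial>radial l) = c_const l / (2 * (real n + l + 1))"
proof -
  have "((\<lambda>r. r powr (2 * l + 1 + 2 * real n)) has_integral 1 powr (2 * l + 1 + 2 * real n + 1) / (2 * l + 1 + 2 * real n + 1)) {0..1}"
    by (rule has_integral_powr_from_0) (use l in auto)
  then have h: "((\<lambda>r. r powr (2 * l + 1 + 2 * real n)) has_integral 1 / (2 * (real n + l + 1))) {0<..<1}"
    by (simp add: has_integral_Icc_iff_Ioo algebra_simps)
  have nn: "(\<integral>\<^sup>+r. ennreal (r powr (2 * l + 1 + 2 * real n)) * indicator {0<..<1} r \<partial>lborel) = ennreal (1 / (2 * (real n + l + 1)))"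
    by (rule nn_integral_has_integral_lebesgue'[OF _ h]) auto
  have "(\<integral>r. r ^ (2 * n) \<partial>radial l) = (\<integral>r. (indicator {0<..<1} r * (c_const l * r powr (2 * l + 1))) *\<^sub>R r ^ (2 * n) \<partial>lborel)"
    unfolding radial_def using c_const_pos[OF l] by (subst integral_density) (auto intro!: AE_I2)
  also have "\<dots> = (\<integral>r. c_const l * (r powr (2 * l + 1 + 2 * real n) * indicator {0<..<1} r) \<partial>lborel)"
  proof (intro Bochner_Integration.integral_cong refl)
    fix r :: real
    have "r powr (2 * real n) = r ^ (2 * n)" if "0 < r" using powr_realpow[OF that, of "2 * n"] by simp
    then show "(indicator {0<..<1} r * (c_const l * r powr (2 * l + 1))) *\<^sub>R r ^ (2 * n) = c_const l * (r powr (2 * l + 1 + 2 * real n) * indicator {0<..<1} r)"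
      by (auto simp: indicator_def powr_add)
  qed
  also have "\<dots> = c_const l * (\<integral>r. r powr (2 * l + 1 + 2 * real n) * indicator {0<..<1} r \<partial>lborel)" by simp
  also have "(\<integral>r. r powr (2 * l + 1 + 2 * real n) * indicator {0<..<1} r \<partial>lborel) = 1 / (2 * (real n + l + 1))"
  proof (rule integral_eq_nn_integral[THEN trans])
    have "(\<integral>\<^sup>+r. ennreal (r powr (2 * l + 1 + 2 * real n) * indicator {0<..<1} r) \<partial>lborel) = ennreal (1 / (2 * (real n + l + 1)))"
      unfolding nn[symmetric] by (intro nn_integral_cong) (auto simp: indicator_def)
    then show "enn2real (\<integral>\<^sup>+r. ennreal (r powr (2 * l + 1 + 2 * real n) * indicator {0<..<1} r) \<partial>lborel) = 1 / (2 * (real n + l + 1))"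
      using l by simp
  qed auto
  finally show ?thesis by simp
qed

section \<open>The projection\<close>

text \<open>
  A finite measure embeds \<open>L\<^sup>p\<close> into \<open>L\<^sup>1\<close>, so the projection is defined by an
  absolutely convergent integral and most of its properties need no more than integrability.
\<close>

lemma Lp_integrable:
  assumes l: "0 \<le> l" and p: "1 < p" and f: "f \<in> Lp_space l p"
  shows "integrable (sigma_measure l) f"
proof -
  interpret finite_measure "sigma_measure l" by (rule finite_measure_sigma[OF l])
  have i: "integrable (sigma_measure l) (\<lambda>z. norm (f z) powr p)" and m: "f \<in> borel_measurable (sigma_measure l)"
    using f by (auto simp: Lp_space_def)
  show ?thesis
  proof (rule Bochner_Integration.integrable_bound[OF _ m])
    show "integrable (sigma_measure l) (\<lambda>z. 1 + norm (f z) powr p)" using i by simp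
    show "AE z in sigma_measure l. norm (f z) \<le> norm (1 + norm (f z) powr p)"
    proof (rule AE_I2)
      fix z
      have "norm (f z) \<le> 1 + norm (f z) powr p"
      proof (cases "norm (f z) \<le> 1")
        case False
        then have "norm (f z) powr 1 \<le> norm (f z) powr p" using p by (intro powr_mono) auto
        then show ?thesis using False by simp
      qed (simp add: add_increasing2)
      then show "norm (f z) \<le> norm (1 + norm (f z) powr p)" by simp
    qed
  qed
qed

lemma integrable_mult_bounded:
  fixes f g :: "'a \<Rightarrow> complex"
  assumes f: "integrable M f" and g: "g \<in> borel_measurable M" "\<And>x. x \<in> space M \<Longrightarrow> norm (g x) \<le> B"
  shows "integrable M (\<lambda>x. f x * g x)"
proof (rule Bochner_Integration.integrable_bound)
  show "integrable M (\<lambda>x. B * norm (f x))" using f by (intro integrable_mult_right integrable_norm)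
  show "(\<lambda>x. f x * g x) \<in> borel_measurable M" by (rule borel_measurable_times[OF borel_measurable_integrable[OF f] g(1)])
  show "AE x in M. norm (f x * g x) \<le> norm (B * norm (f x))"
  proof (rule AE_I2)
    fix x assume x: "x \<in> space M"
    have "norm (f x) * norm (g x) \<le> norm (f x) * B" using g(2)[OF x] by (intro mult_left_mono) auto
    also have "\<dots> \<le> \<bar>B * norm (f x)\<bar>" by (simp add: mult.commute)
    finally show "norm (f x * g x) \<le> norm (B * norm (f x))" by (simp add: norm_mult)
  qed
qed

lemma kernel_product_integrable:
  assumes l: "0 \<le> l" and z: "norm z < 1" and f: "integrable (sigma_measure l) f"
  shows "integrable (sigma_measure l) (\<lambda>w. f w * bergman_kernel l z w)"
proof -
  obtain B where B: "\<And>w. norm w \<le> 1 \<Longrightarrow> norm (bergman_kernel l z w) \<le> B" using kernel_bounded[OF l z] by metis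
  show ?thesis
    by (rule integrable_mult_bounded[OF f borel_measurable_sigma[OF kernel_measurable1], where B = B]) (use B in auto)
qed

text \<open>
  The kernel series converges uniformly in \<open>w\<close>, so it may be integrated term by term. The coefficients grow
  at most linearly, since \<open>\<epsilon>\<^sub>n \<phi>\<^sub>n\<close> is bounded by \<open>1\<close> on the disk.
\<close>

lemma projection_expansion:
  assumes l: "0 \<le> l" and f: "integrable (sigma_measure l) f"
  defines "a \<equiv> \<lambda>n. of_real ((real n + l + 1) / (l + 1) * eps_coeff l n) * (\<integral>w. f w * cnj (phi l n w) \<partial>sigma_measure l)"
  shows "subexp a" and "norm z < 1 \<Longrightarrow> bergman_projection l f z = ser (phi_coef l a) z"
proof -
  have phb: "eps_coeff l n * norm (phi l n w) \<le> 1" if "norm w \<le> 1" for n w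
  proof -
    have g: "0 < gval l n" using gval_ge_1[OF l, of n] by simp
    have "eps_coeff l n * norm (phi l n w) = (eps_coeff l n)\<^sup>2 * norm (gpoly l n w)"
      using eps_coeff_bounds(1)[OF l, of n] by (simp add: phi_eq norm_mult power2_eq_square)
    also have "\<dots> \<le> (1 / gval l n) * (gval l n * 1)"
      unfolding eps_coeff_sq[OF l] using g that
      by (intro mult_left_mono order.trans[OF norm_gpoly_le[OF l]]) (auto intro!: power_le_one)
    finally show ?thesis using g by simp
  qed
  have phm: "(\<lambda>w. cnj (phi l n w)) \<in> borel_measurable (sigma_measure l)" for n
    by (rule borel_measurable_sigma) measurable
  have ip: "integrable (sigma_measure l) (\<lambda>w. f w * cnj (phi l n w))" for n
  proof (rule integrable_mult_bounded[OF f phm])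
    fix w assume "w \<in> space (sigma_measure l)"
    then show "norm (cnj (phi l n w)) \<le> 1 / eps_coeff l n"
      using phb[of w n] eps_coeff_bounds(1)[OF l, of n] by (simp add: pos_le_divide_eq mult.commute)
  qed
  define N where "N = (\<integral>w. norm (f w) \<partial>sigma_measure l)"
  have N0: "0 \<le> N" unfolding N_def by (intro integral_nonneg_AE AE_I2) auto
  have an: "norm (a n) \<le> real (Suc n) * N" for n
  proof -
    have e: "0 < eps_coeff l n" by (rule eps_coeff_bounds[OF l])
    have "norm (\<integral>w. f w * cnj (phi l n w) \<partial>sigma_measure l) \<le> (\<integral>w. norm (f w * cnj (phi l n w)) \<partial>sigma_measure l)"
      by (rule integral_norm_bound)
    also have "\<dots> \<le> (\<integral>w. norm (f w) * (1 / eps_coeff l n) \<partial>sigma_measure l)"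
    proof (rule integral_mono)
      show "integrable (sigma_measure l) (\<lambda>w. norm (f w * cnj (phi l n w)))" by (intro integrable_norm ip)
      show "integrable (sigma_measure l) (\<lambda>w. norm (f w) * (1 / eps_coeff l n))" by (intro integrable_mult_left integrable_norm f)
      fix w assume "w \<in> space (sigma_measure l)"
      then show "norm (f w * cnj (phi l n w)) \<le> norm (f w) * (1 / eps_coeff l n)"
        unfolding norm_mult complex_mod_cnj using phb[of w n] e by (intro mult_left_mono) (auto simp: pos_le_divide_eq mult.commute)
    qed
    also have "\<dots> = N * (1 / eps_coeff l n)" unfolding N_def by (rule integral_mult_left_zero)
    finally have b: "norm (\<integral>w. f w * cnj (phi l n w) \<partial>sigma_measure l) \<le> N * (1 / eps_coeff l n)" .
    have "norm (a n) = (real n + l + 1) / (l + 1) * eps_coeff l n * norm (\<integral>w. f w * cnj (phi l n w) \<partial>sigma_measure l)"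
      unfolding a_def norm_mult norm_of_real using l e by (simp add: abs_mult)
    also have "\<dots> \<le> (real n + l + 1) / (l + 1) * eps_coeff l n * (N * (1 / eps_coeff l n))"
      using b l e by (intro mult_left_mono) auto
    also have "\<dots> = (real n + l + 1) / (l + 1) * N" using e by simp
    also have "\<dots> \<le> real (Suc n) * N" using kernel_weight_le[OF l, of n] N0 by (intro mult_right_mono) auto
    finally show ?thesis .
  qed
  show "subexp a"
    unfolding subexp_def
  proof (intro allI impI)
    fix t :: real assume t: "0 < t \<and> t < 1"
    have "norm (a n) * t ^ n \<le> N * (1 / (1 - t)\<^sup>2)" for n
    proof -
      have "norm (a n) * t ^ n \<le> (real (Suc n) * N) * t ^ n" using an t by (intro mult_right_mono) auto
      also have "\<dots> = N * (real (Suc n) * t ^ n)" by (simp only: mult_ac)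
      also have "\<dots> \<le> N * (1 / (1 - t)\<^sup>2)" using t N0 Suc_geom_bound[of t n] by (intro mult_left_mono) auto
      finally show ?thesis .
    qed
    then show "\<exists>C. \<forall>n. norm (a n) * t ^ n \<le> C" by blast
  qed
  assume z: "norm z < 1"
  define k where "k n w = f w * (of_real ((real n + l + 1) / (l + 1)) * phi l n z * cnj (phi l n w))" for n w
  have ke: "k n w = (of_real ((real n + l + 1) / (l + 1)) * phi l n z) * (f w * cnj (phi l n w))" for n w
    by (simp add: k_def mult_ac)
  have kb: "norm (k n w) \<le> norm (f w) * kernel_majorant l z n" if "norm w \<le> 1" for n w
    unfolding k_def norm_mult[of "f w"] by (intro mult_left_mono kernel_majorant(2)[OF l z that]) auto
  have "(\<lambda>n. \<integral>w. k n w \<partial>sigma_measure l) sums (\<integral>w. (\<Sum>n. k n w) \<partial>sigma_measure l)"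
  proof (rule sums_integral)
    show ik: "integrable (sigma_measure l) (k n)" for n unfolding ke[abs_def] by (intro integrable_mult_right ip)
    show "AE w in sigma_measure l. summable (\<lambda>n. norm (k n w))"
    proof (rule AE_I2)
      fix w assume "w \<in> space (sigma_measure l)"
      then show "summable (\<lambda>n. norm (k n w))"
        by (intro summable_comparison_test'[OF summable_mult[OF kernel_majorant(1)[OF l z], of "norm (f w)"], of 0]) (use kb in auto)
    qed
    show "summable (\<lambda>n. \<integral>w. norm (k n w) \<partial>sigma_measure l)"
    proof (rule summable_comparison_test'[OF summable_mult[OF kernel_majorant(1)[OF l z], of N], of 0])
      fix n
      have "(\<integral>w. norm (k n w) \<partial>sigma_measure l) \<le> (\<integral>w. norm (f w) * kernel_majorant l z n \<partial>sigma_measure l)"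
        using kb by (intro integral_mono integrable_norm ik integrable_mult_left f) auto
      also have "\<dots> = N * kernel_majorant l z n" unfolding N_def by (rule integral_mult_left_zero)
      finally show "norm (\<integral>w. norm (k n w) \<partial>sigma_measure l) \<le> N * kernel_majorant l z n" by simp
    qed
  qed
  moreover have "(\<integral>w. k n w \<partial>sigma_measure l) = hpart (phi_coef l a) n z" for n
    unfolding ke integral_mult_right_zero hpart_phi_coef a_def by (simp add: phi_eq mult_ac)
  moreover have "(\<integral>w. (\<Sum>n. k n w) \<partial>sigma_measure l) = bergman_projection l f z"
    unfolding bergman_projection_def
  proof (intro Bochner_Integration.integral_cong refl)
    fix w assume "w \<in> space (sigma_measure l)"
    then have w: "norm w \<le> 1" by simp
    have "summable (\<lambda>n. of_real ((real n + l + 1) / (l + 1)) * phi l n z * cnj (phi l n w))"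
      by (rule summable_comparison_test'[OF kernel_majorant(1)[OF l z], of 0]) (use kernel_majorant(2)[OF l z w] in auto)
    then show "(\<Sum>n. k n w) = f w * bergman_kernel l z w"
      unfolding k_def bergman_kernel_def by (rule suminf_mult)
  qed
  ultimately show "bergman_projection l f z = ser (phi_coef l a) z" by (simp add: ser_def sums_iff)
qed

lemma has_wirtinger_cong:
  assumes "has_wirtinger f a b z" "z \<in> ball 0 1" "\<And>z. z \<in> ball 0 1 \<Longrightarrow> f z = g z"
  shows "has_wirtinger g a b z"
  unfolding has_wirtinger_def
  by (rule has_derivative_transform_within_open[OF assms(1)[unfolded has_wirtinger_def] open_ball assms(2,3)])

lemma projection_lambda_analytic:
  assumes l: "0 \<le> l" and f: "integrable (sigma_measure l) f"
  shows "lambda_analytic l (bergman_projection l f)"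
proof -
  obtain a where a: "subexp a" "\<And>z. norm z < 1 \<Longrightarrow> bergman_projection l f z = ser (phi_coef l a) z"
    by (rule that[OF projection_expansion[OF l f]])
  define c where "c = phi_coef l a"
  have c: "tame c" unfolding c_def by (rule tame_phi_coef[OF l a(1)])
  have w: "has_wirtinger (bergman_projection l f) (ser (dz_coef c) z) (ser (dzbar_coef c) z) z" if "z \<in> ball 0 1" for z
    by (rule has_wirtinger_cong[OF ser_has_wirtinger[OF c]]) (use that a(2) in \<open>auto simp: c_def\<close>)
  have "wirtinger_analytic l (bergman_projection l f) (ser (dz_coef c)) (ser (dzbar_coef c))"
    using wirtinger_analytic_ser[OF l a(1)] w a(2) unfolding wirtinger_analytic_def c_def[symmetric] by simp
  moreover have "C2_on (ball 0 1) (bergman_projection l f)"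
    by (rule C2_on_wirtinger[OF w ser_has_wirtinger ser_has_wirtinger]) (auto intro!: continuous_on_ser tame_deriv c)
  ultimately show ?thesis by (rule lambda_analyticI)
qed

text \<open>
  The expansion coefficients of the projection coincide with those of \<open>g\<close>: in polar coordinates the circle
  integrals of \<open>g\<close> against \<open>\<phi>\<^sub>n\<close> are known, and the radial moment together with the
  normalisation of \<open>\<sigma>\<close> cancels the weight of the kernel.
\<close>

lemma projection_reproduces:
  assumes l: "0 \<le> l" and g: "lambda_analytic l g" and i: "integrable (sigma_measure l) g" and z: "norm z < 1"
  shows "bergman_projection l g z = g z"
proof -
  obtain g1 g2 where w: "wirtinger_analytic l g g1 g2" using lambda_analyticD[OF g] .
  obtain b where b: "subexp b" "\<And>z. norm z < 1 \<Longrightarrow> g z = ser (phi_coef l b) z"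
    and bc: "\<And>r n. 0 < r \<Longrightarrow> r < 1 \<Longrightarrow>
       (\<integral>\<zeta>. g (of_real r * \<zeta>) * cnj (gpoly l n \<zeta>) \<partial>circ l) = b n * of_real (r ^ n * gval l n * circ_mass l)"
    by (rule wirtinger_analytic_expansion[OF l w]) (rule that)
  have cg: "continuous_on (ball 0 1) g"
  proof -
    have "continuous_on (ball 0 1) (ser (phi_coef l b))" by (intro continuous_on_ser tame_phi_coef l b)
    then show ?thesis using continuous_on_cong[of "ball 0 1" "ball 0 1" g "ser (phi_coef l b)"] b(2) by simp
  qed
  define a where "a n = of_real ((real n + l + 1) / (l + 1) * eps_coeff l n) * (\<integral>w. g w * cnj (phi l n w) \<partial>sigma_measure l)" for n
  have "a n = b n" for n
  proof -
    define e where "e = eps_coeff l n"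
    have e: "0 < e" unfolding e_def by (rule eps_coeff_bounds[OF l])
    have gv: "0 < gval l n" using gval_ge_1[OF l, of n] by simp
    have ee: "e * e * gval l n = 1" using eps_coeff_sq[OF l, of n] gv by (simp add: e_def power2_eq_square)
    \<comment> \<open>cut off to the disk, since nothing is known about g outside and Borel measurability on the plane is needed\<close>
    define F where "F w = indicator (ball 0 1) w *\<^sub>R (g w * cnj (phi l n w))" for w
    have Fm: "F \<in> borel_measurable borel"
      unfolding F_def
    proof (rule borel_measurable_continuous_on_indicator)
      show "continuous_on (ball 0 1) (\<lambda>w. g w * cnj (phi l n w))"
        unfolding phi_eq by (intro continuous_intros cg)
    qed simp
    have pm: "(\<lambda>w. cnj (phi l n w)) \<in> borel_measurable (sigma_measure l)" by (rule borel_measurable_sigma) measurable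
    have "bounded ((\<lambda>w. cnj (phi l n w)) ` cball 0 1)"
      unfolding phi_eq by (intro compact_imp_bounded compact_continuous_image continuous_intros compact_cball)
    then obtain B where "\<forall>x\<in>(\<lambda>w. cnj (phi l n w)) ` cball 0 1. norm x \<le> B" unfolding bounded_iff by blast
    then have "integrable (sigma_measure l) (\<lambda>w. g w * cnj (phi l n w))"
      by (intro integrable_mult_bounded[OF i pm, of B]) auto
    then have Fi: "integrable (sigma_measure l) F"
      by (rule Bochner_Integration.integrable_cong[THEN iffD1, rotated 2]) (auto simp: F_def)
    have "(\<integral>w. g w * cnj (phi l n w) \<partial>sigma_measure l) = (\<integral>w. F w \<partial>sigma_measure l)"
      by (intro Bochner_Integration.integral_cong) (auto simp: F_def)
    also have "\<dots> = (\<integral>r. (\<integral>\<zeta>. F (of_real r * \<zeta>) \<partial>circ l) \<partial>radial l)" by (rule integral_sigma_polar[OF l Fm Fi])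
    also have "\<dots> = (\<integral>r. (of_real e * b n * of_real (gval l n * circ_mass l)) * of_real (r ^ (2 * n)) \<partial>radial l)"
    proof (rule integral_cong_AE)
      have "AE r in radial l. 0 < r \<and> r < 1"
        unfolding radial_def by (subst AE_density) (auto intro!: AE_I2 simp: indicator_def)
      then show "AE r in radial l. (\<integral>\<zeta>. F (of_real r * \<zeta>) \<partial>circ l) = (of_real e * b n * of_real (gval l n * circ_mass l)) * of_real (r ^ (2 * n))"
      proof eventually_elim
        case (elim r)
        have "(\<integral>\<zeta>. F (of_real r * \<zeta>) \<partial>circ l) = (\<integral>\<zeta>. of_real (e * r ^ n) * (g (of_real r * \<zeta>) * cnj (gpoly l n \<zeta>)) \<partial>circ l)"
          using elim by (intro Bochner_Integration.integral_cong) (auto simp: F_def norm_mult phi_eq gpoly_scale e_def indicator_def)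
        also have "\<dots> = of_real (e * r ^ n) * (b n * of_real (r ^ n * gval l n * circ_mass l))"
          using elim by (simp add: bc)
        finally show ?case by (simp add: mult_2 mult_2_right power_add mult_ac)
      qed
      show "(\<lambda>r. \<integral>\<zeta>. F (of_real r * \<zeta>) \<partial>circ l) \<in> borel_measurable (radial l)"
      proof -
        interpret c: finite_measure "circ l" by (rule circ_finite[OF l])
        have "(\<lambda>p. F (of_real (fst p) * snd p)) \<in> borel_measurable (radial l \<Otimes>\<^sub>M circ l)"
          by (rule measurable_compose[OF polar_product_measurable Fm])
        from c.borel_measurable_lebesgue_integral[of "\<lambda>r \<zeta>. F (of_real r * \<zeta>)" "radial l"] this
        show ?thesis by (simp add: case_prod_beta')
      qed
    qed measurable
    also have "\<dots> = (of_real e * b n * of_real (gval l n * circ_mass l)) * of_real (\<integral>r. r ^ (2 * n) \<partial>radial l)"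
      by (simp only: integral_mult_right_zero integral_complex_of_real)
    also have "\<dots> = of_real (e * gval l n * (l + 1) / (real n + l + 1)) * b n"
    proof -
      have "gval l n * circ_mass l * (c_const l / (2 * (real n + l + 1))) = gval l n * (c_const l * circ_mass l) / (2 * (real n + l + 1))" by simp
      also have "\<dots> = gval l n * (l + 1) / (real n + l + 1)"
      proof -
        have "real n + l + 1 \<noteq> 0" using l by linarith
        then show ?thesis unfolding c_const_circ_mass[OF l] by (simp add: divide_simps) (simp add: algebra_simps)
      qed
      finally have "complex_of_real (gval l n * circ_mass l) * of_real (c_const l / (2 * (real n + l + 1))) = of_real (gval l n * (l + 1) / (real n + l + 1))"
        by (simp only: of_real_mult[symmetric])
      then have "(of_real e * b n * of_real (gval l n * circ_mass l)) * of_real (c_const l / (2 * (real n + l + 1))) = of_real e * b n * of_real (gval l n * (l + 1) / (real n + l + 1))"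
        by (simp only: mult.assoc)
      then show ?thesis unfolding radial_moment[OF l] by (simp add: mult_ac)
    qed
    finally have I: "(\<integral>w. g w * cnj (phi l n w) \<partial>sigma_measure l) = of_real (e * gval l n * (l + 1) / (real n + l + 1)) * b n" .
    have "a n = of_real ((real n + l + 1) / (l + 1) * e * (e * gval l n * (l + 1) / (real n + l + 1))) * b n"
      unfolding a_def I e_def[symmetric] by (simp only: of_real_mult mult.assoc)
    moreover have "(real n + l + 1) / (l + 1) * e * (e * gval l n * (l + 1) / (real n + l + 1)) = 1"
    proof -
      have "l + 1 \<noteq> 0" using l by linarith
      moreover have "real n + l + 1 \<noteq> 0" using l by linarith
      ultimately have "(real n + l + 1) / (l + 1) * e * (e * gval l n * (l + 1) / (real n + l + 1)) = e * e * gval l n" by simp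
      then show ?thesis using ee by simp
    qed
    ultimately show ?thesis by (simp only: of_real_1 mult_1_left)
  qed
  then have "a = b" by (rule ext)
  then show ?thesis
    using projection_expansion(2)[OF l i z] b(2)[OF z] unfolding a_def[abs_def, symmetric] by simp
qed

section \<open>Boundedness and surjectivity\<close>

text \<open>
  Schur's test. With the test function \<open>(1 - \<bar>w\<bar>) powr (-1/(p q))\<close>, the two integrals of the
  kernel that occur carry powers of \<open>1 - \<bar>w\<bar>\<close> with exponents \<open>-1/p\<close> and
  \<open>-1/q\<close>, both strictly between \<open>-1\<close> and \<open>0\<close>.
\<close>

theorem projection_Lp_bound:
  assumes l: "0 \<le> l" and p: "1 < p"
  obtains C where "0 \<le> C" "\<And>f. f \<in> Lp_space l p \<Longrightarrow>
    (\<integral>\<^sup>+z. ennreal (norm (bergman_projection l f z) powr p) \<partial>sigma_measure l) \<le> ennreal (C * (\<integral>w. norm (f w) powr p \<partial>sigma_measure l))"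
proof -
  define q where "q = p / (p - 1)"
  have q: "1 < q" "1 / p + 1 / q = 1" using p by (auto simp: q_def field_simps)
  have s: "0 < 1 / p" "1 / p < 1" "0 < 1 / q" "1 / q < 1" using p q by auto
  obtain C1 where C1: "0 < C1" "\<And>z. norm z < 1 \<Longrightarrow>
    (\<integral>\<^sup>+w. ennreal (norm (bergman_kernel l z w) * (1 - norm w) powr - (1 / p)) \<partial>sigma_measure l) \<le> ennreal (C1 * (1 - norm z) powr - (1 / p))"
    by (rule kernel_schur[OF l s(1,2)]) (rule that)
  obtain C2 where C2: "0 < C2" "\<And>z. norm z < 1 \<Longrightarrow>
    (\<integral>\<^sup>+w. ennreal (norm (bergman_kernel l z w) * (1 - norm w) powr - (1 / q)) \<partial>sigma_measure l) \<le> ennreal (C2 * (1 - norm z) powr - (1 / q))"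
    by (rule kernel_schur[OF l s(3,4)]) (rule that)
  interpret S: finite_measure "sigma_measure l" by (rule finite_measure_sigma[OF l])
  interpret SS: pair_sigma_finite "sigma_measure l" "sigma_measure l" ..
  have Km: "(\<lambda>w. bergman_kernel l z w) \<in> borel_measurable (sigma_measure l)" for z
    by (rule borel_measurable_sigma) measurable
  have hm: "(\<lambda>w. (1 - norm w) powr a) \<in> borel_measurable (sigma_measure l)" for a
    by (rule borel_measurable_sigma) measurable
  show thesis
  proof (rule that[of "C1 powr (p / q) * C2"])
    show "0 \<le> C1 powr (p / q) * C2" using C2 by simp
    fix f assume f: "f \<in> Lp_space l p"
    have fm [measurable]: "f \<in> borel_measurable (sigma_measure l)" and fi: "integrable (sigma_measure l) (\<lambda>w. norm (f w) powr p)"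
      using f by (auto simp: Lp_space_def)
    define F where "F w = norm (f w) powr p * (1 - norm w) powr (1 / q)" for w
    have Fm [measurable]: "F \<in> borel_measurable (sigma_measure l)"
      unfolding F_def using hm by measurable
    have F0: "0 \<le> F w" for w by (simp add: F_def)
    have point: "ennreal (norm (bergman_projection l f z) powr p)
      \<le> (\<integral>\<^sup>+w. ennreal (C1 powr (p / q) * (1 - norm z) powr - (1 / q)) * (ennreal (norm (bergman_kernel l z w)) * ennreal (F w)) \<partial>sigma_measure l)"
      if z: "norm z < 1" for z
    proof -
      define k where "k w = norm (bergman_kernel l z w)" for w
      \<comment> \<open>|f| = u v, with the test function in v and its reciprocal in u\<close>
      define u where "u w = norm (f w) * (1 - norm w) powr (1 / (p * q))" for w
      define v where "v w = (1 - norm w) powr - (1 / (p * q))" for w :: complex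
      obtain B where B: "0 \<le> B" "\<And>w. norm w \<le> 1 \<Longrightarrow> norm (bergman_kernel l z w) \<le> B" using kernel_bounded[OF l z] by metis
      have km [measurable]: "k \<in> borel_measurable (sigma_measure l)" unfolding k_def using Km by measurable
      have um [measurable]: "u \<in> borel_measurable (sigma_measure l)" unfolding u_def using hm by measurable
      have vm [measurable]: "v \<in> borel_measurable (sigma_measure l)" unfolding v_def by (rule hm)
      have up: "u w powr p = F w" for w
        using p q by (simp add: u_def F_def powr_mult powr_powr)
      have vq: "v w powr q = (1 - norm w) powr - (1 / p)" for w
        using p q by (simp add: v_def powr_powr)
      have uv: "u w * v w = norm (f w)" if "w \<in> ball 0 1" for w
      proof -
        have "(1 - norm w) powr (1 / (p * q)) * (1 - norm w) powr - (1 / (p * q)) = 1"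
          using that by (simp flip: powr_add)
        then show ?thesis by (simp add: u_def v_def)
      qed
      have iu: "integrable (sigma_measure l) (\<lambda>w. k w * u w powr p)"
      proof (rule Bochner_Integration.integrable_bound)
        show "integrable (sigma_measure l) (\<lambda>w. B * norm (f w) powr p)" using fi by simp
        show "(\<lambda>w. k w * u w powr p) \<in> borel_measurable (sigma_measure l)" by measurable
        show "AE w in sigma_measure l. norm (k w * u w powr p) \<le> norm (B * norm (f w) powr p)"
        proof (rule AE_I2)
          fix w assume "w \<in> space (sigma_measure l)"
          then have w: "norm w < 1" by simp
          have "k w * F w \<le> B * (norm (f w) powr p * 1)"
            unfolding F_def k_def using w B s by (intro mult_mono B(2)) (auto intro!: powr_le1)
          then show "norm (k w * u w powr p) \<le> norm (B * norm (f w) powr p)"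
            using F0[of w] B(1) by (simp add: up k_def abs_mult)
        qed
      qed
      have k0: "0 \<le> k w" for w by (simp add: k_def)
      have nnv: "(\<integral>\<^sup>+w. ennreal (k w * v w powr q) \<partial>sigma_measure l) \<le> ennreal (C1 * (1 - norm z) powr - (1 / p))"
        unfolding vq k_def by (rule C1(2)[OF z])
      have iv: "integrable (sigma_measure l) (\<lambda>w. k w * v w powr q)"
      proof (rule integrableI_bounded)
        show "(\<lambda>w. k w * v w powr q) \<in> borel_measurable (sigma_measure l)" by measurable
        have "(\<integral>\<^sup>+w. ennreal (norm (k w * v w powr q)) \<partial>sigma_measure l) = (\<integral>\<^sup>+w. ennreal (k w * v w powr q) \<partial>sigma_measure l)"
          using k0 by (simp add: abs_mult)
        also have "\<dots> < \<infinity>" using nnv by (rule order.strict_trans1) simp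
        finally show "(\<integral>\<^sup>+w. ennreal (norm (k w * v w powr q)) \<partial>sigma_measure l) < \<infinity>" .
      qed
      define R where "R = C1 * (1 - norm z) powr - (1 / p)"
      have R0: "0 < R" using C1 z by (simp add: R_def)
      have Rv: "(\<integral>w. k w * v w powr q \<partial>sigma_measure l) \<le> R"
      proof -
        have "ennreal (\<integral>w. k w * v w powr q \<partial>sigma_measure l) = (\<integral>\<^sup>+w. ennreal (k w * v w powr q) \<partial>sigma_measure l)"
          using k0 by (intro nn_integral_eq_integral[symmetric] iv) auto
        then have "ennreal (\<integral>w. k w * v w powr q \<partial>sigma_measure l) \<le> ennreal R" using nnv by (simp add: R_def)
        then show ?thesis using R0 by (simp add: ennreal_le_iff)
      qed
      have meas: "(\<lambda>w. k w * (u w * v w)) \<in> borel_measurable (sigma_measure l)" by measurable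
      have u0: "0 \<le> u w" and v0: "0 \<le> v w" for w by (simp_all add: u_def v_def)
      have H: "(\<integral>w. k w * (u w * v w) \<partial>sigma_measure l) powr p \<le> (\<integral>w. k w * u w powr p \<partial>sigma_measure l) * R powr (p / q)"
        by (rule Holder_weighted(2)[OF p q k0 u0 v0 meas iu iv Rv R0])
      have "norm (bergman_projection l f z) \<le> (\<integral>w. norm (f w * bergman_kernel l z w) \<partial>sigma_measure l)"
        unfolding bergman_projection_def by (rule integral_norm_bound)
      also have "\<dots> = (\<integral>w. k w * (u w * v w) \<partial>sigma_measure l)"
        by (intro Bochner_Integration.integral_cong) (auto simp: uv k_def norm_mult mult.commute)
      finally have "norm (bergman_projection l f z) powr p \<le> (\<integral>w. k w * (u w * v w) \<partial>sigma_measure l) powr p"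
        using p by (intro powr_mono2) auto
      also have "\<dots> \<le> R powr (p / q) * (\<integral>w. k w * F w \<partial>sigma_measure l)" using H by (simp add: up mult.commute)
      also have "R powr (p / q) = C1 powr (p / q) * (1 - norm z) powr - (1 / q)"
        using C1(1) z p by (simp add: R_def powr_mult powr_powr)
      finally have "ennreal (norm (bergman_projection l f z) powr p) \<le> ennreal (C1 powr (p / q) * (1 - norm z) powr - (1 / q) * (\<integral>w. k w * F w \<partial>sigma_measure l))"
        by (rule ennreal_leI)
      also have "\<dots> = ennreal (C1 powr (p / q) * (1 - norm z) powr - (1 / q)) * ennreal (\<integral>w. k w * F w \<partial>sigma_measure l)"
        using k0 F0 by (intro ennreal_mult integral_nonneg_AE AE_I2) auto
      also have "ennreal (\<integral>w. k w * F w \<partial>sigma_measure l) = (\<integral>\<^sup>+w. ennreal (k w * F w) \<partial>sigma_measure l)"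
        using iu k0 F0 unfolding up by (intro nn_integral_eq_integral[symmetric]) auto
      also have "ennreal (C1 powr (p / q) * (1 - norm z) powr - (1 / q)) * (\<integral>\<^sup>+w. ennreal (k w * F w) \<partial>sigma_measure l)
         = (\<integral>\<^sup>+w. ennreal (C1 powr (p / q) * (1 - norm z) powr - (1 / q)) * ennreal (k w * F w) \<partial>sigma_measure l)"
        by (rule nn_integral_cmult[symmetric]) measurable
      finally show ?thesis using F0 by (simp add: k_def ennreal_mult)
    qed
    define G where "G z = ennreal (C1 powr (p / q) * (1 - norm z) powr - (1 / q))" for z :: complex
    have Gm: "G \<in> borel_measurable (sigma_measure l)" unfolding G_def using hm by measurable
    have K2: "(\<lambda>x. ennreal (norm (bergman_kernel l (fst x) (snd x)))) \<in> borel_measurable (sigma_measure l \<Otimes>\<^sub>M sigma_measure l)"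
    proof -
      have "(\<lambda>x. (fst x, snd x)) \<in> sigma_measure l \<Otimes>\<^sub>M sigma_measure l \<rightarrow>\<^sub>M borel \<Otimes>\<^sub>M borel"
        by (rule measurable_Pair[OF measurable_compose[OF measurable_fst id_measurable_sigma] measurable_compose[OF measurable_snd id_measurable_sigma]])
      from measurable_compose[OF this kernel_measurable_pair]
      have K: "(\<lambda>x. bergman_kernel l (fst x) (snd x)) \<in> borel_measurable (sigma_measure l \<Otimes>\<^sub>M sigma_measure l)" by simp
      show ?thesis by (rule measurable_compose[OF measurable_compose[OF K borel_measurable_norm] measurable_ennreal])
    qed
    have m: "(\<lambda>x. G (fst x) * (ennreal (norm (bergman_kernel l (fst x) (snd x))) * ennreal (F (snd x)))) \<in> borel_measurable (sigma_measure l \<Otimes>\<^sub>M sigma_measure l)"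
      by (intro borel_measurable_times_ennreal K2 measurable_compose[OF measurable_fst Gm] measurable_compose[OF measurable_snd]) measurable
    have "(\<integral>\<^sup>+z. ennreal (norm (bergman_projection l f z) powr p) \<partial>sigma_measure l)
      \<le> (\<integral>\<^sup>+z. \<integral>\<^sup>+w. G z * (ennreal (norm (bergman_kernel l z w)) * ennreal (F w)) \<partial>sigma_measure l \<partial>sigma_measure l)"
      unfolding G_def using point by (intro nn_integral_mono) auto
    also have "\<dots> = (\<integral>\<^sup>+w. \<integral>\<^sup>+z. G z * (ennreal (norm (bergman_kernel l z w)) * ennreal (F w)) \<partial>sigma_measure l \<partial>sigma_measure l)"
      using SS.Fubini[OF m] by simp
    also have "\<dots> \<le> (\<integral>\<^sup>+w. ennreal (C1 powr (p / q) * C2) * ennreal (norm (f w) powr p) \<partial>sigma_measure l)"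
    proof (rule nn_integral_mono)
      fix w assume "w \<in> space (sigma_measure l)"
      then have w: "norm w < 1" by simp
      have "(\<integral>\<^sup>+z. G z * (ennreal (norm (bergman_kernel l z w)) * ennreal (F w)) \<partial>sigma_measure l)
        = (\<integral>\<^sup>+z. ennreal (C1 powr (p / q) * F w) * ennreal (norm (bergman_kernel l w z) * (1 - norm z) powr - (1 / q)) \<partial>sigma_measure l)"
      proof (rule nn_integral_cong)
        fix z assume "z \<in> space (sigma_measure l)"
        then have "norm (bergman_kernel l z w) = norm (bergman_kernel l w z)"
          using w by (intro norm_kernel_commute[OF l]) auto
        then show "G z * (ennreal (norm (bergman_kernel l z w)) * ennreal (F w)) = ennreal (C1 powr (p / q) * F w) * ennreal (norm (bergman_kernel l w z) * (1 - norm z) powr - (1 / q))"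
          unfolding G_def using F0[of w] by (simp add: ennreal_mult mult_ac)
      qed
      also have "\<dots> = ennreal (C1 powr (p / q) * F w) * (\<integral>\<^sup>+z. ennreal (norm (bergman_kernel l w z) * (1 - norm z) powr - (1 / q)) \<partial>sigma_measure l)"
        by (rule nn_integral_cmult) (use Km hm in measurable)
      also have "\<dots> \<le> ennreal (C1 powr (p / q) * F w) * ennreal (C2 * (1 - norm w) powr - (1 / q))"
        by (intro mult_left_mono C2(2)[OF w]) auto
      also have "\<dots> = ennreal (C1 powr (p / q) * F w * (C2 * (1 - norm w) powr - (1 / q)))"
        using F0[of w] C2(1) by (intro ennreal_mult[symmetric]) auto
      also have "C1 powr (p / q) * F w * (C2 * (1 - norm w) powr - (1 / q)) = C1 powr (p / q) * C2 * norm (f w) powr p"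
      proof -
        have "(1 - norm w) powr (1 / q) * (1 - norm w) powr - (1 / q) = 1" using w by (simp flip: powr_add)
        moreover have "C1 powr (p / q) * F w * (C2 * (1 - norm w) powr - (1 / q)) = C1 powr (p / q) * C2 * norm (f w) powr p * ((1 - norm w) powr (1 / q) * (1 - norm w) powr - (1 / q))"
          by (simp only: F_def mult_ac)
        ultimately show ?thesis by simp
      qed
      also have "ennreal (C1 powr (p / q) * C2 * norm (f w) powr p) = ennreal (C1 powr (p / q) * C2) * ennreal (norm (f w) powr p)"
        using C2(1) by (intro ennreal_mult) auto
      finally show "(\<integral>\<^sup>+z. G z * (ennreal (norm (bergman_kernel l z w)) * ennreal (F w)) \<partial>sigma_measure l) \<le> ennreal (C1 powr (p / q) * C2) * ennreal (norm (f w) powr p)" .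
    qed
    also have "\<dots> = ennreal (C1 powr (p / q) * C2) * (\<integral>\<^sup>+w. ennreal (norm (f w) powr p) \<partial>sigma_measure l)"
      by (rule nn_integral_cmult) measurable
    also have "(\<integral>\<^sup>+w. ennreal (norm (f w) powr p) \<partial>sigma_measure l) = ennreal (\<integral>w. norm (f w) powr p \<partial>sigma_measure l)"
      by (rule nn_integral_eq_integral[OF fi]) auto
    also have "ennreal (C1 powr (p / q) * C2) * ennreal (\<integral>w. norm (f w) powr p \<partial>sigma_measure l) = ennreal (C1 powr (p / q) * C2 * (\<integral>w. norm (f w) powr p \<partial>sigma_measure l))"
      using C2(1) by (intro ennreal_mult[symmetric] integral_nonneg_AE AE_I2) auto
    finally show "(\<integral>\<^sup>+z. ennreal (norm (bergman_projection l f z) powr p) \<partial>sigma_measure l) \<le> ennreal (C1 powr (p / q) * C2 * (\<integral>w. norm (f w) powr p \<partial>sigma_measure l))" .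
  qed
qed

lemma lambda_analytic_measurable:
  assumes "lambda_analytic l g" shows "g \<in> borel_measurable (sigma_measure l)"
proof -
  obtain g1 g2 where "wirtinger_analytic l g g1 g2" using lambda_analyticD[OF assms] .
  then have "continuous_on (ball 0 1) g"
    by (intro continuous_at_imp_continuous_on ballI has_wirtinger_isCont) (auto simp: wirtinger_analytic_def)
  then have "g \<in> borel_measurable (lebesgue_on (ball 0 1))"
    by (rule continuous_imp_measurable_on_sets_lebesgue) simp
  then show ?thesis by (simp add: sigma_measure_def)
qed

theorem theorem3p6:
  fixes l p :: real
  assumes "0 \<le> l" and "1 < p"
  shows "(\<forall>f\<in>Lp_space l p. \<forall>z\<in>ball 0 1.
            integrable (sigma_measure l) (\<lambda>w. f w * bergman_kernel l z w))
       \<and> (\<forall>f\<in>Lp_space l p. \<forall>g\<in>Lp_space l p. \<forall>a b :: complex. \<forall>z\<in>ball 0 1.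
            bergman_projection l (\<lambda>w. a * f w + b * g w) z
              = a * bergman_projection l f z + b * bergman_projection l g z)
       \<and> (\<forall>f\<in>Lp_space l p. bergman_projection l f \<in> Ap_space l p)
       \<and> (\<exists>C. \<forall>f\<in>Lp_space l p. Lp_norm l p (bergman_projection l f) \<le> C * Lp_norm l p f)
       \<and> (\<forall>g\<in>Ap_space l p. \<exists>f\<in>Lp_space l p. \<forall>z\<in>ball 0 1. bergman_projection l f z = g z)"
proof -
  note l = assms(1) and p = assms(2)
  note L1 = Lp_integrable[OF l p]
  obtain C where C: "0 \<le> C" "\<And>f. f \<in> Lp_space l p \<Longrightarrow>
    (\<integral>\<^sup>+z. ennreal (norm (bergman_projection l f z) powr p) \<partial>sigma_measure l) \<le> ennreal (C * (\<integral>w. norm (f w) powr p \<partial>sigma_measure l))"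
    using projection_Lp_bound[OF l p] by metis
  have int: "integrable (sigma_measure l) (\<lambda>w. f w * bergman_kernel l z w)" if "f \<in> Lp_space l p" "z \<in> ball 0 1" for f z
    using that by (intro kernel_product_integrable[OF l] L1) auto
  have lin: "bergman_projection l (\<lambda>w. a * f w + b * g w) z = a * bergman_projection l f z + b * bergman_projection l g z"
    if "f \<in> Lp_space l p" "g \<in> Lp_space l p" "z \<in> ball 0 1" for f g a b z
  proof -
    have "bergman_projection l (\<lambda>w. a * f w + b * g w) z = (\<integral>w. a * (f w * bergman_kernel l z w) + b * (g w * bergman_kernel l z w) \<partial>sigma_measure l)"
      unfolding bergman_projection_def by (intro Bochner_Integration.integral_cong) (auto simp: algebra_simps)
    then show ?thesis
      using int[OF that(1,3)] int[OF that(2,3)] by (simp add: bergman_projection_def)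
  qed
  have ana: "lambda_analytic l (bergman_projection l f)" if "f \<in> Lp_space l p" for f
    by (rule projection_lambda_analytic[OF l L1[OF that]])
  have Pi: "integrable (sigma_measure l) (\<lambda>z. norm (bergman_projection l f z) powr p)" if f: "f \<in> Lp_space l p" for f
  proof (rule integrableI_bounded)
    show "(\<lambda>z. norm (bergman_projection l f z) powr p) \<in> borel_measurable (sigma_measure l)"
      using lambda_analytic_measurable[OF ana[OF f]] by measurable
    have "(\<integral>\<^sup>+z. ennreal (norm (norm (bergman_projection l f z) powr p)) \<partial>sigma_measure l) = (\<integral>\<^sup>+z. ennreal (norm (bergman_projection l f z) powr p) \<partial>sigma_measure l)"
      by simp
    also have "\<dots> < \<infinity>" using C(2)[OF f] by (rule order.strict_trans1) simp
    finally show "(\<integral>\<^sup>+z. ennreal (norm (norm (bergman_projection l f z) powr p)) \<partial>sigma_measure l) < \<infinity>" .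
  qed
  have mem: "bergman_projection l f \<in> Ap_space l p" if "f \<in> Lp_space l p" for f
    using lambda_analytic_measurable[OF ana[OF that]] Pi[OF that] ana[OF that] by (simp add: Ap_space_def Lp_space_def)
  have bound: "Lp_norm l p (bergman_projection l f) \<le> C powr (1 / p) * Lp_norm l p f" if f: "f \<in> Lp_space l p" for f
  proof -
    have N: "0 \<le> (\<integral>w. norm (f w) powr p \<partial>sigma_measure l)" "0 \<le> (\<integral>w. norm (bergman_projection l f w) powr p \<partial>sigma_measure l)"
      by (intro integral_nonneg_AE AE_I2; simp)+
    have "ennreal (\<integral>z. norm (bergman_projection l f z) powr p \<partial>sigma_measure l) \<le> ennreal (C * (\<integral>w. norm (f w) powr p \<partial>sigma_measure l))"
      using C(2)[OF f] by (subst nn_integral_eq_integral[symmetric, OF Pi[OF f]]) auto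
    then have "(\<integral>z. norm (bergman_projection l f z) powr p \<partial>sigma_measure l) \<le> C * (\<integral>w. norm (f w) powr p \<partial>sigma_measure l)"
      using C(1) N by (simp add: ennreal_le_iff)
    then have "(\<integral>z. norm (bergman_projection l f z) powr p \<partial>sigma_measure l) powr (1 / p) \<le> (C * (\<integral>w. norm (f w) powr p \<partial>sigma_measure l)) powr (1 / p)"
      using N p by (intro powr_mono2) auto
    also have "\<dots> = C powr (1 / p) * (\<integral>w. norm (f w) powr p \<partial>sigma_measure l) powr (1 / p)"
      using C(1) N by (intro powr_mult)
    finally show ?thesis by (simp add: Lp_norm_def)
  qed
  have surj: "\<exists>f\<in>Lp_space l p. \<forall>z\<in>ball 0 1. bergman_projection l f z = g z" if g: "g \<in> Ap_space l p" for g
    using g by (intro bexI[of _ g] ballI projection_reproduces[OF l] L1) (auto simp: Ap_space_def)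
  show ?thesis
    using int lin mem bound surj by blast
qed

end
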